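(* Let $\mathcal{C}$ be an idempotent complete additive category. The association $\mathcal{E}\mapsto \operatorname{mod}_{\mathsf{adm}}(\mathcal{E})$ gives a bijection between the following: (1) Exact structures $\mathcal{S}$ on $\mathcal{C}$, where $\mathcal{E}=(\mathcal{C},\mathcal{S})$ is the corresponding exact category. (2) Subcategories $\mathcal{X}$ of $\operatorname{mod}(\mathcal{C})$ satisfying the following: (a) $\mathcal{X}$ is a resolving subcategory of $\mathcal{P}^2(\mathcal{C})$ and $\operatorname{Tr}(\mathcal{X})$ is a resolving subcategory of $\mathcal{P}^2(\mathcal{C}^{\operatorname{op}})$, and (b) $\mathcal{X}$ and $\operatorname{Tr}(\mathcal{X})$ have no objects of grade $1$.
   Context: All categories are essentially small; subcategories are full and closed under isomorphisms. An exact structure on $\mathcal{C}$ is a class $\mathcal{S}$ of kernel-cokernel pairs (conflations), closed under isomorphism, making $(\mathcal{C},\mathcal{S})$ an exact category in the sense of Quillen; kernel parts are inflations, cokernel parts deflations. A morphism is admissible if it is a composite $m\circ p$ with $p$ a deflation and $m$ an inflation. $\operatorname{Mod}(\mathcal{C})$ is the abelian category of additive contravariant functors $\mathcal{C}\to\mathsf{Ab}$. $\operatorname{mod}(\mathcal{C})\subseteq \operatorname{Mod}(\mathcal{C})$ consists of the functors $F$ with an exact sequence $\operatorname{Hom}_{\mathcal{C}}(-,X)\to\operatorname{Hom}_{\mathcal{C}}(-,Y)\to F\to 0$. For $\mathcal{E}=(\mathcal{C},\mathcal{S})$, $\operatorname{mod}_{\mathsf{adm}}(\mathcal{E})\subseteq\operatorname{mod}(\mathcal{C})$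 consists of those $F$ for which such a sequence exists with the first map $\operatorname{Hom}_{\mathcal{C}}(-,f)$ for some $f\colon X\to Y$ admissible in $\mathcal{E}$. $\mathcal{P}^2(\mathcal{C})\subseteq\operatorname{mod}(\mathcal{C})$ consists of those $F$ admitting an exact sequence $0\to\operatorname{Hom}_{\mathcal{C}}(-,X)\to\operatorname{Hom}_{\mathcal{C}}(-,Y)\to\operatorname{Hom}_{\mathcal{C}}(-,Z)\to F\to 0$. It is closed under extensions and kernels of epimorphisms in $\operatorname{Mod}(\mathcal{C})$ and carries the exact structure inherited from $\operatorname{Mod}(\mathcal{C})$. A subcategory $\mathcal{X}$ of an exact category $\mathcal{D}$ is resolving if it is closed under extensions, direct summands and kernels of deflations, and is generating, i.e. for every $D\in\mathcal{D}$ there is a deflation $X\twoheadrightarrow D$ with $X\in\mathcal{X}$. $\underline{\operatorname{mod}}(\mathcal{C})$ is the quotient of $\operatorname{mod}(\mathcal{C})$ by morphisms factoring through representable functors. The Auslander-Bridger transpose $\operatorname{Tr}\colon\underline{\operatorname{mod}}(\mathcal{C})\to\underline{\operatorname{mod}}(\mathcal{C}^{\operatorname{op}})^{\operatorname{op}}$ sends $F$ with presentation $\operatorname{Hom}_{\mathcal{C}}(-,X)\xrightarrow{\operatorname{Hom}_{\mathcal{C}}(-,f)}\operatorname{Hom}_{\mathcal{C}}(-,Y)\to F\to 0$ to $\operatorname{Tr}(F)=\operatorname{coker}(\operatorname{Hom}_{\mathcal{C}}(Y,-)\xrightarrow{\operatorname{Hom}_{\mathcal{C}}(f,-)}\operatorname{Hom}_{\mathcal{C}}(X,-))$;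 it is well defined up to isomorphism in the stable category. For a subcategory $\mathcal{X}$ of $\operatorname{mod}(\mathcal{C})$, $\operatorname{Tr}(\mathcal{X})$ is the subcategory of $\operatorname{mod}(\mathcal{C}^{\operatorname{op}})$ of all objects which are isomorphic in $\underline{\operatorname{mod}}(\mathcal{C}^{\operatorname{op}})$ to $\operatorname{Tr}(F)$ for some $F\in\mathcal{X}$. The grade of $F\in\operatorname{Mod}(\mathcal{C})$ is the biggest integer $i\ge 0$ such that $\operatorname{Ext}^j_{\operatorname{Mod}(\mathcal{C})}(F,\operatorname{Hom}_{\mathcal{C}}(-,X))=0$ for all $0\le j<i$ and all $X\in\mathcal{C}$ (with $\operatorname{Ext}^0=\operatorname{Hom}$; the grade is infinite if all these groups vanish for all $j$); similarly for $\mathcal{C}^{\operatorname{op}}$. *)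

theory Defs
  imports "HOL-Algebra.Coset" "HOL-Library.Extended_Nat"
begin

text \<open>
  Abelian groups are \<open>comm_group\<close>s, so they are written multiplicatively: the sum of two
  parallel morphisms \<open>f\<close>, \<open>g\<close> from \<open>A\<close> to \<open>B\<close> is \<open>f \<otimes>\<^bsub>Hom C A B\<^esub> g\<close> and the zero
  morphism is \<open>\<one>\<^bsub>Hom C A B\<^esub>\<close>.  Objects and morphisms form sets (of types \<open>'o\<close> and
  \<open>'m\<close>), i.e. categories are small.
\<close>

section \<open>Additive categories\<close>

record ('o, 'm) precat =
  Ob  :: "'o set"
  Hom :: "'o \<Rightarrow> 'o \<Rightarrow> 'm monoid"
  Idt :: "'o \<Rightarrow> 'm"
  Cmp :: "'m \<Rightarrow> 'm \<Rightarrow> 'm"  (infixl "\<cdot>\<index>" 75)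

abbreviation mor :: "('o, 'm) precat \<Rightarrow> 'o \<Rightarrow> 'o \<Rightarrow> 'm set"
  where "mor C A B \<equiv> carrier (Hom C A B)"

definition opp :: "('o, 'm) precat \<Rightarrow> ('o, 'm) precat"
  where "opp C = C\<lparr>Hom := (\<lambda>A B. Hom C B A), Cmp := (\<lambda>g f. f \<cdot>\<^bsub>C\<^esub> g)\<rparr>"

text \<open>Hom-sets are pairwise disjoint, so a morphism determines its domain and codomain.\<close>

locale additive_category =
  fixes C :: "('o, 'm) precat" (structure)
  assumes Hom_comm_group: "\<lbrakk>A \<in> Ob C; B \<in> Ob C\<rbrakk> \<Longrightarrow> comm_group (Hom C A B)"
    and Hom_disjoint:
      "\<lbrakk>A \<in> Ob C; B \<in> Ob C; A' \<in> Ob C; B' \<in> Ob C; f \<in> mor C A B; f \<in> mor C A' B'\<rbrakk>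
        \<Longrightarrow> A = A' \<and> B = B'"
    and Idt_mor: "A \<in> Ob C \<Longrightarrow> Idt C A \<in> mor C A A"
    and Cmp_mor: "\<lbrakk>A \<in> Ob C; B \<in> Ob C; D \<in> Ob C; f \<in> mor C A B; g \<in> mor C B D\<rbrakk>
        \<Longrightarrow> g \<cdot> f \<in> mor C A D"
    and Cmp_Idt: "\<lbrakk>A \<in> Ob C; B \<in> Ob C; f \<in> mor C A B\<rbrakk> \<Longrightarrow> f \<cdot> Idt C A = f"
    and Idt_Cmp: "\<lbrakk>A \<in> Ob C; B \<in> Ob C; f \<in> mor C A B\<rbrakk> \<Longrightarrow> Idt C B \<cdot> f = f"
    and Cmp_assoc: "\<lbrakk>A \<in> Ob C; B \<in> Ob C; D \<in> Ob C; E \<in> Ob C;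
          f \<in> mor C A B; g \<in> mor C B D; h \<in> mor C D E\<rbrakk> \<Longrightarrow> (h \<cdot> g) \<cdot> f = h \<cdot> (g \<cdot> f)"
    and Cmp_add_left: "\<lbrakk>A \<in> Ob C; B \<in> Ob C; D \<in> Ob C;
          f \<in> mor C A B; g \<in> mor C B D; g' \<in> mor C B D\<rbrakk>
        \<Longrightarrow> (g \<otimes>\<^bsub>Hom C B D\<^esub> g') \<cdot> f = (g \<cdot> f) \<otimes>\<^bsub>Hom C A D\<^esub> (g' \<cdot> f)"
    and Cmp_add_right: "\<lbrakk>A \<in> Ob C; B \<in> Ob C; D \<in> Ob C;
          f \<in> mor C A B; f' \<in> mor C A B; g \<in> mor C B D\<rbrakk>
        \<Longrightarrow> g \<cdot> (f \<otimes>\<^bsub>Hom C A B\<^esub> f') = (g \<cdot> f) \<otimes>\<^bsub>Hom C A D\<^esub> (g \<cdot> f')"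
    and zero_object: "\<exists>Z\<in>Ob C. Idt C Z = \<one>\<^bsub>Hom C Z Z\<^esub>"
    and biproduct: "\<lbrakk>A \<in> Ob C; B \<in> Ob C\<rbrakk> \<Longrightarrow>
        \<exists>P\<in>Ob C. \<exists>i\<in>mor C A P. \<exists>j\<in>mor C B P. \<exists>p\<in>mor C P A. \<exists>q\<in>mor C P B.
          p \<cdot> i = Idt C A \<and> q \<cdot> j = Idt C B \<and>
          q \<cdot> i = \<one>\<^bsub>Hom C A B\<^esub> \<and> p \<cdot> j = \<one>\<^bsub>Hom C B A\<^esub> \<and>
          (i \<cdot> p) \<otimes>\<^bsub>Hom C P P\<^esub> (j \<cdot> q) = Idt C P"

definition idempotent_complete :: "('o, 'm) precat \<Rightarrow> bool"
  where "idempotent_complete C \<longleftrightarrow>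
    (\<forall>A\<in>Ob C. \<forall>e\<in>mor C A A. e \<cdot>\<^bsub>C\<^esub> e = e \<longrightarrow>
      (\<exists>B\<in>Ob C. \<exists>r\<in>mor C A B. \<exists>s\<in>mor C B A. s \<cdot>\<^bsub>C\<^esub> r = e \<and> r \<cdot>\<^bsub>C\<^esub> s = Idt C B))"

section \<open>Exact structures\<close>

definition is_iso :: "('o, 'm) precat \<Rightarrow> 'o \<Rightarrow> 'o \<Rightarrow> 'm \<Rightarrow> bool"
  where "is_iso C A B f \<longleftrightarrow> f \<in> mor C A B \<and>
    (\<exists>g\<in>mor C B A. g \<cdot>\<^bsub>C\<^esub> f = Idt C A \<and> f \<cdot>\<^bsub>C\<^esub> g = Idt C B)"

definition is_kernel :: "('o, 'm) precat \<Rightarrow> 'o \<Rightarrow> 'o \<Rightarrow> 'o \<Rightarrow> 'm \<Rightarrow> 'm \<Rightarrow> bool"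
  where "is_kernel C A B D i p \<longleftrightarrow>
    i \<in> mor C A B \<and> p \<in> mor C B D \<and> p \<cdot>\<^bsub>C\<^esub> i = \<one>\<^bsub>Hom C A D\<^esub> \<and>
    (\<forall>W\<in>Ob C. \<forall>f\<in>mor C W B. p \<cdot>\<^bsub>C\<^esub> f = \<one>\<^bsub>Hom C W D\<^esub> \<longrightarrow>
      (\<exists>!g. g \<in> mor C W A \<and> i \<cdot>\<^bsub>C\<^esub> g = f))"

text \<open>\<open>p\<close> is a cokernel of \<open>i\<close> iff \<open>p\<close> is a kernel of \<open>i\<close> in the opposite category.\<close>

definition kernel_cokernel_pair ::
    "('o, 'm) precat \<Rightarrow> 'o \<Rightarrow> 'o \<Rightarrow> 'o \<Rightarrow> 'm \<Rightarrow> 'm \<Rightarrow> bool"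
  where "kernel_cokernel_pair C A B D i p \<longleftrightarrow>
    is_kernel C A B D i p \<and> is_kernel (opp C) D B A p i"

text \<open>The square with \<open>p : W \<rightarrow> A\<close>, \<open>q : W \<rightarrow> B\<close>, \<open>f : A \<rightarrow> D\<close>, \<open>g : B \<rightarrow> D\<close> is Cartesian.\<close>

definition is_pullback ::
    "('o, 'm) precat \<Rightarrow> 'o \<Rightarrow> 'o \<Rightarrow> 'o \<Rightarrow> 'o \<Rightarrow> 'm \<Rightarrow> 'm \<Rightarrow> 'm \<Rightarrow> 'm \<Rightarrow> bool"
  where "is_pullback C W A B D p q f g \<longleftrightarrow>
    p \<in> mor C W A \<and> q \<in> mor C W B \<and> f \<in> mor C A D \<and> g \<in> mor C B D \<and>
    f \<cdot>\<^bsub>C\<^esub> p = g \<cdot>\<^bsub>C\<^esub> q \<and>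
    (\<forall>V\<in>Ob C. \<forall>a\<in>mor C V A. \<forall>b\<in>mor C V B. f \<cdot>\<^bsub>C\<^esub> a = g \<cdot>\<^bsub>C\<^esub> b \<longrightarrow>
      (\<exists>!h. h \<in> mor C V W \<and> p \<cdot>\<^bsub>C\<^esub> h = a \<and> q \<cdot>\<^bsub>C\<^esub> h = b))"

text \<open>A class of conflations is a set of pairs \<open>(i, p)\<close>.\<close>

definition inflation :: "('m \<times> 'm) set \<Rightarrow> 'm \<Rightarrow> bool"
  where "inflation S i \<longleftrightarrow> (\<exists>p. (i, p) \<in> S)"

definition deflation :: "('m \<times> 'm) set \<Rightarrow> 'm \<Rightarrow> bool"
  where "deflation S p \<longleftrightarrow> (\<exists>i. (i, p) \<in> S)"

text \<open>
  Quillen's axioms in the self-dual form of Keller and Buehler.  A pushout is a pullback in the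
  opposite category.
\<close>

locale exact_structure =
  fixes C :: "('o, 'm) precat" (structure) and S :: "('m \<times> 'm) set"
  assumes conflation_pair: "(i, p) \<in> S \<Longrightarrow>
        \<exists>A\<in>Ob C. \<exists>B\<in>Ob C. \<exists>D\<in>Ob C. kernel_cokernel_pair C A B D i p"
    and iso_closed: "\<lbrakk>(i, p) \<in> S;
          A \<in> Ob C; B \<in> Ob C; D \<in> Ob C; A' \<in> Ob C; B' \<in> Ob C; D' \<in> Ob C;
          i \<in> mor C A B; p \<in> mor C B D; i' \<in> mor C A' B'; p' \<in> mor C B' D';
          is_iso C A A' a; is_iso C B B' b; is_iso C D D' d;
          b \<cdot> i = i' \<cdot> a; d \<cdot> p = p' \<cdot> b\<rbrakk> \<Longrightarrow> (i', p') \<in> S"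
    and Idt_inflation: "A \<in> Ob C \<Longrightarrow> inflation S (Idt C A)"
    and Idt_deflation: "A \<in> Ob C \<Longrightarrow> deflation S (Idt C A)"
    and inflation_Cmp: "\<lbrakk>A \<in> Ob C; B \<in> Ob C; D \<in> Ob C; i \<in> mor C A B; j \<in> mor C B D;
          inflation S i; inflation S j\<rbrakk> \<Longrightarrow> inflation S (j \<cdot> i)"
    and deflation_Cmp: "\<lbrakk>A \<in> Ob C; B \<in> Ob C; D \<in> Ob C; p \<in> mor C A B; q \<in> mor C B D;
          deflation S p; deflation S q\<rbrakk> \<Longrightarrow> deflation S (q \<cdot> p)"
    and inflation_pushout: "\<lbrakk>A \<in> Ob C; B \<in> Ob C; A' \<in> Ob C; i \<in> mor C A B; f \<in> mor C A A';
          inflation S i\<rbrakk> \<Longrightarrow>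
          \<exists>B'\<in>Ob C. \<exists>i'\<in>mor C A' B'. \<exists>f'\<in>mor C B B'.
            is_pullback (opp C) B' B A' A f' i' i f \<and> inflation S i'"
    and deflation_pullback: "\<lbrakk>B \<in> Ob C; D \<in> Ob C; D' \<in> Ob C; p \<in> mor C B D; f \<in> mor C D' D;
          deflation S p\<rbrakk> \<Longrightarrow>
          \<exists>B'\<in>Ob C. \<exists>p'\<in>mor C B' D'. \<exists>f'\<in>mor C B' B.
            is_pullback C B' B D' D f' p' p f \<and> deflation S p'"

definition admissible ::
    "('o, 'm) precat \<Rightarrow> ('m \<times> 'm) set \<Rightarrow> 'o \<Rightarrow> 'o \<Rightarrow> 'm \<Rightarrow> bool"
  where "admissible C S A B f \<longleftrightarrow>
    (\<exists>I\<in>Ob C. \<exists>p\<in>mor C A I. \<exists>m\<in>mor C I B.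
      deflation S p \<and> inflation S m \<and> f = m \<cdot>\<^bsub>C\<^esub> p)"

section \<open>The category of modules over an additive category\<close>

text \<open>
  Contravariant functors to abelian groups whose underlying sets are subsets of a type \<open>'u\<close>,
  which plays the role of the universe.  Values of \<open>FOb\<close> and \<open>FMap\<close> outside \<open>Ob C\<close> and outside
  the relevant carriers are irrelevant; two functors differing only there are isomorphic.
\<close>

record ('o, 'm, 'u) cfunctor =
  FOb  :: "'o \<Rightarrow> 'u monoid"
  FMap :: "'m \<Rightarrow> 'u \<Rightarrow> 'u"

definition Modules :: "('o, 'm) precat \<Rightarrow> ('o, 'm, 'u) cfunctor set"
  where "Modules C = {F.
    (\<forall>A\<in>Ob C. comm_group (FOb F A)) \<and>
    (\<forall>A\<in>Ob C. \<forall>B\<in>Ob C. \<forall>f\<in>mor C A B. FMap F f \<in> hom (FOb F B) (FOb F A)) \<and>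
    (\<forall>A\<in>Ob C. \<forall>x\<in>carrier (FOb F A). FMap F (Idt C A) x = x) \<and>
    (\<forall>A\<in>Ob C. \<forall>B\<in>Ob C. \<forall>D\<in>Ob C. \<forall>f\<in>mor C A B. \<forall>g\<in>mor C B D. \<forall>x\<in>carrier (FOb F D).
      FMap F (g \<cdot>\<^bsub>C\<^esub> f) x = FMap F f (FMap F g x)) \<and>
    (\<forall>A\<in>Ob C. \<forall>B\<in>Ob C. \<forall>f\<in>mor C A B. \<forall>g\<in>mor C A B. \<forall>x\<in>carrier (FOb F B).
      FMap F (f \<otimes>\<^bsub>Hom C A B\<^esub> g) x = FMap F f x \<otimes>\<^bsub>FOb F A\<^esub> FMap F g x)}"

text \<open>
  The notions below allow source and target to take values in different types, so that
  representable functors (with values in \<open>'m\<close>) and objects of \<open>Modules C\<close> (with values in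
  \<open>'u\<close>) can be related directly.
\<close>

definition nat_trans :: "('o, 'm) precat \<Rightarrow> ('o, 'm, 'a) cfunctor \<Rightarrow> ('o, 'm, 'b) cfunctor \<Rightarrow>
    ('o \<Rightarrow> 'a \<Rightarrow> 'b) \<Rightarrow> bool"
  where "nat_trans C F G \<eta> \<longleftrightarrow>
    (\<forall>A\<in>Ob C. \<eta> A \<in> hom (FOb F A) (FOb G A)) \<and>
    (\<forall>A\<in>Ob C. \<forall>B\<in>Ob C. \<forall>f\<in>mor C A B. \<forall>x\<in>carrier (FOb F B).
      \<eta> A (FMap F f x) = FMap G f (\<eta> B x))"

text \<open>Exactness in the functor category is pointwise.\<close>

definition nt_mono :: "('o, 'm) precat \<Rightarrow> ('o, 'm, 'a) cfunctor \<Rightarrow> ('o \<Rightarrow> 'a \<Rightarrow> 'b) \<Rightarrow> bool"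
  where "nt_mono C F \<eta> \<longleftrightarrow> (\<forall>A\<in>Ob C. inj_on (\<eta> A) (carrier (FOb F A)))"

definition nt_epi :: "('o, 'm) precat \<Rightarrow> ('o, 'm, 'a) cfunctor \<Rightarrow> ('o, 'm, 'b) cfunctor \<Rightarrow>
    ('o \<Rightarrow> 'a \<Rightarrow> 'b) \<Rightarrow> bool"
  where "nt_epi C F G \<eta> \<longleftrightarrow> (\<forall>A\<in>Ob C. \<eta> A ` carrier (FOb F A) = carrier (FOb G A))"

definition nt_exact :: "('o, 'm) precat \<Rightarrow>
    ('o, 'm, 'a) cfunctor \<Rightarrow> ('o, 'm, 'b) cfunctor \<Rightarrow> ('o, 'm, 'c) cfunctor \<Rightarrow>
    ('o \<Rightarrow> 'a \<Rightarrow> 'b) \<Rightarrow> ('o \<Rightarrow> 'b \<Rightarrow> 'c) \<Rightarrow> bool"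
  where "nt_exact C F G H \<eta> \<theta> \<longleftrightarrow>
    (\<forall>A\<in>Ob C. \<eta> A ` carrier (FOb F A) = kernel (FOb G A) (FOb H A) (\<theta> A))"

definition nt_iso :: "('o, 'm) precat \<Rightarrow> ('o, 'm, 'a) cfunctor \<Rightarrow> ('o, 'm, 'b) cfunctor \<Rightarrow> bool"
  where "nt_iso C F G \<longleftrightarrow>
    (\<exists>\<eta>. nat_trans C F G \<eta> \<and>
      (\<forall>A\<in>Ob C. bij_betw (\<eta> A) (carrier (FOb F A)) (carrier (FOb G A))))"

definition direct_sum ::
    "('o, 'm, 'a) cfunctor \<Rightarrow> ('o, 'm, 'b) cfunctor \<Rightarrow> ('o, 'm, 'a \<times> 'b) cfunctor"
  where "direct_sum F G =
    \<lparr>FOb = (\<lambda>A. FOb F A \<times>\<times> FOb G A), FMap = (\<lambda>f. map_prod (FMap F f) (FMap G f))\<rparr>"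

definition Yon :: "('o, 'm) precat \<Rightarrow> 'o \<Rightarrow> ('o, 'm, 'm) cfunctor"
  where "Yon C X = \<lparr>FOb = (\<lambda>A. Hom C A X), FMap = (\<lambda>f g. g \<cdot>\<^bsub>C\<^esub> f)\<rparr>"

definition yon_map :: "('o, 'm) precat \<Rightarrow> 'm \<Rightarrow> 'o \<Rightarrow> 'm \<Rightarrow> 'm"
  where "yon_map C f = (\<lambda>A g. f \<cdot>\<^bsub>C\<^esub> g)"

section \<open>Subcategories of the module category\<close>

definition fp_modules :: "('o, 'm) precat \<Rightarrow> ('o, 'm, 'u) cfunctor set"
  where "fp_modules C = {F \<in> Modules C. \<exists>X\<in>Ob C. \<exists>Y\<in>Ob C. \<exists>\<alpha> \<pi>.
    nat_trans C (Yon C X) (Yon C Y) \<alpha> \<and> nat_trans C (Yon C Y) F \<pi> \<and>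
    nt_exact C (Yon C X) (Yon C Y) F \<alpha> \<pi> \<and> nt_epi C (Yon C Y) F \<pi>}"

text \<open>\<open>Hom(-,X) \<rightarrow> Hom(-,Y) \<rightarrow> F \<rightarrow> 0\<close> is exact, the first map being \<open>Hom(-,f)\<close>.\<close>

definition presented_by ::
    "('o, 'm) precat \<Rightarrow> 'o \<Rightarrow> 'o \<Rightarrow> 'm \<Rightarrow> ('o, 'm, 'u) cfunctor \<Rightarrow> bool"
  where "presented_by C X Y f F \<longleftrightarrow> f \<in> mor C X Y \<and>
    (\<exists>\<pi>. nat_trans C (Yon C Y) F \<pi> \<and>
      nt_exact C (Yon C X) (Yon C Y) F (yon_map C f) \<pi> \<and> nt_epi C (Yon C Y) F \<pi>)"

definition mod_adm :: "('o, 'm) precat \<Rightarrow> ('m \<times> 'm) set \<Rightarrow> ('o, 'm, 'u) cfunctor set"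
  where "mod_adm C S = {F \<in> Modules C. \<exists>X\<in>Ob C. \<exists>Y\<in>Ob C. \<exists>f.
    admissible C S X Y f \<and> presented_by C X Y f F}"

definition P2 :: "('o, 'm) precat \<Rightarrow> ('o, 'm, 'u) cfunctor set"
  where "P2 C = {F \<in> Modules C. \<exists>X\<in>Ob C. \<exists>Y\<in>Ob C. \<exists>Z\<in>Ob C. \<exists>\<alpha> \<beta> \<pi>.
    nat_trans C (Yon C X) (Yon C Y) \<alpha> \<and> nat_trans C (Yon C Y) (Yon C Z) \<beta> \<and>
    nat_trans C (Yon C Z) F \<pi> \<and>
    nt_mono C (Yon C X) \<alpha> \<and> nt_exact C (Yon C X) (Yon C Y) (Yon C Z) \<alpha> \<beta> \<and>
    nt_exact C (Yon C Y) (Yon C Z) F \<beta> \<pi> \<and> nt_epi C (Yon C Z) F \<pi>}"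

definition subcategory_of ::
    "('o, 'm) precat \<Rightarrow> ('o, 'm, 'u) cfunctor set \<Rightarrow> ('o, 'm, 'u) cfunctor set \<Rightarrow> bool"
  where "subcategory_of C \<D> \<X> \<longleftrightarrow>
    \<X> \<subseteq> \<D> \<and> (\<forall>F\<in>\<X>. \<forall>G\<in>\<D>. nt_iso C F G \<longrightarrow> G \<in> \<X>)"

definition short_exact :: "('o, 'm) precat \<Rightarrow>
    ('o, 'm, 'u) cfunctor \<Rightarrow> ('o, 'm, 'u) cfunctor \<Rightarrow> ('o, 'm, 'u) cfunctor \<Rightarrow> bool"
  where "short_exact C F G H \<longleftrightarrow> (\<exists>\<eta> \<theta>.
    nat_trans C F G \<eta> \<and> nat_trans C G H \<theta> \<and>
    nt_mono C F \<eta> \<and> nt_exact C F G H \<eta> \<theta> \<and> nt_epi C G H \<theta>)"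

text \<open>
  Resolving subcategories of a full subcategory \<open>\<D>\<close> of \<open>Modules C\<close> with the inherited exact
  structure: conflations in \<open>\<D>\<close> are the short exact sequences of modules all of whose terms are
  in \<open>\<D>\<close>.
\<close>

definition resolving ::
    "('o, 'm) precat \<Rightarrow> ('o, 'm, 'u) cfunctor set \<Rightarrow> ('o, 'm, 'u) cfunctor set \<Rightarrow> bool"
  where "resolving C \<D> \<X> \<longleftrightarrow>
    subcategory_of C \<D> \<X> \<and>
    (\<forall>F\<in>\<X>. \<forall>G\<in>\<D>. \<forall>H\<in>\<X>. short_exact C F G H \<longrightarrow> G \<in> \<X>) \<and>
    (\<forall>F\<in>\<D>. \<forall>G\<in>\<D>. \<forall>H\<in>\<X>. nt_iso C H (direct_sum F G) \<longrightarrow> F \<in> \<X>) \<and>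
    (\<forall>F\<in>\<D>. \<forall>G\<in>\<X>. \<forall>H\<in>\<X>. short_exact C F G H \<longrightarrow> F \<in> \<X>) \<and>
    (\<forall>H\<in>\<D>. \<exists>G\<in>\<X>. \<exists>F\<in>\<D>. short_exact C F G H)"

section \<open>The stable category and the transpose\<close>

text \<open>The difference \<open>\<eta> - \<eta>'\<close> factors through a representable functor.\<close>

definition stable_eq :: "('o, 'm) precat \<Rightarrow> ('o, 'm, 'a) cfunctor \<Rightarrow> ('o, 'm, 'b) cfunctor \<Rightarrow>
    ('o \<Rightarrow> 'a \<Rightarrow> 'b) \<Rightarrow> ('o \<Rightarrow> 'a \<Rightarrow> 'b) \<Rightarrow> bool"
  where "stable_eq C F G \<eta> \<eta>' \<longleftrightarrow> (\<exists>X\<in>Ob C. \<exists>\<alpha> \<beta>.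
    nat_trans C F (Yon C X) \<alpha> \<and> nat_trans C (Yon C X) G \<beta> \<and>
    (\<forall>A\<in>Ob C. \<forall>x\<in>carrier (FOb F A). \<eta> A x = \<eta>' A x \<otimes>\<^bsub>FOb G A\<^esub> \<beta> A (\<alpha> A x)))"

definition stable_iso ::
    "('o, 'm) precat \<Rightarrow> ('o, 'm, 'a) cfunctor \<Rightarrow> ('o, 'm, 'b) cfunctor \<Rightarrow> bool"
  where "stable_iso C F G \<longleftrightarrow> (\<exists>\<eta> \<theta>.
    nat_trans C F G \<eta> \<and> nat_trans C G F \<theta> \<and>
    stable_eq C F F (\<lambda>A x. \<theta> A (\<eta> A x)) (\<lambda>A x. x) \<and>
    stable_eq C G G (\<lambda>A x. \<eta> A (\<theta> A x)) (\<lambda>A x. x))"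

text \<open>
  The transpose depends on the choice of a presentation and of a cokernel, and is unique up to
  stable isomorphism, so it is rendered as a relation.  Note that
  \<open>Yon (opp C) X = Hom(X,-)\<close> and that \<open>yon_map (opp C) f\<close> is \<open>Hom(f,-)\<close>, going from
  \<open>Hom(Y,-)\<close> to \<open>Hom(X,-)\<close> for \<open>f : X \<rightarrow> Y\<close>.
\<close>

definition is_transpose ::
    "('o, 'm) precat \<Rightarrow> ('o, 'm, 'u) cfunctor \<Rightarrow> ('o, 'm, 'u) cfunctor \<Rightarrow> bool"
  where "is_transpose C F T \<longleftrightarrow> T \<in> Modules (opp C) \<and>
    (\<exists>X\<in>Ob C. \<exists>Y\<in>Ob C. \<exists>f. presented_by C X Y f F \<and> presented_by (opp C) Y X f T)"

definition Tr :: "('o, 'm) precat \<Rightarrow> ('o, 'm, 'u) cfunctor set \<Rightarrow> ('o, 'm, 'u) cfunctor set"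
  where "Tr C \<X> = {G \<in> fp_modules (opp C).
    \<exists>F\<in>\<X>. \<exists>T. is_transpose C F T \<and> stable_iso (opp C) G T}"

section \<open>Ext groups and grade\<close>

text \<open>
  The group of natural transformations; its elements are made extensional so that equal
  transformations are equal as functions.
\<close>

definition Nat_group :: "('o, 'm) precat \<Rightarrow> ('o, 'm, 'a) cfunctor \<Rightarrow> ('o, 'm, 'b) cfunctor \<Rightarrow>
    ('o \<Rightarrow> 'a \<Rightarrow> 'b) monoid"
  where "Nat_group C F G =
    \<lparr>carrier = {\<eta> \<in> extensional (Ob C). nat_trans C F G \<eta> \<and>
                  (\<forall>A\<in>Ob C. \<eta> A \<in> extensional (carrier (FOb F A)))},
     mult = (\<lambda>\<eta> \<theta>. \<lambda>A\<in>Ob C. \<lambda>x\<in>carrier (FOb F A). \<eta> A x \<otimes>\<^bsub>FOb G A\<^esub> \<theta> A x),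
     one = (\<lambda>A\<in>Ob C. \<lambda>x\<in>carrier (FOb F A). \<one>\<^bsub>FOb G A\<^esub>)\<rparr>"

definition nt_comp :: "('o, 'm) precat \<Rightarrow> ('o, 'm, 'a) cfunctor \<Rightarrow>
    ('o \<Rightarrow> 'b \<Rightarrow> 'c) \<Rightarrow> ('o \<Rightarrow> 'a \<Rightarrow> 'b) \<Rightarrow> ('o \<Rightarrow> 'a \<Rightarrow> 'c)"
  where "nt_comp C F \<theta> \<eta> = (\<lambda>A\<in>Ob C. \<lambda>x\<in>carrier (FOb F A). \<theta> A (\<eta> A x))"

definition projective :: "('o, 'm) precat \<Rightarrow> ('o, 'm, 'u) cfunctor \<Rightarrow> bool"
  where "projective C P \<longleftrightarrow> P \<in> Modules C \<and>
    (\<forall>F\<in>Modules C. \<forall>G\<in>Modules C. \<forall>\<pi> \<phi>.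
      nat_trans C (F :: ('o, 'm, 'u) cfunctor) (G :: ('o, 'm, 'u) cfunctor) \<pi> \<and>
      nt_epi C F G \<pi> \<and> nat_trans C P G \<phi> \<longrightarrow>
      (\<exists>\<psi>. nat_trans C P F \<psi> \<and> (\<forall>A\<in>Ob C. \<forall>x\<in>carrier (FOb P A). \<pi> A (\<psi> A x) = \<phi> A x)))"

definition projective_resolution :: "('o, 'm) precat \<Rightarrow> ('o, 'm, 'u) cfunctor \<Rightarrow>
    (nat \<Rightarrow> ('o, 'm, 'u) cfunctor) \<Rightarrow> (nat \<Rightarrow> 'o \<Rightarrow> 'u \<Rightarrow> 'u) \<Rightarrow> ('o \<Rightarrow> 'u \<Rightarrow> 'u) \<Rightarrow> bool"
  where "projective_resolution C F P d \<epsilon> \<longleftrightarrow>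
    (\<forall>n. projective C (P n)) \<and>
    (\<forall>n. nat_trans C (P (Suc n)) (P n) (d n)) \<and> nat_trans C (P 0) F \<epsilon> \<and>
    (\<forall>n. nt_exact C (P (Suc (Suc n))) (P (Suc n)) (P n) (d (Suc n)) (d n)) \<and>
    nt_exact C (P (Suc 0)) (P 0) F (d 0) \<epsilon> \<and> nt_epi C (P 0) F \<epsilon>"

text \<open>
  The cohomology at \<open>P (Suc j)\<close> of the complex obtained by mapping \<open>P\<close> to \<open>G\<close>; here
  \<open>d j : P (Suc j) \<rightarrow> P j\<close>.
\<close>

definition cohomology :: "('o, 'm) precat \<Rightarrow> (nat \<Rightarrow> ('o, 'm, 'u) cfunctor) \<Rightarrow>
    (nat \<Rightarrow> 'o \<Rightarrow> 'u \<Rightarrow> 'u) \<Rightarrow> ('o, 'm, 'b) cfunctor \<Rightarrow> nat \<Rightarrow> ('o \<Rightarrow> 'u \<Rightarrow> 'b) set monoid"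
  where "cohomology C P d G j =
    (Nat_group C (P (Suc j)) G)
      \<lparr>carrier := {\<theta> \<in> carrier (Nat_group C (P (Suc j)) G).
         nt_comp C (P (Suc (Suc j))) \<theta> (d (Suc j)) = \<one>\<^bsub>Nat_group C (P (Suc (Suc j))) G\<^esub>}\<rparr>
    Mod ((\<lambda>\<phi>. nt_comp C (P (Suc j)) \<phi> (d j)) ` carrier (Nat_group C (P j) G))"

text \<open>
  Positive-degree Ext groups, computed from some projective resolution in \<open>Modules C\<close>: the group
  \<open>Ext_pos C F G j\<close> is \<open>Ext\<close> in degree \<open>j + 1\<close>, and \<open>Ext\<close> in degree \<open>0\<close> is
  \<open>Nat_group C F G\<close>.
\<close>

definition Ext_pos :: "('o, 'm) precat \<Rightarrow> ('o, 'm, 'u) cfunctor \<Rightarrow> ('o, 'm, 'b) cfunctor \<Rightarrow>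
    nat \<Rightarrow> ('o \<Rightarrow> 'u \<Rightarrow> 'b) set monoid"
  where "Ext_pos C F G j =
    (case (SOME (P, d, \<epsilon>). projective_resolution C F P d \<epsilon>) of
      (P, d, \<epsilon>) \<Rightarrow> cohomology C P d G j)"

fun Ext_vanishes :: "('o, 'm) precat \<Rightarrow> nat \<Rightarrow> ('o, 'm, 'u) cfunctor \<Rightarrow>
    ('o, 'm, 'b) cfunctor \<Rightarrow> bool"
  where
    "Ext_vanishes C 0 F G \<longleftrightarrow>
      carrier (Nat_group C F G) = {\<one>\<^bsub>Nat_group C F G\<^esub>}"
  | "Ext_vanishes C (Suc j) F G \<longleftrightarrow>
      carrier (Ext_pos C F G j) = {\<one>\<^bsub>Ext_pos C F G j\<^esub>}"

definition grade :: "('o, 'm) precat \<Rightarrow> ('o, 'm, 'u) cfunctor \<Rightarrow> enat"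
  where "grade C F =
    Sup {enat i | i. \<forall>j<i. \<forall>X\<in>Ob C. Ext_vanishes C j F (Yon C X)}"

end

theory Submission
  imports Defs
begin

text \<open>
  A finitely presented module is \<open>coker Hom(-,f)\<close> for an arrow \<open>f\<close>, and its transpose is presented by
  the same \<open>f\<close> in the opposite category.  So a subcategory \<open>\<X>\<close> is replaced by the self-dual datum
  of the class \<open>M\<close> of all arrows presenting its objects: for \<open>mod\<^sub>a\<^sub>d\<^sub>m\<close> these are the admissible
  arrows, because admissibility is invariant under stable isomorphism and retracts.  Membership in
  \<open>\<P>\<^sup>2\<close> means that \<open>f\<close> has a kernel, and closure of \<open>\<X>\<close> under extensions and kernels of
  deflations becomes closure of \<open>M\<close> under short exact sequences of cokernels.  When \<open>f\<close> has a kernel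
  \<open>k\<close>, \<open>Hom(-,f)\<close> and \<open>Hom(-,k)\<close> start a projective resolution, whence the grade of
  \<open>coker Hom(-,f)\<close> is \<open>1\<close> iff \<open>f\<close> is an epimorphism that is not the cokernel of \<open>k\<close>.
  The conflations belonging to \<open>M\<close> are therefore the kernel-cokernel pairs with both components
  in \<open>M\<close>, and every arrow of \<open>M\<close> factors as an epimorphism in \<open>M\<close> followed by a monomorphism
  in \<open>M\<close>.
\<close>

section \<open>Arrows of an additive category\<close>

text \<open>The hypotheses speak of kernels only, so every statement about cokernels and pushouts is
  obtained in \<open>opp C\<close>; this works because \<open>M\<close> is the same set of arrows
  there. That identity is not free: \<open>Tr\<close> is defined up to stable isomorphism, so
  \<open>M\<close> must first be shown to contain, with an arrow, all arrows presenting a stable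
  retract of its module. The conditions of \<open>stably_closed\<close> isolate what this takes, and
  both sides of the correspondence satisfy them. Idempotent completeness enters through retracts of
  arrows: to see that a retract again has a kernel, is a deflation or is admissible, an induced
  idempotent has to be split. The injection of \<open>'m set\<close> into \<open>'u\<close> lets a
  cokernel of representable functors, whose elements are cosets of arrows, be realized in
  \<open>Modules C\<close>. Since \<open>Yon C X\<close> takes values in \<open>'m\<close>, its copy
  with values in \<open>'u\<close> is the module presented by a zero arrow out of a zero object.
  Disjointness of the Hom-sets lets source and target be read off an arrow, so composites and sums
  are written without objects.\<close>

definition arr :: "('o, 'm) precat \<Rightarrow> 'm \<Rightarrow> bool"
  where "arr C f \<longleftrightarrow> (\<exists>A\<in>Ob C. \<exists>B\<in>Ob C. f \<in> mor C A B)"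

definition src :: "('o, 'm) precat \<Rightarrow> 'm \<Rightarrow> 'o"
  where "src C f = (SOME A. A \<in> Ob C \<and> (\<exists>B\<in>Ob C. f \<in> mor C A B))"

definition tgt :: "('o, 'm) precat \<Rightarrow> 'm \<Rightarrow> 'o"
  where "tgt C f = (SOME B. B \<in> Ob C \<and> (\<exists>A\<in>Ob C. f \<in> mor C A B))"

text \<open>The group is found from the source and target of the first summand, so that sums carry
  no object labels.\<close>

definition add :: "('o, 'm) precat \<Rightarrow> 'm \<Rightarrow> 'm \<Rightarrow> 'm"  (infixl "\<boxplus>\<index>" 65)
  where "f \<boxplus>\<^bsub>C\<^esub> g = f \<otimes>\<^bsub>Hom C (src C f) (tgt C f)\<^esub> g"

definition neg :: "('o, 'm) precat \<Rightarrow> 'm \<Rightarrow> 'm"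
  where "neg C f = inv\<^bsub>Hom C (src C f) (tgt C f)\<^esub> f"

abbreviation zer :: "('o, 'm) precat \<Rightarrow> 'o \<Rightarrow> 'o \<Rightarrow> 'm"
  where "zer C A B \<equiv> \<one>\<^bsub>Hom C A B\<^esub>"

lemma opp_simps [simp]:
  "Ob (opp C) = Ob C" "Hom (opp C) A B = Hom C B A" "Idt (opp C) = Idt C"
  "g \<cdot>\<^bsub>opp C\<^esub> f = f \<cdot>\<^bsub>C\<^esub> g" "opp (opp C) = C"
  by (simp_all add: opp_def)

lemma arr_opp [simp]: "arr (opp C) f = arr C f"
  by (auto simp: arr_def)

lemma src_opp [simp]: "src (opp C) f = tgt C f"
  by (simp add: src_def tgt_def)

lemma tgt_opp [simp]: "tgt (opp C) f = src C f"
  by (simp add: src_def tgt_def)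

lemma add_opp [simp]: "f \<boxplus>\<^bsub>opp C\<^esub> g = f \<boxplus>\<^bsub>C\<^esub> g"
  by (simp add: add_def)

text \<open>The axioms are self-dual; a biproduct is dualized by exchanging its injections with its
  projections.\<close>

lemma additive_category_opp:
  assumes "additive_category C"
  shows "additive_category (opp C)"
proof -
  interpret additive_category C by fact
  show ?thesis
  proof (rule additive_category.intro)
    fix A B assume "A \<in> Ob (opp C)" "B \<in> Ob (opp C)"
    then obtain P i j p q where "P \<in> Ob C" "i \<in> mor C A P" "j \<in> mor C B P" "p \<in> mor C P A"
      "q \<in> mor C P B" "p \<cdot>\<^bsub>C\<^esub> i = Idt C A" "q \<cdot>\<^bsub>C\<^esub> j = Idt C B" "q \<cdot>\<^bsub>C\<^esub> i = \<one>\<^bsub>Hom C A B\<^esub>"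
      "p \<cdot>\<^bsub>C\<^esub> j = \<one>\<^bsub>Hom C B A\<^esub>" "(i \<cdot>\<^bsub>C\<^esub> p) \<otimes>\<^bsub>Hom C P P\<^esub> (j \<cdot>\<^bsub>C\<^esub> q) = Idt C P"
      using biproduct[of A B] by auto
    then show "\<exists>P\<in>Ob (opp C). \<exists>i\<in>mor (opp C) A P. \<exists>j\<in>mor (opp C) B P.
        \<exists>p\<in>mor (opp C) P A. \<exists>q\<in>mor (opp C) P B.
          p \<cdot>\<^bsub>opp C\<^esub> i = Idt (opp C) A \<and> q \<cdot>\<^bsub>opp C\<^esub> j = Idt (opp C) B \<and>
          q \<cdot>\<^bsub>opp C\<^esub> i = \<one>\<^bsub>Hom (opp C) A B\<^esub> \<and> p \<cdot>\<^bsub>opp C\<^esub> j = \<one>\<^bsub>Hom (opp C) B A\<^esub> \<and>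
          (i \<cdot>\<^bsub>opp C\<^esub> p) \<otimes>\<^bsub>Hom (opp C) P P\<^esub> (j \<cdot>\<^bsub>opp C\<^esub> q) = Idt (opp C) P"
      by (intro bexI[of _ P] bexI[of _ p] bexI[of _ q] bexI[of _ i] bexI[of _ j]) auto
  qed (auto simp: Hom_comm_group Idt_mor Cmp_mor Cmp_Idt Idt_Cmp Cmp_assoc[symmetric]
      Cmp_add_left Cmp_add_right zero_object dest: Hom_disjoint)
qed

lemma idempotent_complete_opp:
  assumes "idempotent_complete C"
  shows "idempotent_complete (opp C)"
  using assms unfolding idempotent_complete_def by (simp) blast

text \<open>Testing against zero suffices because parallel arrows can be subtracted;
  \<open>monic_cancel\<close> recovers the usual form.\<close>

definition monic :: "('o, 'm) precat \<Rightarrow> 'm \<Rightarrow> bool"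
  where "monic C f \<longleftrightarrow> arr C f \<and> (\<forall>t. arr C t \<longrightarrow> tgt C t = src C f \<longrightarrow>
    f \<cdot>\<^bsub>C\<^esub> t = zer C (src C t) (tgt C f) \<longrightarrow> t = zer C (src C t) (src C f))"

abbreviation epic :: "('o, 'm) precat \<Rightarrow> 'm \<Rightarrow> bool"
  where "epic C \<equiv> monic (opp C)"

text \<open>Uniqueness of the factorization is left to \<open>monic\<close>. In
  \<open>coker_of C p i\<close> the cokernel \<open>p\<close> stands first, being the kernel of
  \<open>i\<close> in the opposite category.\<close>

definition ker_of :: "('o, 'm) precat \<Rightarrow> 'm \<Rightarrow> 'm \<Rightarrow> bool"
  where "ker_of C i p \<longleftrightarrow> monic C i \<and> arr C p \<and> src C p = tgt C i \<and>
    p \<cdot>\<^bsub>C\<^esub> i = zer C (src C i) (tgt C p) \<and>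
    (\<forall>t. arr C t \<longrightarrow> tgt C t = src C p \<longrightarrow> p \<cdot>\<^bsub>C\<^esub> t = zer C (src C t) (tgt C p) \<longrightarrow>
      (\<exists>g. arr C g \<and> src C g = src C t \<and> tgt C g = src C i \<and> i \<cdot>\<^bsub>C\<^esub> g = t))"

abbreviation coker_of :: "('o, 'm) precat \<Rightarrow> 'm \<Rightarrow> 'm \<Rightarrow> bool"
  where "coker_of C p i \<equiv> ker_of (opp C) p i"

text \<open>Uniqueness of the induced arrow is encoded as joint monicity of \<open>p\<close> and
  \<open>q\<close>, again tested against zero.\<close>

definition pullback_of :: "('o, 'm) precat \<Rightarrow> 'm \<Rightarrow> 'm \<Rightarrow> 'm \<Rightarrow> 'm \<Rightarrow> bool"
  where "pullback_of C p q f g \<longleftrightarrow> arr C p \<and> arr C q \<and> arr C f \<and> arr C g \<and>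
    src C q = src C p \<and> src C f = tgt C p \<and> src C g = tgt C q \<and> tgt C g = tgt C f \<and>
    f \<cdot>\<^bsub>C\<^esub> p = g \<cdot>\<^bsub>C\<^esub> q \<and>
    (\<forall>t. arr C t \<longrightarrow> tgt C t = src C p \<longrightarrow> p \<cdot>\<^bsub>C\<^esub> t = zer C (src C t) (tgt C p) \<longrightarrow>
      q \<cdot>\<^bsub>C\<^esub> t = zer C (src C t) (tgt C q) \<longrightarrow> t = zer C (src C t) (src C p)) \<and>
    (\<forall>a b. arr C a \<longrightarrow> arr C b \<longrightarrow> src C b = src C a \<longrightarrow> tgt C a = src C f \<longrightarrow>
      tgt C b = src C g \<longrightarrow> f \<cdot>\<^bsub>C\<^esub> a = g \<cdot>\<^bsub>C\<^esub> b \<longrightarrow>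
      (\<exists>h. arr C h \<and> src C h = src C a \<and> tgt C h = src C p \<and> p \<cdot>\<^bsub>C\<^esub> h = a \<and> q \<cdot>\<^bsub>C\<^esub> h = b))"

definition biprod :: "('o, 'm) precat \<Rightarrow> 'o \<Rightarrow> 'o \<Rightarrow> 'o \<Rightarrow> 'm \<Rightarrow> 'm \<Rightarrow> 'm \<Rightarrow> 'm \<Rightarrow> bool"
  where "biprod C P A B i j p q \<longleftrightarrow> P \<in> Ob C \<and> A \<in> Ob C \<and> B \<in> Ob C \<and>
    arr C i \<and> arr C j \<and> arr C p \<and> arr C q \<and>
    src C i = A \<and> tgt C i = P \<and> src C j = B \<and> tgt C j = P \<and>
    src C p = P \<and> tgt C p = A \<and> src C q = P \<and> tgt C q = B \<and>
    p \<cdot>\<^bsub>C\<^esub> i = Idt C A \<and> q \<cdot>\<^bsub>C\<^esub> j = Idt C B \<and>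
    q \<cdot>\<^bsub>C\<^esub> i = zer C A B \<and> p \<cdot>\<^bsub>C\<^esub> j = zer C B A \<and>
    i \<cdot>\<^bsub>C\<^esub> p \<boxplus>\<^bsub>C\<^esub> j \<cdot>\<^bsub>C\<^esub> q = Idt C P"

definition is_zero :: "('o, 'm) precat \<Rightarrow> 'o \<Rightarrow> bool"
  where "is_zero C Z \<longleftrightarrow> Z \<in> Ob C \<and> Idt C Z = zer C Z Z"

lemma biprod_opp [simp]: "biprod (opp C) P A B p q i j \<longleftrightarrow> biprod C P A B i j p q"
  unfolding biprod_def by auto

section \<open>Arithmetic of arrows and biproducts\<close>

context additive_category
begin

lemma arr_src_tgt:
  assumes "f \<in> mor C A B" "A \<in> Ob C" "B \<in> Ob C"
  shows "arr C f" "src C f = A" "tgt C f = B"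
proof -
  show "arr C f" using assms by (auto simp: arr_def)
  have "src C f \<in> Ob C \<and> (\<exists>B\<in>Ob C. f \<in> mor C (src C f) B)"
    unfolding src_def by (rule someI[of _ A]) (use assms in auto)
  then show "src C f = A" using assms Hom_disjoint by blast
  have "tgt C f \<in> Ob C \<and> (\<exists>A\<in>Ob C. f \<in> mor C A (tgt C f))"
    unfolding tgt_def by (rule someI[of _ B]) (use assms in auto)
  then show "tgt C f = B" using assms Hom_disjoint by blast
qed

lemma src_tgt_Ob [simp]:
  assumes "arr C f"
  shows "src C f \<in> Ob C" "tgt C f \<in> Ob C"
  using assms arr_src_tgt unfolding arr_def by blast+

lemma mor_iff [simp]:
  "\<lbrakk>A \<in> Ob C; B \<in> Ob C\<rbrakk> \<Longrightarrow> f \<in> mor C A B \<longleftrightarrow> arr C f \<and> src C f = A \<and> tgt C f = B"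
  using arr_src_tgt unfolding arr_def by blast

lemma Hom_group: "\<lbrakk>A \<in> Ob C; B \<in> Ob C\<rbrakk> \<Longrightarrow> group (Hom C A B)"
  using Hom_comm_group comm_group.axioms by blast

lemma Idt_arr [simp]:
  "A \<in> Ob C \<Longrightarrow> arr C (Idt C A)" "A \<in> Ob C \<Longrightarrow> src C (Idt C A) = A"
  "A \<in> Ob C \<Longrightarrow> tgt C (Idt C A) = A"
  using Idt_mor[of A] by auto

lemma cmp_arr [simp]:
  assumes "arr C f" "arr C g" "tgt C f = src C g"
  shows "arr C (g \<cdot> f)" "src C (g \<cdot> f) = src C f" "tgt C (g \<cdot> f) = tgt C g"
  using Cmp_mor[of "src C f" "tgt C f" "tgt C g" f g] assms by auto

lemma zer_arr [simp]:
  assumes "A \<in> Ob C" "B \<in> Ob C"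
  shows "arr C (zer C A B)" "src C (zer C A B) = A" "tgt C (zer C A B) = B"
proof -
  have "zer C A B \<in> mor C A B"
    using Hom_group[OF assms] by (meson group.is_monoid monoid.one_closed)
  then show "arr C (zer C A B)" "src C (zer C A B) = A" "tgt C (zer C A B) = B"
    using arr_src_tgt assms by auto
qed

lemma add_mor: "\<lbrakk>A \<in> Ob C; B \<in> Ob C; f \<in> mor C A B; g \<in> mor C A B\<rbrakk>
    \<Longrightarrow> f \<boxplus> g = f \<otimes>\<^bsub>Hom C A B\<^esub> g"
  by (simp add: add_def)

lemma add_arr [simp]:
  assumes "arr C f" "arr C g" "src C g = src C f" "tgt C g = tgt C f"
  shows "arr C (f \<boxplus> g)" "src C (f \<boxplus> g) = src C f" "tgt C (f \<boxplus> g) = tgt C f"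
proof -
  interpret group "Hom C (src C f) (tgt C f)" using Hom_group assms by simp
  have "f \<boxplus> g \<in> mor C (src C f) (tgt C f)" unfolding add_def by (rule m_closed) (use assms in auto)
  then show "arr C (f \<boxplus> g)" "src C (f \<boxplus> g) = src C f" "tgt C (f \<boxplus> g) = tgt C f"
    using assms by auto
qed

lemma neg_arr [simp]:
  assumes "arr C f"
  shows "arr C (neg C f)" "src C (neg C f) = src C f" "tgt C (neg C f) = tgt C f"
proof -
  interpret group "Hom C (src C f) (tgt C f)" using Hom_group assms by simp
  have "neg C f \<in> mor C (src C f) (tgt C f)" unfolding neg_def by (rule inv_closed) (use assms in auto)
  then show "arr C (neg C f)" "src C (neg C f) = src C f" "tgt C (neg C f) = tgt C f"
    using assms by auto
qed

lemma cmp_Idt [simp]: "\<lbrakk>arr C f; src C f = A\<rbrakk> \<Longrightarrow> f \<cdot> Idt C A = f"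
  using Cmp_Idt[of A "tgt C f" f] by auto

lemma Idt_cmp [simp]: "\<lbrakk>arr C f; tgt C f = A\<rbrakk> \<Longrightarrow> Idt C A \<cdot> f = f"
  using Idt_Cmp[of "src C f" A f] by auto

lemma cmp_assoc [simp]: "\<lbrakk>arr C f; arr C g; arr C h; tgt C f = src C g; tgt C g = src C h\<rbrakk>
    \<Longrightarrow> (h \<cdot> g) \<cdot> f = h \<cdot> (g \<cdot> f)"
  using Cmp_assoc[of "src C f" "tgt C f" "tgt C g" "tgt C h" f g h] by auto

text \<open>Composites are normalized to right-nested form, where an equation for
  \<open>g \<cdot> f\<close> no longer matches inside a longer composite. This form applies it under
  a further arrow \<open>x\<close>.\<close>

lemma cmp_red: "\<lbrakk>g \<cdot> f = h; arr C f; arr C g; tgt C f = src C g; arr C x; tgt C x = src C f\<rbrakk>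
    \<Longrightarrow> g \<cdot> (f \<cdot> x) = h \<cdot> x"
  using cmp_assoc[of x f g] by simp

lemma cmp_add_left [simp]:
  assumes "arr C f" "arr C g" "arr C g'" "tgt C f = src C g" "src C g' = src C g" "tgt C g' = tgt C g"
  shows "(g \<boxplus> g') \<cdot> f = g \<cdot> f \<boxplus> g' \<cdot> f"
  using Cmp_add_left[of "src C f" "tgt C f" "tgt C g" f g g'] assms by (simp add: add_def)

lemma cmp_add_right [simp]:
  assumes "arr C f" "arr C f'" "arr C g" "tgt C f = src C g" "src C f' = src C f" "tgt C f' = tgt C f"
  shows "g \<cdot> (f \<boxplus> f') = g \<cdot> f \<boxplus> g \<cdot> f'"
  using Cmp_add_right[of "src C f" "tgt C f" "tgt C g" f f' g] assms by (simp add: add_def)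

lemma add_assoc:
  assumes "arr C f" "arr C g" "arr C h" "src C g = src C f" "tgt C g = tgt C f"
    "src C h = src C f" "tgt C h = tgt C f"
  shows "(f \<boxplus> g) \<boxplus> h = f \<boxplus> (g \<boxplus> h)"
proof -
  interpret group "Hom C (src C f) (tgt C f)" using Hom_group assms by simp
  show ?thesis using m_assoc[of f g h] assms add_arr[of f g] by (simp add: add_def)
qed

lemma add_comm:
  assumes "arr C f" "arr C g" "src C g = src C f" "tgt C g = tgt C f"
  shows "f \<boxplus> g = g \<boxplus> f"
proof -
  interpret comm_group "Hom C (src C f) (tgt C f)" using Hom_comm_group assms by simp
  show ?thesis using m_comm[of f g] assms by (simp add: add_def)
qed

lemma add_left_comm:
  assumes "arr C f" "arr C g" "arr C h" "src C g = src C f" "tgt C g = tgt C f"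
    "src C h = src C f" "tgt C h = tgt C f"
  shows "f \<boxplus> (g \<boxplus> h) = g \<boxplus> (f \<boxplus> h)"
  using add_assoc[of f g h] add_assoc[of g f h] add_comm[of f g] assms by simp

lemmas add_ac = add_assoc add_comm add_left_comm

lemma zer_add [simp]: "\<lbrakk>arr C f; src C f = A; tgt C f = B\<rbrakk> \<Longrightarrow> zer C A B \<boxplus> f = f"
  using group.is_monoid[OF Hom_group[of A B]] monoid.l_one[of "Hom C A B" f] by (auto simp: add_def)

lemma add_zer [simp]: "\<lbrakk>arr C f; src C f = A; tgt C f = B\<rbrakk> \<Longrightarrow> f \<boxplus> zer C A B = f"
  using group.is_monoid[OF Hom_group[of A B]] monoid.r_one[of "Hom C A B" f] by (auto simp: add_def)

lemma add_neg [simp]: "\<lbrakk>arr C f\<rbrakk> \<Longrightarrow> f \<boxplus> neg C f = zer C (src C f) (tgt C f)"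
  using group.r_inv[OF Hom_group[of "src C f" "tgt C f"], of f] by (auto simp: add_def neg_def)

lemma neg_add_self [simp]: "\<lbrakk>arr C f\<rbrakk> \<Longrightarrow> neg C f \<boxplus> f = zer C (src C f) (tgt C f)"
  using add_comm[of "neg C f" f] by simp

lemma add_neg' [simp]:
  "\<lbrakk>arr C f; arr C g; src C g = src C f; tgt C g = tgt C f\<rbrakk> \<Longrightarrow> f \<boxplus> (neg C f \<boxplus> g) = g"
  "\<lbrakk>arr C f; arr C g; src C g = src C f; tgt C g = tgt C f\<rbrakk> \<Longrightarrow> neg C f \<boxplus> (f \<boxplus> g) = g"
  using add_assoc[of f "neg C f" g] add_assoc[of "neg C f" f g] by simp_all

lemma add_left_cancel [simp]:
  assumes "arr C f" "arr C g" "arr C h" "src C g = src C f" "tgt C g = tgt C f"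
    "src C h = src C f" "tgt C h = tgt C f"
  shows "f \<boxplus> g = f \<boxplus> h \<longleftrightarrow> g = h"
  using add_neg'(2)[of f g] add_neg'(2)[of f h] assms by metis

lemma add_eq_zer_neg:
  assumes "arr C f" "arr C g" "src C g = src C f" "tgt C g = tgt C f"
    "f \<boxplus> g = zer C (src C f) (tgt C f)"
  shows "g = neg C f"
  using add_neg'(2)[of f g] assms by simp

lemma cmp_zer [simp]: "\<lbrakk>arr C g; A \<in> Ob C; src C g = B\<rbrakk> \<Longrightarrow> g \<cdot> zer C A B = zer C A (tgt C g)"
proof -
  assume a: "arr C g" "A \<in> Ob C" "src C g = B"
  let ?x = "g \<cdot> zer C A B"
  have B: "B \<in> Ob C" using a by auto
  have "?x = g \<cdot> (zer C A B \<boxplus> zer C A B)" using a B by (simp del: cmp_add_right)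
  also have "\<dots> = ?x \<boxplus> ?x" using a B by (subst cmp_add_right) auto
  finally have "?x \<boxplus> zer C A (tgt C g) = ?x \<boxplus> ?x" using a B by simp
  then show ?thesis using a B by (subst (asm) add_left_cancel) auto
qed

lemma zer_cmp [simp]: "\<lbrakk>arr C g; D \<in> Ob C; tgt C g = B\<rbrakk> \<Longrightarrow> zer C B D \<cdot> g = zer C (src C g) D"
proof -
  assume a: "arr C g" "D \<in> Ob C" "tgt C g = B"
  let ?x = "zer C B D \<cdot> g"
  have B: "B \<in> Ob C" using a by auto
  have "?x = (zer C B D \<boxplus> zer C B D) \<cdot> g" using a B by (simp del: cmp_add_left)
  also have "\<dots> = ?x \<boxplus> ?x" using a B by (subst cmp_add_left) auto
  finally have "?x \<boxplus> zer C (src C g) D = ?x \<boxplus> ?x" using a B by simp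
  then show ?thesis using a B by (subst (asm) add_left_cancel) auto
qed

lemma cmp_neg [simp]: "\<lbrakk>arr C f; arr C g; tgt C f = src C g\<rbrakk> \<Longrightarrow> g \<cdot> neg C f = neg C (g \<cdot> f)"
  by (rule add_eq_zer_neg) (simp_all flip: cmp_add_right)

lemma neg_cmp [simp]: "\<lbrakk>arr C f; arr C g; tgt C f = src C g\<rbrakk> \<Longrightarrow> neg C g \<cdot> f = neg C (g \<cdot> f)"
  by (rule add_eq_zer_neg) (simp_all flip: cmp_add_left)

lemma neg_neg [simp]: "arr C f \<Longrightarrow> neg C (neg C f) = f"
  using add_eq_zer_neg[of "neg C f" f] by simp

lemma neg_zer [simp]: "\<lbrakk>A \<in> Ob C; B \<in> Ob C\<rbrakk> \<Longrightarrow> neg C (zer C A B) = zer C A B"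
  using add_eq_zer_neg[of "zer C A B" "zer C A B"] by simp

lemma neg_add [simp]:
  assumes "arr C f" "arr C g" "src C g = src C f" "tgt C g = tgt C f"
  shows "neg C (f \<boxplus> g) = neg C f \<boxplus> neg C g"
  by (rule add_eq_zer_neg[symmetric])
    (use assms in \<open>simp_all add: add_assoc add_left_comm[of g]\<close>)

lemma eq_if_diff_zer:
  assumes "f \<boxplus> neg C g = zer C (src C f) (tgt C f)" "arr C f" "arr C g"
    "src C g = src C f" "tgt C g = tgt C f"
  shows "f = g"
  using add_eq_zer_neg[of f "neg C g"] assms by (metis neg_arr neg_neg)

lemma monicD: "\<lbrakk>monic C f; f \<cdot> t = zer C (src C t) (tgt C f); arr C t; tgt C t = src C f\<rbrakk>
    \<Longrightarrow> t = zer C (src C t) (src C f)"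
  by (simp add: monic_def)

lemma monic_cancel:
  assumes "monic C f" "arr C t" "arr C t'" "tgt C t = src C f" "tgt C t' = src C f"
    "src C t' = src C t" "f \<cdot> t = f \<cdot> t'"
  shows "t = t'"
proof (rule eq_if_diff_zer)
  have f: "arr C f" using assms by (simp add: monic_def)
  have "f \<cdot> (t \<boxplus> neg C t') = zer C (src C t) (tgt C f)"
    using assms f by simp
  then show "t \<boxplus> neg C t' = zer C (src C t) (tgt C t)"
    using assms f unfolding monic_def by (metis add_arr neg_arr)
qed (use assms in auto)

lemma zero_obE:
  obtains Z where "is_zero C Z"
  using zero_object by (auto simp: is_zero_def)

lemma src_zero: "\<lbrakk>is_zero C (src C f); arr C f\<rbrakk> \<Longrightarrow> f = zer C (src C f) (tgt C f)"
  unfolding is_zero_def by (metis cmp_Idt cmp_zer)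

lemma tgt_zero: "\<lbrakk>is_zero C (tgt C f); arr C f\<rbrakk> \<Longrightarrow> f = zer C (src C f) (tgt C f)"
  unfolding is_zero_def by (metis Idt_cmp zer_cmp)

lemma biprod_ex:
  assumes "A \<in> Ob C" "B \<in> Ob C"
  shows "\<exists>P i j p q. biprod C P A B i j p q"
proof -
  obtain P i j p q where *: "P \<in> Ob C" "i \<in> mor C A P" "j \<in> mor C B P" "p \<in> mor C P A"
      "q \<in> mor C P B" "p \<cdot> i = Idt C A" "q \<cdot> j = Idt C B" "q \<cdot> i = \<one>\<^bsub>Hom C A B\<^esub>"
      "p \<cdot> j = \<one>\<^bsub>Hom C B A\<^esub>" "(i \<cdot> p) \<otimes>\<^bsub>Hom C P P\<^esub> (j \<cdot> q) = Idt C P"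
    using biproduct[OF assms] by auto
  show ?thesis
    by (intro exI[of _ P] exI[of _ i] exI[of _ j] exI[of _ p] exI[of _ q])
      (use * assms in \<open>auto simp: biprod_def add_def\<close>)
qed

lemma split_idempotent:
  assumes "idempotent_complete C" "arr C e" "tgt C e = src C e" "e \<cdot> e = e"
  obtains r s where "arr C r" "arr C s" "src C r = src C e" "tgt C s = src C e"
    "src C s = tgt C r" "s \<cdot> r = e" "r \<cdot> s = Idt C (tgt C r)"
proof -
  obtain B r s where "B \<in> Ob C" "r \<in> mor C (src C e) B" "s \<in> mor C B (src C e)"
      "s \<cdot> r = e" "r \<cdot> s = Idt C B"
    using assms unfolding idempotent_complete_def by (metis mor_iff src_tgt_Ob)
  then show ?thesis using that[of r s] assms by auto
qed

lemma biprodD: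
  assumes "biprod C P A B i j p q"
  shows "P \<in> Ob C" "A \<in> Ob C" "B \<in> Ob C" "arr C i" "arr C j" "arr C p" "arr C q"
    "src C i = A" "tgt C i = P" "src C j = B" "tgt C j = P"
    "src C p = P" "tgt C p = A" "src C q = P" "tgt C q = B"
    "p \<cdot> i = Idt C A" "q \<cdot> j = Idt C B"
    "q \<cdot> i = zer C A B" "p \<cdot> j = zer C B A"
    "\<And>x. \<lbrakk>arr C x; tgt C x = A\<rbrakk> \<Longrightarrow> p \<cdot> (i \<cdot> x) = x"
    "\<And>x. \<lbrakk>arr C x; tgt C x = B\<rbrakk> \<Longrightarrow> q \<cdot> (j \<cdot> x) = x"
    "\<And>x. \<lbrakk>arr C x; tgt C x = A\<rbrakk> \<Longrightarrow> q \<cdot> (i \<cdot> x) = zer C (src C x) B"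
    "\<And>x. \<lbrakk>arr C x; tgt C x = B\<rbrakk> \<Longrightarrow> p \<cdot> (j \<cdot> x) = zer C (src C x) A"
  using assms unfolding biprod_def by (auto simp: cmp_red[of p i] cmp_red[of q j] cmp_red[of q i] cmp_red[of p j])

lemma biprod_expand:
  assumes "biprod C P A B i j p q" "arr C t"
  shows "tgt C t = P \<Longrightarrow> t = i \<cdot> (p \<cdot> t) \<boxplus> j \<cdot> (q \<cdot> t)"
    and "src C t = P \<Longrightarrow> t = (t \<cdot> i) \<cdot> p \<boxplus> (t \<cdot> j) \<cdot> q"
proof -
  have *: "i \<cdot> p \<boxplus> j \<cdot> q = Idt C P" using assms by (simp add: biprod_def)
  { assume "tgt C t = P"
    then show "t = i \<cdot> (p \<cdot> t) \<boxplus> j \<cdot> (q \<cdot> t)"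
      using arg_cong[OF *, of "\<lambda>x. x \<cdot> t"] assms(2) biprodD[OF assms(1)] by simp }
  { assume "src C t = P"
    then show "t = (t \<cdot> i) \<cdot> p \<boxplus> (t \<cdot> j) \<cdot> q"
      using arg_cong[OF *, of "\<lambda>x. t \<cdot> x"] assms(2) biprodD[OF assms(1)] by simp }
qed

lemma biprod_eqI:
  assumes "biprod C P A B i j p q" "arr C t" "arr C t'" "tgt C t = P" "tgt C t' = P"
    "p \<cdot> t = p \<cdot> t'" "q \<cdot> t = q \<cdot> t'"
  shows "t = t'"
  using biprod_expand(1)[OF assms(1), of t] biprod_expand(1)[OF assms(1), of t'] assms(2-) by simp

lemma biprod_eqI':
  assumes "biprod C P A B i j p q" "arr C t" "arr C t'" "src C t = P" "src C t' = P"
    "t \<cdot> i = t' \<cdot> i" "t \<cdot> j = t' \<cdot> j"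
  shows "t = t'"
  using biprod_expand(2)[OF assms(1), of t] biprod_expand(2)[OF assms(1), of t'] assms(2-) by simp

end

definition iso_arr :: "('o, 'm) precat \<Rightarrow> 'm \<Rightarrow> bool"
  where "iso_arr C f \<longleftrightarrow> arr C f \<and> (\<exists>g. arr C g \<and> src C g = tgt C f \<and> tgt C g = src C f \<and>
    g \<cdot>\<^bsub>C\<^esub> f = Idt C (src C f) \<and> f \<cdot>\<^bsub>C\<^esub> g = Idt C (tgt C f))"

lemma iso_arr_opp [simp]: "iso_arr (opp C) f = iso_arr C f"
  unfolding iso_arr_def by (simp) blast

section \<open>Kernels, pullbacks and isomorphisms\<close>

context additive_category
begin

lemma is_iso_iff:
  "\<lbrakk>A \<in> Ob C; B \<in> Ob C\<rbrakk> \<Longrightarrow> is_iso C A B f \<longleftrightarrow> iso_arr C f \<and> src C f = A \<and> tgt C f = B"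
  unfolding is_iso_def iso_arr_def by auto

lemma monic_arr: "monic C f \<Longrightarrow> arr C f"
  by (simp add: monic_def)

lemma ker_ofD:
  assumes "ker_of C i p"
  shows "monic C i" "arr C i" "arr C p" "src C p = tgt C i" "p \<cdot> i = zer C (src C i) (tgt C p)"
    "\<And>x. \<lbrakk>arr C x; tgt C x = src C i\<rbrakk> \<Longrightarrow> p \<cdot> (i \<cdot> x) = zer C (src C x) (tgt C p)"
proof -
  show *: "monic C i" "arr C i" "arr C p" "src C p = tgt C i" "p \<cdot> i = zer C (src C i) (tgt C p)"
    using assms monic_arr by (auto simp: ker_of_def)
  show "\<And>x. \<lbrakk>arr C x; tgt C x = src C i\<rbrakk> \<Longrightarrow> p \<cdot> (i \<cdot> x) = zer C (src C x) (tgt C p)"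
    using cmp_red[OF *(5)] * by simp
qed

lemma ker_lift:
  assumes "ker_of C i p" "p \<cdot> t = zer C (src C t) (tgt C p)" "arr C t" "tgt C t = src C p"
  obtains g where "arr C g" "src C g = src C t" "tgt C g = src C i" "i \<cdot> g = t"
  using assms unfolding ker_of_def by blast

text \<open>Unique factorization gives monicity because, when \<open>i \<cdot> t\<close> is zero,
  both \<open>t\<close> and the zero arrow factor the zero arrow through \<open>i\<close>.\<close>

lemma is_kernel_iff:
  assumes "A \<in> Ob C" "B \<in> Ob C" "D \<in> Ob C"
  shows "is_kernel C A B D i p \<longleftrightarrow> ker_of C i p \<and> src C i = A \<and> tgt C i = B \<and> tgt C p = D"
proof
  assume L: "is_kernel C A B D i p"
  then have ar: "arr C i" "arr C p" "src C i = A" "tgt C i = B" "tgt C p = D" "src C p = B"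
    "p \<cdot> i = zer C A D" using assms by (auto simp: is_kernel_def)
  have uniq: "\<And>t. arr C t \<Longrightarrow> tgt C t = B \<Longrightarrow> p \<cdot> t = zer C (src C t) D \<Longrightarrow>
      \<exists>!g. arr C g \<and> src C g = src C t \<and> tgt C g = A \<and> i \<cdot> g = t"
    using L assms unfolding is_kernel_def by (metis (no_types, lifting) mor_iff src_tgt_Ob)
  have "monic C i" unfolding monic_def
  proof (intro conjI allI impI)
    fix t assume t: "arr C t" "tgt C t = src C i" "i \<cdot> t = zer C (src C t) (tgt C i)"
    have "\<exists>!g. arr C g \<and> src C g = src C t \<and> tgt C g = A \<and> i \<cdot> g = zer C (src C t) B"
      using uniq[of "zer C (src C t) B"] t ar assms by simp
    moreover have "i \<cdot> zer C (src C t) A = zer C (src C t) B" using t ar by simp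
    ultimately show "t = zer C (src C t) (src C i)"
      using t ar assms zer_arr[of "src C t" A] by (metis src_tgt_Ob)
  qed (use ar in auto)
  then show "ker_of C i p \<and> src C i = A \<and> tgt C i = B \<and> tgt C p = D"
    unfolding ker_of_def using ar uniq by metis
next
  assume R: "ker_of C i p \<and> src C i = A \<and> tgt C i = B \<and> tgt C p = D"
  note d = ker_ofD[OF conjunct1[OF R]]
  show "is_kernel C A B D i p" unfolding is_kernel_def
  proof (intro conjI ballI impI)
    fix W f assume W: "W \<in> Ob C" "f \<in> mor C W B" "p \<cdot> f = zer C W D"
    then have f: "arr C f" "src C f = W" "tgt C f = B" using assms by auto
    obtain g where g: "arr C g" "src C g = W" "tgt C g = A" "i \<cdot> g = f"
      using ker_lift[of i p f] R d W f by metis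
    show "\<exists>!g. g \<in> mor C W A \<and> i \<cdot> g = f"
      by (rule ex1I[of _ g]) (use g W assms R in \<open>auto intro: monic_cancel[OF d(1)]\<close>)
  qed (use d R assms in auto)
qed

text \<open>As for kernels, uniqueness for the zero cone gives joint monicity of the projections,
  and subtraction of two induced arrows gives uniqueness back.\<close>

lemma is_pullback_iff:
  assumes "W \<in> Ob C" "A \<in> Ob C" "B \<in> Ob C" "D \<in> Ob C"
  shows "is_pullback C W A B D p q f g \<longleftrightarrow>
    pullback_of C p q f g \<and> src C p = W \<and> tgt C p = A \<and> tgt C q = B \<and> tgt C f = D"
proof
  assume L: "is_pullback C W A B D p q f g"
  then have ar: "arr C p" "arr C q" "arr C f" "arr C g" "src C p = W" "src C q = W"
    "tgt C p = A" "tgt C q = B" "src C f = A" "tgt C f = D" "src C g = B" "tgt C g = D"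
    "f \<cdot> p = g \<cdot> q" using assms by (auto simp: is_pullback_def)
  have uniq: "\<And>a b. arr C a \<Longrightarrow> arr C b \<Longrightarrow> src C b = src C a \<Longrightarrow> tgt C a = A \<Longrightarrow> tgt C b = B \<Longrightarrow>
      f \<cdot> a = g \<cdot> b \<Longrightarrow> \<exists>!h. arr C h \<and> src C h = src C a \<and> tgt C h = W \<and> p \<cdot> h = a \<and> q \<cdot> h = b"
    using L assms unfolding is_pullback_def by (metis (no_types, lifting) mor_iff src_tgt_Ob)
  have "t = zer C (src C t) W" if t: "arr C t" "tgt C t = W" "p \<cdot> t = zer C (src C t) A"
    "q \<cdot> t = zer C (src C t) B" for t
  proof -
    have "\<exists>!h. arr C h \<and> src C h = src C t \<and> tgt C h = W \<and> p \<cdot> h = zer C (src C t) A \<and>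
        q \<cdot> h = zer C (src C t) B"
      using uniq[of "zer C (src C t) A" "zer C (src C t) B"] t ar assms by simp
    moreover have "p \<cdot> zer C (src C t) W = zer C (src C t) A" "q \<cdot> zer C (src C t) W = zer C (src C t) B"
      using t ar by auto
    ultimately show ?thesis using t assms zer_arr[of "src C t" W] by (metis src_tgt_Ob)
  qed
  then show "pullback_of C p q f g \<and> src C p = W \<and> tgt C p = A \<and> tgt C q = B \<and> tgt C f = D"
    unfolding pullback_of_def using ar uniq by metis
next
  assume R: "pullback_of C p q f g \<and> src C p = W \<and> tgt C p = A \<and> tgt C q = B \<and> tgt C f = D"
  then have ar: "arr C p" "arr C q" "arr C f" "arr C g" "src C p = W" "src C q = W"
    "tgt C p = A" "tgt C q = B" "src C f = A" "tgt C f = D" "src C g = B" "tgt C g = D"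
    "f \<cdot> p = g \<cdot> q"
    and u: "\<And>t. arr C t \<Longrightarrow> tgt C t = W \<Longrightarrow> p \<cdot> t = zer C (src C t) A \<Longrightarrow>
      q \<cdot> t = zer C (src C t) B \<Longrightarrow> t = zer C (src C t) W"
    and ex: "\<And>a b. arr C a \<Longrightarrow> arr C b \<Longrightarrow> src C b = src C a \<Longrightarrow> tgt C a = A \<Longrightarrow> tgt C b = B \<Longrightarrow>
      f \<cdot> a = g \<cdot> b \<Longrightarrow> \<exists>h. arr C h \<and> src C h = src C a \<and> tgt C h = W \<and> p \<cdot> h = a \<and> q \<cdot> h = b"
    unfolding pullback_of_def by auto
  show "is_pullback C W A B D p q f g" unfolding is_pullback_def
  proof (intro conjI ballI impI)
    fix V a b assume V: "V \<in> Ob C" "a \<in> mor C V A" "b \<in> mor C V B" "f \<cdot> a = g \<cdot> b"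
    then have ab: "arr C a" "src C a = V" "tgt C a = A" "arr C b" "src C b = V" "tgt C b = B"
      using assms by auto
    obtain h where h: "arr C h" "src C h = V" "tgt C h = W" "p \<cdot> h = a" "q \<cdot> h = b"
      using ex[of a b] ab V by auto
    show "\<exists>!h. h \<in> mor C V W \<and> p \<cdot> h = a \<and> q \<cdot> h = b"
    proof (rule ex1I[of _ h])
      fix h' assume "h' \<in> mor C V W \<and> p \<cdot> h' = a \<and> q \<cdot> h' = b"
      then have h': "arr C h'" "src C h' = V" "tgt C h' = W" "p \<cdot> h' = a" "q \<cdot> h' = b"
        using V assms by auto
      have "h' \<boxplus> neg C h = zer C V W" using u[of "h' \<boxplus> neg C h"] h h' ab ar by simp
      then show "h' = h" using eq_if_diff_zer[of h' h] h h' by simp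
    qed (use h V assms in auto)
  qed (use ar assms in auto)
qed

lemma pullback_ofD:
  assumes "pullback_of C p q f g"
  shows "arr C p" "arr C q" "arr C f" "arr C g" "src C q = src C p" "src C f = tgt C p"
    "src C g = tgt C q" "tgt C g = tgt C f" "f \<cdot> p = g \<cdot> q"
  using assms by (auto simp: pullback_of_def)

lemma pullback_lift:
  assumes "pullback_of C p q f g" "arr C a" "arr C b" "src C b = src C a" "tgt C a = src C f"
    "tgt C b = src C g" "f \<cdot> a = g \<cdot> b"
  obtains h where "arr C h" "src C h = src C a" "tgt C h = src C p" "p \<cdot> h = a" "q \<cdot> h = b"
  using assms unfolding pullback_of_def by blast

lemma pullback_eqI:
  assumes "pullback_of C p q f g" "arr C t" "arr C t'" "src C t' = src C t" "tgt C t = src C p"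
    "tgt C t' = src C p" "p \<cdot> t = p \<cdot> t'" "q \<cdot> t = q \<cdot> t'"
  shows "t = t'"
proof (rule eq_if_diff_zer)
  note d = pullback_ofD[OF assms(1)]
  have u: "\<And>t. arr C t \<Longrightarrow> tgt C t = src C p \<Longrightarrow> p \<cdot> t = zer C (src C t) (tgt C p) \<Longrightarrow>
      q \<cdot> t = zer C (src C t) (tgt C q) \<Longrightarrow> t = zer C (src C t) (src C p)"
    using assms(1) unfolding pullback_of_def by blast
  have "t \<boxplus> neg C t' = zer C (src C (t \<boxplus> neg C t')) (src C p)"
    by (rule u) (use assms(2-) d in simp_all)
  then show "t \<boxplus> neg C t' = zer C (src C t) (tgt C t)" using assms by simp
qed (use assms in auto)

lemma pullback_iso:
  assumes 1: "pullback_of C p q f g" and 2: "pullback_of C p' q' f g"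
  obtains h where "iso_arr C h" "arr C h" "src C h = src C p" "tgt C h = src C p'"
    "p' \<cdot> h = p" "q' \<cdot> h = q"
proof -
  note d = pullback_ofD[OF 1] and d' = pullback_ofD[OF 2]
  obtain h where h: "arr C h" "src C h = src C p" "tgt C h = src C p'" "p' \<cdot> h = p" "q' \<cdot> h = q"
    using pullback_lift[OF 2, of p q] d d' by metis
  obtain k where k: "arr C k" "src C k = src C p'" "tgt C k = src C p" "p \<cdot> k = p'" "q \<cdot> k = q'"
    using pullback_lift[OF 1, of p' q'] d d' by metis
  have pk: "p' \<cdot> (h \<cdot> x) = p \<cdot> x" "q' \<cdot> (h \<cdot> x) = q \<cdot> x" if "arr C x" "tgt C x = src C p" for x
    using cmp_red[OF h(4)] cmp_red[OF h(5)] that h d d' by auto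
  have ph: "p \<cdot> (k \<cdot> x) = p' \<cdot> x" "q \<cdot> (k \<cdot> x) = q' \<cdot> x" if "arr C x" "tgt C x = src C p'" for x
    using cmp_red[OF k(4)] cmp_red[OF k(5)] that k d d' by auto
  have "h \<cdot> k = Idt C (src C p')"
    by (rule pullback_eqI[OF 2]) (use h k d d' pk in simp_all)
  moreover have "k \<cdot> h = Idt C (src C p)"
    by (rule pullback_eqI[OF 1]) (use h k d d' ph in simp_all)
  ultimately have "iso_arr C h" unfolding iso_arr_def using h k by auto
  then show ?thesis using that h by blast
qed

lemma ker_iso:
  assumes 1: "ker_of C i p" and 2: "ker_of C i' p"
  obtains h where "iso_arr C h" "arr C h" "src C h = src C i" "tgt C h = src C i'" "i' \<cdot> h = i"
proof -
  note d = ker_ofD[OF 1] and d' = ker_ofD[OF 2]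
  obtain h where h: "arr C h" "src C h = src C i" "tgt C h = src C i'" "i' \<cdot> h = i"
    using ker_lift[OF 2, of i] d d' by metis
  obtain k where k: "arr C k" "src C k = src C i'" "tgt C k = src C i" "i \<cdot> k = i'"
    using ker_lift[OF 1, of i'] d d' by metis
  have "h \<cdot> k = Idt C (src C i')"
    by (rule monic_cancel[OF d'(1)]) (use h k d d' cmp_red[OF h(4)] in simp_all)
  moreover have "k \<cdot> h = Idt C (src C i)"
    by (rule monic_cancel[OF d(1)]) (use h k d d' cmp_red[OF k(4)] in simp_all)
  ultimately have "iso_arr C h" unfolding iso_arr_def using h k by auto
  then show ?thesis using that h by blast
qed

lemma iso_arrE:
  assumes "iso_arr C f"
  obtains g where "arr C g" "src C g = tgt C f" "tgt C g = src C f"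
    "g \<cdot> f = Idt C (src C f)" "f \<cdot> g = Idt C (tgt C f)" "iso_arr C g" "arr C f"
  using assms unfolding iso_arr_def by force

lemma iso_Idt: "A \<in> Ob C \<Longrightarrow> iso_arr C (Idt C A)"
  unfolding iso_arr_def by (auto intro!: exI[of _ "Idt C A"])

lemma iso_monic: 
  assumes "iso_arr C f" shows "monic C f"
proof -
  obtain g where g: "arr C g" "src C g = tgt C f" "tgt C g = src C f"
    "g \<cdot> f = Idt C (src C f)" "arr C f" using iso_arrE[OF assms] by metis
  show ?thesis unfolding monic_def
  proof (intro conjI allI impI)
    fix t assume t: "arr C t" "tgt C t = src C f" "f \<cdot> t = zer C (src C t) (tgt C f)"
    have "t = g \<cdot> (f \<cdot> t)" using cmp_red[OF g(4)] t(1,2) g by simp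
    also have "\<dots> = zer C (src C t) (src C f)" using t(3) g t(1) by simp
    finally show "t = zer C (src C t) (src C f)" .
  qed (use g in auto)
qed

text \<open>A zero arrow \<open>p\<close> kills the identity, which therefore lifts to a right
  inverse of \<open>i\<close>; a monomorphism with a right inverse is invertible.\<close>

lemma split_mono_kernel_zero:
  assumes "ker_of C i p" "p = zer C (src C p) (tgt C p)"
  shows "iso_arr C i"
proof -
  note d = ker_ofD[OF assms(1)]
  obtain g where g: "arr C g" "src C g = tgt C i" "tgt C g = src C i" "i \<cdot> g = Idt C (tgt C i)"
    using ker_lift[OF assms(1), of "Idt C (tgt C i)"] d assms(2) by (metis Idt_arr cmp_Idt src_tgt_Ob(2))
  have "g \<cdot> i = Idt C (src C i)"
    by (rule monic_cancel[OF d(1)]) (use g d cmp_red[OF g(4)] in simp_all)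
  then show ?thesis unfolding iso_arr_def using g d by auto
qed

lemma biprod_sym: "biprod C P A B i j p q \<Longrightarrow> biprod C P B A j i q p"
  unfolding biprod_def by (auto simp: add_comm)

text \<open>This is the change of coordinates by the elementary matrix with entry \<open>z\<close>.
  It turns a row \<open>(1, z)\<close> into the first projection of another biproduct.\<close>

lemma biprod_shear:
  assumes b: "biprod C P A B i j p q" and z: "arr C z" "src C z = B" "tgt C z = A"
  shows "biprod C P A B i (j \<boxplus> neg C (i \<cdot> z)) (p \<boxplus> z \<cdot> q) q"
proof -
  note d = biprodD[OF b] biprod_expand(1)[OF b]
  have e: "i \<cdot> p \<boxplus> j \<cdot> q = Idt C P" using b by (simp add: biprod_def)
  have "i \<cdot> (p \<boxplus> z \<cdot> q) \<boxplus> (j \<boxplus> neg C (i \<cdot> z)) \<cdot> q = Idt C P"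
    using d z e by (simp add: add_ac)
  then show ?thesis unfolding biprod_def using d(1-23) z by simp
qed

lemma biprod_monic: "biprod C P A B i j p q \<Longrightarrow> monic C i"
proof -
  assume b: "biprod C P A B i j p q"
  note d = biprodD[OF b]
  show "monic C i" unfolding monic_def
  proof (intro conjI allI impI)
    fix t assume t: "arr C t" "tgt C t = src C i" "i \<cdot> t = zer C (src C t) (tgt C i)"
    have "t = p \<cdot> (i \<cdot> t)" using t(1,2) d by simp
    also have "\<dots> = zer C (src C t) (src C i)" unfolding t using t(1) d by simp
    finally show "t = zer C (src C t) (src C i)" .
  qed (use d in auto)
qed

end

section \<open>Exact categories\<close>

locale exact_category = additive_category C + exact_structure C S for C (structure) and S

context exact_category
begin

lemma conflationD:
  assumes "(i, p) \<in> S"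
  shows "ker_of C i p" "coker_of C p i"
proof -
  interpret op: additive_category "opp C" by (rule additive_category_opp) unfold_locales
  obtain A B D where O: "A \<in> Ob C" "B \<in> Ob C" "D \<in> Ob C" "kernel_cokernel_pair C A B D i p"
    using conflation_pair[OF assms] by blast
  then show "ker_of C i p" "coker_of C p i"
    unfolding kernel_cokernel_pair_def using is_kernel_iff[of A B D] op.is_kernel_iff[of D B A]
    by auto
qed

lemma deflation_arr: "deflation S p \<Longrightarrow> arr C p"
  unfolding deflation_def using conflationD(1) ker_ofD(3) by blast

lemma inflation_arr: "inflation S i \<Longrightarrow> arr C i"
  unfolding inflation_def using conflationD(1) ker_ofD(2) by blast

lemma conflation_iso:
  assumes "(i, p) \<in> S" "iso_arr C a" "iso_arr C b" "iso_arr C d" "arr C i'" "arr C p'"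
    "src C a = src C i" "tgt C a = src C i'" "src C b = tgt C i" "tgt C b = tgt C i'"
    "src C d = tgt C p" "tgt C d = tgt C p'" "src C p' = tgt C i'"
    "b \<cdot> i = i' \<cdot> a" "d \<cdot> p = p' \<cdot> b"
  shows "(i', p') \<in> S"
proof -
  note d = ker_ofD[OF conflationD(1)[OF assms(1)]]
  show ?thesis
    by (rule iso_closed[OF assms(1), of "src C i" "tgt C i" "tgt C p" "src C i'" "tgt C i'" "tgt C p'" i' p' a b d])
      (use assms d in \<open>auto simp: is_iso_iff\<close>)
qed

end

text \<open>Quillen's axioms are stated self-dually. Only closure under isomorphism needs an
  argument: an isomorphism of pairs in \<open>opp C\<close> runs in the reverse direction in
  \<open>C\<close> and has to be inverted.\<close>

lemma exact_category_opp:
  assumes "exact_category C S"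
  shows "exact_category (opp C) (S\<inverse>)"
proof -
  interpret exact_category C S by fact
  interpret op: additive_category "opp C" by (rule additive_category_opp) unfold_locales
  have inf: "inflation (S\<inverse>) p = deflation S p" "deflation (S\<inverse>) p = inflation S p" for p
    by (auto simp: inflation_def deflation_def)
  have "exact_structure (opp C) (S\<inverse>)"
  proof (rule exact_structure.intro)
    fix p i A B D A' B' D' p' i' a b d
    assume a: "(p, i) \<in> S\<inverse>" "A \<in> Ob (opp C)" "B \<in> Ob (opp C)" "D \<in> Ob (opp C)"
      "A' \<in> Ob (opp C)" "B' \<in> Ob (opp C)" "D' \<in> Ob (opp C)"
      "p \<in> mor (opp C) A B" "i \<in> mor (opp C) B D" "p' \<in> mor (opp C) A' B'" "i' \<in> mor (opp C) B' D'"
      "is_iso (opp C) A A' a" "is_iso (opp C) B B' b" "is_iso (opp C) D D' d"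
      "b \<cdot>\<^bsub>opp C\<^esub> p = p' \<cdot>\<^bsub>opp C\<^esub> a" "d \<cdot>\<^bsub>opp C\<^esub> i = i' \<cdot>\<^bsub>opp C\<^esub> b"
    then have t: "arr C i" "src C i = D" "tgt C i = B" "arr C p" "src C p = B" "tgt C p = A"
      "arr C i'" "src C i' = D'" "tgt C i' = B'" "arr C p'" "src C p' = B'" "tgt C p' = A'"
      "iso_arr C a" "src C a = A'" "tgt C a = A" "iso_arr C b" "src C b = B'" "tgt C b = B"
      "iso_arr C d" "src C d = D'" "tgt C d = D"
      by (auto simp: op.is_iso_iff)
    obtain a' where a': "arr C a'" "src C a' = A" "tgt C a' = A'" "a' \<cdot>\<^bsub>C\<^esub> a = Idt C A'"
      "a \<cdot>\<^bsub>C\<^esub> a' = Idt C A" "iso_arr C a'" "arr C a" using iso_arrE[OF t(13)] t by metis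
    obtain b' where b': "arr C b'" "src C b' = B" "tgt C b' = B'" "b' \<cdot>\<^bsub>C\<^esub> b = Idt C B'"
      "b \<cdot>\<^bsub>C\<^esub> b' = Idt C B" "iso_arr C b'" "arr C b" using iso_arrE[OF t(16)] t by metis
    obtain d' where d': "arr C d'" "src C d' = D" "tgt C d' = D'" "d' \<cdot>\<^bsub>C\<^esub> d = Idt C D'"
      "d \<cdot>\<^bsub>C\<^esub> d' = Idt C D" "iso_arr C d'" "arr C d" using iso_arrE[OF t(19)] t by metis
    have 1: "p \<cdot>\<^bsub>C\<^esub> b = a \<cdot>\<^bsub>C\<^esub> p'" "i \<cdot>\<^bsub>C\<^esub> d = b \<cdot>\<^bsub>C\<^esub> i'" using a by auto
    have e1: "b' \<cdot>\<^bsub>C\<^esub> i = i' \<cdot>\<^bsub>C\<^esub> d'"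
    proof -
      have "b' \<cdot>\<^bsub>C\<^esub> i = b' \<cdot>\<^bsub>C\<^esub> ((i \<cdot>\<^bsub>C\<^esub> d) \<cdot>\<^bsub>C\<^esub> d')" using t d' by simp
      also have "\<dots> = i' \<cdot>\<^bsub>C\<^esub> d'" unfolding 1 using t b' d' cmp_red[OF b'(4)] by simp
      finally show ?thesis .
    qed
    have e2: "a' \<cdot>\<^bsub>C\<^esub> p = p' \<cdot>\<^bsub>C\<^esub> b'"
    proof -
      have "a' \<cdot>\<^bsub>C\<^esub> p = a' \<cdot>\<^bsub>C\<^esub> ((p \<cdot>\<^bsub>C\<^esub> b) \<cdot>\<^bsub>C\<^esub> b')" using t b' by simp
      also have "\<dots> = p' \<cdot>\<^bsub>C\<^esub> b'" unfolding 1 using t a' b' cmp_red[OF a'(4)] by simp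
      finally show ?thesis .
    qed
    have "(i', p') \<in> S"
      by (rule conflation_iso[of i p d' b' a' i' p']) (use a t a' b' d' e1 e2 in auto)
    then show "(p', i') \<in> S\<inverse>" by simp
  next
    fix p i assume "(p, i) \<in> S\<inverse>"
    then show "\<exists>A\<in>Ob (opp C). \<exists>B\<in>Ob (opp C). \<exists>D\<in>Ob (opp C). kernel_cokernel_pair (opp C) A B D p i"
      using conflation_pair[of i p] by (auto simp: kernel_cokernel_pair_def)
  next
    fix A B D i j
    assume "A \<in> Ob (opp C)" "B \<in> Ob (opp C)" "D \<in> Ob (opp C)" "i \<in> mor (opp C) A B"
      "j \<in> mor (opp C) B D" "inflation (S\<inverse>) i" "inflation (S\<inverse>) j"
    then show "inflation (S\<inverse>) (j \<cdot>\<^bsub>opp C\<^esub> i)"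
      using deflation_Cmp[of D B A j i] inf by auto
  next
    fix A B D i j
    assume "A \<in> Ob (opp C)" "B \<in> Ob (opp C)" "D \<in> Ob (opp C)" "i \<in> mor (opp C) A B"
      "j \<in> mor (opp C) B D" "deflation (S\<inverse>) i" "deflation (S\<inverse>) j"
    then show "deflation (S\<inverse>) (j \<cdot>\<^bsub>opp C\<^esub> i)"
      using inflation_Cmp[of D B A j i] inf by auto
  next
    fix A B A' i f
    assume "A \<in> Ob (opp C)" "B \<in> Ob (opp C)" "A' \<in> Ob (opp C)" "i \<in> mor (opp C) A B"
      "f \<in> mor (opp C) A A'" "inflation (S\<inverse>) i"
    then show "\<exists>B'\<in>Ob (opp C). \<exists>i'\<in>mor (opp C) A' B'. \<exists>f'\<in>mor (opp C) B B'.
            is_pullback (opp (opp C)) B' B A' A f' i' i f \<and> inflation (S\<inverse>) i'"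
      using deflation_pullback[of B A A' i f] inf by simp
  next
    fix A B A' i f
    assume "A \<in> Ob (opp C)" "B \<in> Ob (opp C)" "A' \<in> Ob (opp C)" "i \<in> mor (opp C) A B"
      "f \<in> mor (opp C) A' B" "deflation (S\<inverse>) i"
    then show "\<exists>B'\<in>Ob (opp C). \<exists>i'\<in>mor (opp C) B' A'. \<exists>f'\<in>mor (opp C) B' A.
            is_pullback (opp C) B' A A' B f' i' i f \<and> deflation (S\<inverse>) i'"
      using inflation_pushout[of B A A' i f] inf by simp
  qed (use Idt_inflation Idt_deflation inf in auto)
  then show ?thesis by (intro exact_category.intro op.additive_category_axioms)
qed

lemma inflation_converse [simp]: "inflation (S\<inverse>) p = deflation S p" "deflation (S\<inverse>) p = inflation S p"
  by (auto simp: inflation_def deflation_def)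

text \<open>A retract in the category of arrows: \<open>(s, s')\<close> is the section and
  \<open>(r, r')\<close> the retraction.\<close>

definition arrow_retract ::
    "('o, 'm) precat \<Rightarrow> 'm \<Rightarrow> 'm \<Rightarrow> 'm \<Rightarrow> 'm \<Rightarrow> 'm \<Rightarrow> 'm \<Rightarrow> bool"
  where "arrow_retract C f\<^sub>1 f s r s' r' \<longleftrightarrow> arr C f\<^sub>1 \<and> arr C f \<and>
    arr C s \<and> src C s = src C f\<^sub>1 \<and> tgt C s = src C f \<and>
    arr C r \<and> src C r = src C f \<and> tgt C r = src C f\<^sub>1 \<and>
    arr C s' \<and> src C s' = tgt C f\<^sub>1 \<and> tgt C s' = tgt C f \<and>
    arr C r' \<and> src C r' = tgt C f \<and> tgt C r' = tgt C f\<^sub>1 \<and>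
    r \<cdot>\<^bsub>C\<^esub> s = Idt C (src C f\<^sub>1) \<and> r' \<cdot>\<^bsub>C\<^esub> s' = Idt C (tgt C f\<^sub>1) \<and>
    f \<cdot>\<^bsub>C\<^esub> s = s' \<cdot>\<^bsub>C\<^esub> f\<^sub>1 \<and> r' \<cdot>\<^bsub>C\<^esub> f = f\<^sub>1 \<cdot>\<^bsub>C\<^esub> r"

lemma arrow_retract_opp [simp]: "arrow_retract (opp C) f\<^sub>1 f r' s' r s = arrow_retract C f\<^sub>1 f s r s' r'"
  unfolding arrow_retract_def by auto

definition has_kernel :: "('o, 'm) precat \<Rightarrow> 'm \<Rightarrow> bool"
  where "has_kernel C f \<longleftrightarrow> (\<exists>k. ker_of C k f)"

definition adm :: "('o, 'm) precat \<Rightarrow> ('m \<times> 'm) set \<Rightarrow> 'm \<Rightarrow> bool"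
  where "adm C S f \<longleftrightarrow>
    (\<exists>p m. deflation S p \<and> inflation S m \<and> src C m = tgt C p \<and> f = m \<cdot>\<^bsub>C\<^esub> p)"

lemma adm_opp [simp]: "adm (opp C) (S\<inverse>) f = adm C S f"
  unfolding adm_def by auto metis+

section \<open>Kernels of projections and of retracts\<close>

context additive_category
begin

lemma opp_additive: "additive_category (opp C)"
  by (rule additive_category_opp) unfold_locales

lemma coker_ofD:
  assumes "coker_of C p i"
  shows "epic C p" "arr C i" "arr C p" "tgt C i = src C p" "p \<cdot> i = zer C (src C i) (tgt C p)"
    "\<And>x. \<lbrakk>arr C x; tgt C x = src C i\<rbrakk> \<Longrightarrow> p \<cdot> (i \<cdot> x) = zer C (src C x) (tgt C p)"
proof -
  interpret op: additive_category "opp C" by (rule opp_additive)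
  show *: "epic C p" "arr C i" "arr C p" "tgt C i = src C p" "p \<cdot> i = zer C (src C i) (tgt C p)"
    using op.ker_ofD[OF assms] by auto
  show "\<And>x. \<lbrakk>arr C x; tgt C x = src C i\<rbrakk> \<Longrightarrow> p \<cdot> (i \<cdot> x) = zer C (src C x) (tgt C p)"
    using cmp_red[OF *(5)] * by simp
qed

lemma coker_lift:
  assumes "coker_of C p i" "t \<cdot> i = zer C (src C i) (tgt C t)" "arr C t" "src C t = tgt C i"
  obtains g where "arr C g" "src C g = tgt C p" "tgt C g = tgt C t" "g \<cdot> p = t"
proof -
  interpret op: additive_category "opp C" by (rule opp_additive)
  show ?thesis using op.ker_lift[OF assms(1), of t] assms that by auto
qed

lemma epicD: "\<lbrakk>epic C f; t \<cdot> f = zer C (src C f) (tgt C t); arr C t; src C t = tgt C f\<rbrakk>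
    \<Longrightarrow> t = zer C (tgt C f) (tgt C t)"
  by (simp add: monic_def)

lemma epic_cancel:
  assumes "epic C f" "arr C t" "arr C t'" "src C t = tgt C f" "src C t' = tgt C f"
    "tgt C t' = tgt C t" "t \<cdot> f = t' \<cdot> f"
  shows "t = t'"
proof -
  interpret op: additive_category "opp C" by (rule opp_additive)
  show ?thesis using op.monic_cancel[OF assms(1), of t t'] assms by auto
qed

text \<open>Composing \<open>p\<close> with the projection away from \<open>P\<close> enlarges its
  kernel by the summand \<open>P\<close>; the kernel arrow is \<open>k\<close> on one summand and
  the identity on the other.\<close>

lemma proj_kernel:
  assumes b: "biprod C B X P i j \<pi> \<rho>" and b': "biprod C K' (src C k) P a c pK qP"
    and k: "ker_of C k p" and X: "src C p = X"
  shows "ker_of C (i \<cdot> (k \<cdot> pK) \<boxplus> j \<cdot> qP) (p \<cdot> \<pi>)"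
proof -
  note d = biprodD[OF b] and kd = ker_ofD[OF k] and d' = biprodD[OF b']
  define \<kappa> where "\<kappa> = i \<cdot> (k \<cdot> pK) \<boxplus> j \<cdot> qP"
  have \<kappa>: "arr C \<kappa>" "src C \<kappa> = K'" "tgt C \<kappa> = B" "\<pi> \<cdot> \<kappa> = k \<cdot> pK" "\<rho> \<cdot> \<kappa> = qP"
    "\<kappa> \<cdot> a = i \<cdot> k" "\<kappa> \<cdot> c = j"
    unfolding \<kappa>_def using d d' kd X by simp_all
  have red: "\<And>x. \<lbrakk>arr C x; tgt C x = K'\<rbrakk> \<Longrightarrow> \<pi> \<cdot> (\<kappa> \<cdot> x) = k \<cdot> (pK \<cdot> x)"
     "\<And>x. \<lbrakk>arr C x; tgt C x = K'\<rbrakk> \<Longrightarrow> \<rho> \<cdot> (\<kappa> \<cdot> x) = qP \<cdot> x"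
    using cmp_red[OF \<kappa>(4)] cmp_red[OF \<kappa>(5)] \<kappa>(1-3) d d' kd X by auto
  have "ker_of C \<kappa> (p \<cdot> \<pi>)" unfolding ker_of_def
  proof (intro conjI allI impI)
    show "monic C \<kappa>" unfolding monic_def
    proof (intro conjI allI impI)
      fix t assume t: "arr C t" "tgt C t = src C \<kappa>" "\<kappa> \<cdot> t = zer C (src C t) (tgt C \<kappa>)"
      have "k \<cdot> (pK \<cdot> t) = \<pi> \<cdot> (\<kappa> \<cdot> t)" "qP \<cdot> t = \<rho> \<cdot> (\<kappa> \<cdot> t)"
        using t(1,2) \<kappa>(1-3) red by auto
      then have 1: "k \<cdot> (pK \<cdot> t) = zer C (src C t) X" "qP \<cdot> t = zer C (src C t) P"
        unfolding t(3) using t(1) d \<kappa>(1-3) by simp_all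
      have 2: "pK \<cdot> t = zer C (src C t) (src C k)"
        using monicD[OF kd(1), of "pK \<cdot> t"] 1 t(1,2) \<kappa>(1-3) d' kd X by simp
      show "t = zer C (src C t) (src C \<kappa>)"
        by (rule biprod_eqI[OF b']) (use 1 2 t \<kappa>(1-3) d' in simp_all)
    qed (use \<kappa> in auto)
    fix t assume t: "arr C t" "tgt C t = src C (p \<cdot> \<pi>)"
      "(p \<cdot> \<pi>) \<cdot> t = zer C (src C t) (tgt C (p \<cdot> \<pi>))"
    then have t': "tgt C t = B" "p \<cdot> (\<pi> \<cdot> t) = zer C (src C t) (tgt C p)" using d kd X by simp_all
    have "p \<cdot> (\<pi> \<cdot> t) = zer C (src C (\<pi> \<cdot> t)) (tgt C p)" "arr C (\<pi> \<cdot> t)" "tgt C (\<pi> \<cdot> t) = src C p"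
      using t(1) t' d X by simp_all
    then obtain g where g: "arr C g" "src C g = src C (\<pi> \<cdot> t)" "tgt C g = src C k" "k \<cdot> g = \<pi> \<cdot> t"
      using ker_lift[OF k] by metis
    have "\<kappa> \<cdot> (a \<cdot> g \<boxplus> c \<cdot> (\<rho> \<cdot> t)) = t"
      by (rule biprod_eqI[OF b]) (use \<kappa>(1-3) red g t(1) t' d d' kd(2,4) X in simp_all)
    then show "\<exists>g. arr C g \<and> src C g = src C t \<and> tgt C g = src C \<kappa> \<and> \<kappa> \<cdot> g = t"
      by (intro exI[of _ "a \<cdot> g \<boxplus> c \<cdot> (\<rho> \<cdot> t)"]) (use \<kappa>(1-3) g t t' d d' in simp_all)
  next
    show "(p \<cdot> \<pi>) \<cdot> \<kappa> = zer C (src C \<kappa>) (tgt C (p \<cdot> \<pi>))" using \<kappa> d d' kd X by simp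
  qed (use d kd X \<kappa> in simp_all)
  then show ?thesis unfolding \<kappa>_def .
qed

text \<open>The idempotent \<open>s \<cdot> r\<close> on the source of \<open>p\<close> restricts to
  an idempotent on the kernel of \<open>p\<close>, and its splitting is the kernel of the
  retract.\<close>

lemma retract_kernel:
  assumes ic: "idempotent_complete C" and kk: "ker_of C k p" and ret: "arrow_retract C p1 p s r s' r'"
  shows "has_kernel C p1"
proof -
  have p1: "arr C p1"
    and s: "arr C s" "src C s = src C p1" "tgt C s = src C p"
    and r: "arr C r" "src C r = src C p" "tgt C r = src C p1"
    and s': "arr C s'" "src C s' = tgt C p1" "tgt C s' = tgt C p"
    and r': "arr C r'" "src C r' = tgt C p" "tgt C r' = tgt C p1"
    and eq: "r \<cdot> s = Idt C (src C p1)" "r' \<cdot> s' = Idt C (tgt C p1)"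
      "p \<cdot> s = s' \<cdot> p1" "r' \<cdot> p = p1 \<cdot> r"
    using ret unfolding arrow_retract_def by simp_all
  note kd = ker_ofD[OF kk]
  note red = cmp_red[OF eq(1)] cmp_red[OF eq(2)] cmp_red[OF eq(3)] cmp_red[OF eq(4)]
  \<comment> \<open>Since \<open>p \<cdot> s \<cdot> r = s' \<cdot> r' \<cdot> p\<close>, the
    endomorphism \<open>s \<cdot> r\<close> preserves the kernel \<open>k\<close>.\<close>
  have "p \<cdot> (s \<cdot> (r \<cdot> k)) = s' \<cdot> (r' \<cdot> (p \<cdot> k))"
    using red s r s' r' p1 kd(1-4) by simp
  then have "p \<cdot> (s \<cdot> (r \<cdot> k)) = zer C (src C k) (tgt C p)" using kd s' r' by simp
  then obtain e where e: "arr C e" "src C e = src C k" "tgt C e = src C k" "k \<cdot> e = s \<cdot> (r \<cdot> k)"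
    using ker_lift[OF kk, of "s \<cdot> (r \<cdot> k)"] kd s r by auto
  note rede = cmp_red[OF e(4)]
  have "e \<cdot> e = e"
    by (rule monic_cancel[OF kd(1)]) (use e rede red kd s r in simp_all)
  then obtain rK sK where K: "arr C rK" "arr C sK" "src C rK = src C e" "tgt C sK = src C e"
    "src C sK = tgt C rK" "sK \<cdot> rK = e" "rK \<cdot> sK = Idt C (tgt C rK)"
    using split_idempotent[OF ic, of e] e by metis
  note redK = cmp_red[OF K(6)] cmp_red[OF K(7)]
  have esK: "e \<cdot> sK = sK" using K e unfolding K(6)[symmetric] by simp
  \<comment> \<open>The splitting object is included into the kernel of \<open>p\<close> by
    \<open>sK\<close> and carried to the source of \<open>p1\<close> by \<open>r\<close>; by
    \<open>sk1\<close>, following with \<open>s\<close> leads back to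
    \<open>k \<cdot> sK\<close>.\<close>
  define k1 where "k1 = r \<cdot> (k \<cdot> sK)"
  have k1: "arr C k1" "src C k1 = tgt C rK" "tgt C k1 = src C p1"
    unfolding k1_def using K kd r e by simp_all
  have sk1: "s \<cdot> k1 = k \<cdot> sK"
  proof -
    have "s \<cdot> k1 = (s \<cdot> (r \<cdot> k)) \<cdot> sK" unfolding k1_def using K kd r s e by simp
    also have "\<dots> = k \<cdot> (e \<cdot> sK)" unfolding e(4)[symmetric] using K kd e(1-3) by simp
    finally show ?thesis unfolding esK .
  qed
  have "ker_of C k1 p1" unfolding ker_of_def
  proof (intro conjI allI impI)
    show "monic C k1" unfolding monic_def
    proof (intro conjI allI impI)
      fix t assume t: "arr C t" "tgt C t = src C k1" "k1 \<cdot> t = zer C (src C t) (tgt C k1)"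
      have "k \<cdot> (sK \<cdot> t) = s \<cdot> (k1 \<cdot> t)" using cmp_red[OF sk1] t(1,2) k1 s kd K e by simp
      then have "k \<cdot> (sK \<cdot> t) = zer C (src C t) (tgt C k)" unfolding t(3) using t(1,2) k1 s kd by simp
      then have "sK \<cdot> t = zer C (src C t) (src C k)"
        using monicD[OF kd(1), of "sK \<cdot> t"] K t(1,2) k1 e kd by simp
      then have "rK \<cdot> (sK \<cdot> t) = zer C (src C t) (tgt C rK)" using K t(1,2) k1 e kd by simp
      then show "t = zer C (src C t) (src C k1)" using redK K t(1,2) k1 e by simp
    qed (use k1 in simp)
    have "s' \<cdot> (p1 \<cdot> k1) = p \<cdot> (s \<cdot> k1)" using red k1 s s' p1 kd by simp
    also have "\<dots> = s' \<cdot> zer C (src C k1) (tgt C p1)"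
      unfolding sk1 using kd K s' k1 e p1 by simp
    finally have "r' \<cdot> (s' \<cdot> (p1 \<cdot> k1)) = r' \<cdot> (s' \<cdot> zer C (src C k1) (tgt C p1))" by simp
    then show "p1 \<cdot> k1 = zer C (src C k1) (tgt C p1)" using red k1 s s' r r' p1 K by simp
    fix t assume t: "arr C t" "tgt C t = src C p1" "p1 \<cdot> t = zer C (src C t) (tgt C p1)"
    have "p \<cdot> (s \<cdot> t) = s' \<cdot> (p1 \<cdot> t)" using red t(1,2) s s' p1 kd by simp
    then have "p \<cdot> (s \<cdot> t) = zer C (src C t) (tgt C p)" unfolding t(3) using t(1) s' p1 by simp
    then obtain g where g: "arr C g" "src C g = src C t" "tgt C g = src C k" "k \<cdot> g = s \<cdot> t"
      using ker_lift[OF kk, of "s \<cdot> t"] t(1,2) s kd(4) by auto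
    have "k1 \<cdot> (rK \<cdot> g) = r \<cdot> (k \<cdot> (e \<cdot> g))"
      unfolding k1_def using redK K g r kd e by simp
    also have "\<dots> = t" using rede e g kd r s red t(1,2) by simp
    finally have "k1 \<cdot> (rK \<cdot> g) = t" .
    then show "\<exists>g. arr C g \<and> src C g = src C t \<and> tgt C g = src C k1 \<and> k1 \<cdot> g = t"
      using K e g k1 by (intro exI[of _ "rK \<cdot> g"]) simp
  qed (use k1 p1 in simp_all)
  then show ?thesis by (auto simp: has_kernel_def)
qed

end

section \<open>Base change, biproducts and cancellation of deflations\<close>

context exact_category
begin

lemma opp_exact: "exact_category (opp C) (S\<inverse>)"
  by (rule exact_category_opp) unfold_locales

lemma deflation_epic: "deflation S p \<Longrightarrow> epic C p"
  unfolding deflation_def using conflationD(2) coker_ofD(1) by blast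

lemma inflation_monic: "inflation S p \<Longrightarrow> monic C p"
  unfolding inflation_def using conflationD(1) ker_ofD(1) by blast

lemma deflation_cmp:
  "\<lbrakk>deflation S p; deflation S q; tgt C p = src C q\<rbrakk> \<Longrightarrow> deflation S (q \<cdot> p)"
  using deflation_Cmp[of "src C p" "tgt C p" "tgt C q" p q] deflation_arr by simp

lemma inflation_cmp:
  "\<lbrakk>inflation S p; inflation S q; tgt C p = src C q\<rbrakk> \<Longrightarrow> inflation S (q \<cdot> p)"
  using inflation_Cmp[of "src C p" "tgt C p" "tgt C q" p q] inflation_arr by simp

lemma iso_deflation:
  assumes "iso_arr C f"
  shows "deflation S f"
proof -
  have f: "arr C f" using assms by (simp add: iso_arr_def)
  obtain i where i: "(i, Idt C (src C f)) \<in> S"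
    using Idt_deflation[of "src C f"] f unfolding deflation_def by auto
  note d = ker_ofD[OF conflationD(1)[OF i]]
  have "(i, f) \<in> S"
    by (rule conflation_iso[OF i, of "Idt C (src C i)" "Idt C (tgt C i)" f])
      (use assms f d iso_Idt in auto)
  then show ?thesis by (auto simp: deflation_def)
qed

lemma iso_inflation:
  assumes "iso_arr C f"
  shows "inflation S f"
proof -
  interpret op: exact_category "opp C" "S\<inverse>" by (rule opp_exact)
  show ?thesis using op.iso_deflation[of f] assms by simp
qed

text \<open>Any two kernels of \<open>p\<close> are isomorphic over its source, so closure under
  isomorphism makes every kernel of a deflation a conflation partner.\<close>

lemma ker_conflation:
  assumes "deflation S p" "ker_of C i p"
  shows "(i, p) \<in> S"
proof -
  obtain i0 where i0: "(i0, p) \<in> S" using assms(1) by (auto simp: deflation_def)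
  note d0 = ker_ofD[OF conflationD(1)[OF i0]] and d = ker_ofD[OF assms(2)]
  obtain h where h: "iso_arr C h" "arr C h" "src C h = src C i0" "tgt C h = src C i" "i \<cdot> h = i0"
    using ker_iso[OF conflationD(1)[OF i0] assms(2)] .
  show ?thesis
    by (rule conflation_iso[OF i0, of h "Idt C (tgt C i)" "Idt C (tgt C p)"])
      (use h d0 d iso_Idt in auto)
qed

lemma coker_conflation:
  assumes "inflation S i" "coker_of C p i"
  shows "(i, p) \<in> S"
proof -
  interpret op: exact_category "opp C" "S\<inverse>" by (rule opp_exact)
  show ?thesis using op.ker_conflation[of i p] assms by simp
qed

text \<open>The axiom provides a single pullback with the property. Any other one differs by an
  isomorphism, which is itself a deflation.\<close>

lemma deflation_base_change:
  assumes pb: "pullback_of C q p' p f" and "deflation S p"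
  shows "deflation S p'"
proof -
  note d = pullback_ofD[OF pb]
  obtain B' p2 q2 where *: "B' \<in> Ob C" "p2 \<in> mor C B' (src C f)" "q2 \<in> mor C B' (src C p)"
    "is_pullback C B' (src C p) (src C f) (tgt C p) q2 p2 p f" "deflation S p2"
    using deflation_pullback[of "src C p" "tgt C p" "src C f" p f] assms(2) d by auto
  then have pb2: "pullback_of C q2 p2 p f"
    using is_pullback_iff[of B' "src C p" "src C f" "tgt C p" q2 p2 p f] d by auto
  obtain h where h: "iso_arr C h" "arr C h" "src C h = src C q" "tgt C h = src C q2"
    "q2 \<cdot> h = q" "p2 \<cdot> h = p'"
    using pullback_iso[OF pb pb2] .
  then show ?thesis using deflation_cmp[OF iso_deflation[OF h(1)] *(5)] pullback_ofD[OF pb2] by simp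
qed

lemma inflation_cobase_change:
  assumes "pullback_of (opp C) q p' p f" "inflation S p"
  shows "inflation S p'"
proof -
  interpret op: exact_category "opp C" "S\<inverse>" by (rule opp_exact)
  show ?thesis using op.deflation_base_change[of q p' p f] assms by simp
qed

text \<open>The projection to \<open>A\<close> is the pullback of \<open>B \<rightarrow> 0\<close>
  along \<open>A \<rightarrow> 0\<close>, and \<open>B \<rightarrow> 0\<close> is a deflation, being
  the cokernel of the inflation \<open>Idt C B\<close> up to isomorphism.\<close>

lemma biprod_deflation:
  assumes b: "biprod C P A B i j p q"
  shows "deflation S p"
proof -
  note d = biprodD[OF b]
  obtain Z where Z0: "is_zero C Z" using zero_obE .
  then have Z: "Z \<in> Ob C" by (simp add: is_zero_def)
  obtain c where c: "(Idt C B, c) \<in> S" using Idt_inflation[of B] d by (auto simp: inflation_def)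
  note cd = coker_ofD[OF conflationD(2)[OF c]]
  have ct: "arr C c" "src C c = B" using cd(3,4) d(3) by simp_all
  \<comment> \<open>The cokernel \<open>c\<close> of an identity is both zero and epic, so its
    target is a zero object.\<close>
  have c0: "c = zer C B (tgt C c)" using cd(5) ct d(3) by simp
  have "Idt C (tgt C c) \<cdot> c = zer C (tgt C c) (tgt C c) \<cdot> c"
    using c0 ct d(3) by (metis Idt_cmp src_tgt_Ob(2) zer_cmp)
  then have "Idt C (tgt C c) = zer C (tgt C c) (tgt C c)"
    using epic_cancel[OF cd(1), of "Idt C (tgt C c)" "zer C (tgt C c) (tgt C c)"] ct by simp
  then have "iso_arr C (zer C (tgt C c) Z)"
    unfolding iso_arr_def using Z Z0 ct
    by (auto intro!: exI[of _ "zer C Z (tgt C c)"] simp: is_zero_def)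
  then have "deflation S (zer C (tgt C c) Z \<cdot> c)"
    using deflation_cmp[of c "zer C (tgt C c) Z"] c ct Z iso_deflation by (auto simp: deflation_def)
  then have def: "deflation S (zer C B Z)" using ct Z d by simp
  have "pullback_of C q p (zer C B Z) (zer C A Z)"
    unfolding pullback_of_def
  proof (intro conjI allI impI)
    fix t assume t: "arr C t" "tgt C t = src C q" "q \<cdot> t = zer C (src C t) (tgt C q)"
      "p \<cdot> t = zer C (src C t) (tgt C p)"
    show "t = zer C (src C t) (src C q)" by (rule biprod_eqI[OF b]) (use d t in auto)
  next
    fix a' a assume "arr C a'" "arr C a" "src C a = src C a'" "tgt C a' = src C (zer C B Z)"
      "tgt C a = src C (zer C A Z)"
    then show "\<exists>h. arr C h \<and> src C h = src C a' \<and> tgt C h = src C q \<and> q \<cdot> h = a' \<and> p \<cdot> h = a"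
      by (intro exI[of _ "i \<cdot> a \<boxplus> j \<cdot> a'"]) (use d Z in auto)
  qed (use d Z in auto)
  from deflation_base_change[OF this def] show ?thesis .
qed

lemma biprod_inflation:
  assumes "biprod C P A B i j p q"
  shows "inflation S i"
proof -
  interpret op: exact_category "opp C" "S\<inverse>" by (rule opp_exact)
  show ?thesis using op.biprod_deflation[of P A B p q i j] assms by simp
qed

text \<open>The direct sum of \<open>f\<close> with an identity is the pullback of \<open>f\<close>
  along the projection \<open>p'\<close>.\<close>

lemma deflation_add_Idt:
  assumes b: "biprod C P A B i j p q" and b': "biprod C P' A' B i' j' p' q'"
    and f: "deflation S f" "src C f = A" "tgt C f = A'"
  shows "deflation S (i' \<cdot> (f \<cdot> p) \<boxplus> j' \<cdot> q)" (is "deflation S ?F")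
proof (rule deflation_base_change[OF _ f(1)])
  note d = biprodD[OF b] and d' = biprodD[OF b'] and fa = deflation_arr[OF f(1)]
  show "pullback_of C p ?F f p'"
    unfolding pullback_of_def
  proof (intro conjI allI impI)
    fix t assume t: "arr C t" "tgt C t = src C p" "p \<cdot> t = zer C (src C t) (tgt C p)"
      "?F \<cdot> t = zer C (src C t) (tgt C ?F)"
    have "q \<cdot> t = q' \<cdot> (?F \<cdot> t)" using t(1-2) d d' f fa by simp
    then have qt: "q \<cdot> t = zer C (src C t) B" unfolding t(4) using t(1) d d' f fa by simp
    show "t = zer C (src C t) (src C p)" by (rule biprod_eqI[OF b]) (use d t(1-3) qt in auto)
  next
    fix a c assume a: "arr C a" "arr C c" "src C c = src C a" "tgt C a = src C f"
      "tgt C c = src C p'" "f \<cdot> a = p' \<cdot> c"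
    have "?F \<cdot> (i \<cdot> a \<boxplus> j \<cdot> (q' \<cdot> c)) = c"
      by (rule biprod_eqI[OF b']) (use a d d' f fa in simp_all)
    then show "\<exists>h. arr C h \<and> src C h = src C a \<and> tgt C h = src C p \<and> p \<cdot> h = a \<and> ?F \<cdot> h = c"
      by (intro exI[of _ "i \<cdot> a \<boxplus> j \<cdot> (q' \<cdot> c)"]) (use a d d' f fa in simp_all)
  qed (use d d' f fa in simp_all)
qed

lemma inflation_add_Idt:
  assumes "biprod C P A B i j p q" "biprod C P' A' B i' j' p' q'"
    "inflation S f" "src C f = A" "tgt C f = A'"
  shows "inflation S (i' \<cdot> (f \<cdot> p) \<boxplus> j' \<cdot> q)"
proof -
  interpret op: exact_category "opp C" "S\<inverse>" by (rule opp_exact)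
  show ?thesis using op.deflation_add_Idt[of P' A' B p' q' i' j' P A p q i j f]
      assms biprodD[OF assms(1)] biprodD[OF assms(2)] inflation_arr[OF assms(3)]
    by simp
qed

text \<open>The row \<open>(e, z)\<close> is the direct sum of \<open>e\<close> with the identity of
  \<open>B\<close>, followed by the row \<open>(1, z)\<close>, which is a projection after
  shearing.\<close>

lemma deflation_row:
  assumes b: "biprod C P A B i j p q" and e: "deflation S e" "src C e = A"
    and z: "arr C z" "src C z = B" "tgt C z = tgt C e"
  shows "deflation S (e \<cdot> p \<boxplus> z \<cdot> q)"
proof -
  note d = biprodD[OF b] and ea = deflation_arr[OF e(1)]
  obtain P' i' j' p' q' where b': "biprod C P' (tgt C e) B i' j' p' q'"
    using biprod_ex[of "tgt C e" B] ea d by auto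
  note d' = biprodD[OF b']
  have "deflation S ((p' \<boxplus> z \<cdot> q') \<cdot> (i' \<cdot> (e \<cdot> p) \<boxplus> j' \<cdot> q))"
    by (rule deflation_cmp[OF deflation_add_Idt[OF b b'] biprod_deflation[OF biprod_shear[OF b']]])
      (use e z d d' ea in simp_all)
  then show ?thesis using e z d d' ea by (simp add: add_ac)
qed

lemma inflation_column:
  assumes "biprod C P A B i j p q" "inflation S e" "tgt C e = A"
    "arr C z" "tgt C z = B" "src C z = src C e"
  shows "inflation S (i \<cdot> e \<boxplus> j \<cdot> z)"
proof -
  interpret op: exact_category "opp C" "S\<inverse>" by (rule opp_exact)
  show ?thesis using op.deflation_row[of P A B p q i j e z] assms by simp
qed

text \<open>The kernel of \<open>p \<cdot> \<pi>\<close> is \<open>k\<close> plus an identity.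
  Pushing it out along the projection to \<open>src C k\<close> gives back \<open>k\<close>, which
  is therefore an inflation, and \<open>p\<close> is its cokernel.\<close>

lemma deflation_proj_cancel:
  assumes b: "biprod C B X P i j \<pi> \<rho>" and def: "deflation S (p \<cdot> \<pi>)"
    and k: "ker_of C k p" and X: "src C p = X"
  shows "deflation S p"
proof -
  note d = biprodD[OF b] and kd = ker_ofD[OF k]
  obtain K' a c pK qP where b': "biprod C K' (src C k) P a c pK qP"
    using biprod_ex[of "src C k" P] kd d by auto
  note d' = biprodD[OF b']
  define \<kappa> where "\<kappa> = i \<cdot> (k \<cdot> pK) \<boxplus> j \<cdot> qP"
  have \<kappa>: "arr C \<kappa>" "src C \<kappa> = K'" "tgt C \<kappa> = B" "\<pi> \<cdot> \<kappa> = k \<cdot> pK" "\<rho> \<cdot> \<kappa> = qP"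
    "\<kappa> \<cdot> a = i \<cdot> k" "\<kappa> \<cdot> c = j"
    unfolding \<kappa>_def using d d' kd X by simp_all
  have conf: "(\<kappa>, p \<cdot> \<pi>) \<in> S"
    using ker_conflation[OF def proj_kernel[OF b b' k X]] unfolding \<kappa>_def .
  note cd = conflationD(2)[OF conf]
  \<comment> \<open>In \<open>C\<close> this is the pushout of \<open>\<kappa>\<close> along
    \<open>pK\<close>. An arrow \<open>u\<close> that agrees with some \<open>v\<close> on
    \<open>\<kappa>\<close> vanishes on the summand \<open>P\<close>, so it is determined by
    \<open>u \<cdot> i\<close>.\<close>
  have "pullback_of (opp C) \<pi> k \<kappa> pK"
    unfolding pullback_of_def
  proof (intro conjI allI impI)
    fix t assume t: "arr (opp C) t" "tgt (opp C) t = src (opp C) \<pi>"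
      "\<pi> \<cdot>\<^bsub>opp C\<^esub> t = zer (opp C) (src (opp C) t) (tgt (opp C) \<pi>)"
    have "t = t \<cdot> (\<pi> \<cdot> i)" using t(1,2) d by simp
    also have "\<dots> = (t \<cdot> \<pi>) \<cdot> i" using t(1,2) d by simp
    also have "\<dots> = zer C X (tgt C t)" using t d by simp
    finally show "t = zer (opp C) (src (opp C) t) (src (opp C) \<pi>)" using t d by simp
  next
    fix u v assume "arr (opp C) u" "arr (opp C) v" "src (opp C) v = src (opp C) u"
      "tgt (opp C) u = src (opp C) \<kappa>" "tgt (opp C) v = src (opp C) pK"
      "\<kappa> \<cdot>\<^bsub>opp C\<^esub> u = pK \<cdot>\<^bsub>opp C\<^esub> v"
    then have u: "arr C u" "arr C v" "tgt C v = tgt C u" "src C u = B" "src C v = src C k"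
      "u \<cdot> \<kappa> = v \<cdot> pK" using \<kappa>(1-3) d' by simp_all
    have ui: "(u \<cdot> i) \<cdot> k = v"
    proof -
      have "(u \<cdot> i) \<cdot> k = (u \<cdot> \<kappa>) \<cdot> a" using u(1-5) \<kappa> d d' kd X by simp
      also have "\<dots> = v" unfolding u(6) using u(1-5) d' by simp
      finally show ?thesis .
    qed
    have "u \<cdot> j = (u \<cdot> \<kappa>) \<cdot> c" using u(1-5) \<kappa> d d' by simp
    also have "\<dots> = zer C P (tgt C u)" unfolding u(6) using u(1-5) d' by simp
    finally have uj: "u \<cdot> j = zer C P (tgt C u)" .
    have "(u \<cdot> i) \<cdot> \<pi> = u"
      by (rule biprod_eqI'[OF b]) (use uj u(1-5) d in simp_all)
    then show "\<exists>h. arr (opp C) h \<and> src (opp C) h = src (opp C) u \<and> tgt (opp C) h = src (opp C) \<pi> \<and>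
        \<pi> \<cdot>\<^bsub>opp C\<^esub> h = u \<and> k \<cdot>\<^bsub>opp C\<^esub> h = v"
      using ui u(1-5) d by (intro exI[of _ "u \<cdot> i"]) simp
  qed (use \<kappa> d d' kd X in simp_all)
  then have ki: "inflation S k"
    using inflation_cobase_change[of \<pi> k \<kappa> pK] conf by (auto simp: inflation_def)
  have "coker_of C p k" unfolding ker_of_def
  proof (intro conjI allI impI)
    have ep: "epic C (p \<cdot> \<pi>)" using coker_ofD(1)[OF cd] .
    show "epic C p" unfolding monic_def
    proof (intro conjI allI impI)
      fix t assume "arr (opp C) t" "tgt (opp C) t = src (opp C) p"
        "p \<cdot>\<^bsub>opp C\<^esub> t = zer (opp C) (src (opp C) t) (tgt (opp C) p)"
      then have t: "arr C t" "src C t = tgt C p" "t \<cdot> p = zer C X (tgt C t)" using X by auto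
      have "t \<cdot> (p \<cdot> \<pi>) = zer C B (tgt C t)" using t d kd X cmp_red[OF t(3)] by simp
      then show "t = zer (opp C) (src (opp C) t) (src (opp C) p)"
        using epicD[OF ep, of t] t d kd X by simp
    qed (use kd in simp)
    fix t assume "arr (opp C) t" "tgt (opp C) t = src (opp C) k"
      "k \<cdot>\<^bsub>opp C\<^esub> t = zer (opp C) (src (opp C) t) (tgt (opp C) k)"
    then have t: "arr C t" "src C t = X" "t \<cdot> k = zer C (src C k) (tgt C t)" using kd X by auto
    have "(t \<cdot> \<pi>) \<cdot> \<kappa> = zer C (src C \<kappa>) (tgt C (t \<cdot> \<pi>))" "arr C (t \<cdot> \<pi>)"
      "src C (t \<cdot> \<pi>) = tgt C \<kappa>"
      using t kd d d' X \<kappa>(1-4) cmp_red[OF t(3)] by simp_all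
    then obtain g where "arr C g" "src C g = tgt C (p \<cdot> \<pi>)" "tgt C g = tgt C (t \<cdot> \<pi>)"
      and g4: "g \<cdot> (p \<cdot> \<pi>) = t \<cdot> \<pi>"
      using coker_lift[OF cd] by metis
    then have g: "arr C g" "src C g = tgt C p" "tgt C g = tgt C t" using t d kd X by simp_all
    have "g \<cdot> p = ((g \<cdot> (p \<cdot> \<pi>)) \<cdot> i)" using g(1-3) d kd X by simp
    also have "\<dots> = t" unfolding g4 using t d by simp
    finally show "\<exists>g. arr (opp C) g \<and> src (opp C) g = src (opp C) t \<and>
        tgt (opp C) g = src (opp C) p \<and> p \<cdot>\<^bsub>opp C\<^esub> g = t" using g by auto
  qed (use kd in simp_all)
  then show ?thesis using coker_conflation[OF ki] by (auto simp: deflation_def)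
qed

text \<open>The ``obscure axiom'' of Quillen: the shear \<open>\<pi> \<boxplus> t \<cdot> \<rho>\<close> of the first projection turns
  \<open>p \<cdot> t\<close> into a redundant component of the row \<open>(p, p \<cdot> t)\<close>.\<close>

lemma deflation_right_factor:
  assumes pt: "deflation S (p \<cdot> t)" and t: "arr C t" "tgt C t = src C p" and k: "ker_of C k p"
  shows "deflation S p"
proof -
  note kd = ker_ofD[OF k] 
  obtain B i j \<pi> \<rho> where b: "biprod C B (src C t) (src C p) j i \<rho> \<pi>"
    using biprod_ex[of "src C t" "src C p"] kd t by auto
  note d = biprodD[OF b]
  have "deflation S ((p \<cdot> t) \<cdot> \<rho> \<boxplus> p \<cdot> \<pi>)"
    by (rule deflation_row[OF b pt]) (use t kd in simp_all)
  then have "deflation S (p \<cdot> (\<pi> \<boxplus> t \<cdot> \<rho>))" using t kd d by (simp add: add_ac)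
  from deflation_proj_cancel[OF biprod_shear[OF biprod_sym[OF b] t(1)] this k] t
  show ?thesis by simp
qed

end

section \<open>Retracts in idempotent complete exact categories\<close>

locale exact_ic_category = exact_category +
  assumes ic: "idempotent_complete C"
begin

lemma opp_exact_ic: "exact_ic_category (opp C) (S\<inverse>)"
  using opp_exact idempotent_complete_opp[OF ic]
  by (simp add: exact_ic_category_def exact_ic_category_axioms_def)

text \<open>Pulling \<open>p\<close> back along the section \<open>s'\<close> gives a deflation
  \<open>p2\<close> onto the target of \<open>p1\<close>, and
  \<open>p2 = p1 \<cdot> (r \<cdot> q2)\<close>. As \<open>p1\<close> has a kernel by
  \<open>retract_kernel\<close>, the obscure axiom makes it a deflation.\<close>

lemma deflation_retract:
  assumes p: "deflation S p" and ret: "arrow_retract C p1 p s r s' r'"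
  shows "deflation S p1"
proof -
  obtain k where k: "(k, p) \<in> S" using p by (auto simp: deflation_def)
  note kk = conflationD(1)[OF k]
  note kd = ker_ofD[OF kk]
  have p1: "arr C p1"
    and s: "arr C s" "src C s = src C p1" "tgt C s = src C p"
    and r: "arr C r" "src C r = src C p" "tgt C r = src C p1"
    and s': "arr C s'" "src C s' = tgt C p1" "tgt C s' = tgt C p"
    and r': "arr C r'" "src C r' = tgt C p" "tgt C r' = tgt C p1"
    and eq: "r \<cdot> s = Idt C (src C p1)" "r' \<cdot> s' = Idt C (tgt C p1)"
      "p \<cdot> s = s' \<cdot> p1" "r' \<cdot> p = p1 \<cdot> r"
    using ret unfolding arrow_retract_def by simp_all
  note red = cmp_red[OF eq(1)] cmp_red[OF eq(2)] cmp_red[OF eq(3)] cmp_red[OF eq(4)]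
  obtain k1 where kk1: "ker_of C k1 p1"
    using retract_kernel[OF ic kk ret] by (auto simp: has_kernel_def)
  obtain B' p2 q2 where *: "B' \<in> Ob C" "p2 \<in> mor C B' (src C s')" "q2 \<in> mor C B' (src C p)"
    "is_pullback C B' (src C p) (src C s') (tgt C p) q2 p2 p s'" "deflation S p2"
    using deflation_pullback[of "src C p" "tgt C p" "src C s'" p s'] p s' p1 kd by auto
  then have pb: "arr C p2" "arr C q2" "src C p2 = B'" "tgt C p2 = tgt C p1" "src C q2 = B'"
    "tgt C q2 = src C p" "p \<cdot> q2 = s' \<cdot> p2"
    using is_pullback_iff[of B' "src C p" "src C s'" "tgt C p" q2 p2 p s'] s' p1 kd
    by (auto dest!: pullback_ofD(9))
  have "p1 \<cdot> (r \<cdot> q2) = r' \<cdot> (p \<cdot> q2)" using red pb(1-6) r r' p1 kd by simp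
  also have "\<dots> = p2" unfolding pb(7) using red pb(1-6) s' r' by simp
  finally have "deflation S (p1 \<cdot> (r \<cdot> q2))" using *(5) by simp
  then show ?thesis by (rule deflation_right_factor[OF _ _ _ kk1]) (use r pb in simp_all)
qed

lemma inflation_retract:
  assumes "inflation S p" "arrow_retract C p1 p s r s' r'"
  shows "inflation S p1"
proof -
  interpret op: exact_ic_category "opp C" "S\<inverse>" by (rule opp_exact_ic)
  show ?thesis using op.deflation_retract[of p p1 r' s' r s] assms by simp
qed

text \<open>The column with entries \<open>n \<cdot> m\<close> and \<open>m\<close> is an inflation
  by shearing. Its retract through the section \<open>(n, 1)\<close> and the second projection is
  \<open>m\<close>; the cokernel of \<open>m\<close> is supplied by idempotent completeness.\<close>

lemma inflation_left_factor:
  assumes "inflation S (n \<cdot> m)" "arr C m" "arr C n" "tgt C m = src C n"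
  shows "inflation S m"
proof -
  obtain P a c p q where b: "biprod C P (tgt C n) (src C n) a c p q"
    using biprod_ex[of "tgt C n" "src C n"] assms by auto
  note d = biprodD[OF b]
  have "inflation S (a \<cdot> (n \<cdot> m) \<boxplus> c \<cdot> m)"
    by (rule inflation_column[OF b assms(1)]) (use assms in simp_all)
  then show ?thesis
    by (rule inflation_retract[of _ _ "Idt C (src C m)" "Idt C (src C m)" "a \<cdot> n \<boxplus> c" q])
      (use assms d in \<open>simp add: arrow_retract_def\<close>)
qed

end

text \<open>These are the operations that leave the stable class of the presented module alone:
  adding an identity or enlarging the source by zero does not change the module, enlarging the
  target adds a representable summand. With retracts they suffice for
  \<open>stable_retract_mem\<close>.\<close>

locale stably_closed = additive_category C for C (structure) +
  fixes M :: "'b set"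
  assumes M_arr: "f \<in> M \<Longrightarrow> arr C f"
    and M_add_Idt: "\<lbrakk>f \<in> M; biprod C P (src C f) V i j p q; biprod C P' (tgt C f) V i' j' p' q'\<rbrakk>
      \<Longrightarrow> i' \<cdot> (f \<cdot> p) \<boxplus> j' \<cdot> q \<in> M"
    and M_proj: "\<lbrakk>f \<in> M; biprod C P (src C f) V i j p q\<rbrakk> \<Longrightarrow> f \<cdot> p \<in> M"
    and M_inj: "\<lbrakk>f \<in> M; biprod C P (tgt C f) V i j p q\<rbrakk> \<Longrightarrow> i \<cdot> f \<in> M"
    and M_retract: "\<lbrakk>f \<in> M; arrow_retract C f\<^sub>1 f s r s' r'\<rbrakk> \<Longrightarrow> f\<^sub>1 \<in> M"

text \<open>The conditions are self-dual as a whole: \<open>M_proj\<close> and \<open>M_inj\<close>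
  are interchanged, and the section and retraction of \<open>M_retract\<close> swap roles.\<close>

lemma stably_closed_opp:
  assumes "stably_closed C M"
  shows "stably_closed (opp C) M"
proof -
  interpret stably_closed C M by fact
  interpret op: additive_category "opp C" by (rule opp_additive)
  show ?thesis
  proof (unfold_locales)
    fix f P V i j p q P' i' j' p' q'
    assume a: "f \<in> M" "biprod (opp C) P (src (opp C) f) V i j p q"
      "biprod (opp C) P' (tgt (opp C) f) V i' j' p' q'"
    then have b: "biprod C P (tgt C f) V p q i j" "biprod C P' (src C f) V p' q' i' j'"
      using biprod_opp[of C P "tgt C f" V p i q j] biprod_opp[of C P' "src C f" V p' i' q' j'] by simp_all
    show "i' \<cdot>\<^bsub>opp C\<^esub> (f \<cdot>\<^bsub>opp C\<^esub> p) \<boxplus>\<^bsub>opp C\<^esub> j' \<cdot>\<^bsub>opp C\<^esub> q \<in> M"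
      using M_add_Idt[OF a(1) b(2) b(1)] M_arr[OF a(1)] biprodD[OF b(1)] biprodD[OF b(2)] by simp
  next
    fix f P V i j p q
    assume a: "f \<in> M" "biprod (opp C) P (src (opp C) f) V i j p q"
    then have "biprod C P (tgt C f) V p q i j"
      using biprod_opp[of C P "tgt C f" V p i q j] by simp
    then show "f \<cdot>\<^bsub>opp C\<^esub> p \<in> M" using M_inj[OF a(1)] by simp
  next
    fix f P V i j p q
    assume a: "f \<in> M" "biprod (opp C) P (tgt (opp C) f) V i j p q"
    then have "biprod C P (src C f) V p q i j"
      using biprod_opp[of C P "src C f" V p i q j] by simp
    then show "i \<cdot>\<^bsub>opp C\<^esub> f \<in> M" using M_proj[OF a(1)] by simp
  next
    fix f f1 s r s' r' assume "f \<in> M" "arrow_retract (opp C) f1 f s r s' r'"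
    then show "f1 \<in> M" using M_retract[of f f1 r' s' r s] by (metis arrow_retract_opp)
  qed (use M_arr in simp)
qed

lemma admI: "\<lbrakk>deflation S p; inflation S m; src C m = tgt C p; f = m \<cdot>\<^bsub>C\<^esub> p\<rbrakk> \<Longrightarrow> adm C S f"
  unfolding adm_def by blast

section \<open>Admissible arrows\<close>

context exact_category
begin

lemma adm_arr: "adm C S f \<Longrightarrow> arr C f"
  unfolding adm_def using deflation_arr inflation_arr by auto

lemma admissible_iff:
  "\<lbrakk>A \<in> Ob C; B \<in> Ob C\<rbrakk> \<Longrightarrow> admissible C S A B f \<longleftrightarrow> adm C S f \<and> src C f = A \<and> tgt C f = B"
proof -
  assume O: "A \<in> Ob C" "B \<in> Ob C"
  show ?thesis
  proof
    assume "admissible C S A B f"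
    then show "adm C S f \<and> src C f = A \<and> tgt C f = B"
      unfolding admissible_def using O by (auto intro: admI)
  next
    assume f: "adm C S f \<and> src C f = A \<and> tgt C f = B"
    then obtain p m where *: "deflation S p" "inflation S m" "src C m = tgt C p" "f = m \<cdot> p"
      unfolding adm_def by blast
    note t = deflation_arr[OF *(1)] inflation_arr[OF *(2)]
    show "admissible C S A B f" unfolding admissible_def
      by (rule bexI[of _ "tgt C p"], rule bexI[of _ p], rule bexI[of _ m]) (use * t f O in auto)
  qed
qed

lemma deflation_adm: "deflation S p \<Longrightarrow> adm C S p"
  using deflation_arr iso_inflation[OF iso_Idt, of "tgt C p"]
  by (intro admI[of S p "Idt C (tgt C p)"]) simp_all

lemma inflation_adm: "inflation S p \<Longrightarrow> adm C S p"
  using inflation_arr iso_deflation[OF iso_Idt, of "src C p"]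
  by (intro admI[of S "Idt C (src C p)" p]) simp_all

lemma adm_cmp_deflation:
  assumes "adm C S f" "deflation S d" "tgt C d = src C f"
  shows "adm C S (f \<cdot> d)"
proof -
  obtain p m where *: "deflation S p" "inflation S m" "src C m = tgt C p" "f = m \<cdot> p"
    using assms(1) by (auto simp: adm_def)
  note t = deflation_arr[OF *(1)] inflation_arr[OF *(2)] deflation_arr[OF assms(2)]
  have "deflation S (p \<cdot> d)" by (rule deflation_cmp) (use assms * t in simp_all)
  then show ?thesis
    by (rule admI) (use * assms t in simp_all)
qed

lemma adm_inflation_cmp:
  assumes "adm C S f" "inflation S n" "src C n = tgt C f"
  shows "adm C S (n \<cdot> f)"
proof -
  interpret op: exact_category "opp C" "S\<inverse>" by (rule opp_exact)
  show ?thesis using op.adm_cmp_deflation[of f n] assms by simp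
qed

lemma adm_add_Idt:
  assumes "adm C S f" and b: "biprod C P (src C f) V i j p q" and b': "biprod C P' (tgt C f) V i' j' p' q'"
  shows "adm C S (i' \<cdot> (f \<cdot> p) \<boxplus> j' \<cdot> q)"
proof -
  obtain e m where *: "deflation S e" "inflation S m" "src C m = tgt C e" "f = m \<cdot> e"
    using assms(1) by (auto simp: adm_def)
  note t = deflation_arr[OF *(1)] inflation_arr[OF *(2)]
  note d = biprodD[OF b] and d' = biprodD[OF b']
  have st: "src C f = src C e" "tgt C f = tgt C m" using * t by simp_all
  obtain P0 a c u v where b0: "biprod C P0 (tgt C e) V a c u v"
    using biprod_ex[of "tgt C e" V] t d(3) by auto
  note d0 = biprodD[OF b0]
  have "deflation S (a \<cdot> (e \<cdot> p) \<boxplus> c \<cdot> q)"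
    using deflation_add_Idt[OF b b0 *(1)] st by simp
  moreover have "inflation S (i' \<cdot> (m \<cdot> u) \<boxplus> j' \<cdot> v)"
    using inflation_add_Idt[OF b0 b' *(2)] st * by simp
  ultimately show ?thesis
    by (rule admI) (use t *(3,4) st d d' d0 in simp_all)
qed

text \<open>If \<open>f = m \<cdot> p\<close> is epic, the cokernel of \<open>m\<close> kills
  \<open>f\<close> and is zero, so \<open>m\<close> is invertible.\<close>

lemma adm_epic_deflation:
  assumes "adm C S f" "epic C f"
  shows "deflation S f"
proof -
  obtain p m where *: "deflation S p" "inflation S m" "src C m = tgt C p" "f = m \<cdot> p"
    using assms(1) by (auto simp: adm_def)
  note t = deflation_arr[OF *(1)] inflation_arr[OF *(2)]
  obtain c where c: "(m, c) \<in> S" using * by (auto simp: inflation_def)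
  note k = ker_ofD[OF conflationD(1)[OF c]]
  have "c \<cdot> f = zer C (src C f) (tgt C c)" using k * t by simp
  then have "c = zer C (src C c) (tgt C c)" using epicD[OF assms(2), of c] k * t by simp
  then have "iso_arr C m" using split_mono_kernel_zero[OF conflationD(1)[OF c]] by simp
  then show ?thesis using deflation_cmp[OF *(1) iso_deflation] * by simp
qed

end

context exact_ic_category
begin

text \<open>The retraction induces an idempotent on the image of \<open>f\<close>. Splitting it
  exhibits the two factors of \<open>f1\<close> as retracts of the deflation and of the inflation of
  \<open>f\<close>.\<close>

lemma adm_retract:
  assumes "adm C S f" and ret: "arrow_retract C f1 f s r s' r'"
  shows "adm C S f1"
proof -
  obtain p m where *: "deflation S p" "inflation S m" "src C m = tgt C p" "f = m \<cdot> p"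
    using assms(1) by (auto simp: adm_def)
  note t = deflation_arr[OF *(1)] inflation_arr[OF *(2)]
  have st: "src C f = src C p" "tgt C f = tgt C m" using * t by simp_all
  have R: "arr C f1" "arr C f" "arr C s" "src C s = src C f1" "tgt C s = src C p"
    "arr C r" "src C r = src C p" "tgt C r = src C f1"
    "arr C s'" "src C s' = tgt C f1" "tgt C s' = tgt C m"
    "arr C r'" "src C r' = tgt C m" "tgt C r' = tgt C f1"
    using ret st unfolding arrow_retract_def by simp_all
  have E: "r \<cdot> s = Idt C (src C f1)" "r' \<cdot> s' = Idt C (tgt C f1)"
    "m \<cdot> (p \<cdot> s) = s' \<cdot> f1" "r' \<cdot> (m \<cdot> p) = f1 \<cdot> r"
    using ret * t R unfolding arrow_retract_def by simp_all
  obtain k where k: "(k, p) \<in> S" using * by (auto simp: deflation_def)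
  note kd = ker_ofD[OF conflationD(1)[OF k]] and cd = coker_ofD[OF conflationD(2)[OF k]]
  have mono: "monic C m" using inflation_monic * by simp
  have ep: "epic C p" using deflation_epic * by simp
  have red: "\<And>x. \<lbrakk>arr C x; tgt C x = src C f1\<rbrakk> \<Longrightarrow> r \<cdot> (s \<cdot> x) = x"
    "\<And>x. \<lbrakk>arr C x; tgt C x = tgt C f1\<rbrakk> \<Longrightarrow> r' \<cdot> (s' \<cdot> x) = x"
    "\<And>x. \<lbrakk>arr C x; tgt C x = src C f1\<rbrakk> \<Longrightarrow> m \<cdot> (p \<cdot> (s \<cdot> x)) = s' \<cdot> (f1 \<cdot> x)"
    "\<And>x. \<lbrakk>arr C x; tgt C x = src C p\<rbrakk> \<Longrightarrow> r' \<cdot> (m \<cdot> (p \<cdot> x)) = f1 \<cdot> (r \<cdot> x)"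
    using cmp_red[OF E(1)] cmp_red[OF E(2)] cmp_red[OF E(3)] cmp_red[OF E(4)] R t *(3) by simp_all
  \<comment> \<open>As \<open>m\<close> is monic, it is enough that \<open>m \<cdot> p \<cdot> s
    \<cdot> r = s' \<cdot> r' \<cdot> m \<cdot> p\<close> kills \<open>k\<close>. Hence
    \<open>p \<cdot> s \<cdot> r\<close> descends along \<open>p\<close> to an endomorphism
    \<open>e\<close> of the image.\<close>
  have psrk: "p \<cdot> (s \<cdot> (r \<cdot> k)) = zer C (src C k) (tgt C p)"
  proof -
    have "m \<cdot> (p \<cdot> (s \<cdot> (r \<cdot> k))) = s' \<cdot> (r' \<cdot> (m \<cdot> (p \<cdot> k)))"
      using red R t kd(1-4) *(3) by simp
    also have "\<dots> = zer C (src C k) (tgt C m)" using kd R t *(3) by simp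
    finally show ?thesis using monicD[OF mono, of "p \<cdot> (s \<cdot> (r \<cdot> k))"] R t kd(1-4) *(3) by simp
  qed
  have "(p \<cdot> (s \<cdot> r)) \<cdot> k = zer C (src C k) (tgt C (p \<cdot> (s \<cdot> r)))" "arr C (p \<cdot> (s \<cdot> r))"
    "src C (p \<cdot> (s \<cdot> r)) = tgt C k" using psrk R t kd(1-4) by simp_all
  then obtain e where "arr C e" "src C e = tgt C p" "tgt C e = tgt C (p \<cdot> (s \<cdot> r))" 
    and e4: "e \<cdot> p = p \<cdot> (s \<cdot> r)"
    using coker_lift[OF conflationD(2)[OF k]] by metis
  then have e: "arr C e" "src C e = tgt C p" "tgt C e = tgt C p" using R t by simp_all
  note rede = cmp_red[OF e4]
  have ee: "e \<cdot> e = e"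
    by (rule epic_cancel[OF ep]) (use e e4 rede R t red(1) in simp_all)
  \<comment> \<open>So \<open>m\<close> intertwines \<open>e\<close> with the idempotent
    \<open>s' \<cdot> r'\<close> on the target; this makes \<open>m1\<close> a retract of
    \<open>m\<close>.\<close>
  have me: "m \<cdot> e = s' \<cdot> (r' \<cdot> m)"
    by (rule epic_cancel[OF ep]) (use e e4 rede R t E red *(3) in simp_all)
  obtain rI sI where I: "arr C rI" "arr C sI" "src C rI = src C e" "tgt C sI = src C e"
    "src C sI = tgt C rI" "sI \<cdot> rI = e" "rI \<cdot> sI = Idt C (tgt C rI)"
    using split_idempotent[OF ic, of e] e ee by metis
  have redI: "\<And>x. \<lbrakk>arr C x; tgt C x = tgt C p\<rbrakk> \<Longrightarrow> sI \<cdot> (rI \<cdot> x) = e \<cdot> x"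
    "\<And>x. \<lbrakk>arr C x; tgt C x = tgt C rI\<rbrakk> \<Longrightarrow> rI \<cdot> (sI \<cdot> x) = x"
    using cmp_red[OF I(6)] cmp_red[OF I(7)] I e by simp_all
  have esI: "e \<cdot> sI = sI" and rIe: "rI \<cdot> e = rI"
    using I(1-5,7) e redI unfolding I(6)[symmetric] by simp_all
  have redm: "\<And>x. \<lbrakk>arr C x; tgt C x = tgt C p\<rbrakk> \<Longrightarrow> m \<cdot> (e \<cdot> x) = s' \<cdot> (r' \<cdot> (m \<cdot> x))"
    using cmp_red[OF me] t *(3) e R by simp
  define p1 where "p1 = rI \<cdot> (p \<cdot> s)"
  define m1 where "m1 = r' \<cdot> (m \<cdot> sI)"
  have p1: "arr C p1" "src C p1 = src C f1" "tgt C p1 = tgt C rI"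
    unfolding p1_def using I e R t by simp_all
  have m1: "arr C m1" "src C m1 = tgt C rI" "tgt C m1 = tgt C f1"
    unfolding m1_def using I e R t *(3) by simp_all
  have "rI \<cdot> p = p1 \<cdot> r"
  proof -
    have "p1 \<cdot> r = rI \<cdot> (p \<cdot> (s \<cdot> r))" unfolding p1_def using I e R t by simp
    also have "\<dots> = (rI \<cdot> e) \<cdot> p" unfolding e4[symmetric] using I(1-5) e R t by simp
    finally show ?thesis unfolding rIe by simp
  qed
  moreover have "p \<cdot> s = sI \<cdot> p1"
  proof -
    have "sI \<cdot> p1 = (e \<cdot> p) \<cdot> s" unfolding p1_def using I(1-5) redI e R t by simp
    also have "\<dots> = p \<cdot> s" unfolding e4 using R t red E by simp
    finally show ?thesis by simp
  qed
  ultimately have "deflation S p1"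
    by (intro deflation_retract[OF *(1), of p1 s r sI rI])
      (use t p1 R I(1-5,7) e E in \<open>simp add: arrow_retract_def\<close>)
  moreover have "inflation S m1"
  proof -
    have "s' \<cdot> m1 = (s' \<cdot> (r' \<cdot> m)) \<cdot> sI" unfolding m1_def using R I(1-5) e t *(3) by simp
    also have "\<dots> = m \<cdot> (e \<cdot> sI)" unfolding me[symmetric] using I(1-5) e t *(3) by simp
    finally have 1: "m \<cdot> sI = s' \<cdot> m1" unfolding esI by simp
    have "m1 \<cdot> rI = r' \<cdot> (m \<cdot> e)" unfolding m1_def using R I e t *(3) by simp
    also have "\<dots> = r' \<cdot> m" unfolding me using red R t by simp
    finally have 2: "r' \<cdot> m = m1 \<cdot> rI" by simp
    show ?thesis
      by (rule inflation_retract[OF *(2), of m1 sI rI s' r'])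
        (use t m1 R I(1-5,7) e E *(3) 1 2 in \<open>simp add: arrow_retract_def\<close>)
  qed
  moreover have "f1 = m1 \<cdot> p1"
  proof -
    have "m1 \<cdot> p1 = r' \<cdot> (m \<cdot> ((e \<cdot> p) \<cdot> s))"
      unfolding m1_def p1_def using R I(1-5) redI e t *(3) by simp
    also have "\<dots> = f1" unfolding e4 using R t red E *(3) by simp
    finally show ?thesis by simp
  qed
  ultimately show ?thesis using p1 m1 by (intro admI[of S p1 m1]) simp_all
qed

lemma adm_stably_closed: "stably_closed C {f. adm C S f}"
proof unfold_locales
  fix f P V i j p q assume "f \<in> {f. adm C S f}" "biprod C P (src C f) V i j p q"
  then show "f \<cdot> p \<in> {f. adm C S f}"
    using adm_cmp_deflation[of f p] biprod_deflation[of P "src C f" V i j p q] biprodD(13) by auto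
next
  fix f P V i j p q assume "f \<in> {f. adm C S f}" "biprod C P (tgt C f) V i j p q"
  then show "i \<cdot> f \<in> {f. adm C S f}"
    using adm_inflation_cmp[of f i] biprod_inflation[of P "tgt C f" V i j p q] biprodD(8) by auto
qed (auto intro: adm_arr adm_add_Idt adm_retract)

text \<open>The triangular arrow with diagonal \<open>f\<close>, \<open>h\<close> and corner
  \<open>s\<close> presents an extension of the two cokernel modules; \<open>sk\<close> is what
  makes the left map injective. With \<open>f = m \<cdot> p\<close> and
  \<open>h = n \<cdot> q\<close>, its image is found as a kernel inside the sum of
  \<open>tgt C f\<close> and the image of \<open>h\<close>.\<close>

lemma adm_extension:
  assumes f: "adm C S f" and h: "adm C S h" and s: "arr C s" "src C s = src C h" "tgt C s = tgt C f"
    and sk: "\<And>t. \<lbrakk>arr C t; tgt C t = src C h; h \<cdot> t = zer C (src C t) (tgt C h)\<rbrakk> \<Longrightarrow>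
      \<exists>r. arr C r \<and> src C r = src C t \<and> tgt C r = src C f \<and> s \<cdot> t = f \<cdot> r"
    and X: "biprod C X (src C f) (src C h) i1 i2 p1 p2"
    and Y: "biprod C Y (tgt C f) (tgt C h) j1 j2 q1 q2"
  shows "adm C S (j1 \<cdot> (f \<cdot> p1 \<boxplus> s \<cdot> p2) \<boxplus> j2 \<cdot> (h \<cdot> p2))"
proof -
  obtain p m where F: "deflation S p" "inflation S m" "src C m = tgt C p" "f = m \<cdot> p"
    using f by (auto simp: adm_def)
  obtain q n where H: "deflation S q" "inflation S n" "src C n = tgt C q" "h = n \<cdot> q"
    using h by (auto simp: adm_def)
  note t = deflation_arr[OF F(1)] inflation_arr[OF F(2)] deflation_arr[OF H(1)] inflation_arr[OF H(2)]
  have st: "src C f = src C p" "tgt C f = tgt C m" "src C h = src C q" "tgt C h = tgt C n"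
    using F H t by simp_all
  note s' = s[unfolded st]
  note dX = biprodD[OF X, unfolded st] and dY = biprodD[OF Y, unfolded st]
  obtain e where e: "(m, e) \<in> S" using F by (auto simp: inflation_def)
  note ed = ker_ofD[OF conflationD(1)[OF e]]
  have edef: "deflation S e" using e by (auto simp: deflation_def)
  obtain k where k: "(k, q) \<in> S" using H by (auto simp: deflation_def)
  note kd = ker_ofD[OF conflationD(1)[OF k]]
  \<comment> \<open>Applied to the kernel \<open>k\<close> of \<open>q\<close>, the condition
    \<open>sk\<close> shows that \<open>e \<cdot> s\<close> kills \<open>k\<close> and so descends
    to \<open>z\<close> along \<open>q\<close>.\<close>
  have "h \<cdot> k = zer C (src C k) (tgt C h)" using H kd t by simp
  then obtain r where r: "arr C r" "src C r = src C k" "tgt C r = src C p" "s \<cdot> k = m \<cdot> (p \<cdot> r)"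
    using sk[of k] kd F t st by auto
  have "(e \<cdot> s) \<cdot> k = zer C (src C k) (tgt C (e \<cdot> s))" "arr C (e \<cdot> s)" "src C (e \<cdot> s) = tgt C k"
    using r s' ed kd F(3) t by simp_all
  then obtain z where "arr C z" "src C z = tgt C q" "tgt C z = tgt C (e \<cdot> s)" and z4: "z \<cdot> q = e \<cdot> s"
    using coker_lift[OF conflationD(2)[OF k]] by metis
  then have z: "arr C z" "src C z = tgt C q" "tgt C z = tgt C e" using s' ed by simp_all
  note redz = cmp_red[OF z4]
  obtain YJ c1 c2 d1 d2 where bJ: "biprod C YJ (tgt C m) (tgt C q) c1 c2 d1 d2"
    using biprod_ex[of "tgt C m" "tgt C q"] t by auto
  note dJ = biprodD[OF bJ]
  \<comment> \<open>The image of the triangular arrow is the kernel \<open>v\<close> of the row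
    \<open>(e, -z)\<close>. It receives the columns \<open>(m, 0)\<close> and \<open>(s, q)\<close>,
    lifted below to \<open>mh\<close> and \<open>sh\<close>.\<close>
  define D where "D = e \<cdot> d1 \<boxplus> neg C z \<cdot> d2"
  have Dd: "deflation S D" unfolding D_def by (rule deflation_row[OF bJ edef]) (use z ed in simp_all)
  have D: "arr C D" "src C D = YJ" "tgt C D = tgt C e" unfolding D_def using z ed dJ by simp_all
  obtain v where v: "(v, D) \<in> S" using Dd by (auto simp: deflation_def)
  note kv = conflationD(1)[OF v]
  note vd = ker_ofD[OF kv]
  have "D \<cdot> (c1 \<cdot> m) = zer C (src C (c1 \<cdot> m)) (tgt C D)" "arr C (c1 \<cdot> m)" "tgt C (c1 \<cdot> m) = src C D"
    unfolding D_def using z ed dJ t by simp_all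
  then obtain mh where "arr C mh" "src C mh = src C (c1 \<cdot> m)" "tgt C mh = src C v" and mh4: "v \<cdot> mh = c1 \<cdot> m"
    using ker_lift[OF kv] by metis
  then have mh: "arr C mh" "src C mh = tgt C p" "tgt C mh = src C v" using dJ t F(3) by simp_all
  define w where "w = c1 \<cdot> s \<boxplus> c2 \<cdot> q"
  have w: "arr C w" "src C w = src C q" "tgt C w = YJ" unfolding w_def using dJ s' t by simp_all
  have "D \<cdot> w = zer C (src C w) (tgt C D)"
    unfolding D_def w_def using z z4 ed dJ t s' by simp
  then obtain sh where sh: "arr C sh" "src C sh = src C q" "tgt C sh = src C v" "v \<cdot> sh = w"
    using ker_lift[OF kv, of w] w D by metis
  have redv: "\<And>x. \<lbrakk>arr C x; tgt C x = tgt C p\<rbrakk> \<Longrightarrow> v \<cdot> (mh \<cdot> x) = c1 \<cdot> (m \<cdot> x)"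
    "\<And>x. \<lbrakk>arr C x; tgt C x = src C q\<rbrakk> \<Longrightarrow> v \<cdot> (sh \<cdot> x) = c1 \<cdot> (s \<cdot> x) \<boxplus> c2 \<cdot> (q \<cdot> x)"
    using cmp_red[OF mh4] cmp_red[OF sh(4)] mh sh vd F(3) dJ t s' unfolding w_def by simp_all
  obtain P a1 a2 b1 b2 where bP: "biprod C P (tgt C p) (src C q) a1 a2 b1 b2"
    using biprod_ex[of "tgt C p" "src C q"] t by auto
  note dP = biprodD[OF bP]
  define T where "T = mh \<cdot> b1 \<boxplus> sh \<cdot> b2"
  have T: "arr C T" "src C T = P" "tgt C T = src C v" unfolding T_def using mh sh dP by simp_all
  have vt: "tgt C v = YJ" using vd(4) D by simp
  \<comment> \<open>The row \<open>(mh, sh)\<close> is the pullback of \<open>q\<close> along the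
    second coordinate \<open>d2 \<cdot> v\<close> of the image.\<close>
  have Td: "deflation S T"
  proof (rule deflation_base_change[OF _ H(1)])
    show "pullback_of C b2 T q (d2 \<cdot> v)"
      unfolding pullback_of_def
    proof (intro conjI allI impI)
      show "q \<cdot> b2 = (d2 \<cdot> v) \<cdot> T"
        unfolding T_def using mh sh dP dJ vd(1-3) vt redv t F(3) s' by simp
      fix x assume x: "arr C x" "tgt C x = src C b2" "b2 \<cdot> x = zer C (src C x) (tgt C b2)"
        "T \<cdot> x = zer C (src C x) (tgt C T)"
      have "mh \<cdot> (b1 \<cdot> x) = zer C (src C x) (src C v)"
        using x mh sh dP unfolding T_def by simp
      then have "v \<cdot> (mh \<cdot> (b1 \<cdot> x)) = zer C (src C x) YJ" using x(1) vd(1-3) vt by simp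
      then have "d1 \<cdot> (c1 \<cdot> (m \<cdot> (b1 \<cdot> x))) = zer C (src C x) (tgt C m)"
        using redv x(1,2) dP dJ by simp
      then have "m \<cdot> (b1 \<cdot> x) = zer C (src C x) (tgt C m)" using x(1,2) dP dJ t F(3) by simp
      then have b1x: "b1 \<cdot> x = zer C (src C x) (tgt C p)"
        using monicD[OF inflation_monic[OF F(2)], of "b1 \<cdot> x"] x(1,2) dP F(3) by simp
      show "x = zer C (src C x) (src C b2)"
        by (rule biprod_eqI[OF bP]) (use x b1x dP in simp_all)
    next
      fix x y assume x: "arr C x" "arr C y" "src C y = src C x" "tgt C x = src C q"
        "tgt C y = src C (d2 \<cdot> v)" "q \<cdot> x = (d2 \<cdot> v) \<cdot> y"
      have ty: "tgt C y = src C v" using x(5) vd(2) vt dJ by simp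
      \<comment> \<open>The difference \<open>y - sh \<cdot> x\<close> has second coordinate zero,
        so its first coordinate is killed by \<open>e\<close> and comes from the kernel
        \<open>m\<close> of \<open>e\<close>.\<close>
      define u where "u = y \<boxplus> neg C (sh \<cdot> x)"
      have u: "arr C u" "src C u = src C x" "tgt C u = src C v"
        unfolding u_def using x(1-4) ty sh by simp_all
      have d2u: "d2 \<cdot> (v \<cdot> u) = zer C (src C x) (tgt C q)"
      proof -
        have "d2 \<cdot> (v \<cdot> u) = (d2 \<cdot> v) \<cdot> y \<boxplus> neg C (q \<cdot> x)"
          unfolding u_def using x(1-4) ty sh(1-3) vd(1-3) vt dJ redv s' t by simp
        then show ?thesis using x(1,4) t unfolding x(6)[symmetric] by simp
      qed
      have "D \<cdot> (v \<cdot> u) = zer C (src C x) (tgt C D)" using vd u by simp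
      then have "e \<cdot> (d1 \<cdot> (v \<cdot> u)) = zer C (src C x) (tgt C e)"
        unfolding D_def using d2u u vd(1-3) vt dJ z ed x(1) by simp
      then obtain a where a: "arr C a" "src C a = src C x" "tgt C a = tgt C p" "m \<cdot> a = d1 \<cdot> (v \<cdot> u)"
        using ker_lift[OF conflationD(1)[OF e], of "d1 \<cdot> (v \<cdot> u)"] u vd(1-3) vt dJ ed F(3) by auto
      have mha: "mh \<cdot> a = u"
      proof (rule monic_cancel[OF vd(1)])
        show "v \<cdot> (mh \<cdot> a) = v \<cdot> u"
          by (rule biprod_eqI[OF bJ])
            (use redv a u vd(1-3) vt mh dJ d2u t F(3) in simp_all)
      qed (use a mh u in simp_all)
      have "T \<cdot> (a1 \<cdot> a \<boxplus> a2 \<cdot> x) = y"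
        unfolding T_def using a x(1-4) dP mh(1-3) sh(1-3) mha ty
        unfolding u_def by (simp add: add_ac)
      then show "\<exists>h. arr C h \<and> src C h = src C x \<and> tgt C h = src C b2 \<and> b2 \<cdot> h = x \<and> T \<cdot> h = y"
        using a x(1-4) dP by (intro exI[of _ "a1 \<cdot> a \<boxplus> a2 \<cdot> x"]) simp
    qed (use dP t T vd(1-3) vt dJ in simp_all)
  qed
  define P1 where "P1 = a1 \<cdot> (p \<cdot> p1) \<boxplus> a2 \<cdot> p2"
  have P1: "deflation S P1" "arr C P1" "src C P1 = X" "tgt C P1 = P"
    using deflation_add_Idt[OF X[unfolded st] bP F(1)] dX dP t unfolding P1_def by simp_all
  define N where "N = j2 \<cdot> (n \<cdot> d2) \<boxplus> j1 \<cdot> d1"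
  have N: "inflation S N" "arr C N" "src C N = YJ" "tgt C N = Y"
    using inflation_add_Idt[OF biprod_sym[OF bJ] biprod_sym[OF Y[unfolded st]] H(2)] dY dJ H(3) t
    unfolding N_def by simp_all
  \<comment> \<open>The whole arrow is \<open>p\<close> plus an identity, then \<open>T\<close>,
    then \<open>v\<close>, then \<open>n\<close> plus an identity: two deflations followed by two
    inflations.\<close>
  have "adm C S ((N \<cdot> v) \<cdot> (T \<cdot> P1))" 
  proof (rule admI)
    show "deflation S (T \<cdot> P1)" using deflation_cmp[OF P1(1) Td] P1 T by simp
    show "inflation S (N \<cdot> v)"
      using inflation_cmp[OF _ N(1), of v] v N vt by (auto simp: inflation_def)
  qed (use P1 T vd(1-3) vt N in simp_all)
  moreover have "(N \<cdot> v) \<cdot> (T \<cdot> P1) = j1 \<cdot> (f \<cdot> p1 \<boxplus> s \<cdot> p2) \<boxplus> j2 \<cdot> (h \<cdot> p2)"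
    unfolding N_def T_def P1_def
    using dX dY dJ dP vd(1-3) vt mh(1-3) sh(1-3) redv t F(3,4) H(3,4) s' by (simp add: add_ac)
  ultimately show ?thesis by simp
qed

text \<open>The arrows \<open>h \<cdot> w\<close> and \<open>h\<close> present a quotient map of
  modules with a common generator, and the row \<open>(w, k)\<close> presents its kernel. Its image
  is the preimage under \<open>q\<close> of the image of \<open>h \<cdot> w\<close>.\<close>

lemma adm_kernel:
  assumes h: "adm C S h" and w: "arr C w" "tgt C w = src C h" and hw: "adm C S (h \<cdot> w)"
    and k: "ker_of C k h" and b: "biprod C P (src C w) (src C k) i j \<pi> \<rho>"
  shows "adm C S (w \<cdot> \<pi> \<boxplus> k \<cdot> \<rho>)"
proof -
  obtain q n where H: "deflation S q" "inflation S n" "src C n = tgt C q" "h = n \<cdot> q"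
    using h by (auto simp: adm_def)
  obtain p m where G: "deflation S p" "inflation S m" "src C m = tgt C p" "h \<cdot> w = m \<cdot> p"
    using hw by (auto simp: adm_def)
  note t = deflation_arr[OF G(1)] inflation_arr[OF G(2)] deflation_arr[OF H(1)] inflation_arr[OF H(2)]
  have st: "src C h = src C q" "tgt C h = tgt C n" using H t by simp_all
  have wt: "tgt C w = src C q" using w st by simp
  have nqw: "n \<cdot> (q \<cdot> w) = m \<cdot> p" using G(4) H t w st by simp
  have pt: "src C p = src C w" "tgt C m = tgt C n"
    using arg_cong[OF nqw, of "src C"] arg_cong[OF nqw, of "tgt C"] t w wt H(3) G(3) by simp_all
  note kd = ker_ofD[OF k] and d = biprodD[OF b]
  have kt: "tgt C k = src C q" using kd(4) st by simp
  obtain c where c: "(n, c) \<in> S" using H by (auto simp: inflation_def)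
  note kn = conflationD(1)[OF c]
  note cd = ker_ofD[OF kn]
  have "(c \<cdot> m) \<cdot> p = zer C (src C p) (tgt C (c \<cdot> m))"
    using nqw[symmetric] t G(3) H(3) cd pt w wt by simp
  then have cm: "c \<cdot> m = zer C (src C m) (tgt C c)"
    using epicD[OF deflation_epic[OF G(1)], of "c \<cdot> m"] t G(3) cd pt by simp
  then obtain m' where m': "arr C m'" "src C m' = tgt C p" "tgt C m' = tgt C q" "n \<cdot> m' = m"
    using ker_lift[OF kn, of m] t cd pt H(3) G(3) by metis
  \<comment> \<open>The image of \<open>h \<cdot> w\<close> lies in that of \<open>h\<close>;
    cancelling \<open>n\<close> from the inflation \<open>m = n \<cdot> m'\<close> uses idempotent
    completeness.\<close>
  have m'i: "inflation S m'"
    by (rule inflation_left_factor[of n]) (use m' t G(2) H(3) in simp_all)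
  have qw: "q \<cdot> w = m' \<cdot> p"
    by (rule monic_cancel[OF inflation_monic[OF H(2)]])
      (use nqw m' t w wt H(3) pt cmp_red[OF m'(4)] in simp_all)
  obtain c' where c': "(m', c') \<in> S" using m'i by (auto simp: inflation_def)
  note km = conflationD(1)[OF c']
  note c'd = ker_ofD[OF km]
  have qk: "q \<cdot> k = zer C (src C k) (tgt C q)"
  proof -
    have "n \<cdot> (q \<cdot> k) = zer C (src C k) (tgt C n)" using kd(5) H(3,4) t kt kd(2) by simp
    then show ?thesis
      using monicD[OF inflation_monic[OF H(2)], of "q \<cdot> k"] t kt kd(2) H(3) by simp
  qed
  have kq: "ker_of C k q" unfolding ker_of_def
  proof (intro conjI allI impI)
    fix x assume x: "arr C x" "tgt C x = src C q" "q \<cdot> x = zer C (src C x) (tgt C q)"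
    have "h \<cdot> x = zer C (src C x) (tgt C h)" using x t H(3,4) by simp
    then show "\<exists>g. arr C g \<and> src C g = src C x \<and> tgt C g = src C k \<and> k \<cdot> g = x"
      using ker_lift[OF k, of x] x st by metis
  qed (use kd qk kt t in simp_all)
  have def: "deflation S (c' \<cdot> q)"
    by (rule deflation_cmp[OF H(1)]) (use c' c'd m' in \<open>auto simp: deflation_def\<close>)
  \<comment> \<open>The kernel \<open>u\<close> of \<open>c' \<cdot> q\<close> is the preimage of
    \<open>m'\<close> under \<open>q\<close>. Both \<open>w\<close> and \<open>k\<close> lift to it,
    and \<open>b\<close> is the restriction of \<open>q\<close>.\<close>
  obtain u where u: "(u, c' \<cdot> q) \<in> S" using def by (auto simp: deflation_def)
  note ku = conflationD(1)[OF u]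
  note ud = ker_ofD[OF ku]
  have c'q: "arr C (c' \<cdot> q)" "src C (c' \<cdot> q) = src C q" "tgt C (c' \<cdot> q) = tgt C c'"
    using t c'd m' by simp_all
  have ut: "tgt C u = src C q" using ud(4) c'q by simp
  have "(c' \<cdot> q) \<cdot> w = zer C (src C w) (tgt C (c' \<cdot> q))"
    using qw c'd m' t w wt pt by simp
  then obtain w' where w': "arr C w'" "src C w' = src C w" "tgt C w' = src C u" "u \<cdot> w' = w"
    using ker_lift[OF ku, of w] w wt c'q by metis
  have "(c' \<cdot> q) \<cdot> k = zer C (src C k) (tgt C (c' \<cdot> q))"
    using qk c'd m' t kd(2) kt by simp
  then obtain k' where k': "arr C k'" "src C k' = src C k" "tgt C k' = src C u" "u \<cdot> k' = k"
    using ker_lift[OF ku, of k] kd(2) kt c'q by metis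
  have "c' \<cdot> (q \<cdot> u) = zer C (src C (q \<cdot> u)) (tgt C c')" "arr C (q \<cdot> u)" "tgt C (q \<cdot> u) = src C c'"
    using ud(2,5) ut c'd m' t by simp_all
  then obtain b where "arr C b" "src C b = src C (q \<cdot> u)" "tgt C b = src C m'" and b4: "m' \<cdot> b = q \<cdot> u"
    using ker_lift[OF km] by metis
  then have b: "arr C b" "src C b = src C u" "tgt C b = tgt C p" using t ud(2) ut m' by simp_all
  have redb: "\<And>x. \<lbrakk>arr C x; tgt C x = src C u\<rbrakk> \<Longrightarrow> m' \<cdot> (b \<cdot> x) = q \<cdot> (u \<cdot> x)"
    using cmp_red[OF b4] b m' t ud(2) ut by simp
  have m'm: "monic C m'" using inflation_monic[OF m'i] .
  have bw: "b \<cdot> w' = p"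
    by (rule monic_cancel[OF m'm]) (use b w' m' redb qw t pt in simp_all)
  have bk: "b \<cdot> k' = zer C (src C k) (tgt C p)"
    by (rule monic_cancel[OF m'm]) (use b k' m' redb qk t kd(2) in simp_all)
  define T where "T = w' \<cdot> \<pi> \<boxplus> k' \<cdot> \<rho>"
  have T: "arr C T" "src C T = P" "tgt C T = src C u" unfolding T_def using w' k' d by simp_all
  \<comment> \<open>The row \<open>(w', k')\<close> is the pullback of \<open>p\<close> along
    \<open>b\<close>: elements with equal image under \<open>b\<close> differ by one of the kernel
    \<open>k\<close> of \<open>q\<close>.\<close>
  have Td: "deflation S T"
  proof (rule deflation_base_change[OF _ G(1)])
    show "pullback_of C \<pi> T p b" unfolding pullback_of_def
    proof (intro conjI allI impI)
      show "p \<cdot> \<pi> = b \<cdot> T"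
        unfolding T_def using b w' k' d bk bw cmp_red[OF bw] cmp_red[OF bk] kd(2) t pt by simp
      fix x assume x: "arr C x" "tgt C x = src C \<pi>" "\<pi> \<cdot> x = zer C (src C x) (tgt C \<pi>)"
        "T \<cdot> x = zer C (src C x) (tgt C T)"
      have "k' \<cdot> (\<rho> \<cdot> x) = zer C (src C x) (src C u)"
        using x w' k' d unfolding T_def by simp
      then have "u \<cdot> (k' \<cdot> (\<rho> \<cdot> x)) = zer C (src C x) (src C q)" using x(1) ud(2) ut by simp
      then have "k \<cdot> (\<rho> \<cdot> x) = zer C (src C x) (src C q)"
        using cmp_red[OF k'(4)] k' ud(2) x(1,2) d by simp
      then have rx: "\<rho> \<cdot> x = zer C (src C x) (src C k)"
        using monicD[OF kd(1), of "\<rho> \<cdot> x"] x(1,2) d kt by simp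
      show "x = zer C (src C x) (src C \<pi>)"
        by (rule biprod_eqI[OF \<open>biprod C P (src C w) (src C k) i j \<pi> \<rho>\<close>]) (use x rx d in simp_all)
    next
      fix x y assume x: "arr C x" "arr C y" "src C y = src C x" "tgt C x = src C p"
        "tgt C y = src C b" "p \<cdot> x = b \<cdot> y"
      define z where "z = y \<boxplus> neg C (w' \<cdot> x)"
      have z: "arr C z" "src C z = src C x" "tgt C z = src C u"
        unfolding z_def using x(1-5) b w' pt by simp_all
      have "b \<cdot> z = zer C (src C x) (tgt C p)"
        unfolding z_def using x b(1-3) w'(1-3) pt cmp_red[OF bw] t by (simp flip: x(6))
      then have "m' \<cdot> (b \<cdot> z) = zer C (src C x) (tgt C q)" using m' x(1) t by simp
      then have quz: "q \<cdot> (u \<cdot> z) = zer C (src C (u \<cdot> z)) (tgt C q)" using redb z ud(2) by simp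
      have uz: "arr C (u \<cdot> z)" "tgt C (u \<cdot> z) = src C q" "src C (u \<cdot> z) = src C x"
        using z ud(2) ut by simp_all
      obtain g where g: "arr C g" "src C g = src C x" "tgt C g = src C k" "k \<cdot> g = u \<cdot> z"
        using ker_lift[OF kq quz uz(1,2)] uz(3) by metis
      have "k' \<cdot> g = z"
        by (rule monic_cancel[OF ud(1)]) (use g k' z ud(2) cmp_red[OF k'(4)] in simp_all)
      then have "T \<cdot> (i \<cdot> x \<boxplus> j \<cdot> g) = y"
        unfolding T_def using g(1-3) x(1-5) d w'(1-3) k'(1-3) pt b(2)
        unfolding z_def by (simp add: add_ac)
      then show "\<exists>h. arr C h \<and> src C h = src C x \<and> tgt C h = src C \<pi> \<and> \<pi> \<cdot> h = x \<and> T \<cdot> h = y"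
        using g(1-3) x(1-5) d pt by (intro exI[of _ "i \<cdot> x \<boxplus> j \<cdot> g"]) simp
    qed (use d t T b pt in simp_all)
  qed
  have "w \<cdot> \<pi> \<boxplus> k \<cdot> \<rho> = u \<cdot> T"
    unfolding T_def using w'(1-3) k'(1-3) d ud(2) cmp_red[OF w'(4)] cmp_red[OF k'(4)] by simp
  then show ?thesis
    using adm_inflation_cmp[OF deflation_adm[OF Td], of u] u T by (auto simp: inflation_def)
qed

end

section \<open>Resolving classes of arrows\<close>

text \<open>An arrow \<open>t\<close> into \<open>tgt C f\<close> represents an element of
  \<open>coker Hom(-,f)\<close>; this is the condition for that element to vanish.\<close>

definition factors :: "('o, 'm) precat \<Rightarrow> 'm \<Rightarrow> 'm \<Rightarrow> bool"
  where "factors C t f \<longleftrightarrow> (\<exists>r. arr C r \<and> src C r = src C t \<and> tgt C r = src C f \<and> f \<cdot>\<^bsub>C\<^esub> r = t)"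

text \<open>\<open>arrow_ses C f g h a b\<close> expresses, through presentations, that \<open>Hom(-,a)\<close> and \<open>Hom(-,b)\<close>
  induce a short exact sequence from \<open>coker Hom(-,f)\<close> over \<open>coker Hom(-,g)\<close> to
  \<open>coker Hom(-,h)\<close>.\<close>

definition arrow_ses :: "('o, 'm) precat \<Rightarrow> 'm \<Rightarrow> 'm \<Rightarrow> 'm \<Rightarrow> 'm \<Rightarrow> 'm \<Rightarrow> bool"
  where "arrow_ses C f g h a b \<longleftrightarrow> arr C f \<and> arr C g \<and> arr C h \<and> arr C a \<and> arr C b \<and>
    src C a = tgt C f \<and> tgt C a = tgt C g \<and> src C b = tgt C g \<and> tgt C b = tgt C h \<and>
    (\<forall>t. arr C t \<longrightarrow> tgt C t = tgt C f \<longrightarrow> (factors C (a \<cdot>\<^bsub>C\<^esub> t) g \<longleftrightarrow> factors C t f)) \<and>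
    (\<forall>t. arr C t \<longrightarrow> tgt C t = tgt C g \<longrightarrow> (factors C (b \<cdot>\<^bsub>C\<^esub> t) h \<longleftrightarrow>
      (\<exists>r. arr C r \<and> src C r = src C t \<and> tgt C r = tgt C f \<and>
        factors C (t \<boxplus>\<^bsub>C\<^esub> neg C (a \<cdot>\<^bsub>C\<^esub> r)) g))) \<and>
    (\<forall>t. arr C t \<longrightarrow> tgt C t = tgt C h \<longrightarrow>
      (\<exists>s. arr C s \<and> src C s = src C t \<and> tgt C s = tgt C g \<and>
        factors C (t \<boxplus>\<^bsub>C\<^esub> neg C (b \<cdot>\<^bsub>C\<^esub> s)) h))"

section \<open>Elementary short exact sequences of presented modules\<close>

context additive_category
begin

lemma add_add_neg [simp]:
  assumes "arr C f" "arr C g" "src C g = src C f" "tgt C g = tgt C f"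
  shows "f \<boxplus> (g \<boxplus> neg C f) = g"
  using assms by (simp add: add_left_comm[of f g])

lemma monic_cmp:
  assumes "monic C g" "monic C f" "tgt C f = src C g"
  shows "monic C (g \<cdot> f)"
proof -
  have a: "arr C f" "arr C g" using assms monic_arr by auto
  show ?thesis unfolding monic_def
  proof (intro conjI allI impI)
    fix t assume t: "arr C t" "tgt C t = src C (g \<cdot> f)" "(g \<cdot> f) \<cdot> t = zer C (src C t) (tgt C (g \<cdot> f))"
    have "f \<cdot> t = zer C (src C t) (tgt C f)" using monicD[OF assms(1), of "f \<cdot> t"] t a assms(3) by simp
    then show "t = zer C (src C t) (src C (g \<cdot> f))" using monicD[OF assms(2), of t] t(1,2) a assms(3) by simp
  qed (use a assms in simp)
qed

lemma monic_has_kernel: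
  assumes "monic C f"
  shows "has_kernel C f"
proof -
  obtain Z where Z: "is_zero C Z" using zero_obE .
  then have ZO: "Z \<in> Ob C" by (simp add: is_zero_def)
  have f: "arr C f" using assms by (rule monic_arr)
  have "ker_of C (zer C Z (src C f)) f" unfolding ker_of_def
  proof (intro conjI allI impI)
    show "monic C (zer C Z (src C f))" unfolding monic_def
    proof (intro conjI allI impI)
      fix t assume t: "arr C t" "tgt C t = src C (zer C Z (src C f))"
      then have "tgt C t = Z" using ZO f by simp
      then show "t = zer C (src C t) (src C (zer C Z (src C f)))"
        using tgt_zero[of t] t(1) Z ZO f by simp
    qed (use ZO f in simp)
    fix t assume t: "arr C t" "tgt C t = src C f" "f \<cdot> t = zer C (src C t) (tgt C f)"
    have "t = zer C (src C t) (src C f)" using monicD[OF assms] t by simp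
    then show "\<exists>g. arr C g \<and> src C g = src C t \<and> tgt C g = src C (zer C Z (src C f)) \<and>
        zer C Z (src C f) \<cdot> g = t"
      using ZO f t(1) by (intro exI[of _ "zer C (src C t) Z"]) simp
  qed (use ZO f in simp_all)
  then show ?thesis by (auto simp: has_kernel_def)
qed

lemma has_kernel_monic_cmp:
  assumes h: "monic C h" and g: "arr C g" "tgt C g = src C h"
  shows "ker_of C k (h \<cdot> g) \<longleftrightarrow> ker_of C k g"
proof -
  have ha: "arr C h" using h by (rule monic_arr)
  have "h \<cdot> (g \<cdot> t) = zer C (src C t) (tgt C h) \<longleftrightarrow> g \<cdot> t = zer C (src C t) (tgt C g)"
    if "arr C t" "tgt C t = src C g" for t
    using monicD[OF h, of "g \<cdot> t"] that g ha by auto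
  then show ?thesis unfolding ker_of_def using g ha monic_arr[of k] by auto
qed

text \<open>The image of \<open>Hom(-,f)\<close> in \<open>Hom(-,tgt f)\<close> is the cokernel of
  \<open>Hom(-,k)\<close>. The middle term is the representable functor itself, presented by the
  zero arrow from \<open>Z\<close>.\<close>

lemma arrow_ses_kernel:
  assumes Z: "is_zero C Z" and k: "ker_of C k f"
  shows "arrow_ses C k (zer C Z (tgt C f)) f f (Idt C (tgt C f))"
proof -
  have ZO: "Z \<in> Ob C" using Z by (simp add: is_zero_def)
  note d = ker_ofD[OF k]
  let ?z = "zer C Z (tgt C f)"
  have z: "arr C ?z" "src C ?z = Z" "tgt C ?z = tgt C f" using d ZO by simp_all
  have fz: "factors C t ?z \<longleftrightarrow> t = zer C (src C t) (tgt C f)" if "arr C t" "tgt C t = tgt C f" for t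
  proof
    assume "factors C t ?z"
    then obtain r where r: "arr C r" "src C r = src C t" "tgt C r = Z" "?z \<cdot> r = t"
      using z by (auto simp: factors_def)
    show "t = zer C (src C t) (tgt C f)" using r(4) r(1-3) z d by simp
  next
    assume t0: "t = zer C (src C t) (tgt C f)"
    show "factors C t ?z" unfolding factors_def
      by (rule exI[of _ "zer C (src C t) Z"]) (use t0 that d ZO in simp)
  qed
  show ?thesis
    unfolding arrow_ses_def
  proof (intro conjI allI impI)
    fix t assume t: "arr C t" "tgt C t = tgt C k"
    show "factors C (f \<cdot> t) ?z \<longleftrightarrow> factors C t k"
    proof
      assume "factors C (f \<cdot> t) ?z"
      then have "f \<cdot> t = zer C (src C t) (tgt C f)" using fz[of "f \<cdot> t"] t d by simp
      then show "factors C t k" using ker_lift[OF k, of t] t d unfolding factors_def by metis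
    next
      assume "factors C t k"
      then obtain r where r: "arr C r" "src C r = src C t" "tgt C r = src C k" "k \<cdot> r = t"
        by (auto simp: factors_def)
      have "f \<cdot> t = zer C (src C t) (tgt C f)" unfolding r(4)[symmetric] using r(1-3) d by simp
      then show "factors C (f \<cdot> t) ?z" using fz[of "f \<cdot> t"] t d by simp
    qed
  next
    fix t assume t: "arr C t" "tgt C t = tgt C ?z"
    show "factors C (Idt C (tgt C f) \<cdot> t) f \<longleftrightarrow> (\<exists>r. arr C r \<and> src C r = src C t \<and>
        tgt C r = tgt C k \<and> factors C (t \<boxplus> neg C (f \<cdot> r)) ?z)"
    proof
      assume "factors C (Idt C (tgt C f) \<cdot> t) f"
      then obtain r where r: "arr C r" "src C r = src C t" "tgt C r = src C f" "f \<cdot> r = t"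
        using t z by (auto simp: factors_def)
      then have "factors C (t \<boxplus> neg C (f \<cdot> r)) ?z" using fz t d z by simp
      then show "\<exists>r. arr C r \<and> src C r = src C t \<and>
        tgt C r = tgt C k \<and> factors C (t \<boxplus> neg C (f \<cdot> r)) ?z" using r d by auto
    next
      assume "\<exists>r. arr C r \<and> src C r = src C t \<and> tgt C r = tgt C k \<and>
        factors C (t \<boxplus> neg C (f \<cdot> r)) ?z"
      then obtain r where r: "arr C r" "src C r = src C t" "tgt C r = tgt C k"
        "factors C (t \<boxplus> neg C (f \<cdot> r)) ?z" by blast
      then have e: "t \<boxplus> neg C (f \<cdot> r) = zer C (src C t) (tgt C f)" using fz t d z by simp
      have "f \<cdot> r = t" by (rule eq_if_diff_zer[symmetric]) (use e t r d z in simp_all)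
      then show "factors C (Idt C (tgt C f) \<cdot> t) f" unfolding factors_def
        using r(1-3) d t z by (intro exI[of _ r]) simp
    qed
  next
    fix t assume t: "arr C t" "tgt C t = tgt C f"
    have "factors C (t \<boxplus> neg C (Idt C (tgt C f) \<cdot> t)) f" unfolding factors_def
      by (rule exI[of _ "zer C (src C t) (src C f)"]) (use t d in simp)
    then show "\<exists>s. arr C s \<and> src C s = src C t \<and> tgt C s = tgt C ?z \<and>
        factors C (t \<boxplus> neg C (Idt C (tgt C f) \<cdot> s)) f" using t z by auto
  qed (use d z in simp_all)
qed

text \<open>Multiplication by \<open>h\<close> maps \<open>coker Hom(-,g)\<close> into
  \<open>coker Hom(-,h g)\<close> with quotient \<open>coker Hom(-,h)\<close>; monicity of
  \<open>h\<close> gives injectivity.\<close>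

lemma arrow_ses_monic_cmp:
  assumes h: "monic C h" and g: "arr C g" "tgt C g = src C h"
  shows "arrow_ses C g (h \<cdot> g) h h (Idt C (tgt C h))"
proof -
  have ha: "arr C h" using h by (rule monic_arr)
  show ?thesis unfolding arrow_ses_def
  proof (intro conjI allI impI)
    fix t assume t: "arr C t" "tgt C t = tgt C g"
    show "factors C (h \<cdot> t) (h \<cdot> g) \<longleftrightarrow> factors C t g"
    proof
      assume "factors C (h \<cdot> t) (h \<cdot> g)"
      then obtain r where r: "arr C r" "src C r = src C t" "tgt C r = src C g" "h \<cdot> (g \<cdot> r) = h \<cdot> t"
        using t g ha by (auto simp: factors_def)
      have "g \<cdot> r = t" by (rule monic_cancel[OF h]) (use r t g in simp_all)
      then show "factors C t g" using r by (auto simp: factors_def)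
    qed (use t g ha in \<open>force simp: factors_def\<close>)
  next
    fix t assume t: "arr C t" "tgt C t = tgt C (h \<cdot> g)"
    show "factors C (Idt C (tgt C h) \<cdot> t) h \<longleftrightarrow> (\<exists>r. arr C r \<and> src C r = src C t \<and>
        tgt C r = tgt C g \<and> factors C (t \<boxplus> neg C (h \<cdot> r)) (h \<cdot> g))"
    proof
      assume "factors C (Idt C (tgt C h) \<cdot> t) h"
      then obtain r where r: "arr C r" "src C r = src C t" "tgt C r = src C h" "h \<cdot> r = t"
        using t g ha by (auto simp: factors_def)
      have "factors C (t \<boxplus> neg C (h \<cdot> r)) (h \<cdot> g)" unfolding factors_def
        by (rule exI[of _ "zer C (src C t) (src C g)"]) (use r t g ha in simp)
      then show "\<exists>r. arr C r \<and> src C r = src C t \<and>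
        tgt C r = tgt C g \<and> factors C (t \<boxplus> neg C (h \<cdot> r)) (h \<cdot> g)" using r g by auto
    next
      assume "\<exists>r. arr C r \<and> src C r = src C t \<and>
        tgt C r = tgt C g \<and> factors C (t \<boxplus> neg C (h \<cdot> r)) (h \<cdot> g)"
      then obtain r r' where r: "arr C r" "src C r = src C t" "tgt C r = src C h"
        "arr C r'" "src C r' = src C t" "tgt C r' = src C g"
        and e: "h \<cdot> (g \<cdot> r') = t \<boxplus> neg C (h \<cdot> r)"
        using t g ha by (auto simp: factors_def)
      have "h \<cdot> (r \<boxplus> g \<cdot> r') = t" using r t g ha e by (simp add: add_ac)
      then show "factors C (Idt C (tgt C h) \<cdot> t) h" unfolding factors_def
        by (intro exI[of _ "r \<boxplus> g \<cdot> r'"]) (use r t g ha in simp)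
    qed
  next
    fix t assume t: "arr C t" "tgt C t = tgt C h"
    have "factors C (t \<boxplus> neg C (Idt C (tgt C h) \<cdot> t)) h" unfolding factors_def
      by (rule exI[of _ "zer C (src C t) (src C h)"]) (use t ha in simp)
    then show "\<exists>s. arr C s \<and> src C s = src C t \<and> tgt C s = tgt C (h \<cdot> g) \<and>
        factors C (t \<boxplus> neg C (Idt C (tgt C h) \<cdot> s)) h" using t g ha by auto
  qed (use g ha in simp_all)
qed

end

text \<open>Two clauses are less direct translations: \<open>RM_zero\<close> says that the
  representable functors belong to the subcategory, which stands for generation, and
  \<open>RM_epic\<close> expresses the absence of modules of grade 1.\<close>

locale resolving_arrows = additive_category C for C (structure) +
  fixes M :: "'b set"
  assumes RM_arr: "f \<in> M \<Longrightarrow> arr C f"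
    and RM_kernel: "f \<in> M \<Longrightarrow> has_kernel C f"
    and RM_extension: "\<lbrakk>arrow_ses C f g h a b; f \<in> M; h \<in> M; has_kernel C g\<rbrakk> \<Longrightarrow> g \<in> M"
    and RM_deflation_kernel: "\<lbrakk>arrow_ses C f g h a b; g \<in> M; h \<in> M; has_kernel C f\<rbrakk> \<Longrightarrow> f \<in> M"
    and RM_zero: "\<lbrakk>arr C f; is_zero C (src C f)\<rbrakk> \<Longrightarrow> f \<in> M"
    and RM_epic: "\<lbrakk>f \<in> M; epic C f; ker_of C k f\<rbrakk> \<Longrightarrow> coker_of C f k"
begin

text \<open>The module presented by \<open>k\<close> is the syzygy of the one presented by
  \<open>f\<close>, the kernel of a deflation from a representable functor.\<close>

lemma kernel_mem:
  assumes f: "f \<in> M" and k: "ker_of C k f"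
  shows "k \<in> M"
proof -
  obtain Z where Z: "is_zero C Z" using zero_obE .
  then have ZO: "Z \<in> Ob C" by (simp add: is_zero_def)
  note d = ker_ofD[OF k]
  show ?thesis
    by (rule RM_deflation_kernel[OF arrow_ses_kernel[OF Z k]])
      (use f RM_zero Z ZO d monic_has_kernel[OF d(1)] in auto)
qed

text \<open>This is closure under extensions for \<open>arrow_ses_monic_cmp\<close>;
  \<open>monic_cmp_cancel\<close> applies closure under kernels of deflations to the same
  sequence.\<close>

lemma monic_cmp_mem:
  assumes "g \<in> M" "h \<in> M" "monic C h" "tgt C g = src C h"
  shows "h \<cdot> g \<in> M"
  using RM_extension[OF arrow_ses_monic_cmp[of h g]] assms RM_arr RM_kernel[of g]
  by (auto simp: has_kernel_def has_kernel_monic_cmp)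

lemma monic_cmp_cancel:
  assumes "h \<cdot> g \<in> M" "h \<in> M" "monic C h" "arr C g" "tgt C g = src C h"
  shows "g \<in> M"
  using RM_deflation_kernel[OF arrow_ses_monic_cmp[of h g]] assms RM_arr RM_kernel[of "h \<cdot> g"]
  by (auto simp: has_kernel_def has_kernel_monic_cmp)

text \<open>The column with entries \<open>i\<close> and \<open>f\<close> presents an extension of
  the module of \<open>i\<close> by the representable functor on \<open>tgt C f\<close>, which
  embeds because \<open>i\<close> is monic.\<close>

lemma column_mem:
  assumes i: "i \<in> M" "monic C i" and f: "arr C f" "src C f = src C i"
    and b: "biprod C P (tgt C i) (tgt C f) a b u v"
  shows "a \<cdot> i \<boxplus> b \<cdot> f \<in> M" "monic C (a \<cdot> i \<boxplus> b \<cdot> f)"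
proof -
  define T where "T = a \<cdot> i \<boxplus> b \<cdot> f"
  obtain Z where Z: "is_zero C Z" using zero_obE .
  then have ZO: "Z \<in> Ob C" by (simp add: is_zero_def)
  note d = biprodD[OF b] and ia = RM_arr[OF i(1)]
  have T: "arr C T" "src C T = src C i" "tgt C T = P" "u \<cdot> T = i" "v \<cdot> T = f"
    unfolding T_def using d ia f by simp_all
  have uT: "u \<cdot> (T \<cdot> x) = i \<cdot> x" "v \<cdot> (T \<cdot> x) = f \<cdot> x" if "arr C x" "tgt C x = src C i" for x
    using cmp_red[OF T(4)] cmp_red[OF T(5)] that T(1-3) d by simp_all
  have mT: "monic C T" unfolding monic_def
  proof (intro conjI allI impI)
    fix t assume t: "arr C t" "tgt C t = src C T" "T \<cdot> t = zer C (src C t) (tgt C T)"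
    then have ts: "tgt C t = src C i" using T(2) by simp
    have "u \<cdot> (T \<cdot> t) = zer C (src C t) (tgt C i)" unfolding t(3) T(3) using d t(1) by simp
    then have "i \<cdot> t = zer C (src C t) (tgt C i)" using uT(1)[OF t(1) ts] by simp
    then show "t = zer C (src C t) (src C T)" using monicD[OF i(2)] t(1) ts T(2) by simp
  qed (rule T(1))
  let ?z = "zer C Z (tgt C f)"
  have z: "arr C ?z" "src C ?z = Z" "tgt C ?z = tgt C f" using d ZO by simp_all
  have "arrow_ses C ?z T i b u" unfolding arrow_ses_def
  proof (intro conjI allI impI)
    fix t assume t: "arr C t" "tgt C t = tgt C ?z"
    then have tf: "tgt C t = tgt C f" using z by simp
    show "factors C (b \<cdot> t) T \<longleftrightarrow> factors C t ?z"
    proof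
      assume "factors C (b \<cdot> t) T"
      then obtain r where r: "arr C r" "src C r = src C t" "tgt C r = src C i" and e: "T \<cdot> r = b \<cdot> t"
        unfolding factors_def T(2) using t(1) tf d by auto
      have "i \<cdot> r = zer C (src C t) (tgt C i)"
        using arg_cong[OF e, of "\<lambda>x. u \<cdot> x"] uT(1)[OF r(1,3)] t(1) tf d by simp
      then have r0: "r = zer C (src C t) (src C i)" using monicD[OF i(2), of r] r by simp
      have "t = f \<cdot> r"
        using arg_cong[OF e, of "\<lambda>x. v \<cdot> x"] uT(2)[OF r(1,3)] t(1) tf d by simp
      then have "t = zer C (src C t) (tgt C f)" unfolding r0 using t(1) f ia by simp
      then show "factors C t ?z" unfolding factors_def
        by (intro exI[of _ "zer C (src C t) Z"]) (use t(1) ZO d z(1,2) in simp)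
    next
      assume "factors C t ?z"
      then obtain r where r: "arr C r" "src C r = src C t" "tgt C r = Z" "?z \<cdot> r = t"
        using z by (auto simp: factors_def)
      then have t0: "t = zer C (src C t) (tgt C f)" using d by simp
      have "b \<cdot> t = zer C (src C t) P" by (subst t0) (use t(1) d in simp)
      moreover have "T \<cdot> zer C (src C t) (src C i) = zer C (src C t) P"
        using t(1) T(1-3) by (subst cmp_zer) simp_all
      ultimately show "factors C (b \<cdot> t) T" unfolding factors_def T(2)
        by (intro exI[of _ "zer C (src C t) (src C i)"]) (use t(1) tf d ia in simp)
    qed
  next
    fix t assume "arr C t" "tgt C t = tgt C T"
    then have t: "arr C t" "tgt C t = P" using T by simp_all
    show "factors C (u \<cdot> t) i \<longleftrightarrow> (\<exists>r. arr C r \<and> src C r = src C t \<and>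
        tgt C r = tgt C ?z \<and> factors C (t \<boxplus> neg C (b \<cdot> r)) T)"
    proof
      assume "factors C (u \<cdot> t) i"
      then obtain r where r: "arr C r" "src C r = src C t" "tgt C r = src C i" "i \<cdot> r = u \<cdot> t"
        using t d by (auto simp: factors_def)
      let ?r = "v \<cdot> t \<boxplus> neg C (f \<cdot> r)"
      have "t \<boxplus> neg C (b \<cdot> ?r) = T \<cdot> r"
        by (rule biprod_eqI[OF b]) (use r t d f ia T(1-3) uT in \<open>simp_all add: add_ac\<close>)
      then have "factors C (t \<boxplus> neg C (b \<cdot> ?r)) T" unfolding factors_def T(2)
        by (intro exI[of _ r]) (use r t d f T(1-3) in simp)
      then show "\<exists>r. arr C r \<and> src C r = src C t \<and>
        tgt C r = tgt C ?z \<and> factors C (t \<boxplus> neg C (b \<cdot> r)) T"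
        using r t d f z by (intro exI[of _ ?r]) simp
    next
      assume "\<exists>r. arr C r \<and> src C r = src C t \<and>
        tgt C r = tgt C ?z \<and> factors C (t \<boxplus> neg C (b \<cdot> r)) T"
      then obtain r r' where r: "arr C r" "src C r = src C t" "tgt C r = tgt C f"
        "arr C r'" "src C r' = src C t" "tgt C r' = src C i" and e: "T \<cdot> r' = t \<boxplus> neg C (b \<cdot> r)"
        unfolding factors_def T(2) using t d z by auto
      have "i \<cdot> r' = u \<cdot> t"
        using arg_cong[OF e, of "\<lambda>x. u \<cdot> x"] uT(1)[OF r(4,6)] t d r(1-3) by simp
      then show "factors C (u \<cdot> t) i" using r t d by (auto simp: factors_def)
    qed
  next
    fix t assume t: "arr C t" "tgt C t = tgt C i"
    have "factors C (t \<boxplus> neg C (u \<cdot> (a \<cdot> t))) i" unfolding factors_def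
      by (rule exI[of _ "zer C (src C t) (src C i)"]) (use t d ia in simp)
    then show "\<exists>s. arr C s \<and> src C s = src C t \<and> tgt C s = tgt C T \<and>
        factors C (t \<boxplus> neg C (u \<cdot> s)) i" using t d T by (intro exI[of _ "a \<cdot> t"]) simp
  qed (use z T(1,3) d ia in simp_all)
  then have "T \<in> M"
    by (rule RM_extension) (use i RM_zero Z z monic_has_kernel[OF mT] in auto)
  with mT show "a \<cdot> i \<boxplus> b \<cdot> f \<in> M" "monic C (a \<cdot> i \<boxplus> b \<cdot> f)"
    unfolding T_def by simp_all
qed

end

locale biresolving_arrows = resolving_arrows C M + op: resolving_arrows "opp C" M
  for C (structure) and M

lemma biresolving_arrows_opp:
  "biresolving_arrows C M \<Longrightarrow> biresolving_arrows (opp C) M"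
  unfolding biresolving_arrows_def by simp

definition conflations :: "('o, 'm) precat \<Rightarrow> 'm set \<Rightarrow> ('m \<times> 'm) set"
  where "conflations C M = {(i, p). ker_of C i p \<and> coker_of C p i \<and> i \<in> M \<and> p \<in> M}"

lemma conflations_opp: "conflations (opp C) M = (conflations C M)\<inverse>"
  by (auto simp: conflations_def)

section \<open>The exact structure of a biresolving class\<close>

context biresolving_arrows
begin

text \<open>This is \<open>RM_epic\<close> in the opposite category, the absence of grade 1 on the
  transposed side.\<close>

lemma monic_ker_of:
  assumes "i \<in> M" "monic C i" "coker_of C p i"
  shows "ker_of C i p"
  using op.RM_epic[of i p] assms by simp

lemma cokernelE:
  assumes "f \<in> M"
  obtains c where "coker_of C c f" "c \<in> M"
  using op.RM_kernel[OF assms] op.kernel_mem[OF assms] by (auto simp: has_kernel_def)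

lemma inflation_iff: "inflation (conflations C M) i \<longleftrightarrow> i \<in> M \<and> monic C i"
proof
  assume "inflation (conflations C M) i"
  then show "i \<in> M \<and> monic C i"
    unfolding inflation_def conflations_def using ker_ofD(1) by auto
next
  assume i: "i \<in> M \<and> monic C i"
  then obtain c where c: "coker_of C c i" "c \<in> M" using cokernelE by blast
  then have "(i, c) \<in> conflations C M" unfolding conflations_def using monic_ker_of i by auto
  then show "inflation (conflations C M) i" by (auto simp: inflation_def)
qed

text \<open>Let \<open>m\<close> be the kernel of the cokernel \<open>c\<close> of \<open>f\<close>,
  and \<open>f = m \<cdot> g\<close>. That \<open>g\<close> is epic is seen by repeating the
  construction for \<open>g\<close>: the new kernel \<open>m'\<close> composes with \<open>m\<close>
  to a monomorphism of \<open>M\<close> with the same cokernel \<open>c\<close>, hence to another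
  kernel of \<open>c\<close>. This gives \<open>m'\<close> a right inverse and makes the cokernel
  \<open>c'\<close> of \<open>g\<close> zero.\<close>

lemma factorization:
  assumes f: "f \<in> M"
  obtains p m where "p \<in> M" "epic C p" "m \<in> M" "monic C m" "src C m = tgt C p" "f = m \<cdot> p"
proof -
  obtain c where c: "coker_of C c f" "c \<in> M" using cokernelE[OF f] .
  note cd = coker_ofD[OF c(1)]
  obtain m where m: "ker_of C m c" using RM_kernel[OF c(2)] by (auto simp: has_kernel_def)
  note md = ker_ofD[OF m]
  have mM: "m \<in> M" using kernel_mem[OF c(2) m] .
  obtain g where g: "arr C g" "src C g = src C f" "tgt C g = src C m" "m \<cdot> g = f"
    using ker_lift[OF m, of f] cd md by metis
  have gM: "g \<in> M" by (rule monic_cmp_cancel[of m]) (use g f mM md in simp_all)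
  obtain c' where c': "coker_of C c' g" "c' \<in> M" using cokernelE[OF gM] .
  note c'd = coker_ofD[OF c'(1)]
  obtain m' where m': "ker_of C m' c'" using RM_kernel[OF c'(2)] by (auto simp: has_kernel_def)
  note m'd = ker_ofD[OF m']
  have m'M: "m' \<in> M" using kernel_mem[OF c'(2) m'] .
  obtain t where t: "arr C t" "src C t = src C g" "tgt C t = src C m'" "m' \<cdot> t = g"
    using ker_lift[OF m', of g] c'd m'd by metis
  have m'm: "tgt C m' = src C m" using c'd(4) m'd(4) g(3) by simp
  have mm: "m \<cdot> m' \<in> M" by (rule monic_cmp_mem) (use mM m'M md m'm in simp_all)
  have mono: "monic C (m \<cdot> m')" unfolding monic_def
  proof (intro conjI allI impI)
    fix x assume x: "arr C x" "tgt C x = src C (m \<cdot> m')" "(m \<cdot> m') \<cdot> x = zer C (src C x) (tgt C (m \<cdot> m'))"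
    then have x2: "tgt C x = src C m'" using md m'd m'm by simp
    have "m \<cdot> (m' \<cdot> x) = zer C (src C x) (tgt C m)" using x(1,3) x2 md m'd m'm by simp
    then have "m' \<cdot> x = zer C (src C x) (tgt C m')"
      using monicD[OF md(1), of "m' \<cdot> x"] x(1) x2 m'd m'm by simp
    then show "x = zer C (src C x) (src C (m \<cdot> m'))"
      using monicD[OF m'd(1), of x] x(1) x2 md m'd m'm by simp
  qed (use md m'd m'm in simp)
  \<comment> \<open>An arrow killing \<open>m \<cdot> m'\<close> kills
    \<open>f = m \<cdot> m' \<cdot> t\<close>, so it factors through \<open>c\<close>.\<close>
  have "coker_of C c (m \<cdot> m')" unfolding ker_of_def
  proof (intro conjI allI impI)
    show "epic C c" using cd(1) .
    show "m \<cdot> m' \<cdot>\<^bsub>opp C\<^esub> c = zer (opp C) (src (opp C) c) (tgt (opp C) (m \<cdot> m'))"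
      using md m'd(2) m'm by simp
    fix h assume "arr (opp C) h" "tgt (opp C) h = src (opp C) (m \<cdot> m')"
      "m \<cdot> m' \<cdot>\<^bsub>opp C\<^esub> h = zer (opp C) (src (opp C) h) (tgt (opp C) (m \<cdot> m'))"
    then have h: "arr C h" "src C h = tgt C m" "h \<cdot> (m \<cdot> m') = zer C (src C m') (tgt C h)"
      using md(1-3) m'd(2) m'm by simp_all
    have "h \<cdot> f = (h \<cdot> (m \<cdot> m')) \<cdot> t"
      unfolding g(4)[symmetric] t(4)[symmetric] using h(1,2) md(2) m'd(2) m'm t(1-3) by simp
    then have "h \<cdot> f = zer C (src C f) (tgt C h)"
      unfolding h(3) using t h(1) m'd(2) g(2) by simp
    then obtain x where "arr C x" "src C x = tgt C c" "tgt C x = tgt C h" "x \<cdot> c = h"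
      using coker_lift[OF c(1), of h] h(1,2) cd(4) md(4) by metis
    then show "\<exists>g. arr (opp C) g \<and> src (opp C) g = src (opp C) h \<and> tgt (opp C) g = src (opp C) c \<and>
        c \<cdot>\<^bsub>opp C\<^esub> g = h" by auto
  qed (use md m'd m'm cd in simp_all)
  \<comment> \<open>Membership of \<open>m \<cdot> m'\<close> in \<open>M\<close> is used here: only
    for such monomorphisms is the cokernel known to return them as kernels. Then \<open>m\<close>,
    which is killed by \<open>c\<close>, factors through \<open>m \<cdot> m'\<close>.\<close>
  then have kc: "ker_of C (m \<cdot> m') c" using monic_ker_of mm mono by blast
  obtain w where "arr C w" "src C w = src C m" "tgt C w = src C (m \<cdot> m')" "(m \<cdot> m') \<cdot> w = m"
    using ker_lift[OF kc, of m] md by metis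
  then have w: "arr C w" "src C w = src C m" "tgt C w = src C m'" "m \<cdot> (m' \<cdot> w) = m"
    using md m'd m'm by simp_all
  have m'w: "m' \<cdot> w = Idt C (src C m)"
    by (rule monic_cancel[OF md(1)]) (use w md(2) m'd(2) m'm in simp_all)
  have c'0: "c' = zer C (src C m) (tgt C c')"
  proof -
    have "c' \<cdot> (m' \<cdot> w) = zer C (src C m) (tgt C c')" using m'd w by simp
    then show ?thesis unfolding m'w using c'd(3,4) g(3) by simp
  qed
  have "epic C g" unfolding monic_def
  proof (intro conjI allI impI)
    fix h assume "arr (opp C) h" "tgt (opp C) h = src (opp C) g"
      "g \<cdot>\<^bsub>opp C\<^esub> h = zer (opp C) (src (opp C) h) (tgt (opp C) g)"
    then have h: "arr C h" "src C h = tgt C g" "h \<cdot> g = zer C (src C g) (tgt C h)" by simp_all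
    obtain x where x: "arr C x" "src C x = tgt C c'" "tgt C x = tgt C h" "x \<cdot> c' = h"
      using coker_lift[OF c'(1), of h] h by metis
    have "x \<cdot> c' = zer C (src C m) (tgt C h)" by (subst c'0) (use x(1-3) md in simp)
    then show "h = zer (opp C) (src (opp C) h) (src (opp C) g)" using x(4) h g by simp
  qed (use g in simp)
  then show ?thesis using that[of g m] gM mM md g by simp
qed

text \<open>The pushout is the cokernel \<open>q\<close> of the column with entries \<open>i\<close>
  and \<open>-f\<close>, a monomorphism of \<open>M\<close> and thus the kernel of \<open>q\<close>.
  That \<open>i'\<close> lies in \<open>M\<close> comes from a short exact sequence linking
  \<open>i\<close>, \<open>i'\<close> and \<open>q\<close>.\<close>

lemma pushout:
  assumes i: "i \<in> M" "monic C i" and f: "arr C f" "src C f = src C i"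
  obtains i' f' where "pullback_of (opp C) f' i' i f" "i' \<in> M" "monic C i'"
proof -
  have ia: "arr C i" using RM_arr i by simp
  obtain P a b u v where bp: "biprod C P (tgt C i) (tgt C f) a b u v"
    using biprod_ex[of "tgt C i" "tgt C f"] ia f by auto
  note d = biprodD[OF bp]
  define T where "T = a \<cdot> i \<boxplus> b \<cdot> neg C f"
  have T: "arr C T" "src C T = src C i" "tgt C T = P"
    unfolding T_def using d ia f by simp_all
  have TM: "T \<in> M" "monic C T"
    using column_mem[OF i, of "neg C f" P a b u v] f bp unfolding T_def by simp_all
  obtain q where q: "coker_of C q T" "q \<in> M" using cokernelE[OF TM(1)] .
  note qd = coker_ofD[OF q(1)]
  have kT: "ker_of C T q" using monic_ker_of[OF TM q(1)] .
  have qs: "src C q = P" using qd(4) T by simp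
  define f' where "f' = q \<cdot> a"
  define i' where "i' = q \<cdot> b"
  have f': "arr C f'" "src C f' = tgt C i" "tgt C f' = tgt C q"
    and i': "arr C i'" "src C i' = tgt C f" "tgt C i' = tgt C q"
    unfolding f'_def i'_def using qd qs d by simp_all
  have sq: "f' \<cdot> i = i' \<cdot> f"
  proof (rule eq_if_diff_zer)
    have "f' \<cdot> i \<boxplus> neg C (i' \<cdot> f) = q \<cdot> T"
      unfolding f'_def i'_def T_def using qd(3) qs d ia f by simp
    then show "f' \<cdot> i \<boxplus> neg C (i' \<cdot> f) = zer C (src C (f' \<cdot> i)) (tgt C (f' \<cdot> i))"
      using qd(5) T f' ia by simp
  qed (use f' i' ia f in simp_all)
  have red: "f' \<cdot> (i \<cdot> x) = i' \<cdot> (f \<cdot> x)" if "arr C x" "tgt C x = src C i" for x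
    using cmp_red[OF sq] that f' i' ia f by simp
  \<comment> \<open>The square is Cartesian too, since the column \<open>T\<close> is a kernel of
    \<open>q\<close>.\<close>
  have key: "\<exists>s. arr C s \<and> src C s = src C x \<and> tgt C s = src C i \<and> x = i \<cdot> s \<and> y = f \<cdot> s"
    if x: "arr C x" "tgt C x = tgt C i" and y: "arr C y" "tgt C y = tgt C f" "src C y = src C x"
      and e: "f' \<cdot> x = i' \<cdot> y" for x y
  proof -
    let ?w = "a \<cdot> x \<boxplus> neg C (b \<cdot> y)"
    have w: "arr C ?w" "src C ?w = src C x" "tgt C ?w = P" using x y d by simp_all
    have "q \<cdot> ?w = f' \<cdot> x \<boxplus> neg C (i' \<cdot> y)"
      unfolding f'_def i'_def using x y d qd(3) qs by simp
    also have "\<dots> = zer C (src C x) (tgt C q)" unfolding e using y i' by simp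
    finally obtain s where s: "arr C s" "src C s = src C x" "tgt C s = src C i" "T \<cdot> s = ?w"
      using ker_lift[OF kT, of ?w] w qs T by metis
    have "i \<cdot> s = u \<cdot> (T \<cdot> s)" unfolding T_def using s(1-3) d ia f x(1) by simp
    also have "\<dots> = x" unfolding s(4) using x y d by simp
    finally have 1: "x = i \<cdot> s" by simp
    have "neg C (f \<cdot> s) = v \<cdot> (T \<cdot> s)" unfolding T_def using s(1-3) d ia f x(1) by simp
    also have "\<dots> = neg C y" unfolding s(4) using x y d by simp
    finally have "y = f \<cdot> s" using neg_neg[of y] neg_neg[of "f \<cdot> s"] y s f by (metis cmp_arr(1))
    then show ?thesis using 1 s by auto
  qed
  have mi': "monic C i'" unfolding monic_def
  proof (intro conjI allI impI)
    fix t assume t: "arr C t" "tgt C t = src C i'" "i' \<cdot> t = zer C (src C t) (tgt C i')"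
    obtain s where s: "arr C s" "src C s = src C t" "tgt C s = src C i"
      "zer C (src C t) (tgt C i) = i \<cdot> s" "t = f \<cdot> s"
      using key[of "zer C (src C t) (tgt C i)" t] t i' f' ia by auto
    have s0: "s = zer C (src C t) (src C i)" using monicD[OF i(2), of s] s(1-3) s(4)[symmetric] by simp
    have "f \<cdot> s = zer C (src C t) (src C i')" unfolding s0 using f i' t(1) ia by simp
    with s(5) show "t = zer C (src C t) (src C i')" by (rule trans)
  qed (rule i')
  \<comment> \<open>Dividing \<open>coker Hom(-,i')\<close> by the image of \<open>f'\<close> leaves
    \<open>coker Hom(-,q)\<close>, as \<open>f'\<close> and \<open>i'\<close> are the two components
    of \<open>q\<close>. Injectivity on the left is the Cartesian property
    \<open>key\<close>.\<close>
  have "arrow_ses C i i' q f' (Idt C (tgt C q))" unfolding arrow_ses_def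
  proof (intro conjI allI impI)
    fix t assume t: "arr C t" "tgt C t = tgt C i"
    show "factors C (f' \<cdot> t) i' \<longleftrightarrow> factors C t i"
    proof
      assume "factors C (f' \<cdot> t) i'"
      then obtain r where r: "arr C r" "src C r = src C t" "tgt C r = tgt C f" "i' \<cdot> r = f' \<cdot> t"
        using t f' i' by (auto simp: factors_def)
      then show "factors C t i" using key[of t r] t by (auto simp: factors_def)
    next
      assume "factors C t i"
      then obtain r where r: "arr C r" "src C r = src C t" "tgt C r = src C i" "i \<cdot> r = t"
        by (auto simp: factors_def)
      have "i' \<cdot> (f \<cdot> r) = f' \<cdot> t" using red[OF r(1,3)] r(4) by simp
      then show "factors C (f' \<cdot> t) i'" unfolding factors_def
        using r f i' f' t by (intro exI[of _ "f \<cdot> r"]) simp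
    qed
  next
    fix t assume "arr C t" "tgt C t = tgt C i'"
    then have t: "arr C t" "tgt C t = tgt C q" using i' by simp_all
    show "factors C (Idt C (tgt C q) \<cdot> t) q \<longleftrightarrow> (\<exists>r. arr C r \<and> src C r = src C t \<and>
        tgt C r = tgt C i \<and> factors C (t \<boxplus> neg C (f' \<cdot> r)) i')"
    proof
      assume "factors C (Idt C (tgt C q) \<cdot> t) q"
      then obtain r where r: "arr C r" "src C r = src C t" "tgt C r = P" "q \<cdot> r = t"
        using t qs by (auto simp: factors_def)
      have "t = q \<cdot> (a \<cdot> (u \<cdot> r) \<boxplus> b \<cdot> (v \<cdot> r))"
        using biprod_expand(1)[OF bp r(1,3)] r(4) by simp
      then have "t = f' \<cdot> (u \<cdot> r) \<boxplus> i' \<cdot> (v \<cdot> r)"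
        unfolding f'_def i'_def using r(1-3) d qd(3) qs by simp
      then have "t \<boxplus> neg C (f' \<cdot> (u \<cdot> r)) = i' \<cdot> (v \<cdot> r)"
        using r(1-3) d f' i' by (simp add: add_ac)
      then have "factors C (t \<boxplus> neg C (f' \<cdot> (u \<cdot> r))) i'" unfolding factors_def
        using r d f' i' t by (intro exI[of _ "v \<cdot> r"]) simp
      then show "\<exists>r. arr C r \<and> src C r = src C t \<and>
        tgt C r = tgt C i \<and> factors C (t \<boxplus> neg C (f' \<cdot> r)) i'"
        using r d by (intro exI[of _ "u \<cdot> r"]) simp
    next
      assume "\<exists>r. arr C r \<and> src C r = src C t \<and>
        tgt C r = tgt C i \<and> factors C (t \<boxplus> neg C (f' \<cdot> r)) i'"
      then obtain r r' where r: "arr C r" "src C r = src C t" "tgt C r = tgt C i"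
        "arr C r'" "src C r' = src C t" "tgt C r' = tgt C f" and e: "i' \<cdot> r' = t \<boxplus> neg C (f' \<cdot> r)"
        using t f' i' by (auto simp: factors_def)
      have "q \<cdot> (a \<cdot> r \<boxplus> b \<cdot> r') = f' \<cdot> r \<boxplus> i' \<cdot> r'"
        unfolding f'_def i'_def using r d qd(3) qs by simp
      also have "\<dots> = t" unfolding e using r t f' by (simp add: add_ac)
      finally show "factors C (Idt C (tgt C q) \<cdot> t) q" unfolding factors_def
        using r t d qs by (intro exI[of _ "a \<cdot> r \<boxplus> b \<cdot> r'"]) simp
    qed
  next
    fix t assume t: "arr C t" "tgt C t = tgt C q"
    have "factors C (t \<boxplus> neg C (Idt C (tgt C q) \<cdot> t)) q" unfolding factors_def
      by (rule exI[of _ "zer C (src C t) P"]) (use t qd(3) qs d in simp)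
    then show "\<exists>s. arr C s \<and> src C s = src C t \<and> tgt C s = tgt C i' \<and>
        factors C (t \<boxplus> neg C (Idt C (tgt C q) \<cdot> s)) q" using t i' by auto
  qed (use ia i' f' qd in simp_all)
  then have i'M: "i' \<in> M"
    by (rule RM_extension) (use i q monic_has_kernel[OF mi'] in auto)
  have "pullback_of (opp C) f' i' i f" unfolding pullback_of_def
  proof (intro conjI allI impI)
    fix t assume "arr (opp C) t" "tgt (opp C) t = src (opp C) f'"
      "f' \<cdot>\<^bsub>opp C\<^esub> t = zer (opp C) (src (opp C) t) (tgt (opp C) f')"
      "i' \<cdot>\<^bsub>opp C\<^esub> t = zer (opp C) (src (opp C) t) (tgt (opp C) i')"
    then have t: "arr C t" "src C t = tgt C q" "t \<cdot> f' = zer C (tgt C i) (tgt C t)"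
      "t \<cdot> i' = zer C (tgt C f) (tgt C t)" using f' i' by simp_all
    have "t \<cdot> q = zer C P (tgt C t)"
      by (rule biprod_eqI'[OF bp]) (use t d qd(3) qs in \<open>simp_all add: f'_def i'_def\<close>)
    then have "t = zer C (tgt C q) (tgt C t)" using epicD[OF qd(1), of t] t qs by simp
    then show "t = zer (opp C) (src (opp C) t) (src (opp C) f')" using t f' by simp
  next
    fix x y assume "arr (opp C) x" "arr (opp C) y" "src (opp C) y = src (opp C) x"
      "tgt (opp C) x = src (opp C) i" "tgt (opp C) y = src (opp C) f"
      "i \<cdot>\<^bsub>opp C\<^esub> x = f \<cdot>\<^bsub>opp C\<^esub> y"
    then have x: "arr C x" "arr C y" "tgt C y = tgt C x" "src C x = tgt C i" "src C y = tgt C f"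
      "x \<cdot> i = y \<cdot> f" by simp_all
    let ?w = "x \<cdot> u \<boxplus> y \<cdot> v"
    have w: "arr C ?w" "src C ?w = P" "tgt C ?w = tgt C x" using x d by simp_all
    have "?w \<cdot> T = x \<cdot> i \<boxplus> neg C (y \<cdot> f)"
      unfolding T_def using x(1-5) d ia f by simp
    also have "\<dots> = zer C (src C T) (tgt C ?w)" unfolding x(6) using x(1-5) f T w by simp
    finally obtain h where h: "arr C h" "src C h = tgt C q" "tgt C h = tgt C x" "h \<cdot> q = ?w"
      using coker_lift[OF q(1), of ?w] w T by metis
    have "h \<cdot> f' = (h \<cdot> q) \<cdot> a" unfolding f'_def using h(1-3) d qd(3) qs by simp
    also have "\<dots> = x" unfolding h(4) using x(1-5) d by simp
    finally have 1: "h \<cdot> f' = x" .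
    have "h \<cdot> i' = (h \<cdot> q) \<cdot> b" unfolding i'_def using h(1-3) d qd(3) qs by simp
    also have "\<dots> = y" unfolding h(4) using x(1-5) d by simp
    finally have 2: "h \<cdot> i' = y" .
    show "\<exists>h. arr (opp C) h \<and> src (opp C) h = src (opp C) x \<and> tgt (opp C) h = src (opp C) f' \<and>
        f' \<cdot>\<^bsub>opp C\<^esub> h = x \<and> i' \<cdot>\<^bsub>opp C\<^esub> h = y"
      by (rule exI[of _ h]) (use 1 2 h f' in simp)
  qed (use f' i' ia f sq in simp_all)
  then show ?thesis using that i'M mi' by blast
qed

lemma deflation_iff: "deflation (conflations C M) p \<longleftrightarrow> p \<in> M \<and> epic C p"
proof -
  interpret opb: biresolving_arrows "opp C" M
    by (rule biresolving_arrows_opp) unfold_locales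
  show ?thesis using opb.inflation_iff[of p] by (simp add: conflations_opp)
qed

text \<open>An isomorphism is a cokernel of the zero arrow from a zero object. That arrow lies in
  \<open>M\<close>, and \<open>M\<close> contains the cokernels of its members by
  \<open>op.kernel_mem\<close>.\<close>

lemma iso_mem:
  assumes "iso_arr C f"
  shows "f \<in> M"
proof -
  obtain g where g: "arr C g" "src C g = tgt C f" "tgt C g = src C f"
    "g \<cdot> f = Idt C (src C f)" "f \<cdot> g = Idt C (tgt C f)" "iso_arr C g" "arr C f"
    using iso_arrE[OF assms] .
  obtain Z where Z: "is_zero C Z" using zero_obE .
  then have ZO: "Z \<in> Ob C" by (simp add: is_zero_def)
  have "coker_of C f (zer C Z (src C f))" unfolding ker_of_def
  proof (intro conjI allI impI)
    show "epic C f" using op.iso_monic[of f] assms by simp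
    fix t assume "arr (opp C) t" "tgt (opp C) t = src (opp C) (zer C Z (src C f))"
    then have t: "arr C t" "src C t = src C f" using g ZO by simp_all
    have "(t \<cdot> g) \<cdot> f = t" using t g by simp
    then show "\<exists>g. arr (opp C) g \<and> src (opp C) g = src (opp C) t \<and>
        tgt (opp C) g = src (opp C) f \<and> f \<cdot>\<^bsub>opp C\<^esub> g = t"
      by (intro exI[of _ "t \<cdot> g"]) (use t g in simp)
  qed (use g ZO in simp_all)
  then show ?thesis
    using op.kernel_mem[of "zer C Z (src C f)" f] RM_zero[of "zer C Z (src C f)"] g Z ZO by simp
qed

text \<open>Composition and pushout are settled for the monic members of \<open>M\<close>. The
  axioms on deflations are the same statements in \<open>opp C\<close>, where the class is again
  \<open>M\<close> and its conflations are reversed.\<close>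

lemma exact_conflations: "exact_structure C (conflations C M)"
proof -
  interpret opb: biresolving_arrows "opp C" M
    by (rule biresolving_arrows_opp) unfold_locales
  let ?S = "conflations C M"
  show ?thesis
  proof (rule exact_structure.intro)
    fix i p assume "(i, p) \<in> ?S"
    then have k: "ker_of C i p" "coker_of C p i" by (auto simp: conflations_def)
    note d = ker_ofD[OF k(1)]
    show "\<exists>A\<in>Ob C. \<exists>B\<in>Ob C. \<exists>D\<in>Ob C. kernel_cokernel_pair C A B D i p"
      unfolding kernel_cokernel_pair_def
      by (rule bexI[of _ "src C i"], rule bexI[of _ "tgt C i"], rule bexI[of _ "tgt C p"])
        (use k d is_kernel_iff op.is_kernel_iff in auto)
  next
    fix i p A B D A' B' D' i' p' a b d
    assume S: "(i, p) \<in> ?S" and O: "A \<in> Ob C" "B \<in> Ob C" "D \<in> Ob C" "A' \<in> Ob C" "B' \<in> Ob C" "D' \<in> Ob C"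
      and "i \<in> mor C A B" "p \<in> mor C B D" "i' \<in> mor C A' B'" "p' \<in> mor C B' D'"
        "is_iso C A A' a" "is_iso C B B' b" "is_iso C D D' d"
      and e: "b \<cdot> i = i' \<cdot> a" "d \<cdot> p = p' \<cdot> b"
    then have t: "arr C i" "src C i = A" "tgt C i = B" "arr C p" "src C p = B" "tgt C p = D"
      "arr C i'" "src C i' = A'" "tgt C i' = B'" "arr C p'" "src C p' = B'" "tgt C p' = D'"
      "iso_arr C a" "src C a = A" "tgt C a = A'" "iso_arr C b" "src C b = B" "tgt C b = B'"
      "iso_arr C d" "src C d = D" "tgt C d = D'"
      using is_iso_iff by auto
    have k: "ker_of C i p" "coker_of C p i" and M: "i \<in> M" "p \<in> M"
      using S by (auto simp: conflations_def)
    obtain a' where a': "arr C a'" "src C a' = A'" "tgt C a' = A"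
      "a \<cdot> a' = Idt C A'" "iso_arr C a'" "arr C a" using iso_arrE[OF t(13)] t by metis
    obtain b' where b': "arr C b'" "src C b' = B'" "tgt C b' = B"
      "b \<cdot> b' = Idt C B'" "iso_arr C b'" "arr C b" using iso_arrE[OF t(16)] t by metis
    have da: "arr C d" using t(19) by (simp add: iso_arr_def)
    have "(d \<cdot> p) \<cdot> b' = p'" unfolding e(2) using b' t by simp
    then have p'e: "p' = (d \<cdot> p) \<cdot> b'" ..
    \<comment> \<open>Isomorphisms are monic and epic members of \<open>M\<close>, so
      \<open>p' = d \<cdot> p \<cdot> b'\<close> is reached by one composition in each of the two
      categories.\<close>
    have "d \<cdot> p \<in> M"
      by (rule monic_cmp_mem) (use M iso_mem t iso_monic in simp_all)
    then have "(d \<cdot> p) \<cdot> b' \<in> M"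
      using op.monic_cmp_mem[of "d \<cdot> p" b'] iso_mem[OF b'(5)] op.iso_monic[of b'] b' t da by simp
    then have p'M: "p' \<in> M" unfolding p'e .
    have ep: "epic C p'" unfolding monic_def
    proof (intro conjI allI impI)
      fix h assume "arr (opp C) h" "tgt (opp C) h = src (opp C) p'"
        "p' \<cdot>\<^bsub>opp C\<^esub> h = zer (opp C) (src (opp C) h) (tgt (opp C) p')"
      then have h: "arr C h" "src C h = D'" "h \<cdot> p' = zer C B' (tgt C h)" using t by simp_all
      have "(h \<cdot> d) \<cdot> p = (h \<cdot> p') \<cdot> b" using h(1,2) t da b' e(2) by simp
      then have "(h \<cdot> d) \<cdot> p = zer C B (tgt C h)" unfolding h(3) using h(1) t b' by simp
      then have "h \<cdot> d = zer C D (tgt C h)"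
        using epicD[OF coker_ofD(1)[OF k(2)], of "h \<cdot> d"] h(1,2) t da by simp
      then show "h = zer (opp C) (src (opp C) h) (src (opp C) p')"
        using epicD[of d h] op.iso_monic[of d] h t da by simp
    qed (use t in simp)
    have ki: "ker_of C i' p'" unfolding ker_of_def
    proof (intro conjI allI impI)
      have i'e: "i' = b \<cdot> (i \<cdot> a')"
      proof -
        have "i' = (i' \<cdot> a) \<cdot> a'" using t a' by simp
        then show ?thesis unfolding e(1)[symmetric] using t a' b' by simp
      qed
      show "monic C i'" unfolding monic_def
      proof (intro conjI allI impI)
        fix x assume x: "arr C x" "tgt C x = src C i'" "i' \<cdot> x = zer C (src C x) (tgt C i')"
        have "b \<cdot> (i \<cdot> (a' \<cdot> x)) = zer C (src C x) B'"
          using x(1,2) x(3)[unfolded i'e] t a' b' by simp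
        then have "i \<cdot> (a' \<cdot> x) = zer C (src C x) B"
          using monicD[OF iso_monic[OF t(16)], of "i \<cdot> (a' \<cdot> x)"] x(1,2) t a' by simp
        then have "a' \<cdot> x = zer C (src C x) A"
          using monicD[OF ker_ofD(1)[OF k(1)], of "a' \<cdot> x"] x(1,2) t a' by simp
        then show "x = zer C (src C x) (src C i')"
          using monicD[OF iso_monic[OF a'(5)], of x] x(1,2) t a' by simp
      qed (use t in simp)
      have "p' \<cdot> i' = (p' \<cdot> b) \<cdot> (i \<cdot> a')" using i'e t a' b' by simp
      also have "\<dots> = zer C A' D'"
        unfolding e(2)[symmetric] using t a' da ker_ofD(6)[OF k(1)] O by simp
      finally show "p' \<cdot> i' = zer C (src C i') (tgt C p')" using t by simp
      fix x assume x: "arr C x" "tgt C x = src C p'" "p' \<cdot> x = zer C (src C x) (tgt C p')"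
      have "d \<cdot> (p \<cdot> (b' \<cdot> x)) = zer C (src C x) D'"
        using x(1,2) x(3)[unfolded p'e] t b' da by simp
      then have "p \<cdot> (b' \<cdot> x) = zer C (src C (b' \<cdot> x)) (tgt C p)"
        using monicD[OF iso_monic[OF t(19)], of "p \<cdot> (b' \<cdot> x)"] x(1,2) t b' by simp
      then obtain g where g: "arr C g" "src C g = src C (b' \<cdot> x)" "tgt C g = src C i" "i \<cdot> g = b' \<cdot> x"
        using ker_lift[OF k(1), of "b' \<cdot> x"] x(1,2) t b' by (metis cmp_arr(1,3))
      have "i' \<cdot> (a \<cdot> g) = b \<cdot> (i \<cdot> g)" using cmp_red[OF e(1)] cmp_red[of i' a] g(1-3) t a' b' x(1,2) e(1)
        by (metis cmp_assoc)
      also have "\<dots> = x" unfolding g(4) using x(1,2) t b' cmp_red[OF b'(4)] by simp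
      finally show "\<exists>g. arr C g \<and> src C g = src C x \<and> tgt C g = src C i' \<and> i' \<cdot> g = x"
        using g(1-3) t a' b' x(1,2) by (intro exI[of _ "a \<cdot> g"]) simp
    qed (use t in simp_all)
    show "(i', p') \<in> ?S"
      unfolding conflations_def using ki RM_epic[OF p'M ep ki] kernel_mem[OF p'M ki] p'M by simp
  next
    fix A assume "A \<in> Ob C"
    then show "inflation ?S (Idt C A)" "deflation ?S (Idt C A)"
      unfolding inflation_iff deflation_iff
      using iso_mem[OF iso_Idt] iso_monic[OF iso_Idt] op.iso_monic[OF op.iso_Idt] by simp_all
  next
    fix A B D i j assume "A \<in> Ob C" "B \<in> Ob C" "D \<in> Ob C" "i \<in> mor C A B" "j \<in> mor C B D"
      "inflation ?S i" "inflation ?S j"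
    then show "inflation ?S (j \<cdot> i)"
      unfolding inflation_iff using monic_cmp_mem[of i j] monic_cmp[of j i] by simp
  next
    fix A B D i j assume "A \<in> Ob C" "B \<in> Ob C" "D \<in> Ob C" "i \<in> mor C A B" "j \<in> mor C B D"
      "deflation ?S i" "deflation ?S j"
    then show "deflation ?S (j \<cdot> i)"
      unfolding deflation_iff using op.monic_cmp_mem[of j i] op.monic_cmp[of i j] by simp
  next
    fix A B A' i f assume O: "A \<in> Ob C" "B \<in> Ob C" "A' \<in> Ob C" and "i \<in> mor C A B" "f \<in> mor C A A'"
      "inflation ?S i"
    then have t: "arr C i" "src C i = A" "tgt C i = B" "arr C f" "src C f = A" "tgt C f = A'"
      "i \<in> M" "monic C i" by (simp_all add: inflation_iff)
    obtain i' f' where p: "pullback_of (opp C) f' i' i f" "i' \<in> M" "monic C i'"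
      using pushout[of i f] t by metis
    note d = op.pullback_ofD[OF p(1)]
    show "\<exists>B'\<in>Ob C. \<exists>i'\<in>mor C A' B'. \<exists>f'\<in>mor C B B'.
            is_pullback (opp C) B' B A' A f' i' i f \<and> inflation ?S i'"
      by (rule bexI[of _ "tgt C i'"], rule bexI[of _ i'], rule bexI[of _ f'])
        (use p d t O op.is_pullback_iff in \<open>auto simp: inflation_iff\<close>)
  next
    fix A B A' i f assume O: "A \<in> Ob C" "B \<in> Ob C" "A' \<in> Ob C" and "i \<in> mor C A B" "f \<in> mor C A' B"
      "deflation ?S i"
    then have t: "arr C i" "src C i = A" "tgt C i = B" "arr C f" "src C f = A'" "tgt C f = B"
      "i \<in> M" "epic C i" by (simp_all add: deflation_iff)
    obtain i' f' where p: "pullback_of C f' i' i f" "i' \<in> M" "epic C i'"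
      using opb.pushout[of i f] t by (metis opp_simps(5) tgt_opp src_opp arr_opp)
    note d = pullback_ofD[OF p(1)]
    show "\<exists>B'\<in>Ob C. \<exists>i'\<in>mor C B' A'. \<exists>f'\<in>mor C B' A.
            is_pullback C B' A A' B f' i' i f \<and> deflation ?S i'"
      by (rule bexI[of _ "src C i'"], rule bexI[of _ i'], rule bexI[of _ f'])
        (use p d t O is_pullback_iff in \<open>auto simp: deflation_iff\<close>)
  qed
qed

text \<open>Factorization gives one direction and composition with a monic member the other; thus
  \<open>M\<close>, and with it the subcategory, is recovered from the exact structure.\<close>

lemma mem_iff_adm: "f \<in> M \<longleftrightarrow> adm C (conflations C M) f"
proof
  assume "f \<in> M"
  then show "adm C (conflations C M) f"
    using factorization[of f] unfolding adm_def deflation_iff inflation_iff by metis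
next
  assume "adm C (conflations C M) f"
  then show "f \<in> M"
    unfolding adm_def deflation_iff inflation_iff using monic_cmp_mem by metis
qed

end

section \<open>Modules and presentations\<close>

abbreviation el :: "('o, 'm, 'u) cfunctor \<Rightarrow> 'o \<Rightarrow> 'u set"
  where "el F A \<equiv> carrier (FOb F A)"

lemma Yon_simps [simp]: "FOb (Yon C X) A = Hom C A X" "FMap (Yon C X) f g = g \<cdot>\<^bsub>C\<^esub> f"
  by (simp_all add: Yon_def)

text \<open>By Yoneda, an exact sequence \<open>Hom(-,X) \<rightarrow> Hom(-,Y) \<rightarrow> F \<rightarrow> 0\<close> is an element \<open>x\<close> of \<open>F(Y)\<close>.\<close>

definition pres :: "('o, 'm) precat \<Rightarrow> 'm \<Rightarrow> ('o, 'm, 'u) cfunctor \<Rightarrow> 'u \<Rightarrow> bool"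
  where "pres C f F x \<longleftrightarrow> F \<in> Modules C \<and> arr C f \<and> x \<in> el F (tgt C f) \<and>
    (\<forall>A\<in>Ob C. \<forall>y\<in>el F A. \<exists>g. arr C g \<and> src C g = A \<and> tgt C g = tgt C f \<and> FMap F g x = y) \<and>
    (\<forall>g. arr C g \<longrightarrow> tgt C g = tgt C f \<longrightarrow>
      (FMap F g x = \<one>\<^bsub>FOb F (src C g)\<^esub> \<longleftrightarrow> factors C g f))"

section \<open>Modules, Yoneda and presentations by an element\<close>

context additive_category
begin

lemma mod_comm_group: "\<lbrakk>F \<in> Modules C; A \<in> Ob C\<rbrakk> \<Longrightarrow> comm_group (FOb F A)"
  by (simp add: Modules_def)

lemma mod_group: "\<lbrakk>F \<in> Modules C; A \<in> Ob C\<rbrakk> \<Longrightarrow> group (FOb F A)"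
  using mod_comm_group comm_group.axioms by blast

lemma mod_monoid: "\<lbrakk>F \<in> Modules C; A \<in> Ob C\<rbrakk> \<Longrightarrow> monoid (FOb F A)"
  using mod_group group.is_monoid by blast

lemma act_hom: "\<lbrakk>F \<in> Modules C; arr C f\<rbrakk> \<Longrightarrow> FMap F f \<in> hom (FOb F (tgt C f)) (FOb F (src C f))"
  by (simp add: Modules_def)

lemma act_closed [simp]: "\<lbrakk>F \<in> Modules C; arr C f; x \<in> el F (tgt C f); src C f = A\<rbrakk> \<Longrightarrow> FMap F f x \<in> el F A"
  using act_hom[of F f] by (auto simp: hom_def)

lemma act_mult: "\<lbrakk>F \<in> Modules C; arr C f; x \<in> el F (tgt C f); y \<in> el F (tgt C f)\<rbrakk>
    \<Longrightarrow> FMap F f (x \<otimes>\<^bsub>FOb F (tgt C f)\<^esub> y) = FMap F f x \<otimes>\<^bsub>FOb F (src C f)\<^esub> FMap F f y"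
  using act_hom[of F f] by (auto simp: hom_def)

lemma act_one: "\<lbrakk>F \<in> Modules C; arr C f\<rbrakk> \<Longrightarrow> FMap F f \<one>\<^bsub>FOb F (tgt C f)\<^esub> = \<one>\<^bsub>FOb F (src C f)\<^esub>"
  using hom_one[OF act_hom[of F f]] mod_group[of F] by simp

lemma act_Idt [simp]: "\<lbrakk>F \<in> Modules C; A \<in> Ob C; x \<in> el F A\<rbrakk> \<Longrightarrow> FMap F (Idt C A) x = x"
  by (simp add: Modules_def)

lemma act_cmp [simp]: "\<lbrakk>F \<in> Modules C; arr C f; arr C g; tgt C f = src C g; x \<in> el F (tgt C g)\<rbrakk>
    \<Longrightarrow> FMap F (g \<cdot> f) x = FMap F f (FMap F g x)"
proof -
  assume a: "F \<in> Modules C" "arr C f" "arr C g" "tgt C f = src C g" "x \<in> el F (tgt C g)"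
  have "\<forall>A\<in>Ob C. \<forall>B\<in>Ob C. \<forall>D\<in>Ob C. \<forall>f\<in>mor C A B. \<forall>g\<in>mor C B D. \<forall>x\<in>carrier (FOb F D).
      FMap F (g \<cdot> f) x = FMap F f (FMap F g x)" using a(1) unfolding Modules_def by blast
  from this[rule_format, of "src C f" "tgt C f" "tgt C g" f g x] a show ?thesis by simp
qed

lemma act_add: "\<lbrakk>F \<in> Modules C; arr C f; arr C g; src C g = src C f; tgt C g = tgt C f; x \<in> el F (tgt C f)\<rbrakk>
    \<Longrightarrow> FMap F (f \<boxplus> g) x = FMap F f x \<otimes>\<^bsub>FOb F (src C f)\<^esub> FMap F g x"
proof -
  assume a: "F \<in> Modules C" "arr C f" "arr C g" "src C g = src C f" "tgt C g = tgt C f" "x \<in> el F (tgt C f)"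
  have "\<forall>A\<in>Ob C. \<forall>B\<in>Ob C. \<forall>f\<in>mor C A B. \<forall>g\<in>mor C A B. \<forall>x\<in>carrier (FOb F B).
      FMap F (f \<otimes>\<^bsub>Hom C A B\<^esub> g) x = FMap F f x \<otimes>\<^bsub>FOb F A\<^esub> FMap F g x"
    using a(1) unfolding Modules_def by blast
  from this[rule_format, of "src C f" "tgt C f" f g x] a show ?thesis by (simp add: add_def)
qed

lemma act_zer [simp]:
  assumes "F \<in> Modules C" "A \<in> Ob C" "B \<in> Ob C" "x \<in> el F B"
  shows "FMap F (zer C A B) x = \<one>\<^bsub>FOb F A\<^esub>"
proof -
  interpret G: comm_group "FOb F A" by (rule mod_comm_group) (use assms in simp_all)
  have "FMap F (zer C A B \<boxplus> zer C A B) x = FMap F (zer C A B) x \<otimes>\<^bsub>FOb F A\<^esub> FMap F (zer C A B) x"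
    using act_add[of F "zer C A B" "zer C A B" x] assms by simp
  then show ?thesis using assms by (simp add: G.l_cancel_one')
qed

lemma act_neg [simp]:
  assumes "F \<in> Modules C" "arr C f" "x \<in> el F (tgt C f)"
  shows "FMap F (neg C f) x = inv\<^bsub>FOb F (src C f)\<^esub> (FMap F f x)"
proof -
  interpret G: comm_group "FOb F (src C f)" by (rule mod_comm_group) (use assms in simp_all)
  have "FMap F (neg C f \<boxplus> f) x = FMap F (neg C f) x \<otimes>\<^bsub>FOb F (src C f)\<^esub> FMap F f x"
    using act_add[of F "neg C f" f x] assms by simp
  then have "FMap F (neg C f) x \<otimes>\<^bsub>FOb F (src C f)\<^esub> FMap F f x = \<one>\<^bsub>FOb F (src C f)\<^esub>"
    using assms by simp
  then show ?thesis using assms by (intro G.inv_equality[symmetric]) simp_all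
qed

lemma nt_closed: "\<lbrakk>nat_trans C F G \<eta>; A \<in> Ob C; x \<in> el F A\<rbrakk> \<Longrightarrow> \<eta> A x \<in> el G A"
  by (auto simp: nat_trans_def hom_def)

lemma nt_mult: "\<lbrakk>nat_trans C F G \<eta>; A \<in> Ob C; x \<in> el F A; y \<in> el F A\<rbrakk>
    \<Longrightarrow> \<eta> A (x \<otimes>\<^bsub>FOb F A\<^esub> y) = \<eta> A x \<otimes>\<^bsub>FOb G A\<^esub> \<eta> A y"
  by (auto simp: nat_trans_def hom_def)

lemma nt_natural: "\<lbrakk>nat_trans C F G \<eta>; arr C f; x \<in> el F (tgt C f)\<rbrakk>
    \<Longrightarrow> \<eta> (src C f) (FMap F f x) = FMap G f (\<eta> (tgt C f) x)"
  by (simp add: nat_trans_def)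

lemma nt_one: "\<lbrakk>nat_trans C F G \<eta>; F \<in> Modules C; G \<in> Modules C; A \<in> Ob C\<rbrakk>
    \<Longrightarrow> \<eta> A \<one>\<^bsub>FOb F A\<^esub> = \<one>\<^bsub>FOb G A\<^esub>"
  using hom_one[of "\<eta> A" "FOb F A" "FOb G A"] mod_group[of F A] mod_group[of G A]
  by (simp add: nat_trans_def)

lemma nt_inv: "\<lbrakk>nat_trans C F G \<eta>; F \<in> Modules C; G \<in> Modules C; A \<in> Ob C; x \<in> el F A\<rbrakk>
    \<Longrightarrow> \<eta> A (inv\<^bsub>FOb F A\<^esub> x) = inv\<^bsub>FOb G A\<^esub> (\<eta> A x)"
  using group_hom.hom_inv[of "FOb F A" "FOb G A" "\<eta> A" x] mod_group[of F A] mod_group[of G A]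
  by (simp add: nat_trans_def group_hom_def group_hom_axioms_def)

lemma nt_monoI:
  assumes "nat_trans C F G \<eta>" "F \<in> Modules C" "G \<in> Modules C"
    "\<And>A x. \<lbrakk>A \<in> Ob C; x \<in> el F A; \<eta> A x = \<one>\<^bsub>FOb G A\<^esub>\<rbrakk> \<Longrightarrow> x = \<one>\<^bsub>FOb F A\<^esub>"
  shows "nt_mono C F \<eta>"
  unfolding nt_mono_def
proof (intro ballI inj_onI)
  fix A x y assume A: "A \<in> Ob C" "x \<in> el F A" "y \<in> el F A" "\<eta> A x = \<eta> A y"
  interpret F: comm_group "FOb F A" by (rule mod_comm_group) (use assms A in simp_all)
  interpret G: comm_group "FOb G A" by (rule mod_comm_group) (use assms A in simp_all)
  have "\<eta> A (x \<otimes>\<^bsub>FOb F A\<^esub> inv\<^bsub>FOb F A\<^esub> y) = \<one>\<^bsub>FOb G A\<^esub>"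
    using nt_mult[OF assms(1) A(1,2), of "inv\<^bsub>FOb F A\<^esub> y"] nt_inv[OF assms(1-3) A(1,3)]
      nt_closed[OF assms(1) A(1,3)] A by simp
  then have "x \<otimes>\<^bsub>FOb F A\<^esub> inv\<^bsub>FOb F A\<^esub> y = \<one>\<^bsub>FOb F A\<^esub>" using assms(4) A by simp
  then show "x = y" using A by (metis F.inv_closed F.inv_equality F.inv_inv)
qed

lemma nt_monoD:
  assumes "nt_mono C F \<eta>" "nat_trans C F G \<eta>" "F \<in> Modules C" "G \<in> Modules C"
    "A \<in> Ob C" "x \<in> el F A" "\<eta> A x = \<one>\<^bsub>FOb G A\<^esub>"
  shows "x = \<one>\<^bsub>FOb F A\<^esub>"
  using assms nt_one[OF assms(2-5)] monoid.one_closed[OF mod_monoid[of F A]]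
  unfolding nt_mono_def inj_on_def by metis

lemma Yon_Modules: "X \<in> Ob C \<Longrightarrow> Yon C X \<in> Modules C"
  unfolding Modules_def
  by (auto simp: Hom_comm_group hom_def simp flip: add_mor)

lemma presD:
  assumes "pres C f F x"
  shows "F \<in> Modules C" "arr C f" "x \<in> el F (tgt C f)"
    "\<And>A y. \<lbrakk>A \<in> Ob C; y \<in> el F A\<rbrakk> \<Longrightarrow>
      \<exists>g. arr C g \<and> src C g = A \<and> tgt C g = tgt C f \<and> FMap F g x = y"
    "\<And>g. \<lbrakk>arr C g; tgt C g = tgt C f\<rbrakk> \<Longrightarrow>
      FMap F g x = \<one>\<^bsub>FOb F (src C g)\<^esub> \<longleftrightarrow> factors C g f"
  using assms unfolding pres_def by blast+

lemma factors_refl: "arr C f \<Longrightarrow> factors C f f"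
  unfolding factors_def by (rule exI[of _ "Idt C (src C f)"]) simp

lemma pres_rel: "pres C f F x \<Longrightarrow> FMap F f x = \<one>\<^bsub>FOb F (src C f)\<^esub>"
  using presD(5)[of f F x f] presD(2)[of f F x] factors_refl by simp

lemma pres_eq:
  assumes "pres C f F x" "arr C g" "arr C g'" "src C g' = src C g" "tgt C g = tgt C f" "tgt C g' = tgt C f"
  shows "FMap F g x = FMap F g' x \<longleftrightarrow> factors C (g \<boxplus> neg C g') f"
proof -
  note p = presD[OF assms(1)]
  interpret G: comm_group "FOb F (src C g)" by (rule mod_comm_group) (use p(1) assms in simp_all)
  have "FMap F (g \<boxplus> neg C g') x = FMap F g x \<otimes>\<^bsub>FOb F (src C g)\<^esub> inv\<^bsub>FOb F (src C g)\<^esub> (FMap F g' x)"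
    using act_add[OF p(1), of g "neg C g'" x] assms p by simp
  moreover have "FMap F g x \<in> el F (src C g)" "FMap F g' x \<in> el F (src C g)" using p assms by simp_all
  ultimately have "FMap F g x = FMap F g' x \<longleftrightarrow> FMap F (g \<boxplus> neg C g') x = \<one>\<^bsub>FOb F (src C g)\<^esub>"
    by (metis G.inv_closed G.inv_equality G.inv_inv G.r_inv)
  then show ?thesis using p(5)[of "g \<boxplus> neg C g'"] assms by simp
qed

lemma nat_trans_from_Yon:
  assumes "nat_trans C (Yon C Y) F \<pi>" "Y \<in> Ob C" "arr C g" "tgt C g = Y"
  shows "\<pi> (src C g) g = FMap F g (\<pi> Y (Idt C Y))"
  using nt_natural[OF assms(1), of g "Idt C Y"] assms by simp

lemma nat_trans_Yon_el:
  assumes "F \<in> Modules C" "Y \<in> Ob C" "x \<in> el F Y"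
  shows "nat_trans C (Yon C Y) F (\<lambda>A g. FMap F g x)"
  unfolding nat_trans_def
proof (intro conjI ballI)
  fix A assume A: "A \<in> Ob C"
  show "(\<lambda>g. FMap F g x) \<in> hom (FOb (Yon C Y) A) (FOb F A)"
    unfolding hom_def using A assms act_add[OF assms(1)] by (auto simp flip: add_mor)
qed (use assms in auto)

text \<open>A transformation out of \<open>Hom(-,Y)\<close> is \<open>\<lambda>g. FMap F g x\<close>
  for the image \<open>x\<close> of the identity; exactness and surjectivity then become the clauses
  of \<open>pres\<close>.\<close>

lemma presented_by_iff:
  assumes "X \<in> Ob C" "Y \<in> Ob C" "F \<in> Modules C"
  shows "presented_by C X Y f F \<longleftrightarrow> src C f = X \<and> tgt C f = Y \<and> (\<exists>x. pres C f F x)"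
proof
  assume L: "presented_by C X Y f F"
  then obtain \<pi> where f: "arr C f" "src C f = X" "tgt C f = Y" and p: "nat_trans C (Yon C Y) F \<pi>"
    "nt_exact C (Yon C X) (Yon C Y) F (yon_map C f) \<pi>" "nt_epi C (Yon C Y) F \<pi>"
    unfolding presented_by_def using assms by auto
  let ?x = "\<pi> Y (Idt C Y)"
  have x: "?x \<in> el F Y" using nt_closed[OF p(1), of Y "Idt C Y"] assms by simp
  have "pres C f F ?x" unfolding pres_def
  proof (intro conjI ballI allI impI)
    fix A y assume A: "A \<in> Ob C" "y \<in> el F A"
    then obtain g where "g \<in> mor C A Y" "\<pi> A g = y"
      using p(3) unfolding nt_epi_def by (metis (no_types, lifting) Yon_simps(1) imageE)
    then show "\<exists>g. arr C g \<and> src C g = A \<and> tgt C g = tgt C f \<and> FMap F g ?x = y"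
      using nat_trans_from_Yon[OF p(1), of g] A assms f by auto
  next
    fix g assume g: "arr C g" "tgt C g = tgt C f"
    have e: "\<pi> (src C g) g = FMap F g ?x" using nat_trans_from_Yon[OF p(1), of g] g assms f by simp
    have E: "yon_map C f (src C g) ` carrier (FOb (Yon C X) (src C g)) =
        kernel (FOb (Yon C Y) (src C g)) (FOb F (src C g)) (\<pi> (src C g))"
      using p(2) src_tgt_Ob(1)[OF g(1)] unfolding nt_exact_def by blast
    have "g \<in> yon_map C f (src C g) ` carrier (FOb (Yon C X) (src C g)) \<longleftrightarrow>
        \<pi> (src C g) g = \<one>\<^bsub>FOb F (src C g)\<^esub>"
      unfolding E kernel_def using g f assms(2) by simp
    moreover have "g \<in> yon_map C f (src C g) ` carrier (FOb (Yon C X) (src C g)) \<longleftrightarrow> factors C g f"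
      unfolding factors_def yon_map_def using g(1) f(2) assms(1) by auto
    ultimately show "FMap F g ?x = \<one>\<^bsub>FOb F (src C g)\<^esub> \<longleftrightarrow> factors C g f" using e by simp
  qed (use f x assms in auto)
  then show "src C f = X \<and> tgt C f = Y \<and> (\<exists>x. pres C f F x)" using f by auto
next
  assume R: "src C f = X \<and> tgt C f = Y \<and> (\<exists>x. pres C f F x)"
  then obtain x where p: "pres C f F x" by blast
  note d = presD[OF p]
  show "presented_by C X Y f F" unfolding presented_by_def
  proof (intro conjI exI)
    show "nat_trans C (Yon C Y) F (\<lambda>A g. FMap F g x)" using nat_trans_Yon_el[of F Y x] assms d(3) R by simp
    show "nt_exact C (Yon C X) (Yon C Y) F (yon_map C f) (\<lambda>A g. FMap F g x)"
      unfolding nt_exact_def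
    proof (intro ballI equalityI subsetI)
      fix A t assume A: "A \<in> Ob C" "t \<in> yon_map C f A ` carrier (FOb (Yon C X) A)"
      then obtain r where "arr C r" "src C r = A" "tgt C r = X" "t = f \<cdot> r"
        using assms by (auto simp: yon_map_def)
      then have "arr C t" "src C t = A" "tgt C t = tgt C f" "factors C t f"
        using d(2) R by (auto simp: factors_def)
      then show "t \<in> kernel (FOb (Yon C Y) A) (FOb F A) (\<lambda>g. FMap F g x)"
        using d(5)[of t] R A assms by (simp add: kernel_def)
    next
      fix A t assume A: "A \<in> Ob C" "t \<in> kernel (FOb (Yon C Y) A) (FOb F A) (\<lambda>g. FMap F g x)"
      then have t: "arr C t" "src C t = A" "tgt C t = Y" "FMap F t x = \<one>\<^bsub>FOb F A\<^esub>"
        using assms by (auto simp: kernel_def)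
      then have "factors C t f" using d(5)[of t] R by simp
      then show "t \<in> yon_map C f A ` carrier (FOb (Yon C X) A)"
        using t(2) R A assms by (force simp: factors_def yon_map_def)
    qed
    show "nt_epi C (Yon C Y) F (\<lambda>A g. FMap F g x)"
      unfolding nt_epi_def
    proof (intro ballI equalityI subsetI)
      fix A y assume "A \<in> Ob C" "y \<in> (\<lambda>g. FMap F g x) ` carrier (FOb (Yon C Y) A)"
      then show "y \<in> el F A" using d(1,3) R assms by auto
    next
      fix A y assume A: "A \<in> Ob C" "y \<in> el F A"
      from d(4)[OF this] show "y \<in> (\<lambda>g. FMap F g x) ` carrier (FOb (Yon C Y) A)"
        using R A assms by force
    qed
  qed (use d R assms in auto)
qed

lemma yon_nat_trans:
  assumes "nat_trans C (Yon C X) (Yon C Y) \<alpha>" "X \<in> Ob C" "Y \<in> Ob C"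
  shows "\<exists>f. arr C f \<and> src C f = X \<and> tgt C f = Y \<and>
    (\<forall>g. arr C g \<longrightarrow> tgt C g = X \<longrightarrow> \<alpha> (src C g) g = f \<cdot> g)"
  using nat_trans_from_Yon[OF assms(1,2)] nt_closed[OF assms(1,2), of "Idt C X"] assms
  by (intro exI[of _ "\<alpha> X (Idt C X)"]) auto

lemma nt_exact_yon_cong:
  assumes "\<And>g. \<lbrakk>arr C g; tgt C g = X\<rbrakk> \<Longrightarrow> \<alpha> (src C g) g = f \<cdot> g" "X \<in> Ob C"
  shows "nt_exact C (Yon C X) G H \<alpha> \<theta> \<longleftrightarrow> nt_exact C (Yon C X) G H (yon_map C f) \<theta>"
proof -
  have "\<alpha> A ` mor C A X = yon_map C f A ` mor C A X" if "A \<in> Ob C" for A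
    by (rule image_cong) (use that assms in \<open>auto simp: yon_map_def\<close>)
  then show ?thesis unfolding nt_exact_def by simp
qed

lemma fp_iff: "F \<in> fp_modules C \<longleftrightarrow> (\<exists>f x. pres C f F x)"
proof
  assume "F \<in> fp_modules C"
  then obtain X Y \<alpha> \<pi> where F: "F \<in> Modules C" "X \<in> Ob C" "Y \<in> Ob C" "nat_trans C (Yon C X) (Yon C Y) \<alpha>"
    and p: "nat_trans C (Yon C Y) F \<pi>" "nt_exact C (Yon C X) (Yon C Y) F \<alpha> \<pi>" "nt_epi C (Yon C Y) F \<pi>"
    unfolding fp_modules_def by blast
  obtain f where f: "arr C f" "src C f = X" "tgt C f = Y"
    and fa: "\<And>g. \<lbrakk>arr C g; tgt C g = X\<rbrakk> \<Longrightarrow> \<alpha> (src C g) g = f \<cdot> g"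
    using yon_nat_trans[OF F(4,2,3)] by blast
  have "presented_by C X Y f F" unfolding presented_by_def
    using f p F nt_exact_yon_cong[of X \<alpha> f, OF fa F(2)] by auto
  then show "\<exists>f x. pres C f F x" using presented_by_iff F by blast
next
  assume "\<exists>f x. pres C f F x"
  then obtain f x where p: "pres C f F x" by blast
  note d = presD[OF p]
  have "presented_by C (src C f) (tgt C f) f F"
    using presented_by_iff[of "src C f" "tgt C f" F f] d p by auto
  moreover have "nat_trans C (Yon C (src C f)) (Yon C (tgt C f)) (yon_map C f)"
    unfolding nat_trans_def hom_def yon_map_def using d by (auto simp flip: add_mor)
  ultimately show "F \<in> fp_modules C" unfolding fp_modules_def presented_by_def using d(1) src_tgt_Ob[OF d(2)] by blast
qed

text \<open>Yoneda turns the maps between representable functors into arrows \<open>k\<close> and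
  \<open>f\<close>. Injectivity of the first and exactness at the second term together say that
  \<open>k\<close> is a kernel of \<open>f\<close>.\<close>

lemma P2_iff: "F \<in> P2 C \<longleftrightarrow> (\<exists>f x. pres C f F x \<and> has_kernel C f)"
proof
  assume "F \<in> P2 C"
  then obtain X Y Z \<alpha> \<beta> \<pi> where F: "F \<in> Modules C" "X \<in> Ob C" "Y \<in> Ob C" "Z \<in> Ob C"
    "nat_trans C (Yon C X) (Yon C Y) \<alpha>" "nat_trans C (Yon C Y) (Yon C Z) \<beta>"
    and p: "nat_trans C (Yon C Z) F \<pi>"
    "nt_mono C (Yon C X) \<alpha>" "nt_exact C (Yon C X) (Yon C Y) (Yon C Z) \<alpha> \<beta>"
    "nt_exact C (Yon C Y) (Yon C Z) F \<beta> \<pi>" "nt_epi C (Yon C Z) F \<pi>"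
    unfolding P2_def by blast
  obtain k where k: "arr C k" "src C k = X" "tgt C k = Y"
    and ka: "\<And>g. \<lbrakk>arr C g; tgt C g = X\<rbrakk> \<Longrightarrow> \<alpha> (src C g) g = k \<cdot> g"
    using yon_nat_trans[OF F(5,2,3)] by blast
  obtain f where f: "arr C f" "src C f = Y" "tgt C f = Z"
    and fa: "\<And>g. \<lbrakk>arr C g; tgt C g = Y\<rbrakk> \<Longrightarrow> \<beta> (src C g) g = f \<cdot> g"
    using yon_nat_trans[OF F(6,3,4)] by blast
  have "presented_by C Y Z f F" unfolding presented_by_def
    using f p F nt_exact_yon_cong[of Y \<beta> f, OF fa F(3)] by auto
  then obtain x where x: "pres C f F x" using presented_by_iff F by blast
  have ex: "\<And>A. A \<in> Ob C \<Longrightarrow> \<alpha> A ` mor C A X = {t \<in> mor C A Y. \<beta> A t = zer C A Z}"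
    using p(3) unfolding nt_exact_def kernel_def by simp
  have "ker_of C k f" unfolding ker_of_def
  proof (intro conjI allI impI)
    show "monic C k" unfolding monic_def
    proof (intro conjI allI impI)
      fix t assume t: "arr C t" "tgt C t = src C k" "k \<cdot> t = zer C (src C t) (tgt C k)"
      have "inj_on (\<alpha> (src C t)) (mor C (src C t) X)" using p(2) t unfolding nt_mono_def by simp
      moreover have "\<alpha> (src C t) t = \<alpha> (src C t) (zer C (src C t) X)"
        using ka[of t] ka[of "zer C (src C t) X"] t k F by simp
      ultimately show "t = zer C (src C t) (src C k)" using t k F unfolding inj_on_def by simp
    qed (use k in simp)
    have "\<alpha> X (Idt C X) \<in> {t \<in> mor C X Y. \<beta> X t = zer C X Z}" using ex[of X] F by fastforce
    then show "f \<cdot> k = zer C (src C k) (tgt C f)" using ka[of "Idt C X"] fa[of k] k f F by simp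
    fix t assume t: "arr C t" "tgt C t = src C f" "f \<cdot> t = zer C (src C t) (tgt C f)"
    then have "t \<in> \<alpha> (src C t) ` mor C (src C t) X" using ex[of "src C t"] fa[of t] f F by simp
    then show "\<exists>g. arr C g \<and> src C g = src C t \<and> tgt C g = src C k \<and> k \<cdot> g = t"
      using ka k F t by (auto simp: image_iff) (metis)
  qed (use k f in auto)
  then show "\<exists>f x. pres C f F x \<and> has_kernel C f" using x by (auto simp: has_kernel_def)
next
  assume "\<exists>f x. pres C f F x \<and> has_kernel C f"
  then obtain f x k where p: "pres C f F x" and k: "ker_of C k f" by (auto simp: has_kernel_def)
  note d = presD[OF p] and kd = ker_ofD[OF k]
  have pb: "presented_by C (src C f) (tgt C f) f F"
    using presented_by_iff[of "src C f" "tgt C f" F f] d p by auto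
  have nt: "nat_trans C (Yon C (src C h)) (Yon C (tgt C h)) (yon_map C h)" if "arr C h" for h
    unfolding nat_trans_def hom_def yon_map_def using that by (auto simp flip: add_mor)
  have m: "nt_mono C (Yon C (src C k)) (yon_map C k)"
    unfolding nt_mono_def yon_map_def inj_on_def using monic_cancel[OF kd(1)] kd by auto
  have ex: "nt_exact C (Yon C (src C k)) (Yon C (src C f)) (Yon C (tgt C f)) (yon_map C k) (yon_map C f)"
    unfolding nt_exact_def
  proof (intro ballI equalityI subsetI)
    fix A t assume A: "A \<in> Ob C" "t \<in> yon_map C k A ` carrier (FOb (Yon C (src C k)) A)"
    then show "t \<in> kernel (FOb (Yon C (src C f)) A) (FOb (Yon C (tgt C f)) A) (yon_map C f A)"
      using kd unfolding kernel_def yon_map_def by auto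
  next
    fix A t assume A: "A \<in> Ob C" "t \<in> kernel (FOb (Yon C (src C f)) A) (FOb (Yon C (tgt C f)) A) (yon_map C f A)"
    then have "arr C t" "src C t = A" "tgt C t = src C f" "f \<cdot> t = zer C (src C t) (tgt C f)"
      using kd(2-4) unfolding kernel_def yon_map_def by auto
    then obtain g where "arr C g" "src C g = A" "tgt C g = src C k" "k \<cdot> g = t"
      using ker_lift[OF k, of t] by metis
    then show "t \<in> yon_map C k A ` carrier (FOb (Yon C (src C k)) A)"
      using A kd unfolding yon_map_def by auto
  qed
  have "\<exists>\<pi>. nat_trans C (Yon C (tgt C f)) F \<pi> \<and>
      nt_exact C (Yon C (src C f)) (Yon C (tgt C f)) F (yon_map C f) \<pi> \<and> nt_epi C (Yon C (tgt C f)) F \<pi>"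
    using pb unfolding presented_by_def by blast
  moreover have "nat_trans C (Yon C (src C k)) (Yon C (src C f)) (yon_map C k)"
    using nt[of k] kd by simp
  ultimately show "F \<in> P2 C" unfolding P2_def
    using nt[of f] m ex d kd by (simp, intro bexI[of _ "src C k"] bexI[of _ "src C f"] bexI[of _ "tgt C f"]) auto
qed

text \<open>The universal property of the cokernel: an element \<open>z\<close> of \<open>G\<close>
  satisfying the relation \<open>f\<close> is the image of the generator under a
  transformation.\<close>

lemma pres_map:
  assumes p: "pres C f F x" and G: "G \<in> Modules C" and z: "z \<in> el G (tgt C f)"
    "FMap G f z = \<one>\<^bsub>FOb G (src C f)\<^esub>"
  obtains \<eta> where "nat_trans C F G \<eta>"
    "\<And>g. \<lbrakk>arr C g; tgt C g = tgt C f\<rbrakk> \<Longrightarrow> \<eta> (src C g) (FMap F g x) = FMap G g z"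
proof -
  note d = presD[OF p]
  \<comment> \<open>Each element is written as a multiple of the generator \<open>x\<close> by a
    chosen arrow; \<open>wd\<close> shows that the choice does not matter.\<close>
  define \<eta> where "\<eta> A y = FMap G (SOME g. arr C g \<and> src C g = A \<and> tgt C g = tgt C f \<and> FMap F g x = y) z" for A y
  have wd: "FMap G g z = FMap G g' z" if g: "arr C g" "arr C g'" "src C g' = src C g" "tgt C g = tgt C f"
    "tgt C g' = tgt C f" and e: "FMap F g x = FMap F g' x" for g g'
  proof -
    interpret G: comm_group "FOb G (src C g)" by (rule mod_comm_group) (use G g in simp_all)
    have "factors C (g \<boxplus> neg C g') f" using pres_eq[OF p g] e by simp
    then obtain r where r: "arr C r" "src C r = src C g" "tgt C r = src C f" "f \<cdot> r = g \<boxplus> neg C g'"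
      using g by (auto simp: factors_def)
    have gz: "FMap G g z \<in> el G (src C g)" "FMap G g' z \<in> el G (src C g)" using G g z by simp_all
    have "FMap G (f \<cdot> r) z = \<one>\<^bsub>FOb G (src C g)\<^esub>"
      using act_cmp[OF G r(1) d(2) r(3) z(1)] z(2) act_one[OF G r(1)] r(2,3) by simp
    then have "FMap G g z \<otimes>\<^bsub>FOb G (src C g)\<^esub> inv\<^bsub>FOb G (src C g)\<^esub> (FMap G g' z) = \<one>\<^bsub>FOb G (src C g)\<^esub>"
      unfolding r(4) using act_add[OF G, of g "neg C g'" z] G g z by simp
    then show ?thesis using gz by (metis G.inv_closed G.inv_equality G.inv_inv)
  qed
  have \<eta>: "\<eta> (src C g) (FMap F g x) = FMap G g z" if g: "arr C g" "tgt C g = tgt C f" for g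
  proof -
    have "\<exists>h. arr C h \<and> src C h = src C g \<and> tgt C h = tgt C f \<and> FMap F h x = FMap F g x" using g by auto
    from someI_ex[OF this] show ?thesis unfolding \<eta>_def by (intro wd) (use g in auto)
  qed
  have "nat_trans C F G \<eta>" unfolding nat_trans_def
  proof (intro conjI ballI)
    fix A assume A: "A \<in> Ob C"
    show "\<eta> A \<in> hom (FOb F A) (FOb G A)" unfolding hom_def
    proof (intro CollectI conjI Pi_I ballI)
      fix y assume "y \<in> el F A"
      then obtain g where g: "arr C g" "src C g = A" "tgt C g = tgt C f" "FMap F g x = y" using d(4) A by blast
      then show "\<eta> A y \<in> el G A" using \<eta>[of g] G z by auto
      fix y' assume "y' \<in> el F A"
      then obtain g' where g': "arr C g'" "src C g' = A" "tgt C g' = tgt C f" "FMap F g' x = y'" using d(4) A by blast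
      show "\<eta> A (y \<otimes>\<^bsub>FOb F A\<^esub> y') = \<eta> A y \<otimes>\<^bsub>FOb G A\<^esub> \<eta> A y'"
        using \<eta>[of g] \<eta>[of g'] \<eta>[of "g \<boxplus> g'"] act_add[OF d(1), of g g' x] act_add[OF G, of g g' z] g g' d(3) z
        by simp
    qed
  next
    fix A B h y assume A: "A \<in> Ob C" "B \<in> Ob C" "h \<in> mor C A B" "y \<in> el F B"
    then obtain g where g: "arr C g" "src C g = B" "tgt C g = tgt C f" "FMap F g x = y" using d(4) by blast
    have h: "arr C h" "src C h = A" "tgt C h = B" using A by auto
    show "\<eta> A (FMap F h y) = FMap G h (\<eta> B y)"
      using \<eta>[of g] \<eta>[of "g \<cdot> h"] act_cmp[OF d(1), of h g x] act_cmp[OF G, of h g z] g h d(3) z by simp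
  qed
  then show ?thesis using that \<eta> by blast
qed

lemma factors_zer: "\<lbrakk>arr C f; A \<in> Ob C; tgt C f = B\<rbrakk> \<Longrightarrow> factors C (zer C A B) f"
  unfolding factors_def by (rule exI[of _ "zer C A (src C f)"]) auto

lemma factors_add:
  assumes "factors C g f" "factors C g' f" "arr C f" "src C g' = src C g"
  shows "factors C (g \<boxplus> g') f"
proof -
  obtain r r' where "arr C r" "src C r = src C g" "tgt C r = src C f" "f \<cdot> r = g"
    "arr C r'" "src C r' = src C g" "tgt C r' = src C f" "f \<cdot> r' = g'"
    using assms by (auto simp: factors_def)
  then have "arr C (r \<boxplus> r')" "src C (r \<boxplus> r') = src C (g \<boxplus> g')" "tgt C (r \<boxplus> r') = src C f"
    "f \<cdot> (r \<boxplus> r') = g \<boxplus> g'" using assms(3) by auto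
  then show ?thesis unfolding factors_def by blast
qed

lemma factors_neg:
  assumes "factors C g f" "arr C f"
  shows "factors C (neg C g) f"
proof -
  obtain r where "arr C r" "src C r = src C g" "tgt C r = src C f" "f \<cdot> r = g"
    using assms by (auto simp: factors_def)
  then have "arr C (neg C r)" "src C (neg C r) = src C (neg C g)" "tgt C (neg C r) = src C f"
    "f \<cdot> neg C r = neg C g" using assms(2) by auto
  then show ?thesis unfolding factors_def by blast
qed

lemma factors_cmp:
  assumes "factors C g f" "arr C f" "arr C h" "tgt C h = src C g"
  shows "factors C (g \<cdot> h) f"
proof -
  obtain r where "arr C r" "src C r = src C g" "tgt C r = src C f" "f \<cdot> r = g"
    using assms by (auto simp: factors_def)
  then have "arr C (r \<cdot> h)" "src C (r \<cdot> h) = src C (g \<cdot> h)" "tgt C (r \<cdot> h) = src C f"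
    "f \<cdot> (r \<cdot> h) = g \<cdot> h" using assms(2-) by auto
  then show ?thesis unfolding factors_def by blast
qed

text \<open>The cokernel of \<open>Hom(-,f)\<close> is built with cosets as its elements. A coset is
  a set of arrows, hence the injection from \<open>'m set\<close>.\<close>

lemma pres_ex:
  assumes e: "inj (e :: 'm set \<Rightarrow> 'u)" and f: "arr C f"
  shows "\<exists>(F :: ('o, 'm, 'u) cfunctor) x. pres C f F x"
proof -
  \<comment> \<open>The coset of \<open>g\<close> modulo the arrows that factor through
    \<open>f\<close>; \<open>q g\<close> is its code in \<open>'u\<close>.\<close>
  define cls where "cls g = {g'. arr C g' \<and> src C g' = src C g \<and> tgt C g' = tgt C f \<and>
    factors C (g \<boxplus> neg C g') f}" for g
  define q where "q g = e (cls g)" for g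
  have q_eq: "q g = q g' \<longleftrightarrow> factors C (g \<boxplus> neg C g') f"
    if g: "arr C g" "arr C g'" "src C g' = src C g" "tgt C g = tgt C f" "tgt C g' = tgt C f" for g g'
  proof
    assume "q g = q g'"
    then have "cls g = cls g'" unfolding q_def using e by (auto dest: injD)
    moreover have "g' \<in> cls g'" unfolding cls_def using g factors_zer[OF f] by simp
    ultimately have "g' \<in> cls g" by blast
    then show "factors C (g \<boxplus> neg C g') f" by (simp add: cls_def)
  next
    assume L: "factors C (g \<boxplus> neg C g') f"
    have "factors C (g \<boxplus> neg C h) f \<longleftrightarrow> factors C (g' \<boxplus> neg C h) f"
      if h: "arr C h" "src C h = src C g" "tgt C h = tgt C f" for h
    proof
      assume "factors C (g \<boxplus> neg C h) f"
      from factors_add[OF factors_neg[OF L f] this f]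
      show "factors C (g' \<boxplus> neg C h) f" using g h by (simp add: add_assoc add_left_comm[of g'])
    next
      assume "factors C (g' \<boxplus> neg C h) f"
      from factors_add[OF L this f]
      show "factors C (g \<boxplus> neg C h) f" using g h by (simp add: add_assoc)
    qed
    then show "q g = q g'" unfolding q_def cls_def using g by (intro arg_cong[of _ _ e]) auto
  qed
  define H where "H A = {g. arr C g \<and> src C g = A \<and> tgt C g = tgt C f}" for A
  have q_eq': "q g = q g' \<longleftrightarrow> factors C (g \<boxplus> neg C g') f" if "g \<in> H A" "g' \<in> H A" for g g' A
    using q_eq[of g g'] that by (simp add: H_def)
  define rep where "rep A u = (SOME g. g \<in> H A \<and> q g = u)" for A u
  have rep: "rep A (q g) \<in> H A" "q (rep A (q g)) = q g" if "g \<in> H A" for A g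
    unfolding rep_def using someI[of "\<lambda>g'. g' \<in> H A \<and> q g' = q g" g] that by auto
  \<comment> \<open>Sums and restrictions are computed on chosen representatives; independence of
    the choice is \<open>Fmult\<close> and \<open>FFMap\<close>.\<close>
  define F :: "('o, 'm, 'u) cfunctor" where "F =
    \<lparr>FOb = (\<lambda>A. \<lparr>carrier = q ` H A, mult = (\<lambda>u v. q (rep A u \<boxplus> rep A v)), one = q (zer C A (tgt C f))\<rparr>),
     FMap = (\<lambda>h u. q (rep (tgt C h) u \<cdot> h))\<rparr>"
  have Fel: "el F A = q ` H A" and Fone: "\<one>\<^bsub>FOb F A\<^esub> = q (zer C A (tgt C f))" for A
    by (simp_all add: F_def)
  have H_add: "g \<boxplus> g' \<in> H A" if "g \<in> H A" "g' \<in> H A" for g g' A using that by (simp add: H_def)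
  have H_cmp: "g \<cdot> h \<in> H (src C h)" if "g \<in> H (tgt C h)" "arr C h" for g h using that by (simp add: H_def)
  have H_zer: "zer C A (tgt C f) \<in> H A" if "A \<in> Ob C" for A using that f by (simp add: H_def)
  have Fmult: "q g \<otimes>\<^bsub>FOb F A\<^esub> q g' = q (g \<boxplus> g')" if g: "g \<in> H A" "g' \<in> H A" for g g' A
  proof -
    let ?r = "rep A (q g)" and ?r' = "rep A (q g')"
    have "factors C (?r \<boxplus> neg C g) f" "factors C (?r' \<boxplus> neg C g') f"
      using q_eq'[OF rep(1)[OF g(1)] g(1)] q_eq'[OF rep(1)[OF g(2)] g(2)] rep g by simp_all
    from factors_add[OF this f]
    have "factors C ((?r \<boxplus> neg C g) \<boxplus> (?r' \<boxplus> neg C g')) f"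
      using rep(1)[OF g(1)] rep(1)[OF g(2)] g by (simp add: H_def)
    also have "(?r \<boxplus> neg C g) \<boxplus> (?r' \<boxplus> neg C g') = (?r \<boxplus> ?r') \<boxplus> neg C (g \<boxplus> g')"
      using rep(1)[OF g(1)] rep(1)[OF g(2)] g by (simp add: H_def add_ac)
    finally have "q (?r \<boxplus> ?r') = q (g \<boxplus> g')"
      using q_eq'[OF H_add[OF rep(1)[OF g(1)] rep(1)[OF g(2)]] H_add[OF g]] by simp
    then show ?thesis by (simp add: F_def)
  qed
  have FFMap: "FMap F h (q g) = q (g \<cdot> h)" if g: "g \<in> H (tgt C h)" "arr C h" for g h
  proof -
    let ?r = "rep (tgt C h) (q g)"
    have "factors C (?r \<boxplus> neg C g) f" using q_eq'[OF rep(1)[OF g(1)] g(1)] rep g by simp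
    from factors_cmp[OF this f g(2)]
    have "factors C (?r \<cdot> h \<boxplus> neg C (g \<cdot> h)) f" using rep(1)[OF g(1)] g by (simp add: H_def)
    then have "q (?r \<cdot> h) = q (g \<cdot> h)" using q_eq'[OF H_cmp[OF rep(1)[OF g(1)] g(2)] H_cmp[OF g]] by simp
    then show ?thesis by (simp add: F_def)
  qed
  have grp: "comm_group (FOb F A)" if A: "A \<in> Ob C" for A
  proof (rule comm_groupI)
    show "\<one>\<^bsub>FOb F A\<^esub> \<in> el F A" using H_zer[OF A] by (auto simp: Fel Fone)
    fix u assume "u \<in> el F A"
    then obtain g where g: "g \<in> H A" "u = q g" by (auto simp: Fel)
    show "\<one>\<^bsub>FOb F A\<^esub> \<otimes>\<^bsub>FOb F A\<^esub> u = u"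
      using Fmult[OF H_zer[OF A] g(1)] g by (simp add: Fone H_def)
    have "neg C g \<in> H A" using g by (simp add: H_def)
    then show "\<exists>v\<in>el F A. v \<otimes>\<^bsub>FOb F A\<^esub> u = \<one>\<^bsub>FOb F A\<^esub>"
      using Fmult[of "neg C g" A g] g by (intro bexI[of _ "q (neg C g)"]) (auto simp: Fone Fel H_def)
    fix v assume "v \<in> el F A"
    then obtain g' where g': "g' \<in> H A" "v = q g'" by (auto simp: Fel)
    show "u \<otimes>\<^bsub>FOb F A\<^esub> v \<in> el F A" using Fmult[OF g(1) g'(1)] H_add g g' by (auto simp: Fel)
    show "u \<otimes>\<^bsub>FOb F A\<^esub> v = v \<otimes>\<^bsub>FOb F A\<^esub> u"
      using Fmult[OF g(1) g'(1)] Fmult[OF g'(1) g(1)] add_comm[of g g'] g g' by (simp add: H_def)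
    fix w assume "w \<in> el F A"
    then obtain g'' where g'': "g'' \<in> H A" "w = q g''" by (auto simp: Fel)
    show "(u \<otimes>\<^bsub>FOb F A\<^esub> v) \<otimes>\<^bsub>FOb F A\<^esub> w = u \<otimes>\<^bsub>FOb F A\<^esub> (v \<otimes>\<^bsub>FOb F A\<^esub> w)"
      using Fmult[OF g(1) g'(1)] Fmult[OF g'(1) g''(1)] Fmult[OF H_add[OF g(1) g'(1)] g''(1)]
        Fmult[OF g(1) H_add[OF g'(1) g''(1)]] add_assoc[of g g' g''] g g' g'' by (simp add: H_def)
  qed
  have FM: "F \<in> Modules C"
    unfolding Modules_def
  proof (intro CollectI conjI ballI)
    fix A B h assume "A \<in> Ob C" "B \<in> Ob C" "h \<in> mor C A B"
    then have h: "arr C h" "src C h = A" "tgt C h = B" by auto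
    show "FMap F h \<in> hom (FOb F B) (FOb F A)" unfolding hom_def
    proof (intro CollectI conjI Pi_I ballI)
      fix u assume "u \<in> el F B"
      then obtain g where g: "g \<in> H B" "u = q g" by (auto simp: Fel)
      show "FMap F h u \<in> el F A" using FFMap[of g h] H_cmp[of g h] g h by (auto simp: Fel)
      fix v assume "v \<in> el F B"
      then obtain g' where g': "g' \<in> H B" "v = q g'" by (auto simp: Fel)
      show "FMap F h (u \<otimes>\<^bsub>FOb F B\<^esub> v) = FMap F h u \<otimes>\<^bsub>FOb F A\<^esub> FMap F h v"
        using FFMap[of g h] FFMap[of g' h] FFMap[of "g \<boxplus> g'" h] H_cmp[of g h] H_cmp[of g' h]
          H_add[of g B g'] Fmult[of g B g'] Fmult[of "g \<cdot> h" A "g' \<cdot> h"] g g' h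
        by (simp add: H_def)
    qed
    fix h' u assume "h' \<in> mor C A B" "u \<in> el F B"
    then obtain g where g: "g \<in> H B" "u = q g" and h': "arr C h'" "src C h' = A" "tgt C h' = B"
      using \<open>A \<in> Ob C\<close> \<open>B \<in> Ob C\<close> by (auto simp: Fel)
    show "FMap F (h \<otimes>\<^bsub>Hom C A B\<^esub> h') u = FMap F h u \<otimes>\<^bsub>FOb F A\<^esub> FMap F h' u"
      using FFMap[of g h] FFMap[of g h'] FFMap[of g "h \<boxplus> h'"] Fmult[of "g \<cdot> h" A "g \<cdot> h'"]
        H_cmp[of g h] H_cmp[of g h'] g h h' \<open>A \<in> Ob C\<close> \<open>B \<in> Ob C\<close>
      by (simp add: H_def flip: add_mor)
  next
    fix A u assume "A \<in> Ob C" "u \<in> el F A"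
    then obtain g where g: "g \<in> H A" "u = q g" by (auto simp: Fel)
    show "FMap F (Idt C A) u = u" using FFMap[of g "Idt C A"] g \<open>A \<in> Ob C\<close> by (simp add: H_def)
  next
    fix A B D h k u assume "A \<in> Ob C" "B \<in> Ob C" "D \<in> Ob C" "h \<in> mor C A B" "k \<in> mor C B D" "u \<in> el F D"
    then obtain g where g: "g \<in> H D" "u = q g" and h: "arr C h" "src C h = A" "tgt C h = B"
      "arr C k" "src C k = B" "tgt C k = D" by (auto simp: Fel)
    show "FMap F (k \<cdot> h) u = FMap F h (FMap F k u)"
      using FFMap[of g "k \<cdot> h"] FFMap[of g k] FFMap[of "g \<cdot> k" h] H_cmp[of g k] g h by (simp add: H_def)
  qed (rule grp)
  let ?i = "Idt C (tgt C f)"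
  have iH: "?i \<in> H (tgt C f)" using f by (simp add: H_def)
  have act: "FMap F g (q ?i) = q g" if "arr C g" "tgt C g = tgt C f" for g
    using FFMap[of ?i g] iH that by simp
  have "pres C f F (q ?i)" unfolding pres_def
  proof (intro conjI ballI allI impI)
    fix A y assume "A \<in> Ob C" "y \<in> el F A"
    then obtain g where "g \<in> H A" "y = q g" by (auto simp: Fel)
    then show "\<exists>g. arr C g \<and> src C g = A \<and> tgt C g = tgt C f \<and> FMap F g (q ?i) = y"
      using act[of g] by (auto simp: H_def)
  next
    fix g assume g: "arr C g" "tgt C g = tgt C f"
    then show "FMap F g (q ?i) = \<one>\<^bsub>FOb F (src C g)\<^esub> \<longleftrightarrow> factors C g f"
      using act[of g] q_eq[of g "zer C (src C g) (tgt C f)"] f by (simp add: Fone)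
  qed (use FM f iH in \<open>auto simp: Fel\<close>)
  then show ?thesis by blast
qed

section \<open>Short exact sequences through presentations\<close>

lemma arrow_sesD:
  assumes "arrow_ses C f g h a b"
  shows "arr C f" "arr C g" "arr C h" "arr C a" "arr C b" "src C a = tgt C f" "tgt C a = tgt C g"
    "src C b = tgt C g" "tgt C b = tgt C h"
    "\<And>t. \<lbrakk>arr C t; tgt C t = tgt C f\<rbrakk> \<Longrightarrow> factors C (a \<cdot> t) g \<longleftrightarrow> factors C t f"
    "\<And>t. \<lbrakk>arr C t; tgt C t = tgt C g\<rbrakk> \<Longrightarrow> factors C (b \<cdot> t) h \<longleftrightarrow>
      (\<exists>r. arr C r \<and> src C r = src C t \<and> tgt C r = tgt C f \<and> factors C (t \<boxplus> neg C (a \<cdot> r)) g)"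
    "\<And>t. \<lbrakk>arr C t; tgt C t = tgt C h\<rbrakk> \<Longrightarrow>
      \<exists>s. arr C s \<and> src C s = src C t \<and> tgt C s = tgt C g \<and> factors C (t \<boxplus> neg C (b \<cdot> s)) h"
  using assms unfolding arrow_ses_def by blast+

text \<open>The generator \<open>x\<close> is sent to the multiple of \<open>y\<close> by
  \<open>a\<close>, and \<open>y\<close> to the multiple of \<open>z\<close> by \<open>b\<close>.
  The three equivalences in \<open>arrow_ses\<close> then give injectivity, exactness in the middle
  and surjectivity.\<close>

lemma short_exact_pres:
  assumes F: "pres C f F x" and G: "pres C g G y" and H: "pres C h H z" and ses: "arrow_ses C f g h a b"
  shows "short_exact C F G H"
proof -
  note dF = presD[OF F] and dG = presD[OF G] and dH = presD[OF H]
  note s = arrow_sesD(1-9)[OF ses] and s1 = arrow_sesD(10)[OF ses] and s2 = arrow_sesD(11)[OF ses]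
    and s3 = arrow_sesD(12)[OF ses]
  have ay: "FMap G a y \<in> el G (tgt C f)" using dG(1,3) s by simp
  have "factors C (a \<cdot> f) g" using s1[of f] s factors_refl by simp
  then have "FMap G f (FMap G a y) = \<one>\<^bsub>FOb G (src C f)\<^esub>"
    using dG(5)[of "a \<cdot> f"] act_cmp[OF dG(1), of f a y] dG(3) s by simp
  then obtain \<eta> where \<eta>: "nat_trans C F G \<eta>"
    and \<eta>x: "\<And>t. \<lbrakk>arr C t; tgt C t = tgt C f\<rbrakk> \<Longrightarrow> \<eta> (src C t) (FMap F t x) = FMap G t (FMap G a y)"
    using pres_map[OF F dG(1) ay] by metis
  have \<eta>x': "\<eta> (src C t) (FMap F t x) = FMap G (a \<cdot> t) y" if "arr C t" "tgt C t = tgt C f" for t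
    using \<eta>x[OF that] act_cmp[OF dG(1), of t a y] that dG(3) s by simp
  have bz: "FMap H b z \<in> el H (tgt C g)" using dH(1,3) s by simp
  have "factors C (b \<cdot> g) h"
  proof -
    have "factors C (g \<boxplus> neg C (a \<cdot> zer C (src C g) (tgt C f))) g" using s factors_refl by simp
    then show ?thesis using s2[of g] s by (metis src_tgt_Ob zer_arr)
  qed
  then have "FMap H g (FMap H b z) = \<one>\<^bsub>FOb H (src C g)\<^esub>"
    using dH(5)[of "b \<cdot> g"] act_cmp[OF dH(1), of g b z] dH(3) s by simp
  then obtain \<theta> where \<theta>: "nat_trans C G H \<theta>"
    and \<theta>y: "\<And>t. \<lbrakk>arr C t; tgt C t = tgt C g\<rbrakk> \<Longrightarrow> \<theta> (src C t) (FMap G t y) = FMap H t (FMap H b z)"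
    using pres_map[OF G dH(1) bz] by metis
  have \<theta>y': "\<theta> (src C t) (FMap G t y) = FMap H (b \<cdot> t) z" if "arr C t" "tgt C t = tgt C g" for t
    using \<theta>y[OF that] act_cmp[OF dH(1), of t b z] that dH(3) s by simp
  have "nt_mono C F \<eta>"
  proof (rule nt_monoI[OF \<eta> dF(1) dG(1)])
    fix A v assume A: "A \<in> Ob C" "v \<in> el F A" "\<eta> A v = \<one>\<^bsub>FOb G A\<^esub>"
    then obtain t where t: "arr C t" "src C t = A" "tgt C t = tgt C f" "FMap F t x = v" using dF(4) by blast
    have "FMap G (a \<cdot> t) y = \<one>\<^bsub>FOb G A\<^esub>" using \<eta>x'[OF t(1,3)] t A by simp
    then have "factors C t f" using dG(5)[of "a \<cdot> t"] s1[of t] t s by simp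
    then show "v = \<one>\<^bsub>FOb F A\<^esub>" using dF(5)[of t] t by simp
  qed
  moreover have "nt_exact C F G H \<eta> \<theta>" unfolding nt_exact_def
  proof (intro ballI equalityI subsetI)
    fix A v assume A: "A \<in> Ob C" "v \<in> \<eta> A ` el F A"
    then obtain u where u: "u \<in> el F A" "v = \<eta> A u" by blast
    then obtain t where t: "arr C t" "src C t = A" "tgt C t = tgt C f" "FMap F t x = u" using dF(4) A by blast
    have v: "v = FMap G (a \<cdot> t) y" using \<eta>x'[OF t(1,3)] t u by simp
    have "factors C ((a \<cdot> t) \<boxplus> neg C (a \<cdot> t)) g" using factors_zer[OF s(2), of A "tgt C g"] t s A by simp
    then have "factors C (b \<cdot> (a \<cdot> t)) h" using s2[of "a \<cdot> t"] t s by (auto intro!: exI[of _ t])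
    then have "\<theta> A v = \<one>\<^bsub>FOb H A\<^esub>" using \<theta>y'[of "a \<cdot> t"] dH(5)[of "b \<cdot> (a \<cdot> t)"] v t s by simp
    moreover have "v \<in> el G A" using nt_closed[OF \<eta> A(1) u(1)] u by simp
    ultimately show "v \<in> kernel (FOb G A) (FOb H A) (\<theta> A)" by (simp add: kernel_def)
  next
    fix A v assume A: "A \<in> Ob C" "v \<in> kernel (FOb G A) (FOb H A) (\<theta> A)"
    then have v: "v \<in> el G A" "\<theta> A v = \<one>\<^bsub>FOb H A\<^esub>" by (auto simp: kernel_def)
    then obtain t where t: "arr C t" "src C t = A" "tgt C t = tgt C g" "FMap G t y = v" using dG(4) A by blast
    have "factors C (b \<cdot> t) h" using \<theta>y'[OF t(1,3)] dH(5)[of "b \<cdot> t"] v t s by simp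
    then obtain r where r: "arr C r" "src C r = A" "tgt C r = tgt C f" "factors C (t \<boxplus> neg C (a \<cdot> r)) g"
      using s2[of t] t by auto
    have "FMap G t y = FMap G (a \<cdot> r) y" using pres_eq[OF G, of t "a \<cdot> r"] r t s by simp
    then have "v = \<eta> A (FMap F r x)" using \<eta>x'[OF r(1,3)] r t by simp
    then show "v \<in> \<eta> A ` el F A" using r dF(1,3) by auto
  qed
  moreover have "nt_epi C G H \<theta>" unfolding nt_epi_def
  proof (intro ballI equalityI subsetI)
    fix A v assume "A \<in> Ob C" "v \<in> \<theta> A ` el G A"
    then show "v \<in> el H A" using nt_closed[OF \<theta>] by blast
  next
    fix A v assume A: "A \<in> Ob C" "v \<in> el H A"
    then obtain t where t: "arr C t" "src C t = A" "tgt C t = tgt C h" "FMap H t z = v" using dH(4) by blast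
    obtain r where r: "arr C r" "src C r = A" "tgt C r = tgt C g" "factors C (t \<boxplus> neg C (b \<cdot> r)) h"
      using s3[OF t(1,3)] t by blast
    have "FMap H t z = FMap H (b \<cdot> r) z" using pres_eq[OF H, of t "b \<cdot> r"] r t s by simp
    then have "v = \<theta> A (FMap G r y)" using \<theta>y'[OF r(1,3)] r t by simp
    then show "v \<in> \<theta> A ` el G A" using r dG(1,3) by auto
  qed
  ultimately show ?thesis unfolding short_exact_def using \<eta> \<theta> by blast
qed

lemma short_exactE:
  assumes "short_exact C F G H" "F \<in> Modules C" "G \<in> Modules C" "H \<in> Modules C"
  obtains \<eta> \<theta> where "nat_trans C F G \<eta>" "nat_trans C G H \<theta>"
    "\<And>A v. \<lbrakk>A \<in> Ob C; v \<in> el F A; \<eta> A v = \<one>\<^bsub>FOb G A\<^esub>\<rbrakk> \<Longrightarrow> v = \<one>\<^bsub>FOb F A\<^esub>"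
    "\<And>A v. \<lbrakk>A \<in> Ob C; v \<in> el F A\<rbrakk> \<Longrightarrow> \<theta> A (\<eta> A v) = \<one>\<^bsub>FOb H A\<^esub>"
    "\<And>A v. \<lbrakk>A \<in> Ob C; v \<in> el G A; \<theta> A v = \<one>\<^bsub>FOb H A\<^esub>\<rbrakk> \<Longrightarrow> \<exists>u\<in>el F A. v = \<eta> A u"
    "\<And>A v. \<lbrakk>A \<in> Ob C; v \<in> el H A\<rbrakk> \<Longrightarrow> \<exists>u\<in>el G A. v = \<theta> A u"
proof -
  obtain \<eta> \<theta> where *: "nat_trans C F G \<eta>" "nat_trans C G H \<theta>" "nt_mono C F \<eta>"
    "nt_exact C F G H \<eta> \<theta>" "nt_epi C G H \<theta>" using assms(1) unfolding short_exact_def by blast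
  have ex: "\<eta> A ` el F A = {v \<in> el G A. \<theta> A v = \<one>\<^bsub>FOb H A\<^esub>}" if "A \<in> Ob C" for A
    using *(4) that unfolding nt_exact_def kernel_def by simp
  show ?thesis
  proof (rule that[OF *(1,2)])
    fix A v assume A: "A \<in> Ob C"
    show "v \<in> el F A \<Longrightarrow> \<eta> A v = \<one>\<^bsub>FOb G A\<^esub> \<Longrightarrow> v = \<one>\<^bsub>FOb F A\<^esub>"
      using nt_monoD[OF *(3,1) assms(2,3) A] by blast
    show "v \<in> el F A \<Longrightarrow> \<theta> A (\<eta> A v) = \<one>\<^bsub>FOb H A\<^esub>" using ex[OF A] by blast
    show "v \<in> el G A \<Longrightarrow> \<theta> A v = \<one>\<^bsub>FOb H A\<^esub> \<Longrightarrow> \<exists>u\<in>el F A. v = \<eta> A u" using ex[OF A] by blast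
    show "v \<in> el H A \<Longrightarrow> \<exists>u\<in>el G A. v = \<theta> A u" using *(5) A unfolding nt_epi_def by blast
  qed
qed

text \<open>This is the horseshoe lemma with its corner made explicit: a lift \<open>w\<close> of
  the generator of \<open>H\<close> fails to satisfy the relation \<open>h\<close> by an element of
  \<open>F\<close>, which is a multiple of the generator of \<open>F\<close> by some
  \<open>s0\<close>.\<close>

lemma short_exact_extension:
  assumes se: "short_exact C F G H" and G: "G \<in> Modules C"
    and F: "pres C f F x" and H: "pres C h H z"
    and X: "biprod C X (src C f) (src C h) i1 i2 p1 p2"
    and Y: "biprod C Y (tgt C f) (tgt C h) j1 j2 q1 q2"
  obtains s y where "arr C s" "src C s = src C h" "tgt C s = tgt C f"
    "\<And>t. \<lbrakk>arr C t; tgt C t = src C h; h \<cdot> t = zer C (src C t) (tgt C h)\<rbrakk> \<Longrightarrow> factors C (s \<cdot> t) f"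
    "pres C (j1 \<cdot> (f \<cdot> p1 \<boxplus> s \<cdot> p2) \<boxplus> j2 \<cdot> (h \<cdot> p2)) G y"
proof -
  note dF = presD[OF F] and dH = presD[OF H] and dX = biprodD[OF X] and dY = biprodD[OF Y]
  obtain \<eta> \<theta> where \<eta>: "nat_trans C F G \<eta>" and \<theta>: "nat_trans C G H \<theta>"
    and mono: "\<And>A v. \<lbrakk>A \<in> Ob C; v \<in> el F A; \<eta> A v = \<one>\<^bsub>FOb G A\<^esub>\<rbrakk> \<Longrightarrow> v = \<one>\<^bsub>FOb F A\<^esub>"
    and comp: "\<And>A v. \<lbrakk>A \<in> Ob C; v \<in> el F A\<rbrakk> \<Longrightarrow> \<theta> A (\<eta> A v) = \<one>\<^bsub>FOb H A\<^esub>"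
    and ex: "\<And>A v. \<lbrakk>A \<in> Ob C; v \<in> el G A; \<theta> A v = \<one>\<^bsub>FOb H A\<^esub>\<rbrakk> \<Longrightarrow> \<exists>u\<in>el F A. v = \<eta> A u"
    and epi: "\<And>A v. \<lbrakk>A \<in> Ob C; v \<in> el H A\<rbrakk> \<Longrightarrow> \<exists>u\<in>el G A. v = \<theta> A u"
    using short_exactE[OF se dF(1) G dH(1)] by blast
  define x' where "x' = \<eta> (tgt C f) x"
  have x': "x' \<in> el G (tgt C f)" unfolding x'_def using nt_closed[OF \<eta>] dF by simp
  have \<eta>x: "\<eta> (src C t) (FMap F t x) = FMap G t x'" if "arr C t" "tgt C t = tgt C f" for t
    unfolding x'_def using nt_natural[OF \<eta> that(1), of x] that dF by simp
  have x'1: "FMap G t x' = \<one>\<^bsub>FOb G (src C t)\<^esub> \<longleftrightarrow> factors C t f" if t: "arr C t" "tgt C t = tgt C f" for t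
  proof -
    have "FMap F t x \<in> el F (src C t)" using t dF by simp
    then have "FMap G t x' = \<one>\<^bsub>FOb G (src C t)\<^esub> \<longleftrightarrow> FMap F t x = \<one>\<^bsub>FOb F (src C t)\<^esub>"
      using \<eta>x[OF t] mono[of "src C t" "FMap F t x"] nt_one[OF \<eta> dF(1) G, of "src C t"] t(1)
      by (metis src_tgt_Ob(1))
    then show ?thesis using dF(5)[OF t] by simp
  qed
  obtain w where w: "w \<in> el G (tgt C h)" "\<theta> (tgt C h) w = z" using epi[of "tgt C h" z] dH by auto
  have \<theta>w: "\<theta> (src C t) (FMap G t w) = FMap H t z" if "arr C t" "tgt C t = tgt C h" for t
    using nt_natural[OF \<theta> that(1), of w] that w by simp
  have lift: "\<exists>s. arr C s \<and> src C s = A \<and> tgt C s = tgt C f \<and> v = FMap G s x'"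
    if A: "A \<in> Ob C" "v \<in> el G A" "\<theta> A v = \<one>\<^bsub>FOb H A\<^esub>" for A v
  proof -
    obtain u where u: "u \<in> el F A" "v = \<eta> A u" using ex[OF A] by blast
    obtain s where "arr C s" "src C s = A" "tgt C s = tgt C f" "FMap F s x = u" using dF(4)[OF A(1) u(1)] by blast
    then show ?thesis using \<eta>x[of s] u by auto
  qed
  have "\<theta> (src C h) (FMap G h w) = \<one>\<^bsub>FOb H (src C h)\<^esub>" using \<theta>w[of h] pres_rel[OF H] dH(2) by simp
  then obtain s0 where s0: "arr C s0" "src C s0 = src C h" "tgt C s0 = tgt C f" "FMap G h w = FMap G s0 x'"
    using lift[of "src C h" "FMap G h w"] w G dH(2) by auto
  have hw: "FMap G (h \<cdot> t) w = FMap G (s0 \<cdot> t) x'" if "arr C t" "tgt C t = src C h" for t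
    using act_cmp[OF G that(1) dH(2) that(2) w(1)] act_cmp[OF G that(1) s0(1), of x'] s0 x' that by simp
  \<comment> \<open>The relation says that \<open>h\<close> applied to \<open>w\<close> equals
    \<open>s0\<close> applied to \<open>x'\<close>; moved to one side, it puts \<open>-s0\<close>
    into the corner of the matrix.\<close>
  define s where "s = neg C s0"
  have s: "arr C s" "src C s = src C h" "tgt C s = tgt C f" unfolding s_def using s0 by simp_all
  have sk: "factors C (s \<cdot> t) f" if t: "arr C t" "tgt C t = src C h" "h \<cdot> t = zer C (src C t) (tgt C h)" for t
  proof -
    have "FMap G (s0 \<cdot> t) x' = \<one>\<^bsub>FOb G (src C t)\<^esub>"
      using hw[OF t(1,2)] t(3) G w t(1) dH(2) by simp
    then have "factors C (s0 \<cdot> t) f" using x'1[of "s0 \<cdot> t"] s0 t by simp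
    from factors_neg[OF this dF(2)] show ?thesis unfolding s_def using s0 t by simp
  qed
  define T where "T = j1 \<cdot> (f \<cdot> p1 \<boxplus> s \<cdot> p2) \<boxplus> j2 \<cdot> (h \<cdot> p2)"
  have T: "arr C T" "src C T = X" "tgt C T = Y"
    unfolding T_def using dX dY dF(2) dH(2) s by simp_all
  \<comment> \<open>The generator over the biproduct has the image of the generator of
    \<open>F\<close> and the lift \<open>w\<close> as its coordinates.\<close>
  define y where "y = FMap G q1 x' \<otimes>\<^bsub>FOb G Y\<^esub> FMap G q2 w"
  have y: "y \<in> el G Y" unfolding y_def
    using monoid.m_closed[OF mod_monoid[OF G dY(1)]] G x' w dY by simp
  have acty: "FMap G t y = FMap G (q1 \<cdot> t) x' \<otimes>\<^bsub>FOb G (src C t)\<^esub> FMap G (q2 \<cdot> t) w"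
    if "arr C t" "tgt C t = Y" for t
    unfolding y_def
    using act_mult[OF G that(1), of "FMap G q1 x'" "FMap G q2 w"] act_cmp[OF G that(1), of q1 x']
      act_cmp[OF G that(1), of q2 w] that x' w dY G by simp
  have "pres C T G y" unfolding pres_def
  proof (intro conjI ballI allI impI)
    fix A v assume A: "A \<in> Ob C" "v \<in> el G A"
    interpret GA: comm_group "FOb G A" by (rule mod_comm_group[OF G A(1)])
    interpret HA: comm_group "FOb H A" by (rule mod_comm_group[OF dH(1) A(1)])
    obtain g2 where g2: "arr C g2" "src C g2 = A" "tgt C g2 = tgt C h" "FMap H g2 z = \<theta> A v"
      using dH(4)[OF A(1) nt_closed[OF \<theta> A]] by blast
    let ?u = "FMap G g2 w"
    have u: "?u \<in> el G A" "\<theta> A ?u = \<theta> A v" using g2 G w \<theta>w[of g2] by simp_all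
    have "\<theta> A (v \<otimes>\<^bsub>FOb G A\<^esub> inv\<^bsub>FOb G A\<^esub> ?u) = \<one>\<^bsub>FOb H A\<^esub>"
      using nt_mult[OF \<theta> A(1,2), of "inv\<^bsub>FOb G A\<^esub> ?u"] nt_inv[OF \<theta> G dH(1) A(1) u(1)] u A
        nt_closed[OF \<theta> A] by simp
    then obtain g1 where g1: "arr C g1" "src C g1 = A" "tgt C g1 = tgt C f"
      "v \<otimes>\<^bsub>FOb G A\<^esub> inv\<^bsub>FOb G A\<^esub> ?u = FMap G g1 x'" using lift[OF A(1), of "v \<otimes>\<^bsub>FOb G A\<^esub> inv\<^bsub>FOb G A\<^esub> ?u"] A u by auto
    have "v = FMap G g1 x' \<otimes>\<^bsub>FOb G A\<^esub> ?u" unfolding g1(4)[symmetric] using A u by (simp add: GA.m_assoc)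
    then have "FMap G (j1 \<cdot> g1 \<boxplus> j2 \<cdot> g2) y = v"
      using acty[of "j1 \<cdot> g1 \<boxplus> j2 \<cdot> g2"] g1(1-3) g2 dY by simp
    then show "\<exists>g. arr C g \<and> src C g = A \<and> tgt C g = tgt C T \<and> FMap G g y = v"
      using g1 g2 dY T by (intro exI[of _ "j1 \<cdot> g1 \<boxplus> j2 \<cdot> g2"]) simp
  next
    fix t assume "arr C t" "tgt C t = tgt C T"
    then have t: "arr C t" "tgt C t = Y" using T by simp_all
    let ?A = "src C t"
    have A: "?A \<in> Ob C" using t by simp
    interpret GA: comm_group "FOb G ?A" by (rule mod_comm_group[OF G A])
    have c1: "FMap G (q1 \<cdot> t) x' \<in> el G ?A" and c2: "FMap G (q2 \<cdot> t) w \<in> el G ?A"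
      using G x' w t dY by simp_all
    show "FMap G t y = \<one>\<^bsub>FOb G ?A\<^esub> \<longleftrightarrow> factors C t T"
    proof
      assume e: "FMap G t y = \<one>\<^bsub>FOb G ?A\<^esub>"
      have "\<theta> ?A (FMap G (q1 \<cdot> t) x') = \<one>\<^bsub>FOb H ?A\<^esub>"
        using \<eta>x[of "q1 \<cdot> t"] comp[OF A, of "FMap F (q1 \<cdot> t) x"] dF(1,3) t dY by simp
      then have "\<theta> ?A (FMap G t y) = \<theta> ?A (FMap G (q2 \<cdot> t) w)"
        using acty[OF t] nt_mult[OF \<theta> A c1 c2] nt_closed[OF \<theta> A c2] mod_monoid[OF dH(1) A]
        by (simp add: monoid.l_one)
      then have "FMap H (q2 \<cdot> t) z = \<one>\<^bsub>FOb H ?A\<^esub>"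
        using e \<theta>w[of "q2 \<cdot> t"] nt_one[OF \<theta> G dH(1) A] t dY by simp
      then have "factors C (q2 \<cdot> t) h" using dH(5)[of "q2 \<cdot> t"] t dY by simp
      then obtain r2 where r2: "arr C r2" "src C r2 = ?A" "tgt C r2 = src C h" "h \<cdot> r2 = q2 \<cdot> t"
        using t dY by (auto simp: factors_def)
      have "FMap G (q1 \<cdot> t \<boxplus> s0 \<cdot> r2) x' = FMap G (q1 \<cdot> t) x' \<otimes>\<^bsub>FOb G ?A\<^esub> FMap G (q2 \<cdot> t) w"
        using act_add[OF G, of "q1 \<cdot> t" "s0 \<cdot> r2" x'] hw[OF r2(1,3)] r2 s0 t dY x' by simp
      then have "factors C (q1 \<cdot> t \<boxplus> s0 \<cdot> r2) f"
        using acty[OF t] e x'1[of "q1 \<cdot> t \<boxplus> s0 \<cdot> r2"] r2 s0 t dY by simp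
      then obtain r1 where r1: "arr C r1" "src C r1 = ?A" "tgt C r1 = src C f" "f \<cdot> r1 = q1 \<cdot> t \<boxplus> s0 \<cdot> r2"
        using r2 s0 t dY by (auto simp: factors_def)
      have "T \<cdot> (i1 \<cdot> r1 \<boxplus> i2 \<cdot> r2) = t"
        unfolding T_def s_def
        by (rule biprod_eqI[OF Y]) (use r1 r2 s0 t dX dY dF(2) dH(2) in \<open>simp_all add: add_assoc\<close>)
      then show "factors C t T" unfolding factors_def
        by (intro exI[of _ "i1 \<cdot> r1 \<boxplus> i2 \<cdot> r2"]) (use r1 r2 t dX T in simp)
    next
      assume "factors C t T"
      then obtain r where r: "arr C r" "src C r = ?A" "tgt C r = X" "T \<cdot> r = t"
        using T t by (auto simp: factors_def)
      have q1t: "q1 \<cdot> t = f \<cdot> (p1 \<cdot> r) \<boxplus> neg C (s0 \<cdot> (p2 \<cdot> r))" and q2t: "q2 \<cdot> t = h \<cdot> (p2 \<cdot> r)"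
        unfolding r(4)[symmetric] T_def s_def using r(1-3) t(1) s0 dX dY dF(2) dH(2) by simp_all
      have sr: "FMap G (s0 \<cdot> (p2 \<cdot> r)) x' \<in> el G ?A" using G x' r s0 dX by simp
      have "factors C (f \<cdot> (p1 \<cdot> r)) f"
        using factors_cmp[OF factors_refl[OF dF(2)] dF(2), of "p1 \<cdot> r"] r dX by simp
      then have "FMap G (f \<cdot> (p1 \<cdot> r)) x' = \<one>\<^bsub>FOb G ?A\<^esub>"
        using x'1[of "f \<cdot> (p1 \<cdot> r)"] r(1-3) dX dF(2) by simp
      then have "FMap G (q1 \<cdot> t) x' = inv\<^bsub>FOb G ?A\<^esub> FMap G (s0 \<cdot> (p2 \<cdot> r)) x'"
        unfolding q1t using act_add[OF G, of "f \<cdot> (p1 \<cdot> r)" "neg C (s0 \<cdot> (p2 \<cdot> r))" x']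
          act_neg[OF G, of "s0 \<cdot> (p2 \<cdot> r)" x'] r(1-3) s0 dX dF(2) x' sr by (simp del: act_cmp act_neg)
      moreover have "FMap G (q2 \<cdot> t) w = FMap G (s0 \<cdot> (p2 \<cdot> r)) x'"
        unfolding q2t using hw[of "p2 \<cdot> r"] r(1-3) dX by simp
      ultimately show "FMap G t y = \<one>\<^bsub>FOb G ?A\<^esub>" using acty[OF t] sr by simp
    qed
  qed (use G T y in auto)
  then show ?thesis using that[OF s] sk unfolding T_def by blast
qed

text \<open>If \<open>u\<close> writes the new generator in terms of the old one and
  \<open>v\<close> the old in terms of the new, the relations of the new generator are spanned by
  \<open>1 - v \<cdot> u\<close> and \<open>v \<cdot> h0\<close>.\<close>

lemma pres_change_generator:
  assumes H: "pres C h0 H z0" and Y: "Y \<in> Ob C" and z: "z \<in> el H Y"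
    and gen: "\<And>A v. \<lbrakk>A \<in> Ob C; v \<in> el H A\<rbrakk> \<Longrightarrow> \<exists>t. arr C t \<and> src C t = A \<and> tgt C t = Y \<and> FMap H t z = v"
  obtains h where "pres C h H z" "tgt C h = Y"
proof -
  note d = presD[OF H]
  let ?B = "tgt C h0"
  obtain u where u: "arr C u" "src C u = Y" "tgt C u = ?B" "FMap H u z0 = z" using d(4)[OF Y z] by blast
  obtain v where v: "arr C v" "src C v = ?B" "tgt C v = Y" "FMap H v z = z0" using gen[of ?B z0] d by auto
  obtain P i j p q where b: "biprod C P Y (src C h0) i j p q" using biprod_ex[of Y "src C h0"] Y d(2) by auto
  note db = biprodD[OF b]
  \<comment> \<open>An arrow \<open>t\<close> killing \<open>z\<close> satisfies
    \<open>u \<cdot> t = h0 \<cdot> r\<close> for some \<open>r\<close>, whence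
    \<open>t = (1 - v \<cdot> u) \<cdot> t + v \<cdot> h0 \<cdot> r\<close>.\<close>
  define h where "h = (Idt C Y \<boxplus> neg C (v \<cdot> u)) \<cdot> p \<boxplus> (v \<cdot> h0) \<cdot> q"
  have h: "arr C h" "src C h = P" "tgt C h = Y" unfolding h_def using u v db d(2) by simp_all
  have ut: "FMap H t z = FMap H (u \<cdot> t) z0" if "arr C t" "tgt C t = Y" for t
    using act_cmp[OF d(1) that(1) u(1), of z0] that u d(3) by simp
  have "pres C h H z" unfolding pres_def
  proof (intro conjI ballI allI impI)
    fix t assume "arr C t" "tgt C t = tgt C h"
    then have t: "arr C t" "tgt C t = Y" using h by simp_all
    show "FMap H t z = \<one>\<^bsub>FOb H (src C t)\<^esub> \<longleftrightarrow> factors C t h"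
    proof
      assume "FMap H t z = \<one>\<^bsub>FOb H (src C t)\<^esub>"
      then have "factors C (u \<cdot> t) h0" using ut[OF t] d(5)[of "u \<cdot> t"] t u by simp
      then obtain r where r: "arr C r" "src C r = src C t" "tgt C r = src C h0" "h0 \<cdot> r = u \<cdot> t"
        using t u by (auto simp: factors_def)
      have "h \<cdot> (i \<cdot> t \<boxplus> j \<cdot> r) = t"
        unfolding h_def using r t u v db d(2) by (simp add: add_assoc)
      then show "factors C t h" unfolding factors_def
        by (intro exI[of _ "i \<cdot> t \<boxplus> j \<cdot> r"]) (use r t db h in simp)
    next
      assume "factors C t h"
      then obtain r where r: "arr C r" "src C r = src C t" "tgt C r = P" "h \<cdot> r = t"
        using h by (auto simp: factors_def)
      have e1: "FMap H (p \<cdot> r) z = FMap H (v \<cdot> (u \<cdot> (p \<cdot> r))) z"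
        using ut[of "p \<cdot> r"] act_cmp[OF d(1), of "u \<cdot> (p \<cdot> r)" v z] u v db r z d(3) by simp
      have e2: "FMap H (v \<cdot> (h0 \<cdot> (q \<cdot> r))) z = \<one>\<^bsub>FOb H (src C t)\<^esub>"
      proof -
        have "FMap H (v \<cdot> (h0 \<cdot> (q \<cdot> r))) z = FMap H (h0 \<cdot> (q \<cdot> r)) z0"
          using act_cmp[OF d(1), of "h0 \<cdot> (q \<cdot> r)" v z] u v db r z d(2) by simp
        also have "factors C (h0 \<cdot> (q \<cdot> r)) h0"
          using factors_cmp[OF factors_refl[OF d(2)] d(2), of "q \<cdot> r"] r db by simp
        then have "FMap H (h0 \<cdot> (q \<cdot> r)) z0 = \<one>\<^bsub>FOb H (src C t)\<^esub>"
          using d(5)[of "h0 \<cdot> (q \<cdot> r)"] r(1-3) db d(2) by simp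
        finally show ?thesis .
      qed
      interpret HA: comm_group "FOb H (src C t)" by (rule mod_comm_group[OF d(1)]) (use t in simp)
      have c: "FMap H (v \<cdot> (u \<cdot> (p \<cdot> r))) z \<in> el H (src C t)" using d(1,3) u v db r z by simp
      have "t = (p \<cdot> r \<boxplus> neg C (v \<cdot> (u \<cdot> (p \<cdot> r)))) \<boxplus> v \<cdot> (h0 \<cdot> (q \<cdot> r))"
        unfolding r(4)[symmetric] h_def using r(1-3) u v db d(2) by simp
      then have "FMap H t z = FMap H ((p \<cdot> r \<boxplus> neg C (v \<cdot> (u \<cdot> (p \<cdot> r)))) \<boxplus> v \<cdot> (h0 \<cdot> (q \<cdot> r))) z" by simp
      also have "\<dots> = \<one>\<^bsub>FOb H (src C t)\<^esub>"
        using act_add[OF d(1), of "p \<cdot> r \<boxplus> neg C (v \<cdot> (u \<cdot> (p \<cdot> r)))" "v \<cdot> (h0 \<cdot> (q \<cdot> r))" z]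
          act_add[OF d(1), of "p \<cdot> r" "neg C (v \<cdot> (u \<cdot> (p \<cdot> r)))" z]
          act_neg[OF d(1), of "v \<cdot> (u \<cdot> (p \<cdot> r))" z] e1 e2 c r(1-3) u v db d(2) z
        by (simp del: act_cmp act_neg)
      finally show "FMap H t z = \<one>\<^bsub>FOb H (src C t)\<^esub>" .
    qed
  qed (use d(1) h z gen in auto)
  then show ?thesis using that h by blast
qed

text \<open>With the image of the generator of \<open>G\<close> as generator of \<open>H\<close>,
  both presentations share a target and \<open>g = h \<cdot> w\<close>. The kernel is then the image
  of \<open>Hom(-,h)\<close> modulo that of \<open>Hom(-,g)\<close>, so it is generated over
  \<open>src C h\<close> with relations \<open>w\<close> and \<open>k\<close>.\<close>

lemma short_exact_deflation_kernel:
  assumes se: "short_exact C F G H" and F: "F \<in> Modules C"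
    and G: "pres C g G y" and H: "pres C h0 H z0"
  obtains h z w where "pres C h H z" "arr C w" "src C w = src C g" "tgt C w = src C h" "h \<cdot> w = g"
    "\<And>k P i j \<pi> \<rho>. \<lbrakk>ker_of C k h; biprod C P (src C w) (src C k) i j \<pi> \<rho>\<rbrakk> \<Longrightarrow>
      \<exists>x. pres C (w \<cdot> \<pi> \<boxplus> k \<cdot> \<rho>) F x"
proof -
  note dG = presD[OF G] and dH0 = presD[OF H]
  obtain \<eta> \<theta> where \<eta>: "nat_trans C F G \<eta>" and \<theta>: "nat_trans C G H \<theta>"
    and mono: "\<And>A v. \<lbrakk>A \<in> Ob C; v \<in> el F A; \<eta> A v = \<one>\<^bsub>FOb G A\<^esub>\<rbrakk> \<Longrightarrow> v = \<one>\<^bsub>FOb F A\<^esub>"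
    and comp: "\<And>A v. \<lbrakk>A \<in> Ob C; v \<in> el F A\<rbrakk> \<Longrightarrow> \<theta> A (\<eta> A v) = \<one>\<^bsub>FOb H A\<^esub>"
    and ex: "\<And>A v. \<lbrakk>A \<in> Ob C; v \<in> el G A; \<theta> A v = \<one>\<^bsub>FOb H A\<^esub>\<rbrakk> \<Longrightarrow> \<exists>u\<in>el F A. v = \<eta> A u"
    and epi: "\<And>A v. \<lbrakk>A \<in> Ob C; v \<in> el H A\<rbrakk> \<Longrightarrow> \<exists>u\<in>el G A. v = \<theta> A u"
    using short_exactE[OF se F dG(1) dH0(1)] by blast
  let ?Y = "tgt C g"
  define z where "z = \<theta> ?Y y"
  have z: "z \<in> el H ?Y" unfolding z_def using nt_closed[OF \<theta>] dG by simp
  have \<theta>y: "\<theta> (src C t) (FMap G t y) = FMap H t z" if "arr C t" "tgt C t = ?Y" for t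
    unfolding z_def using nt_natural[OF \<theta> that(1), of y] that dG by simp
  have gen: "\<exists>t. arr C t \<and> src C t = A \<and> tgt C t = ?Y \<and> FMap H t z = v" if A: "A \<in> Ob C" "v \<in> el H A" for A v
  proof -
    obtain u where u: "u \<in> el G A" "v = \<theta> A u" using epi[OF A] by blast
    obtain t where "arr C t" "src C t = A" "tgt C t = ?Y" "FMap G t y = u" using dG(4)[OF A(1) u(1)] by blast
    then show ?thesis using \<theta>y[of t] u by auto
  qed
  obtain h where h: "pres C h H z" "tgt C h = ?Y"
    by (rule pres_change_generator[OF H _ z gen]) (use dG in auto)
  note dH = presD[OF h(1)]
  have "FMap H g z = \<one>\<^bsub>FOb H (src C g)\<^esub>"
    using \<theta>y[of g] pres_rel[OF G] nt_one[OF \<theta> dG(1) dH(1)] dG(2) by simp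
  then have "factors C g h" using dH(5)[of g] dG(2) h(2) by simp
  then obtain w where w: "arr C w" "src C w = src C g" "tgt C w = src C h" "h \<cdot> w = g"
    by (auto simp: factors_def)
  have hy: "FMap G h y \<in> el G (src C h)" using dG(1,3) dH(2) h(2) by simp
  have "\<theta> (src C h) (FMap G h y) = \<one>\<^bsub>FOb H (src C h)\<^esub>"
    using \<theta>y[of h] pres_rel[OF h(1)] dH(2) h(2) by simp
  \<comment> \<open>The multiple of \<open>y\<close> by \<open>h\<close> dies in \<open>H\<close>;
    its preimage in \<open>F\<close> is the generator over \<open>src C h\<close>.\<close>
  then obtain x where x: "x \<in> el F (src C h)" "FMap G h y = \<eta> (src C h) x"
    using ex[of "src C h" "FMap G h y"] hy dH(2) by auto
  have \<eta>x: "\<eta> (src C t) (FMap F t x) = FMap G (h \<cdot> t) y" if "arr C t" "tgt C t = src C h" for t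
    using nt_natural[OF \<eta> that(1), of x] act_cmp[OF dG(1) that(1) dH(2), of y] that x dG(3) h(2) by simp
  have "\<exists>x. pres C (w \<cdot> \<pi> \<boxplus> k \<cdot> \<rho>) F x"
    if k: "ker_of C k h" and b: "biprod C P (src C w) (src C k) i j \<pi> \<rho>" for k P i j \<pi> \<rho>
  proof (rule exI[of _ x])
    note kd = ker_ofD[OF k] and d = biprodD[OF b]
    let ?T = "w \<cdot> \<pi> \<boxplus> k \<cdot> \<rho>"
    have T: "arr C ?T" "src C ?T = P" "tgt C ?T = src C h" using w kd d by simp_all
    have h0: "h \<cdot> (k \<cdot> t) = zer C (src C t) (tgt C h)" if "arr C t" "tgt C t = src C k" for t
      using kd(6)[OF that] .
    show "pres C ?T F x" unfolding pres_def
    proof (intro conjI ballI allI impI)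
      fix A v assume A: "A \<in> Ob C" "v \<in> el F A"
      obtain t where t: "arr C t" "src C t = A" "tgt C t = ?Y" "FMap G t y = \<eta> A v"
        using dG(4)[OF A(1) nt_closed[OF \<eta> A]] by blast
      have "FMap H t z = \<one>\<^bsub>FOb H A\<^esub>" using \<theta>y[of t] comp[OF A] t by simp
      then have "factors C t h" using dH(5)[of t] t h(2) by simp
      then obtain r where r: "arr C r" "src C r = A" "tgt C r = src C h" "h \<cdot> r = t"
        using t by (auto simp: factors_def)
      have "\<eta> A (FMap F r x) = \<eta> A v" using \<eta>x[of r] r t by simp
      moreover have "nt_mono C F \<eta>" by (rule nt_monoI[OF \<eta> F dG(1)]) (use mono in auto)
      ultimately have "FMap F r x = v"
        using A r x F unfolding nt_mono_def inj_on_def by simp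
      then show "\<exists>g. arr C g \<and> src C g = A \<and> tgt C g = tgt C ?T \<and> FMap F g x = v"
        using r T by (intro exI[of _ r]) simp
    next
      fix t assume "arr C t" "tgt C t = tgt C ?T"
      then have t: "arr C t" "tgt C t = src C h" using T by simp_all
      have "FMap F t x \<in> el F (src C t)" using t x F by simp
      then have "FMap F t x = \<one>\<^bsub>FOb F (src C t)\<^esub> \<longleftrightarrow> FMap G (h \<cdot> t) y = \<one>\<^bsub>FOb G (src C t)\<^esub>"
        using \<eta>x[OF t] mono[of "src C t" "FMap F t x"] nt_one[OF \<eta> F dG(1), of "src C t"] t(1)
        by (metis src_tgt_Ob(1))
      also have "\<dots> \<longleftrightarrow> factors C (h \<cdot> t) g" using dG(5)[of "h \<cdot> t"] t dH(2) h(2) by simp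
      also have "\<dots> \<longleftrightarrow> factors C t ?T"
      proof
        assume "factors C (h \<cdot> t) g"
        then obtain r where r: "arr C r" "src C r = src C t" "tgt C r = src C g" "g \<cdot> r = h \<cdot> t"
          using t dH(2) by (auto simp: factors_def)
        have "h \<cdot> (w \<cdot> r) = h \<cdot> t" using cmp_red[OF w(4)] r w dH(2) by simp
        then have "h \<cdot> (t \<boxplus> neg C (w \<cdot> r)) = zer C (src C (t \<boxplus> neg C (w \<cdot> r))) (tgt C h)"
          "arr C (t \<boxplus> neg C (w \<cdot> r))" "tgt C (t \<boxplus> neg C (w \<cdot> r)) = src C h"
          using r(1-3) w(1-3) t dH(2) by simp_all
        then obtain l where "arr C l" "src C l = src C (t \<boxplus> neg C (w \<cdot> r))" "tgt C l = src C k"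
          "k \<cdot> l = t \<boxplus> neg C (w \<cdot> r)" using ker_lift[OF k] by metis
        then have l: "arr C l" "src C l = src C t" "tgt C l = src C k" "k \<cdot> l = t \<boxplus> neg C (w \<cdot> r)"
          using r(1-3) w(1-3) t by simp_all
        have "?T \<cdot> (i \<cdot> r \<boxplus> j \<cdot> l) = t"
          using r(1-3) w(1-3) l t kd(2,4) d by (simp add: add_ac)
        then show "factors C t ?T" unfolding factors_def T(2)
          by (intro exI[of _ "i \<cdot> r \<boxplus> j \<cdot> l"]) (use r(1-3) w(1-3) l t d in simp)
      next
        assume "factors C t ?T"
        then obtain r where r: "arr C r" "src C r = src C t" "tgt C r = P" "?T \<cdot> r = t"
          unfolding factors_def T(2) by auto
        have "h \<cdot> t = g \<cdot> (\<pi> \<cdot> r)"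
          unfolding r(4)[symmetric] using r(1-3) w kd(2,4) d dH(2) h0 cmp_red[OF w(4)] dG(2) h(2) by simp
        then show "factors C (h \<cdot> t) g" unfolding factors_def
          by (intro exI[of _ "\<pi> \<cdot> r"]) (use r(1-3) d w t dH(2) dG(2) in simp)
      qed
      finally show "FMap F t x = \<one>\<^bsub>FOb F (src C t)\<^esub> \<longleftrightarrow> factors C t ?T" .
    qed (use F T x in auto)
  qed
  then show ?thesis using that[OF h(1) w] by blast
qed

lemma pres_nt_iso:
  assumes iso: "nt_iso C F G" and G: "G \<in> Modules C" and F: "pres C f F x"
  shows "\<exists>y. pres C f G y"
proof -
  note d = presD[OF F]
  obtain \<eta> where \<eta>: "nat_trans C F G \<eta>"
    and bij: "\<And>A. A \<in> Ob C \<Longrightarrow> bij_betw (\<eta> A) (el F A) (el G A)"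
    using iso unfolding nt_iso_def by blast
  let ?y = "\<eta> (tgt C f) x"
  have nat: "\<eta> (src C t) (FMap F t x) = FMap G t ?y" if "arr C t" "tgt C t = tgt C f" for t
    using nt_natural[OF \<eta> that(1), of x] that d(3) by simp
  have "pres C f G ?y" unfolding pres_def
  proof (intro conjI ballI allI impI)
    fix A v assume A: "A \<in> Ob C" "v \<in> el G A"
    then obtain u where u: "u \<in> el F A" "v = \<eta> A u" using bij[OF A(1)] by (auto simp: bij_betw_def)
    obtain t where "arr C t" "src C t = A" "tgt C t = tgt C f" "FMap F t x = u" using d(4)[OF A(1) u(1)] by blast
    then show "\<exists>g. arr C g \<and> src C g = A \<and> tgt C g = tgt C f \<and> FMap G g ?y = v" using nat[of t] u by auto
  next
    fix t assume t: "arr C t" "tgt C t = tgt C f"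
    have "FMap G t ?y = \<one>\<^bsub>FOb G (src C t)\<^esub> \<longleftrightarrow> \<eta> (src C t) (FMap F t x) = \<eta> (src C t) \<one>\<^bsub>FOb F (src C t)\<^esub>"
      using nat[OF t] nt_one[OF \<eta> d(1) G, of "src C t"] t by simp
    also have "\<dots> \<longleftrightarrow> FMap F t x = \<one>\<^bsub>FOb F (src C t)\<^esub>"
      using bij[of "src C t"] t d monoid.one_closed[OF mod_monoid[OF d(1)], of "src C t"]
      unfolding bij_betw_def by (intro inj_on_eq_iff) auto
    finally show "FMap G t ?y = \<one>\<^bsub>FOb G (src C t)\<^esub> \<longleftrightarrow> factors C t f" using d(5)[OF t] by simp
  qed (use G d nt_closed[OF \<eta>] in auto)
  then show ?thesis by blast
qed

lemma nt_iso_pres: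
  assumes F: "pres C f F x" and G: "pres C f G y"
  shows "nt_iso C F G"
proof -
  note d = presD[OF F] and dG = presD[OF G]
  obtain \<eta> where \<eta>: "nat_trans C F G \<eta>"
    and \<eta>x: "\<And>t. \<lbrakk>arr C t; tgt C t = tgt C f\<rbrakk> \<Longrightarrow> \<eta> (src C t) (FMap F t x) = FMap G t y"
    using pres_map[OF F dG(1,3) pres_rel[OF G]] by metis
  have "bij_betw (\<eta> A) (el F A) (el G A)" if A: "A \<in> Ob C" for A
  proof -
    have "nt_mono C F \<eta>"
    proof (rule nt_monoI[OF \<eta> d(1) dG(1)])
      fix A u assume A: "A \<in> Ob C" "u \<in> el F A" "\<eta> A u = \<one>\<^bsub>FOb G A\<^esub>"
      obtain t where "arr C t" "src C t = A" "tgt C t = tgt C f" "FMap F t x = u" using d(4)[OF A(1,2)] by blast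
      then show "u = \<one>\<^bsub>FOb F A\<^esub>" using \<eta>x[of t] A(3) d(5)[of t] dG(5)[of t] by simp
    qed
    moreover have "\<eta> A ` el F A = el G A"
    proof (intro equalityI subsetI)
      fix v assume "v \<in> el G A"
      then obtain t where t: "arr C t" "src C t = A" "tgt C t = tgt C f" "FMap G t y = v" using dG(4) A by blast
      then have "v = \<eta> A (FMap F t x)" using \<eta>x[of t] by simp
      then show "v \<in> \<eta> A ` el F A" using t d by auto
    qed (use nt_closed[OF \<eta> A] in auto)
    ultimately show ?thesis using A unfolding bij_betw_def nt_mono_def by blast
  qed
  then show ?thesis using \<eta> unfolding nt_iso_def by blast
qed

end

section \<open>Stable retracts of presented modules\<close>

context stably_closed
begin

text \<open>A stable retraction lifts to maps between presentations that compose to the identity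
  only up to three errors: a homotopy \<open>\<sigma>\<close>, a map through \<open>W\<close>, and
  an endomorphism \<open>N\<close> of the source killed by \<open>f'\<close>. Enlarging
  \<open>f\<close> by an identity, a zero source summand and a zero target summand absorbs them, so
  \<open>f'\<close> becomes an honest retract of the enlarged arrow.\<close>

lemma stable_retract_mem:
  assumes F: "pres C f F x" and fM: "f \<in> M" and F': "pres C f' F' x'"
    and \<eta>: "nat_trans C F' F \<eta>" and \<theta>: "nat_trans C F F' \<theta>"
    and st: "stable_eq C F' F' (\<lambda>A y. \<theta> A (\<eta> A y)) (\<lambda>A y. y)"
  shows "f' \<in> M"
proof -
  note d = presD[OF F] and d' = presD[OF F']
  let ?X = "src C f" and ?Y = "tgt C f" and ?X' = "src C f'" and ?Y' = "tgt C f'"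
  obtain W \<alpha> \<beta> where W: "W \<in> Ob C" and \<alpha>: "nat_trans C F' (Yon C W) \<alpha>" and \<beta>: "nat_trans C (Yon C W) F' \<beta>"
    and e: "\<And>A y. \<lbrakk>A \<in> Ob C; y \<in> el F' A\<rbrakk> \<Longrightarrow> \<theta> A (\<eta> A y) = y \<otimes>\<^bsub>FOb F' A\<^esub> \<beta> A (\<alpha> A y)"
    using st unfolding stable_eq_def by blast
  \<comment> \<open>The arrows \<open>b\<close> and \<open>c0\<close> represent
    \<open>\<eta>\<close> and \<open>\<theta>\<close> on generators; \<open>a\<close> and
    \<open>c\<close> cover them on the sources.\<close>
  obtain b where b: "arr C b" "src C b = ?Y'" "tgt C b = ?Y" "FMap F b x = \<eta> ?Y' x'"
    using d(4)[of ?Y' "\<eta> ?Y' x'"] nt_closed[OF \<eta>, of ?Y' x'] d' by auto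
  obtain c0 where c0: "arr C c0" "src C c0 = ?Y" "tgt C c0 = ?Y'" "FMap F' c0 x' = \<theta> ?Y x"
    using d'(4)[of ?Y "\<theta> ?Y x"] nt_closed[OF \<theta>, of ?Y x] d by auto
  have "FMap F (b \<cdot> f') x = \<one>\<^bsub>FOb F ?X'\<^esub>"
    using act_cmp[OF d(1), of f' b x] nt_natural[OF \<eta>, of f' x'] pres_rel[OF F'] nt_one[OF \<eta> d'(1) d(1), of ?X'] b d(2,3) d'(2,3)
    by simp
  then have "factors C (b \<cdot> f') f" using d(5)[of "b \<cdot> f'"] b d'(2) by simp
  then obtain a where a: "arr C a" "src C a = ?X'" "tgt C a = ?X" "f \<cdot> a = b \<cdot> f'"
    using b d'(2) by (auto simp: factors_def)
  have "FMap F' (c0 \<cdot> f) x' = \<one>\<^bsub>FOb F' ?X\<^esub>"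
    using act_cmp[OF d'(1), of f c0 x'] nt_natural[OF \<theta>, of f x] pres_rel[OF F] nt_one[OF \<theta> d(1) d'(1), of ?X] c0 d(2,3) d'(2,3)
    by simp
  then have "factors C (c0 \<cdot> f) f'" using d'(5)[of "c0 \<cdot> f"] c0 d(2) by simp
  then obtain c where c: "arr C c" "src C c = ?X" "tgt C c = ?X'" "f' \<cdot> c = c0 \<cdot> f"
    using c0 d(2) by (auto simp: factors_def)
  define \<alpha>0 where "\<alpha>0 = \<alpha> ?Y' x'"
  have \<alpha>0: "arr C \<alpha>0" "src C \<alpha>0 = ?Y'" "tgt C \<alpha>0 = W"
    using nt_closed[OF \<alpha>, of ?Y' x'] d' W unfolding \<alpha>0_def by auto
  have \<alpha>f: "\<alpha>0 \<cdot> f' = zer C ?X' W"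
    using nt_natural[OF \<alpha>, of f' x'] pres_rel[OF F'] nt_one[OF \<alpha> d'(1) Yon_Modules[OF W], of ?X'] d'(2,3)
    unfolding \<alpha>0_def by simp
  have \<beta>W: "\<beta> W (Idt C W) \<in> el F' W" using nt_closed[OF \<beta> W, of "Idt C W"] W by simp
  then obtain \<beta>0 where \<beta>0: "arr C \<beta>0" "src C \<beta>0 = W" "tgt C \<beta>0 = ?Y'" "FMap F' \<beta>0 x' = \<beta> W (Idt C W)"
    using d'(4)[OF W] by blast
  have "\<beta> ?Y' (\<alpha> ?Y' x') = FMap F' \<alpha>0 (\<beta> W (Idt C W))"
    using nat_trans_from_Yon[OF \<beta> W \<alpha>0(1,3)] \<alpha>0(2) unfolding \<alpha>0_def by simp
  then have \<beta>\<alpha>: "\<beta> ?Y' (\<alpha> ?Y' x') = FMap F' (\<beta>0 \<cdot> \<alpha>0) x'"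
    using act_cmp[OF d'(1), of \<alpha>0 \<beta>0 x'] \<alpha>0 \<beta>0 d'(3) by simp
  \<comment> \<open>On generators \<open>c0 \<cdot> b\<close> differs from
    \<open>1 + \<beta>0 \<cdot> \<alpha>0\<close> by a relation
    \<open>f' \<cdot> \<sigma>\<close>.\<close>
  have "FMap F' (c0 \<cdot> b) x' = \<theta> ?Y' (\<eta> ?Y' x')"
    using act_cmp[OF d'(1), of b c0 x'] nt_natural[OF \<theta>, of b x] b c0 d(3) d'(3) by simp
  also have "\<dots> = FMap F' (Idt C ?Y' \<boxplus> \<beta>0 \<cdot> \<alpha>0) x'"
    using e[of ?Y' x'] \<beta>\<alpha> act_add[OF d'(1), of "Idt C ?Y'" "\<beta>0 \<cdot> \<alpha>0" x'] d' \<alpha>0 \<beta>0 by simp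
  finally have "factors C (c0 \<cdot> b \<boxplus> neg C (Idt C ?Y' \<boxplus> \<beta>0 \<cdot> \<alpha>0)) f'"
    using pres_eq[OF F', of "c0 \<cdot> b" "Idt C ?Y' \<boxplus> \<beta>0 \<cdot> \<alpha>0"] b c0 \<alpha>0 \<beta>0 d'(2) by simp
  then obtain \<sigma> where \<sigma>: "arr C \<sigma>" "src C \<sigma> = ?Y'" "tgt C \<sigma> = ?X'"
    and \<sigma>4: "f' \<cdot> \<sigma> = c0 \<cdot> b \<boxplus> neg C (Idt C ?Y' \<boxplus> \<beta>0 \<cdot> \<alpha>0)"
    using b c0 \<alpha>0 \<beta>0 d'(2) by (auto simp: factors_def)
  have fa': "arr C f" "arr C f'" using d(2) d'(2) .
  have red: "\<And>t. \<lbrakk>arr C t; tgt C t = ?X'\<rbrakk> \<Longrightarrow> f \<cdot> (a \<cdot> t) = b \<cdot> (f' \<cdot> t)"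
    "\<And>t. \<lbrakk>arr C t; tgt C t = ?X\<rbrakk> \<Longrightarrow> f' \<cdot> (c \<cdot> t) = c0 \<cdot> (f \<cdot> t)"
    "\<And>t. \<lbrakk>arr C t; tgt C t = ?X'\<rbrakk> \<Longrightarrow> \<alpha>0 \<cdot> (f' \<cdot> t) = zer C (src C t) W"
    "\<And>t. \<lbrakk>arr C t; tgt C t = ?Y'\<rbrakk> \<Longrightarrow> f' \<cdot> (\<sigma> \<cdot> t) = c0 \<cdot> (b \<cdot> t) \<boxplus> (neg C t \<boxplus> neg C (\<beta>0 \<cdot> (\<alpha>0 \<cdot> t)))"
    using cmp_red[OF a(4)] cmp_red[OF c(4)] cmp_red[OF \<alpha>f] cmp_red[OF \<sigma>4] a(1-3) b(1-3) c(1-3) c0(1-3) \<alpha>0 \<beta>0(1-3) \<sigma> fa' W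
    by simp_all
  \<comment> \<open>The error on the source, \<open>c \<cdot> a - \<sigma> \<cdot> f' - 1\<close>.
    It is killed by \<open>f'\<close> because \<open>\<alpha>0 \<cdot> f'\<close> is zero.\<close>
  define N where "N = c \<cdot> a \<boxplus> (neg C (\<sigma> \<cdot> f') \<boxplus> neg C (Idt C ?X'))"
  have N: "arr C N" "src C N = ?X'" "tgt C N = ?X'" unfolding N_def using c a \<sigma> fa' by simp_all
  have fN: "f' \<cdot> N = zer C ?X' ?Y'"
    unfolding N_def using red a c \<sigma> b(1-3) c0(1-3) \<alpha>0 \<beta>0(1-3) \<alpha>f fa' by (simp add: add_assoc)
  have redN: "\<And>t. \<lbrakk>arr C t; tgt C t = ?X'\<rbrakk> \<Longrightarrow> f' \<cdot> (N \<cdot> t) = zer C (src C t) ?Y'"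
    using cmp_red[OF fN] N fa' by simp
  obtain P1 i j p q where B1: "biprod C P1 ?X ?X' i j p q" using biprod_ex[of ?X ?X'] fa' by auto
  obtain Q1 i' j' p' q' where B2: "biprod C Q1 ?Y ?X' i' j' p' q'" using biprod_ex[of ?Y ?X'] fa' by auto
  note e1 = biprodD[OF B1] and e2 = biprodD[OF B2]
  obtain P2 i2 j2 \<pi> \<rho> where B3: "biprod C P2 P1 ?X' i2 j2 \<pi> \<rho>" using biprod_ex[of P1 ?X'] e1(1) fa' by auto
  obtain Q2 \<iota> \<kappa> \<mu> \<nu> where B4: "biprod C Q2 Q1 W \<iota> \<kappa> \<mu> \<nu>" using biprod_ex[of Q1 W] e2(1) W by auto
  note e3 = biprodD[OF B3] and e4 = biprodD[OF B4]
  \<comment> \<open>The identity summand on \<open>?X'\<close> carries \<open>\<sigma>\<close>. The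
    second copy of \<open>?X'\<close>, added to the source with zero map, carries \<open>N\<close>,
    and \<open>W\<close>, added to the target, carries
    \<open>\<beta>0 \<cdot> \<alpha>0\<close>.\<close>
  define g1 where "g1 = i' \<cdot> (f \<cdot> p) \<boxplus> j' \<cdot> q"
  have g1: "arr C g1" "src C g1 = P1" "tgt C g1 = Q1" unfolding g1_def using e1 e2 fa' by simp_all
  have g1M: "g1 \<in> M" unfolding g1_def by (rule M_add_Idt[OF fM B1 B2])
  have g2M: "g1 \<cdot> \<pi> \<in> M" using M_proj[OF g1M] B3 g1 by simp
  have g3M: "\<iota> \<cdot> (g1 \<cdot> \<pi>) \<in> M" using M_inj[OF g2M] B4 g1 e3 by simp
  show ?thesis
  proof (rule M_retract[OF g3M])
    \<comment> \<open>In coordinates the sections are \<open>(a, -\<sigma> \<cdot> f', -1)\<close>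
      and \<open>(b, -\<sigma>, -\<alpha>0)\<close>, the retractions \<open>(c, 1, N)\<close> and
      \<open>(c0, f', \<beta>0)\<close>.\<close>
    show "arrow_retract C f' (\<iota> \<cdot> (g1 \<cdot> \<pi>))
      (i2 \<cdot> (i \<cdot> a \<boxplus> neg C (j \<cdot> (\<sigma> \<cdot> f'))) \<boxplus> neg C j2) ((c \<cdot> p \<boxplus> q) \<cdot> \<pi> \<boxplus> N \<cdot> \<rho>)
      (\<iota> \<cdot> (i' \<cdot> b \<boxplus> neg C (j' \<cdot> \<sigma>)) \<boxplus> neg C (\<kappa> \<cdot> \<alpha>0)) ((c0 \<cdot> p' \<boxplus> f' \<cdot> q') \<cdot> \<mu> \<boxplus> \<beta>0 \<cdot> \<nu>)"
      unfolding arrow_retract_def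
    proof (intro conjI)
      show "((c \<cdot> p \<boxplus> q) \<cdot> \<pi> \<boxplus> N \<cdot> \<rho>) \<cdot> (i2 \<cdot> (i \<cdot> a \<boxplus> neg C (j \<cdot> (\<sigma> \<cdot> f'))) \<boxplus> neg C j2) = Idt C ?X'"
        using a(1-3) c(1-3) \<sigma> N fa' e1 e2 e3 e4 unfolding N_def by (simp add: add_ac)
      show "((c0 \<cdot> p' \<boxplus> f' \<cdot> q') \<cdot> \<mu> \<boxplus> \<beta>0 \<cdot> \<nu>) \<cdot> (\<iota> \<cdot> (i' \<cdot> b \<boxplus> neg C (j' \<cdot> \<sigma>)) \<boxplus> neg C (\<kappa> \<cdot> \<alpha>0)) = Idt C ?Y'"
        using b(1-3) c0(1-3) \<sigma> \<sigma>4 \<alpha>0 \<beta>0(1-3) fa' e1 e2 e3 e4 by (simp add: add_ac)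
      show "\<iota> \<cdot> (g1 \<cdot> \<pi>) \<cdot> (i2 \<cdot> (i \<cdot> a \<boxplus> neg C (j \<cdot> (\<sigma> \<cdot> f'))) \<boxplus> neg C j2) =
          (\<iota> \<cdot> (i' \<cdot> b \<boxplus> neg C (j' \<cdot> \<sigma>)) \<boxplus> neg C (\<kappa> \<cdot> \<alpha>0)) \<cdot> f'"
        unfolding g1_def using a b(1-3) \<sigma> \<alpha>0 \<alpha>f fa' e1 e2 e3 e4 W by simp
      show "((c0 \<cdot> p' \<boxplus> f' \<cdot> q') \<cdot> \<mu> \<boxplus> \<beta>0 \<cdot> \<nu>) \<cdot> (\<iota> \<cdot> (g1 \<cdot> \<pi>)) = f' \<cdot> ((c \<cdot> p \<boxplus> q) \<cdot> \<pi> \<boxplus> N \<cdot> \<rho>)"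
        unfolding g1_def using c0(1-3) \<beta>0(1-3) c red redN N fa' e1 e2 e3 e4 W by simp
    qed (use a(1-3) b(1-3) c(1-3) c0(1-3) \<sigma> \<alpha>0 \<beta>0(1-3) N fa' e1 e2 e3 e4 W g1 in simp_all)
  qed
qed

end

section \<open>Grade\<close>

text \<open>Whether the grade is 1 is decided in degrees 0 and 1, so only transformations and the
  first Ext group have to be computed.\<close>

lemma grade_eq_1_iff:
  "grade C F = 1 \<longleftrightarrow> (\<forall>X\<in>Ob C. Ext_vanishes C 0 F (Yon C X)) \<and>
    \<not> (\<forall>X\<in>Ob C. Ext_vanishes C (Suc 0) F (Yon C X))"
proof -
  define V where "V j \<longleftrightarrow> (\<forall>X\<in>Ob C. Ext_vanishes C j F (Yon C X))" for j
  define I where "I = {enat i | i. \<forall>j<i. V j}"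
  have g: "grade C F = Sup I" by (simp add: grade_def I_def V_def)
  have "Sup I = 1 \<longleftrightarrow> V 0 \<and> \<not> V (Suc 0)"
  proof (cases "V 0")
    case False
    then have "i = 0" if "\<forall>j<i. V j" for i :: nat using that by (cases i) auto
    then have "I = {enat 0}" unfolding I_def by auto
    then show ?thesis using False by (simp add: zero_enat_def[symmetric])
  next
    case True
    show ?thesis
    proof (cases "V (Suc 0)")
      case T: True
      have "enat 2 \<in> I" unfolding I_def using T \<open>V 0\<close> by (auto simp: numeral_2_eq_2 less_Suc_eq)
      then have "enat 2 \<le> Sup I" by (rule Sup_upper)
      then show ?thesis using T by (auto simp: one_enat_def)
    next
      case F: False
      then have "i = 0 \<or> i = 1" if "\<forall>j<i. V j" for i :: nat using that
        by (metis One_nat_def linorder_neqE_nat less_one)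
      moreover have "\<forall>j<1. V j" using True by simp
      ultimately have "I = {enat 0, enat 1}" unfolding I_def by auto
      then have "Sup I = 1" by (simp add: one_enat_def zero_enat_def[symmetric] sup_max)
      then show ?thesis using F True by simp
    qed
  qed
  then show ?thesis using g by (simp add: V_def)
qed

section \<open>Groups of transformations and first cohomology\<close>

context additive_category
begin

lemma nat_trans_cong:
  assumes "nat_trans C F G \<eta>" "F \<in> Modules C" "\<And>A x. \<lbrakk>A \<in> Ob C; x \<in> el F A\<rbrakk> \<Longrightarrow> \<eta>' A x = \<eta> A x"
  shows "nat_trans C F G \<eta>'"
  unfolding nat_trans_def
proof (intro conjI ballI)
  fix A assume A: "A \<in> Ob C"
  show "\<eta>' A \<in> hom (FOb F A) (FOb G A)" unfolding hom_def
    using A assms(3) nt_closed[OF assms(1)] nt_mult[OF assms(1)] monoid.m_closed[OF mod_monoid[OF assms(2) A]]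
    by auto
next
  fix A B f x assume "A \<in> Ob C" "B \<in> Ob C" "f \<in> mor C A B" "x \<in> el F B"
  then show "\<eta>' A (FMap F f x) = FMap G f (\<eta>' B x)"
    using assms nt_natural[OF assms(1), of f x] by auto
qed

lemma nat_trans_mult:
  assumes "nat_trans C F G \<eta>" "nat_trans C F G \<theta>" "F \<in> Modules C" "G \<in> Modules C"
  shows "nat_trans C F G (\<lambda>A x. \<eta> A x \<otimes>\<^bsub>FOb G A\<^esub> \<theta> A x)"
  unfolding nat_trans_def
proof (intro conjI ballI)
  fix A assume A: "A \<in> Ob C"
  interpret G: comm_group "FOb G A" by (rule mod_comm_group[OF assms(4) A])
  show "(\<lambda>x. \<eta> A x \<otimes>\<^bsub>FOb G A\<^esub> \<theta> A x) \<in> hom (FOb F A) (FOb G A)" unfolding hom_def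
    using A nt_closed[OF assms(1) A] nt_closed[OF assms(2) A] nt_mult[OF assms(1) A] nt_mult[OF assms(2) A]
    by (auto simp: G.m_ac)
next
  fix A B f x assume "A \<in> Ob C" "B \<in> Ob C" "f \<in> mor C A B" "x \<in> el F B"
  then have f: "arr C f" "src C f = A" "tgt C f = B" "x \<in> el F (tgt C f)" by auto
  show "\<eta> A (FMap F f x) \<otimes>\<^bsub>FOb G A\<^esub> \<theta> A (FMap F f x) = FMap G f (\<eta> B x \<otimes>\<^bsub>FOb G B\<^esub> \<theta> B x)"
    using nt_natural[OF assms(1) f(1,4)] nt_natural[OF assms(2) f(1,4)] f
      act_mult[OF assms(4) f(1), of "\<eta> B x" "\<theta> B x"] nt_closed[OF assms(1), of B x] nt_closed[OF assms(2), of B x]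
      \<open>B \<in> Ob C\<close> by simp
qed

lemma nat_trans_inv:
  assumes "nat_trans C F G \<eta>" "F \<in> Modules C" "G \<in> Modules C"
  shows "nat_trans C F G (\<lambda>A x. inv\<^bsub>FOb G A\<^esub> (\<eta> A x))"
  unfolding nat_trans_def
proof (intro conjI ballI)
  fix A assume A: "A \<in> Ob C"
  interpret G: comm_group "FOb G A" by (rule mod_comm_group[OF assms(3) A])
  show "(\<lambda>x. inv\<^bsub>FOb G A\<^esub> (\<eta> A x)) \<in> hom (FOb F A) (FOb G A)" unfolding hom_def
    using A nt_closed[OF assms(1) A] nt_mult[OF assms(1) A] by (auto simp: G.inv_mult)
next
  fix A B f x assume "A \<in> Ob C" "B \<in> Ob C" "f \<in> mor C A B" "x \<in> el F B"
  then have f: "arr C f" "src C f = A" "tgt C f = B" "x \<in> el F (tgt C f)" "B \<in> Ob C" "A \<in> Ob C" by auto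
  have gh: "group_hom (FOb G B) (FOb G A) (FMap G f)"
    using mod_group[OF assms(3)] f act_hom[OF assms(3) f(1)] by (simp add: group_hom_def group_hom_axioms_def)
  show "inv\<^bsub>FOb G A\<^esub> (\<eta> A (FMap F f x)) = FMap G f (inv\<^bsub>FOb G B\<^esub> (\<eta> B x))"
    using group_hom.hom_inv[OF gh, of "\<eta> B x"] nt_natural[OF assms(1) f(1,4)] f nt_closed[OF assms(1), of B x]
    by simp
qed

lemma nat_trans_one:
  assumes "F \<in> Modules C" "G \<in> Modules C"
  shows "nat_trans C F G (\<lambda>A x. \<one>\<^bsub>FOb G A\<^esub>)"
  unfolding nat_trans_def hom_def
  using monoid.one_closed[OF mod_monoid[OF assms(2)]] monoid.l_one[OF mod_monoid[OF assms(2)]]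
    act_one[OF assms(2)] by auto

lemma nat_trans_restrict:
  assumes "nat_trans C F G \<eta>" "F \<in> Modules C"
  shows "(\<lambda>A\<in>Ob C. \<lambda>x\<in>el F A. \<eta> A x) \<in> carrier (Nat_group C F G)"
  using nat_trans_cong[OF assms, of "\<lambda>A\<in>Ob C. \<lambda>x\<in>el F A. \<eta> A x"] by (simp add: Nat_group_def)

lemma Nat_groupD:
  "\<eta> \<in> carrier (Nat_group C F G) \<Longrightarrow> nat_trans C F G \<eta>"
  by (simp add: Nat_group_def)

lemma Nat_group_eqI:
  assumes "\<eta> \<in> carrier (Nat_group C F G)" "\<theta> \<in> carrier (Nat_group C F G)"
    "\<And>A x. \<lbrakk>A \<in> Ob C; x \<in> el F A\<rbrakk> \<Longrightarrow> \<eta> A x = \<theta> A x"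
  shows "\<eta> = \<theta>"
proof (rule extensionalityI[of _ "Ob C"])
  fix A assume A: "A \<in> Ob C"
  show "\<eta> A = \<theta> A"
    by (rule extensionalityI[of _ "el F A"]) (use assms A in \<open>auto simp: Nat_group_def\<close>)
qed (use assms in \<open>auto simp: Nat_group_def\<close>)

lemma Nat_group_ops:
  "\<lbrakk>A \<in> Ob C; x \<in> el F A\<rbrakk> \<Longrightarrow> (\<eta> \<otimes>\<^bsub>Nat_group C F G\<^esub> \<theta>) A x = \<eta> A x \<otimes>\<^bsub>FOb G A\<^esub> \<theta> A x"
  "\<lbrakk>A \<in> Ob C; x \<in> el F A\<rbrakk> \<Longrightarrow> \<one>\<^bsub>Nat_group C F G\<^esub> A x = \<one>\<^bsub>FOb G A\<^esub>"
  by (simp_all add: Nat_group_def)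

lemma Nat_group_closed:
  assumes "F \<in> Modules C" "G \<in> Modules C"
  shows "\<lbrakk>\<eta> \<in> carrier (Nat_group C F G); \<theta> \<in> carrier (Nat_group C F G)\<rbrakk> \<Longrightarrow>
      \<eta> \<otimes>\<^bsub>Nat_group C F G\<^esub> \<theta> \<in> carrier (Nat_group C F G)"
    and "\<one>\<^bsub>Nat_group C F G\<^esub> \<in> carrier (Nat_group C F G)"
  using nat_trans_restrict[OF nat_trans_mult[OF _ _ assms] assms(1)]
    nat_trans_restrict[OF nat_trans_one[OF assms] assms(1)]
  by (simp_all add: Nat_group_def)

lemma Nat_group_comm_group:
  assumes F: "F \<in> Modules C" and G: "G \<in> Modules C"
  shows "comm_group (Nat_group C F G)" (is "comm_group ?N")
proof (rule comm_groupI)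
  note cl = Nat_group_closed[OF assms]
  have G': "comm_group (FOb G A)" "group (FOb G A)" if "A \<in> Ob C" for A
    using mod_comm_group[OF G that] mod_group[OF G that] .
  show "\<one>\<^bsub>?N\<^esub> \<in> carrier ?N" by (rule cl)
  fix \<eta> assume \<eta>: "\<eta> \<in> carrier ?N"
  have e: "\<eta> A x \<in> el G A" if "A \<in> Ob C" "x \<in> el F A" for A x
    using nt_closed[OF Nat_groupD[OF \<eta>] that] .
  show "\<one>\<^bsub>?N\<^esub> \<otimes>\<^bsub>?N\<^esub> \<eta> = \<eta>"
    by (rule Nat_group_eqI[OF cl(1)[OF cl(2) \<eta>] \<eta>])
      (simp add: Nat_group_ops monoid.l_one[OF mod_monoid[OF G]] e)
  let ?\<iota> = "\<lambda>A\<in>Ob C. \<lambda>x\<in>el F A. inv\<^bsub>FOb G A\<^esub> (\<eta> A x)"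
  have i: "?\<iota> \<in> carrier ?N" using nat_trans_restrict[OF nat_trans_inv[OF Nat_groupD[OF \<eta>] F G] F] .
  have "?\<iota> \<otimes>\<^bsub>?N\<^esub> \<eta> = \<one>\<^bsub>?N\<^esub>"
    by (rule Nat_group_eqI[OF cl(1)[OF i \<eta>] cl(2)])
      (simp add: Nat_group_ops group.l_inv[OF mod_group[OF G]] e)
  then show "\<exists>\<theta>\<in>carrier ?N. \<theta> \<otimes>\<^bsub>?N\<^esub> \<eta> = \<one>\<^bsub>?N\<^esub>" using i by blast
  fix \<theta> assume \<theta>: "\<theta> \<in> carrier ?N"
  have e': "\<theta> A x \<in> el G A" if "A \<in> Ob C" "x \<in> el F A" for A x
    using nt_closed[OF Nat_groupD[OF \<theta>] that] .
  show "\<eta> \<otimes>\<^bsub>?N\<^esub> \<theta> \<in> carrier ?N" by (rule cl(1)[OF \<eta> \<theta>])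
  show "\<eta> \<otimes>\<^bsub>?N\<^esub> \<theta> = \<theta> \<otimes>\<^bsub>?N\<^esub> \<eta>"
    by (rule Nat_group_eqI[OF cl(1)[OF \<eta> \<theta>] cl(1)[OF \<theta> \<eta>]])
      (simp add: Nat_group_ops comm_monoid.m_comm[OF comm_group.axioms(1)[OF G'(1)]] e e')
  fix \<zeta> assume \<zeta>: "\<zeta> \<in> carrier ?N"
  have e'': "\<zeta> A x \<in> el G A" if "A \<in> Ob C" "x \<in> el F A" for A x
    using nt_closed[OF Nat_groupD[OF \<zeta>] that] .
  show "(\<eta> \<otimes>\<^bsub>?N\<^esub> \<theta>) \<otimes>\<^bsub>?N\<^esub> \<zeta> = \<eta> \<otimes>\<^bsub>?N\<^esub> (\<theta> \<otimes>\<^bsub>?N\<^esub> \<zeta>)"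
    by (rule Nat_group_eqI[OF cl(1)[OF cl(1)[OF \<eta> \<theta>] \<zeta>] cl(1)[OF \<eta> cl(1)[OF \<theta> \<zeta>]]])
      (simp add: Nat_group_ops monoid.m_assoc[OF mod_monoid[OF G]] e e' e'')
qed

lemma Ext_vanishes_0_iff:
  assumes "F \<in> Modules C" "G \<in> Modules C"
  shows "Ext_vanishes C 0 F G \<longleftrightarrow>
    (\<forall>\<eta>. nat_trans C F G \<eta> \<longrightarrow> (\<forall>A\<in>Ob C. \<forall>x\<in>el F A. \<eta> A x = \<one>\<^bsub>FOb G A\<^esub>))"
proof
  assume L: "Ext_vanishes C 0 F G"
  show "\<forall>\<eta>. nat_trans C F G \<eta> \<longrightarrow> (\<forall>A\<in>Ob C. \<forall>x\<in>el F A. \<eta> A x = \<one>\<^bsub>FOb G A\<^esub>)"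
  proof (intro allI impI ballI)
    fix \<eta> A x assume \<eta>: "nat_trans C F G \<eta>" and A: "A \<in> Ob C" "x \<in> el F A"
    have "(\<lambda>A\<in>Ob C. \<lambda>x\<in>el F A. \<eta> A x) = \<one>\<^bsub>Nat_group C F G\<^esub>"
      using nat_trans_restrict[OF \<eta> assms(1)] L by simp
    then have "(\<lambda>A\<in>Ob C. \<lambda>x\<in>el F A. \<eta> A x) A x = \<one>\<^bsub>Nat_group C F G\<^esub> A x" by simp
    then show "\<eta> A x = \<one>\<^bsub>FOb G A\<^esub>" using A by (simp add: Nat_group_ops)
  qed
next
  assume R: "\<forall>\<eta>. nat_trans C F G \<eta> \<longrightarrow> (\<forall>A\<in>Ob C. \<forall>x\<in>el F A. \<eta> A x = \<one>\<^bsub>FOb G A\<^esub>)"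
  have "\<eta> = \<one>\<^bsub>Nat_group C F G\<^esub>" if "\<eta> \<in> carrier (Nat_group C F G)" for \<eta>
    by (rule Nat_group_eqI[OF that Nat_group_closed(2)[OF assms]])
      (use R Nat_groupD[OF that] in \<open>simp add: Nat_group_ops\<close>)
  then have "carrier (Nat_group C F G) = {\<one>\<^bsub>Nat_group C F G\<^esub>}"
    using Nat_group_closed(2)[OF assms] by blast
  then show "Ext_vanishes C 0 F G" by simp
qed

lemma projective_resolutionD:
  assumes "projective_resolution C F P d \<epsilon>" and F: "F \<in> Modules C"
  shows "\<And>n. P n \<in> Modules C" "\<And>n. nat_trans C (P (Suc n)) (P n) (d n)" "nat_trans C (P 0) F \<epsilon>"
    "\<And>n A v. \<lbrakk>A \<in> Ob C; v \<in> el (P (Suc n)) A\<rbrakk> \<Longrightarrow>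
      d n A v = \<one>\<^bsub>FOb (P n) A\<^esub> \<longleftrightarrow> (\<exists>u\<in>el (P (Suc (Suc n))) A. v = d (Suc n) A u)"
    "\<And>A v. \<lbrakk>A \<in> Ob C; v \<in> el (P 0) A\<rbrakk> \<Longrightarrow>
      \<epsilon> A v = \<one>\<^bsub>FOb F A\<^esub> \<longleftrightarrow> (\<exists>u\<in>el (P (Suc 0)) A. v = d 0 A u)"
    "\<And>A v. \<lbrakk>A \<in> Ob C; v \<in> el F A\<rbrakk> \<Longrightarrow> \<exists>u\<in>el (P 0) A. v = \<epsilon> A u"
proof -
  note a = assms(1)[unfolded projective_resolution_def]
  show "P n \<in> Modules C" for n using a unfolding projective_def by blast
  show nt: "nat_trans C (P (Suc n)) (P n) (d n)" for n using a by blast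
  show "nat_trans C (P 0) F \<epsilon>" using a by blast
  fix A assume A: "A \<in> Ob C"
  show "d n A v = \<one>\<^bsub>FOb (P n) A\<^esub> \<longleftrightarrow> (\<exists>u\<in>el (P (Suc (Suc n))) A. v = d (Suc n) A u)"
    if "v \<in> el (P (Suc n)) A" for n v
  proof -
    have "d (Suc n) A ` el (P (Suc (Suc n))) A = {v \<in> el (P (Suc n)) A. d n A v = \<one>\<^bsub>FOb (P n) A\<^esub>}"
      using a A unfolding nt_exact_def kernel_def by blast
    then show ?thesis using that by blast
  qed
  show "\<epsilon> A v = \<one>\<^bsub>FOb F A\<^esub> \<longleftrightarrow> (\<exists>u\<in>el (P (Suc 0)) A. v = d 0 A u)" if "v \<in> el (P 0) A" for v
  proof -
    have "d 0 A ` el (P (Suc 0)) A = {v \<in> el (P 0) A. \<epsilon> A v = \<one>\<^bsub>FOb F A\<^esub>}"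
      using a A unfolding nt_exact_def kernel_def by blast
    then show ?thesis using that by blast
  qed
  show "\<exists>u\<in>el (P 0) A. v = \<epsilon> A u" if "v \<in> el F A" for v
    using a A that unfolding nt_epi_def by blast
qed

text \<open>A quotient by coboundaries is trivial when every cocycle is a coboundary; the
  restriction of transformations to extensional functions is removed here as well.\<close>

lemma cohomology_0_trivial_iff:
  assumes P: "\<And>n. P n \<in> Modules C" and d: "\<And>n. nat_trans C (P (Suc n)) (P n) (d n)" and G: "G \<in> Modules C"
  shows "carrier (cohomology C P d G 0) = {\<one>\<^bsub>cohomology C P d G 0\<^esub>} \<longleftrightarrow>
    (\<forall>\<theta>. nat_trans C (P (Suc 0)) G \<theta> \<and>
        (\<forall>A\<in>Ob C. \<forall>b\<in>el (P (Suc (Suc 0))) A. \<theta> A (d (Suc 0) A b) = \<one>\<^bsub>FOb G A\<^esub>) \<longrightarrow>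
      (\<exists>\<phi>. nat_trans C (P 0) G \<phi> \<and> (\<forall>A\<in>Ob C. \<forall>b\<in>el (P (Suc 0)) A. \<theta> A b = \<phi> A (d 0 A b))))"
proof -
  let ?N0 = "Nat_group C (P 0) G" and ?N1 = "Nat_group C (P (Suc 0)) G" and ?N2 = "Nat_group C (P (Suc (Suc 0))) G"
  let ?K = "{\<theta> \<in> carrier ?N1. nt_comp C (P (Suc (Suc 0))) \<theta> (d (Suc 0)) = \<one>\<^bsub>?N2\<^esub>}"
  let ?h = "\<lambda>\<phi>. nt_comp C (P (Suc 0)) \<phi> (d 0)"
  let ?B = "?h ` carrier ?N0"
  interpret N0: comm_group ?N0 by (rule Nat_group_comm_group[OF P G])
  interpret N1: comm_group ?N1 by (rule Nat_group_comm_group[OF P G])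
  interpret N2: comm_group ?N2 by (rule Nat_group_comm_group[OF P G])
  have ntc: "nat_trans C (P (Suc n)) G (\<lambda>A x. \<phi> A (d n A x))" if "nat_trans C (P n) G \<phi>" for \<phi> n
    unfolding nat_trans_def
  proof (intro conjI ballI)
    fix A assume A: "A \<in> Ob C"
    show "(\<lambda>x. \<phi> A (d n A x)) \<in> hom (FOb (P (Suc n)) A) (FOb G A)"
      unfolding hom_def using nt_closed[OF d A] nt_closed[OF that A] nt_mult[OF d A] nt_mult[OF that A] by auto
  next
    fix A B f x assume "A \<in> Ob C" "B \<in> Ob C" "f \<in> mor C A B" "x \<in> el (P (Suc n)) B"
    then show "\<phi> A (d n A (FMap (P (Suc n)) f x)) = FMap G f (\<phi> B (d n B x))"
      using nt_natural[OF d, of f x n] nt_natural[OF that, of f "d n B x"] nt_closed[OF d, of B x n] by auto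
  qed
  have hcl: "nt_comp C (P (Suc n)) \<phi> (d n) \<in> carrier (Nat_group C (P (Suc n)) G)"
    if "nat_trans C (P n) G \<phi>" for \<phi> n
    using nat_trans_restrict[OF ntc[OF that] P] by (simp add: nt_comp_def)
  have hap: "nt_comp C (P (Suc n)) \<phi> (d n) A x = \<phi> A (d n A x)" if "A \<in> Ob C" "x \<in> el (P (Suc n)) A" for \<phi> n A x
    using that by (simp add: nt_comp_def)
  have "?h \<in> hom ?N0 ?N1" unfolding hom_def
  proof (intro CollectI conjI Pi_I ballI)
    fix \<phi> assume \<phi>: "\<phi> \<in> carrier ?N0"
    show c: "?h \<phi> \<in> carrier ?N1" using hcl[OF Nat_groupD[OF \<phi>]] .
    fix \<phi>' assume \<phi>': "\<phi>' \<in> carrier ?N0"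
    have c': "?h \<phi>' \<in> carrier ?N1" using hcl[OF Nat_groupD[OF \<phi>']] .
    have c2: "?h (\<phi> \<otimes>\<^bsub>?N0\<^esub> \<phi>') \<in> carrier ?N1" using hcl[OF Nat_groupD[OF N0.m_closed[OF \<phi> \<phi>']]] .
    show "?h (\<phi> \<otimes>\<^bsub>?N0\<^esub> \<phi>') = ?h \<phi> \<otimes>\<^bsub>?N1\<^esub> ?h \<phi>'"
      by (rule Nat_group_eqI[OF c2 N1.m_closed[OF c c']])
        (simp add: hap Nat_group_ops nt_closed[OF d])
  qed
  then have "group_hom ?N0 ?N1 ?h" by (simp add: group_hom_def group_hom_axioms_def)
  then have sub: "subgroup ?B ?N1" by (rule group_hom.img_is_subgroup)
  have car: "carrier (cohomology C P d G 0) = (\<lambda>a. ?B #>\<^bsub>?N1\<^esub> a) ` ?K"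
    unfolding cohomology_def FactGroup_def RCOSETS_def r_coset_def by auto
  have one: "\<one>\<^bsub>cohomology C P d G 0\<^esub> = ?B" by (simp add: cohomology_def FactGroup_def)
  have "\<one>\<^bsub>?N1\<^esub> \<in> ?K"
  proof -
    have "nt_comp C (P (Suc (Suc 0))) \<one>\<^bsub>?N1\<^esub> (d (Suc 0)) = \<one>\<^bsub>?N2\<^esub>"
      by (rule Nat_group_eqI[OF hcl[OF Nat_groupD[OF N1.one_closed]] N2.one_closed])
        (simp add: hap Nat_group_ops nt_closed[OF d])
    then show ?thesis by simp
  qed
  have eq: "carrier (cohomology C P d G 0) = {\<one>\<^bsub>cohomology C P d G 0\<^esub>} \<longleftrightarrow> ?K \<subseteq> ?B"
    unfolding car one
  proof
    assume L: "(\<lambda>a. ?B #>\<^bsub>?N1\<^esub> a) ` ?K = {?B}"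
    show "?K \<subseteq> ?B"
    proof
      fix a assume a: "a \<in> ?K"
      then have "?B #>\<^bsub>?N1\<^esub> a = ?B" using L by blast
      moreover have "a \<in> ?B #>\<^bsub>?N1\<^esub> a" using N1.rcos_self[OF _ sub] a by simp
      ultimately show "a \<in> ?B" by simp
    qed
  next
    assume R: "?K \<subseteq> ?B"
    have "?B #>\<^bsub>?N1\<^esub> a = ?B" if "a \<in> ?K" for a
      using N1.coset_join2[OF _ sub] that R by blast
    then show "(\<lambda>a. ?B #>\<^bsub>?N1\<^esub> a) ` ?K = {?B}" using \<open>\<one>\<^bsub>?N1\<^esub> \<in> ?K\<close> by auto
  qed
  show ?thesis unfolding eq
  proof (intro iffI allI impI)
    fix \<theta> assume KB: "?K \<subseteq> ?B" and \<theta>: "nat_trans C (P (Suc 0)) G \<theta> \<and>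
        (\<forall>A\<in>Ob C. \<forall>b\<in>el (P (Suc (Suc 0))) A. \<theta> A (d (Suc 0) A b) = \<one>\<^bsub>FOb G A\<^esub>)"
    let ?t = "\<lambda>A\<in>Ob C. \<lambda>x\<in>el (P (Suc 0)) A. \<theta> A x"
    have t: "?t \<in> carrier ?N1" using nat_trans_restrict \<theta> P by blast
    have "nt_comp C (P (Suc (Suc 0))) ?t (d (Suc 0)) = \<one>\<^bsub>?N2\<^esub>"
      by (rule Nat_group_eqI[OF hcl[OF Nat_groupD[OF t]] N2.one_closed])
        (use \<theta> in \<open>simp add: hap Nat_group_ops nt_closed[OF d]\<close>)
    then have "?t \<in> ?B" using KB t by blast
    then obtain \<phi> where \<phi>: "\<phi> \<in> carrier ?N0" "?t = ?h \<phi>" by blast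
    have "\<theta> A b = \<phi> A (d 0 A b)" if "A \<in> Ob C" "b \<in> el (P (Suc 0)) A" for A b
    proof -
      have "?t A b = ?h \<phi> A b" using \<phi>(2) by simp
      then show ?thesis using that by (simp add: hap)
    qed
    then show "\<exists>\<phi>. nat_trans C (P 0) G \<phi> \<and> (\<forall>A\<in>Ob C. \<forall>b\<in>el (P (Suc 0)) A. \<theta> A b = \<phi> A (d 0 A b))"
      using Nat_groupD[OF \<phi>(1)] by blast
  next
    assume R: "\<forall>\<theta>. nat_trans C (P (Suc 0)) G \<theta> \<and>
        (\<forall>A\<in>Ob C. \<forall>b\<in>el (P (Suc (Suc 0))) A. \<theta> A (d (Suc 0) A b) = \<one>\<^bsub>FOb G A\<^esub>) \<longrightarrow>
      (\<exists>\<phi>. nat_trans C (P 0) G \<phi> \<and> (\<forall>A\<in>Ob C. \<forall>b\<in>el (P (Suc 0)) A. \<theta> A b = \<phi> A (d 0 A b)))"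
    show "?K \<subseteq> ?B"
    proof
      fix \<theta> assume "\<theta> \<in> ?K"
      then have \<theta>: "\<theta> \<in> carrier ?N1" "nt_comp C (P (Suc (Suc 0))) \<theta> (d (Suc 0)) = \<one>\<^bsub>?N2\<^esub>" by auto
      have "\<theta> A (d (Suc 0) A b) = \<one>\<^bsub>FOb G A\<^esub>" if "A \<in> Ob C" "b \<in> el (P (Suc (Suc 0))) A" for A b
        using hap[OF that, of \<theta>] \<theta>(2) Nat_group_ops(2)[OF that, of G] by simp
      then obtain \<phi> where \<phi>: "nat_trans C (P 0) G \<phi>" "\<forall>A\<in>Ob C. \<forall>b\<in>el (P (Suc 0)) A. \<theta> A b = \<phi> A (d 0 A b)"
        using R Nat_groupD[OF \<theta>(1)] by blast
      let ?p = "\<lambda>A\<in>Ob C. \<lambda>x\<in>el (P 0) A. \<phi> A x"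
      have p: "?p \<in> carrier ?N0" using nat_trans_restrict[OF \<phi>(1) P] .
      have "\<theta> = ?h ?p"
        by (rule Nat_group_eqI[OF \<theta>(1) hcl[OF Nat_groupD[OF p]]]) (simp add: hap \<phi>(2) nt_closed[OF d])
      then show "\<theta> \<in> ?B" using p by blast
    qed
  qed
qed

section \<open>Projective resolutions and the first Ext group\<close>

lemma pres_zero_iff:
  assumes "pres C (zer C Z A) E y" "is_zero C Z" "A \<in> Ob C" "arr C t" "tgt C t = A"
  shows "FMap E t y = \<one>\<^bsub>FOb E (src C t)\<^esub> \<longleftrightarrow> t = zer C (src C t) A"
proof -
  have Z: "Z \<in> Ob C" using assms by (simp add: is_zero_def)
  have "factors C t (zer C Z A) \<longleftrightarrow> t = zer C (src C t) A"
  proof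
    assume "factors C t (zer C Z A)"
    then obtain r where r: "arr C r" "src C r = src C t" "tgt C r = Z" "zer C Z A \<cdot> r = t"
      using Z assms by (auto simp: factors_def)
    have "zer C Z A \<cdot> r = zer C (src C t) A" using r(1-3) assms(3) by simp
    then show "t = zer C (src C t) A" using r(4) by simp
  next
    assume e: "t = zer C (src C t) A"
    show "factors C t (zer C Z A)"
      using factors_zer[of "zer C Z A" "src C t" A] assms Z e by simp
  qed
  then show ?thesis using presD(5)[OF assms(1), of t] assms Z by simp
qed

text \<open>The module \<open>E\<close> is the copy of \<open>Hom(-,A)\<close> with values in
  \<open>'u\<close>. By Yoneda, lifting a transformation out of \<open>E\<close> amounts to lifting
  the image of its generator.\<close>

lemma projective_pres_zero:
  assumes E: "pres C (zer C Z A) E y" and Z: "is_zero C Z" and A: "A \<in> Ob C"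
  shows "projective C E"
  unfolding projective_def
proof (intro conjI ballI allI impI)
  note dE = presD[OF E]
  have ZO: "Z \<in> Ob C" using Z by (simp add: is_zero_def)
  have tA: "tgt C (zer C Z A) = A" "src C (zer C Z A) = Z" using A ZO by simp_all
  show "E \<in> Modules C" by (rule dE)
  fix F G \<pi> \<phi>
  assume F: "F \<in> Modules C" and G: "G \<in> Modules C"
    and "nat_trans C F G \<pi> \<and> nt_epi C F G \<pi> \<and> nat_trans C E G \<phi>"
  then have \<pi>: "nat_trans C F G \<pi>" "nt_epi C F G \<pi>" and \<phi>: "nat_trans C E G \<phi>" by auto
  have "\<phi> A y \<in> el G A" using nt_closed[OF \<phi> A] dE(3) tA by simp
  then obtain v where v: "v \<in> el F A" "\<pi> A v = \<phi> A y" using \<pi>(2) A unfolding nt_epi_def by force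
  have "FMap F (zer C Z A) v = \<one>\<^bsub>FOb F Z\<^esub>" using F A ZO v by simp
  then obtain \<psi> where \<psi>: "nat_trans C E F \<psi>"
    and \<psi>y: "\<And>g. \<lbrakk>arr C g; tgt C g = A\<rbrakk> \<Longrightarrow> \<psi> (src C g) (FMap E g y) = FMap F g v"
    using pres_map[OF E F, of v] v tA by metis
  show "\<exists>\<psi>. nat_trans C E F \<psi> \<and> (\<forall>B\<in>Ob C. \<forall>x\<in>el E B. \<pi> B (\<psi> B x) = \<phi> B x)"
  proof (intro exI conjI ballI)
    show "nat_trans C E F \<psi>" by (rule \<psi>)
    fix B x assume B: "B \<in> Ob C" "x \<in> el E B"
    then obtain g where g: "arr C g" "src C g = B" "tgt C g = A" "FMap E g y = x" using dE(4) tA by metis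
    show "\<pi> B (\<psi> B x) = \<phi> B x"
      using \<psi>y[of g] nt_natural[OF \<pi>(1), of g v] nt_natural[OF \<phi>, of g y] g v dE(3) tA by simp
  qed
qed

text \<open>The sequence \<open>Hom(-,src k)\<close>, \<open>Hom(-,src f)\<close>,
  \<open>Hom(-,tgt f)\<close> resolves \<open>F\<close> and is continued by zero. Existence matters
  because \<open>Ext_pos\<close> picks a resolution by choice.\<close>

lemma projective_resolution_ex:
  fixes F :: "('o, 'm, 'u) cfunctor"
  assumes e: "inj (e :: 'm set \<Rightarrow> 'u)" and F: "pres C f F x" and k: "ker_of C k f"
  shows "\<exists>P d \<epsilon>. projective_resolution C F P d \<epsilon>"
proof -
  note dF = presD[OF F] and kd = ker_ofD[OF k]
  obtain Z where Z: "is_zero C Z" using zero_obE .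
  then have ZO: "Z \<in> Ob C" by (simp add: is_zero_def)
  \<comment> \<open>From degree 3 on the objects are the zero object \<open>Z\<close>;
    \<open>\<delta> n\<close> is the arrow from degree \<open>n + 1\<close> to degree
    \<open>n\<close>.\<close>
  define A where "A n = (if n = 0 then tgt C f else if n = 1 then src C f else if n = 2 then src C k else Z)" for n :: nat
  define \<delta> where "\<delta> n = (if n = 0 then f else if n = 1 then k else if n = 2 then zer C Z (src C k) else zer C Z Z)" for n :: nat
  have A: "A n \<in> Ob C" for n unfolding A_def using dF(2) kd(2) ZO by simp
  have \<delta>: "arr C (\<delta> n)" "src C (\<delta> n) = A (Suc n)" "tgt C (\<delta> n) = A n" for n
    unfolding A_def \<delta>_def using dF(2) kd(2,4) ZO by (auto simp: numeral_2_eq_2)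
  have fz: "factors C t g" if "arr C t" "arr C g" "tgt C t = tgt C g" "t = zer C (src C t) (tgt C t)" for t g
    using factors_zer[of g "src C t" "tgt C t"] that by simp
  have ex: "\<delta> n \<cdot> t = zer C (src C t) (A n) \<longleftrightarrow> factors C t (\<delta> (Suc n))" if t: "arr C t" "tgt C t = A (Suc n)" for n t
  proof
    assume L: "\<delta> n \<cdot> t = zer C (src C t) (A n)"
    \<comment> \<open>Exactness holds for three different reasons: \<open>k\<close> is a kernel of
      \<open>f\<close>, \<open>k\<close> is monic, and beyond that the object is zero.\<close>
    consider "n = 0" | "n = 1" | "n \<ge> 2" by linarith
    then show "factors C t (\<delta> (Suc n))"
    proof cases
      case 1
      then show ?thesis using ker_lift[OF k, of t] L t kd by (auto simp: A_def \<delta>_def factors_def)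
    next
      case 2
      then have "t = zer C (src C t) (src C k)" using monicD[OF kd(1), of t] L t kd by (simp add: A_def \<delta>_def)
      then show ?thesis using fz[of t "\<delta> (Suc n)"] t \<delta>[of "Suc n"] 2 by (simp add: A_def)
    next
      case 3
      then have "t = zer C (src C t) Z" using tgt_zero[of t] t Z by (simp add: A_def)
      then show ?thesis using fz[of t "\<delta> (Suc n)"] t \<delta>[of "Suc n"] 3 by (simp add: A_def)
    qed
  next
    assume "factors C t (\<delta> (Suc n))"
    then obtain r where r: "arr C r" "src C r = src C t" "tgt C r = A (Suc (Suc n))" "\<delta> (Suc n) \<cdot> r = t"
      using \<delta> by (auto simp: factors_def)
    have "\<delta> n \<cdot> \<delta> (Suc n) = zer C (A (Suc (Suc n))) (A n)"
      unfolding A_def \<delta>_def using dF(2) kd ZO by (auto simp: numeral_2_eq_2)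
    from cmp_red[OF this] have "\<delta> n \<cdot> (\<delta> (Suc n) \<cdot> r) = zer C (src C t) (A n)" using r(1-3) \<delta> A by simp
    then show "\<delta> n \<cdot> t = zer C (src C t) (A n)" using r(4) by simp
  qed
  have "\<exists>(E :: ('o, 'm, 'u) cfunctor) y. pres C (zer C Z (A n)) E y" for n
    using pres_ex[OF e] A ZO by simp
  then obtain P :: "nat \<Rightarrow> ('o, 'm, 'u) cfunctor" and y where P: "\<And>n. pres C (zer C Z (A n)) (P n) (y n)" by metis
  have tz: "tgt C (zer C Z (A n)) = A n" "src C (zer C Z (A n)) = Z" for n using A ZO by simp_all
  note dP = presD[OF P, unfolded tz]
  have P0: "FMap (P n) t (y n) = \<one>\<^bsub>FOb (P n) (src C t)\<^esub> \<longleftrightarrow> t = zer C (src C t) (A n)"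
    if "arr C t" "tgt C t = A n" for n t using pres_zero_iff[OF P Z A that] .
  have "\<exists>\<eta>. nat_trans C (P (Suc n)) (P n) \<eta> \<and> (\<forall>g. arr C g \<longrightarrow> tgt C g = A (Suc n) \<longrightarrow>
      \<eta> (src C g) (FMap (P (Suc n)) g (y (Suc n))) = FMap (P n) (\<delta> n \<cdot> g) (y n))" for n
  proof -
    have v: "FMap (P n) (\<delta> n) (y n) \<in> el (P n) (A (Suc n))" using dP(1,3) \<delta> by simp
    then have "FMap (P n) (zer C Z (A (Suc n))) (FMap (P n) (\<delta> n) (y n)) = \<one>\<^bsub>FOb (P n) Z\<^esub>"
      using dP(1) A ZO by simp
    then obtain \<eta> where "nat_trans C (P (Suc n)) (P n) \<eta>"
      "\<And>g. \<lbrakk>arr C g; tgt C g = A (Suc n)\<rbrakk> \<Longrightarrow>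
        \<eta> (src C g) (FMap (P (Suc n)) g (y (Suc n))) = FMap (P n) g (FMap (P n) (\<delta> n) (y n))"
      using pres_map[OF P dP(1), of _ n] v tz by metis
    then show ?thesis using act_cmp[OF dP(1) _ \<delta>(1)] \<delta>(2,3) dP(3) by (intro exI[of _ \<eta>]) simp
  qed
  then obtain d where d: "\<And>n. nat_trans C (P (Suc n)) (P n) (d n)"
    and dy: "\<And>n g. \<lbrakk>arr C g; tgt C g = A (Suc n)\<rbrakk> \<Longrightarrow>
      d n (src C g) (FMap (P (Suc n)) g (y (Suc n))) = FMap (P n) (\<delta> n \<cdot> g) (y n)" by metis
  have A0: "A 0 = tgt C f" and \<delta>0: "\<delta> 0 = f" by (simp_all add: A_def \<delta>_def)
  obtain \<epsilon> where \<epsilon>: "nat_trans C (P 0) F \<epsilon>"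
    and \<epsilon>y: "\<And>g. \<lbrakk>arr C g; tgt C g = A 0\<rbrakk> \<Longrightarrow> \<epsilon> (src C g) (FMap (P 0) g (y 0)) = FMap F g x"
  proof -
    have x: "x \<in> el F (A 0)" "FMap F (zer C Z (A 0)) x = \<one>\<^bsub>FOb F Z\<^esub>" using dF A ZO A0 by simp_all
    show ?thesis using pres_map[OF P dF(1), of x 0] x tz that by metis
  qed
  have "projective_resolution C F P d \<epsilon>" unfolding projective_resolution_def
  proof (intro conjI allI)
    show "projective C (P n)" for n by (rule projective_pres_zero[OF P Z A])
    show "nat_trans C (P (Suc n)) (P n) (d n)" for n by (rule d)
    show "nat_trans C (P 0) F \<epsilon>" by (rule \<epsilon>)
    show "nt_exact C (P (Suc (Suc n))) (P (Suc n)) (P n) (d (Suc n)) (d n)" for n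
      unfolding nt_exact_def
    proof (intro ballI equalityI subsetI)
      fix B v assume B: "B \<in> Ob C" "v \<in> d (Suc n) B ` el (P (Suc (Suc n))) B"
      then obtain u where u: "u \<in> el (P (Suc (Suc n))) B" "v = d (Suc n) B u" by blast
      then obtain r where r: "arr C r" "src C r = B" "tgt C r = A (Suc (Suc n))" "u = FMap (P (Suc (Suc n))) r (y (Suc (Suc n)))"
        using dP(4)[OF B(1)] by metis
      have v: "v = FMap (P (Suc n)) (\<delta> (Suc n) \<cdot> r) (y (Suc n))" using dy[of r "Suc n"] r u by simp
      have "factors C (\<delta> (Suc n) \<cdot> r) (\<delta> (Suc n))"
        using factors_cmp[OF factors_refl[OF \<delta>(1)] \<delta>(1) r(1)] r \<delta> by simp
      then have "\<delta> n \<cdot> (\<delta> (Suc n) \<cdot> r) = zer C B (A n)" using ex[of "\<delta> (Suc n) \<cdot> r" n] r \<delta> by simp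
      then have "d n B v = \<one>\<^bsub>FOb (P n) B\<^esub>"
        using dy[of "\<delta> (Suc n) \<cdot> r" n] P0[of "\<delta> n \<cdot> (\<delta> (Suc n) \<cdot> r)" n] r v \<delta> A B(1) by simp
      then show "v \<in> kernel (FOb (P (Suc n)) B) (FOb (P n) B) (d n B)"
        using nt_closed[OF d B(1) u(1)] u(2) by (simp add: kernel_def)
    next
      fix B v assume B: "B \<in> Ob C" "v \<in> kernel (FOb (P (Suc n)) B) (FOb (P n) B) (d n B)"
      then have v: "v \<in> el (P (Suc n)) B" "d n B v = \<one>\<^bsub>FOb (P n) B\<^esub>" by (auto simp: kernel_def)
      then obtain t where t: "arr C t" "src C t = B" "tgt C t = A (Suc n)" "v = FMap (P (Suc n)) t (y (Suc n))"
        using dP(4)[OF B(1)] by metis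
      have "\<delta> n \<cdot> t = zer C B (A n)" using dy[of t n] P0[of "\<delta> n \<cdot> t" n] t v \<delta> by simp
      then have "factors C t (\<delta> (Suc n))" using ex[of t n] t by simp
      then obtain r where r: "arr C r" "src C r = B" "tgt C r = A (Suc (Suc n))" "\<delta> (Suc n) \<cdot> r = t"
        using t \<delta> by (auto simp: factors_def)
      have "v = d (Suc n) B (FMap (P (Suc (Suc n))) r (y (Suc (Suc n))))" using dy[of r "Suc n"] r t by simp
      then show "v \<in> d (Suc n) B ` el (P (Suc (Suc n))) B" using r dP(1,3) by auto
    qed
    show "nt_exact C (P (Suc 0)) (P 0) F (d 0) \<epsilon>" unfolding nt_exact_def
    proof (intro ballI equalityI subsetI)
      fix B v assume B: "B \<in> Ob C" "v \<in> d 0 B ` el (P (Suc 0)) B"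
      then obtain u where u: "u \<in> el (P (Suc 0)) B" "v = d 0 B u" by blast
      then obtain r where r: "arr C r" "src C r = B" "tgt C r = A (Suc 0)" "u = FMap (P (Suc 0)) r (y (Suc 0))"
        using dP(4)[OF B(1)] by metis
      have v: "v = FMap (P 0) (f \<cdot> r) (y 0)" using dy[of r 0] r u \<delta>0 by simp
      have "factors C (f \<cdot> r) f"
        using factors_cmp[OF factors_refl[OF dF(2)] dF(2) r(1)] r \<delta>(2)[of 0] \<delta>0 by simp
      then have "\<epsilon> B v = \<one>\<^bsub>FOb F B\<^esub>"
        using \<epsilon>y[of "f \<cdot> r"] dF(5)[of "f \<cdot> r"] r v \<delta>[of 0] \<delta>0 by simp
      then show "v \<in> kernel (FOb (P 0) B) (FOb F B) (\<epsilon> B)"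
        using nt_closed[OF d B(1) u(1)] u(2) by (simp add: kernel_def)
    next
      fix B v assume B: "B \<in> Ob C" "v \<in> kernel (FOb (P 0) B) (FOb F B) (\<epsilon> B)"
      then have v: "v \<in> el (P 0) B" "\<epsilon> B v = \<one>\<^bsub>FOb F B\<^esub>" by (auto simp: kernel_def)
      then obtain t where t: "arr C t" "src C t = B" "tgt C t = A 0" "v = FMap (P 0) t (y 0)"
        using dP(4)[OF B(1)] by metis
      have "factors C t f" using \<epsilon>y[of t] dF(5)[of t] t v A0 by simp
      then obtain r where r: "arr C r" "src C r = B" "tgt C r = A (Suc 0)" "f \<cdot> r = t"
        using t \<delta>(2)[of 0] \<delta>0 by (auto simp: factors_def)
      have "v = d 0 B (FMap (P (Suc 0)) r (y (Suc 0)))" using dy[of r 0] r t \<delta>0 by simp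
      then show "v \<in> d 0 B ` el (P (Suc 0)) B" using r dP(1,3) by auto
    qed
    show "nt_epi C (P 0) F \<epsilon>" unfolding nt_epi_def
    proof (intro ballI equalityI subsetI)
      fix B v assume B: "B \<in> Ob C" "v \<in> el F B"
      then obtain t where t: "arr C t" "src C t = B" "tgt C t = A 0" "FMap F t x = v" using dF(4) A0 by metis
      then have "v = \<epsilon> B (FMap (P 0) t (y 0))" using \<epsilon>y[of t] by simp
      then show "v \<in> \<epsilon> B ` el (P 0) B" using t dP(1,3) by auto
    qed (use nt_closed[OF \<epsilon>] in auto)
  qed
  then show ?thesis by blast
qed

text \<open>The chosen resolution is arbitrary, so independence of Ext from it is proved by hand in
  low degrees: \<open>\<psi>\<close> compares it with the presentation in one direction, the
  elements \<open>y0\<close>, \<open>y1\<close>, \<open>y2\<close> in the other.\<close>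

lemma Ext_1_zero_iff:
  fixes F :: "('o, 'm, 'u) cfunctor"
  assumes e: "inj (e :: 'm set \<Rightarrow> 'u)" and F: "pres C f F x" and k: "ker_of C k f"
    and res: "projective_resolution C F P d \<epsilon>"
  shows "(\<forall>Z\<in>Ob C. \<forall>\<theta>. nat_trans C (P (Suc 0)) (Yon C Z) \<theta> \<and>
        (\<forall>A\<in>Ob C. \<forall>b\<in>el (P (Suc (Suc 0))) A. \<theta> A (d (Suc 0) A b) = zer C A Z) \<longrightarrow>
      (\<exists>\<phi>. nat_trans C (P 0) (Yon C Z) \<phi> \<and> (\<forall>A\<in>Ob C. \<forall>b\<in>el (P (Suc 0)) A. \<theta> A b = \<phi> A (d 0 A b)))) \<longleftrightarrow>
    (\<forall>h. arr C h \<and> src C h = src C f \<and> h \<cdot> k = zer C (src C k) (tgt C h) \<longrightarrow>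
      (\<exists>g. arr C g \<and> src C g = tgt C f \<and> tgt C g = tgt C h \<and> g \<cdot> f = h))" (is "?L \<longleftrightarrow> ?R")
proof -
  note dF = presD[OF F] and kd = ker_ofD[OF k]
  note P = projective_resolutionD(1)[OF res dF(1)] and d = projective_resolutionD(2)[OF res dF(1)]
    and \<epsilon> = projective_resolutionD(3)[OF res dF(1)] and ex = projective_resolutionD(4)[OF res dF(1)]
    and ex0 = projective_resolutionD(5)[OF res dF(1)] and epi = projective_resolutionD(6)[OF res dF(1)]
  let ?X = "src C f" and ?Y = "tgt C f"
  have O: "?X \<in> Ob C" "?Y \<in> Ob C" using dF(2) by simp_all
  text \<open>\<open>\<psi>\<close> lifts the augmentation \<open>\<epsilon>\<close> through the presentation \<open>Hom(-,Y) \<rightarrow> F\<close>.\<close>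
  obtain \<psi> where \<psi>: "nat_trans C (P 0) (Yon C ?Y) \<psi>"
    and \<psi>\<epsilon>: "\<And>A a. \<lbrakk>A \<in> Ob C; a \<in> el (P 0) A\<rbrakk> \<Longrightarrow> FMap F (\<psi> A a) x = \<epsilon> A a"
  proof -
    obtain Z where Z: "is_zero C Z" using zero_obE .
    then have ZO: "Z \<in> Ob C" by (simp add: is_zero_def)
    have t: "tgt C (zer C Z ?Y) = ?Y" "src C (zer C Z ?Y) = Z" using O ZO by simp_all
    \<comment> \<open>Projectivity of \<open>P 0\<close> is tested on modules with values in
      \<open>'u\<close>, so the lift is made into the copy \<open>E\<close> and then carried to
      \<open>Hom(-,Y)\<close> by \<open>\<sigma>\<close>.\<close>
    obtain E :: "('o, 'm, 'u) cfunctor" and y where E: "pres C (zer C Z ?Y) E y"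
      using pres_ex[OF e, of "zer C Z ?Y"] O ZO by auto
    note dE = presD[OF E, unfolded t]
    obtain \<pi> where \<pi>: "nat_trans C E F \<pi>"
      and \<pi>y: "\<And>g. \<lbrakk>arr C g; tgt C g = ?Y\<rbrakk> \<Longrightarrow> \<pi> (src C g) (FMap E g y) = FMap F g x"
      using pres_map[OF E dF(1), of x] dF(1,3) O ZO t by (metis act_zer)
    have YZ: "FMap (Yon C ?Y) (zer C Z ?Y) (Idt C ?Y) = zer C Z ?Y" using O ZO by simp
    obtain \<sigma> where \<sigma>: "nat_trans C E (Yon C ?Y) \<sigma>"
      and \<sigma>y: "\<And>g. \<lbrakk>arr C g; tgt C g = ?Y\<rbrakk> \<Longrightarrow> \<sigma> (src C g) (FMap E g y) = FMap (Yon C ?Y) g (Idt C ?Y)"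
      using pres_map[OF E Yon_Modules[OF O(2)], of "Idt C ?Y"] YZ O t by (metis Idt_mor Yon_simps(1))
    have pe: "nt_epi C E F \<pi>" unfolding nt_epi_def
    proof (intro ballI equalityI subsetI)
      fix A v assume A: "A \<in> Ob C" "v \<in> el F A"
      obtain g where g: "arr C g" "src C g = A" "tgt C g = ?Y" "FMap F g x = v" using dF(4)[OF A] by blast
      then have "v = \<pi> A (FMap E g y)" using \<pi>y[of g] by simp
      then show "v \<in> \<pi> A ` el E A" using g dE(1,3) by auto
    qed (use nt_closed[OF \<pi>] in auto)
    have "projective C (P 0)" using res unfolding projective_resolution_def by blast
    then obtain \<psi>0 where \<psi>0: "nat_trans C (P 0) E \<psi>0"
      "\<And>A a. \<lbrakk>A \<in> Ob C; a \<in> el (P 0) A\<rbrakk> \<Longrightarrow> \<pi> A (\<psi>0 A a) = \<epsilon> A a"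
      unfolding projective_def using dE(1) dF(1) \<pi> pe \<epsilon> by metis
    show ?thesis
    proof (rule that[of "\<lambda>A a. \<sigma> A (\<psi>0 A a)"])
      show "nat_trans C (P 0) (Yon C ?Y) (\<lambda>A a. \<sigma> A (\<psi>0 A a))" unfolding nat_trans_def
      proof (intro conjI ballI)
        fix A assume A: "A \<in> Ob C"
        show "(\<lambda>a. \<sigma> A (\<psi>0 A a)) \<in> hom (FOb (P 0) A) (FOb (Yon C ?Y) A)" unfolding hom_def
          using nt_closed[OF \<psi>0(1) A] nt_closed[OF \<sigma> A] nt_mult[OF \<psi>0(1) A] nt_mult[OF \<sigma> A] by auto
      next
        fix A B g a assume "A \<in> Ob C" "B \<in> Ob C" "g \<in> mor C A B" "a \<in> el (P 0) B"
        then show "\<sigma> A (\<psi>0 A (FMap (P 0) g a)) = FMap (Yon C ?Y) g (\<sigma> B (\<psi>0 B a))"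
          using nt_natural[OF \<psi>0(1), of g a] nt_natural[OF \<sigma>, of g "\<psi>0 B a"] nt_closed[OF \<psi>0(1), of B a] by auto
      qed
      fix A a assume A: "A \<in> Ob C" "a \<in> el (P 0) A"
      obtain g where g: "arr C g" "src C g = A" "tgt C g = ?Y" "FMap E g y = \<psi>0 A a"
        using dE(4)[OF A(1) nt_closed[OF \<psi>0(1) A]] by blast
      show "FMap F (\<sigma> A (\<psi>0 A a)) x = \<epsilon> A a"
        using \<sigma>y[of g] \<pi>y[of g] \<psi>0(2)[OF A] g by simp
    qed
  qed
  have \<psi>a: "arr C (\<psi> A a)" "src C (\<psi> A a) = A" "tgt C (\<psi> A a) = ?Y" if "A \<in> Ob C" "a \<in> el (P 0) A" for A a
    using nt_closed[OF \<psi> that] that O by auto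
  \<comment> \<open>By Yoneda \<open>y0\<close>, \<open>y1\<close>, \<open>y2\<close> are a chain
    map from the resolution given by \<open>f\<close> and \<open>k\<close>: \<open>y0\<close> lies
    over \<open>x\<close>, while \<open>f\<close> and \<open>k\<close> carry \<open>y0\<close> and
    \<open>y1\<close> to the boundaries of \<open>y1\<close> and \<open>y2\<close>.\<close>
  obtain y0 where y0: "y0 \<in> el (P 0) ?Y" "\<epsilon> ?Y y0 = x" using epi[OF O(2) dF(3)] by auto
  have fy0: "FMap (P 0) f y0 \<in> el (P 0) ?X" using P y0 dF(2) by simp
  have "\<epsilon> ?X (FMap (P 0) f y0) = \<one>\<^bsub>FOb F ?X\<^esub>"
    using nt_natural[OF \<epsilon> dF(2) y0(1)] y0(2) pres_rel[OF F] by simp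
  then obtain y1 where y1: "y1 \<in> el (P (Suc 0)) ?X" "FMap (P 0) f y0 = d 0 ?X y1"
    using ex0[OF O(1) fy0] by blast
  have ky1: "FMap (P (Suc 0)) k y1 \<in> el (P (Suc 0)) (src C k)" using P y1 kd by simp
  have "d 0 (src C k) (FMap (P (Suc 0)) k y1) = FMap (P 0) (f \<cdot> k) y0"
    using nt_natural[OF d, of k y1 0] act_cmp[OF P[of 0], of k f y0] y1 y0 kd by simp
  then have "d 0 (src C k) (FMap (P (Suc 0)) k y1) = \<one>\<^bsub>FOb (P 0) (src C k)\<^esub>"
    using kd y0 P O by simp
  then obtain y2 where y2: "y2 \<in> el (P (Suc (Suc 0))) (src C k)" "FMap (P (Suc 0)) k y1 = d (Suc 0) (src C k) y2"
    using ex[of "src C k" _ 0] ky1 kd by auto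
  show ?thesis
  proof (intro iffI ballI allI impI)
    fix Z \<theta> assume R: ?R and Z: "Z \<in> Ob C"
      and "nat_trans C (P (Suc 0)) (Yon C Z) \<theta> \<and>
        (\<forall>A\<in>Ob C. \<forall>b\<in>el (P (Suc (Suc 0))) A. \<theta> A (d (Suc 0) A b) = zer C A Z)"
    then have \<theta>: "nat_trans C (P (Suc 0)) (Yon C Z) \<theta>"
      and \<theta>d: "\<And>A b. \<lbrakk>A \<in> Ob C; b \<in> el (P (Suc (Suc 0))) A\<rbrakk> \<Longrightarrow> \<theta> A (d (Suc 0) A b) = zer C A Z" by auto
    note YM = Yon_Modules[OF Z]
    have \<theta>a: "arr C (\<theta> A b)" "src C (\<theta> A b) = A" "tgt C (\<theta> A b) = Z"
      if "A \<in> Ob C" "b \<in> el (P (Suc 0)) A" for A b using nt_closed[OF \<theta> that] that Z by auto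
    have \<theta>m: "\<theta> A (b \<otimes>\<^bsub>FOb (P (Suc 0)) A\<^esub> b') = \<theta> A b \<boxplus> \<theta> A b'"
      if "A \<in> Ob C" "b \<in> el (P (Suc 0)) A" "b' \<in> el (P (Suc 0)) A" for A b b'
      using nt_mult[OF \<theta> that] \<theta>a[OF that(1,2)] \<theta>a[OF that(1,3)] that Z by (simp add: add_mor)
    have \<theta>n: "\<theta> (src C t) (FMap (P (Suc 0)) t b) = \<theta> (tgt C t) b \<cdot> t"
      if "arr C t" "b \<in> el (P (Suc 0)) (tgt C t)" for t b using nt_natural[OF \<theta> that] by simp
    \<comment> \<open>The cocycle \<open>\<theta>\<close> restricts along the chain map to the arrow
      \<open>h\<close>; it kills \<open>k\<close> because \<open>\<theta>\<close> kills the boundary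
      of \<open>y2\<close>.\<close>
    define h where "h = \<theta> ?X y1"
    have h: "arr C h" "src C h = ?X" "tgt C h = Z" unfolding h_def using \<theta>a[OF O(1) y1(1)] by simp_all
    have "h \<cdot> k = zer C (src C k) (tgt C h)"
      using \<theta>n[of k y1] y1 y2 \<theta>d[of "src C k" y2] kd h unfolding h_def by simp
    then obtain g where g: "arr C g" "src C g = ?Y" "tgt C g = Z" "g \<cdot> f = h" using R h by metis
    \<comment> \<open>Every \<open>a\<close> has the same augmentation as the multiple of
      \<open>y0\<close> by \<open>\<psi> A a\<close>, so they differ by a boundary
      \<open>d 0 A b\<close>. The cochain is defined by \<open>g \<cdot> \<psi> A a\<close> plus
      \<open>\<theta> A b\<close>.\<close>
    define Q where "Q A a b \<longleftrightarrow> b \<in> el (P (Suc 0)) A \<and>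
      a = FMap (P 0) (\<psi> A a) y0 \<otimes>\<^bsub>FOb (P 0) A\<^esub> d 0 A b" for A a b
    have Qex: "\<exists>b. Q A a b" if A: "A \<in> Ob C" "a \<in> el (P 0) A" for A a
    proof -
      interpret G: comm_group "FOb (P 0) A" by (rule mod_comm_group[OF P A(1)])
      interpret FA: comm_group "FOb F A" by (rule mod_comm_group[OF dF(1) A(1)])
      let ?u = "FMap (P 0) (\<psi> A a) y0"
      have u: "?u \<in> el (P 0) A" using P \<psi>a[OF A] y0 by simp
      have "\<epsilon> A ?u = \<epsilon> A a" using nt_natural[OF \<epsilon>, of "\<psi> A a" y0] \<psi>a[OF A] y0 \<psi>\<epsilon>[OF A] by simp
      then have "\<epsilon> A (inv\<^bsub>FOb (P 0) A\<^esub> ?u \<otimes>\<^bsub>FOb (P 0) A\<^esub> a) = \<one>\<^bsub>FOb F A\<^esub>"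
        using nt_mult[OF \<epsilon> A(1), of "inv\<^bsub>FOb (P 0) A\<^esub> ?u" a] nt_inv[OF \<epsilon> P dF(1) A(1) u] u A nt_closed[OF \<epsilon> A] by simp
      then obtain b where "b \<in> el (P (Suc 0)) A" "inv\<^bsub>FOb (P 0) A\<^esub> ?u \<otimes>\<^bsub>FOb (P 0) A\<^esub> a = d 0 A b"
        using ex0[OF A(1), of "inv\<^bsub>FOb (P 0) A\<^esub> ?u \<otimes>\<^bsub>FOb (P 0) A\<^esub> a"] u A by auto
      then have "Q A a b" unfolding Q_def using u A by (simp add: G.m_assoc[symmetric] flip: \<open>_ = d 0 A b\<close>)
      then show ?thesis by blast
    qed
    \<comment> \<open>Two choices of \<open>b\<close> have the same boundary and so differ by an
      element in the image of \<open>d 1\<close>, on which the cocycle vanishes.\<close>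
    have Quniq: "\<theta> A b = \<theta> A b'" if A: "A \<in> Ob C" "a \<in> el (P 0) A" and q: "Q A a b" "Q A a b'" for A a b b'
    proof -
      interpret G: comm_group "FOb (P 0) A" by (rule mod_comm_group[OF P A(1)])
      interpret G1: comm_group "FOb (P (Suc 0)) A" by (rule mod_comm_group[OF P A(1)])
      have b: "b \<in> el (P (Suc 0)) A" "b' \<in> el (P (Suc 0)) A" using q by (auto simp: Q_def)
      have u: "FMap (P 0) (\<psi> A a) y0 \<in> el (P 0) A" using P \<psi>a[OF A] y0 by simp
      have "FMap (P 0) (\<psi> A a) y0 \<otimes>\<^bsub>FOb (P 0) A\<^esub> d 0 A b = FMap (P 0) (\<psi> A a) y0 \<otimes>\<^bsub>FOb (P 0) A\<^esub> d 0 A b'"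
        using q by (simp add: Q_def)
      then have eq: "d 0 A b = d 0 A b'" using u nt_closed[OF d A(1) b(1)] nt_closed[OF d A(1) b(2)] by simp
      let ?c = "b \<otimes>\<^bsub>FOb (P (Suc 0)) A\<^esub> inv\<^bsub>FOb (P (Suc 0)) A\<^esub> b'"
      have "d 0 A ?c = \<one>\<^bsub>FOb (P 0) A\<^esub>"
        using nt_mult[OF d A(1) b(1), of "inv\<^bsub>FOb (P (Suc 0)) A\<^esub> b'"] nt_inv[OF d P P A(1) b(2)] eq
          nt_closed[OF d A(1) b(2)] b by simp
      then obtain u where u: "u \<in> el (P (Suc (Suc 0))) A" "?c = d (Suc 0) A u"
        using ex[OF A(1), of ?c 0] b by auto
      have "\<theta> A (?c \<otimes>\<^bsub>FOb (P (Suc 0)) A\<^esub> b') = \<theta> A ?c \<boxplus> \<theta> A b'" using \<theta>m[OF A(1), of ?c b'] b by simp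
      also have "\<theta> A ?c = zer C A Z" using u \<theta>d[OF A(1)] by simp
      finally show ?thesis using b \<theta>a[OF A(1) b(2)] by (simp add: G1.m_assoc)
    qed
    define \<phi> where "\<phi> A a = g \<cdot> \<psi> A a \<boxplus> \<theta> A (SOME b. Q A a b)" for A a
    have \<phi>: "\<phi> A a = g \<cdot> \<psi> A a \<boxplus> \<theta> A b" if A: "A \<in> Ob C" "a \<in> el (P 0) A" "Q A a b" for A a b
    proof -
      have "Q A a (SOME b. Q A a b)" using A(3) by (metis someI_ex)
      then show ?thesis unfolding \<phi>_def using Quniq[OF A(1,2) _ A(3)] by simp
    qed
    have nt: "nat_trans C (P 0) (Yon C Z) \<phi>" unfolding nat_trans_def
    proof (intro conjI ballI)
      fix A assume A: "A \<in> Ob C"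
      interpret G: comm_group "FOb (P 0) A" by (rule mod_comm_group[OF P A(1)])
      interpret G1: comm_group "FOb (P (Suc 0)) A" by (rule mod_comm_group[OF P A(1)])
      show "\<phi> A \<in> hom (FOb (P 0) A) (FOb (Yon C Z) A)" unfolding hom_def
      proof (intro CollectI conjI Pi_I ballI)
        fix a assume a: "a \<in> el (P 0) A"
        obtain b where q: "Q A a b" using Qex[OF A a] by blast
        then have b: "b \<in> el (P (Suc 0)) A" by (simp add: Q_def)
        note ar = \<psi>a[OF A a] \<theta>a[OF A b]
        show "\<phi> A a \<in> el (Yon C Z) A" using \<phi>[OF A a q] ar g A Z by simp
        fix a' assume a': "a' \<in> el (P 0) A"
        obtain b' where q': "Q A a' b'" using Qex[OF A a'] by blast
        then have b': "b' \<in> el (P (Suc 0)) A" by (simp add: Q_def)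
        note ar' = \<psi>a[OF A a'] \<theta>a[OF A b']
        have \<psi>m: "\<psi> A (a \<otimes>\<^bsub>FOb (P 0) A\<^esub> a') = \<psi> A a \<boxplus> \<psi> A a'"
          using nt_mult[OF \<psi> A a a'] ar ar' A O by (simp add: add_mor)
        let ?u = "FMap (P 0) (\<psi> A a) y0" and ?u' = "FMap (P 0) (\<psi> A a') y0"
        have c: "?u \<in> el (P 0) A" "?u' \<in> el (P 0) A" "d 0 A b \<in> el (P 0) A" "d 0 A b' \<in> el (P 0) A"
          using P ar ar' y0 nt_closed[OF d A b] nt_closed[OF d A b'] by simp_all
        have "a \<otimes>\<^bsub>FOb (P 0) A\<^esub> a' = (?u \<otimes>\<^bsub>FOb (P 0) A\<^esub> d 0 A b) \<otimes>\<^bsub>FOb (P 0) A\<^esub> (?u' \<otimes>\<^bsub>FOb (P 0) A\<^esub> d 0 A b')"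
          using q q' by (simp add: Q_def)
        also have "\<dots> = (?u \<otimes>\<^bsub>FOb (P 0) A\<^esub> ?u') \<otimes>\<^bsub>FOb (P 0) A\<^esub> (d 0 A b \<otimes>\<^bsub>FOb (P 0) A\<^esub> d 0 A b')"
          using c by (simp add: G.m_ac)
        finally have "Q A (a \<otimes>\<^bsub>FOb (P 0) A\<^esub> a') (b \<otimes>\<^bsub>FOb (P (Suc 0)) A\<^esub> b')"
          unfolding Q_def \<psi>m using act_add[OF P, of "\<psi> A a" "\<psi> A a'" y0 0] ar ar' y0 nt_mult[OF d A b b'] b b' by simp
        from \<phi>[OF A _ this] show "\<phi> A (a \<otimes>\<^bsub>FOb (P 0) A\<^esub> a') = \<phi> A a \<otimes>\<^bsub>FOb (Yon C Z) A\<^esub> \<phi> A a'"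
          using \<phi>[OF A a q] \<phi>[OF A a' q'] \<psi>m \<theta>m[OF A b b'] ar ar' g A Z a a' by (simp add: add_ac flip: add_mor)
      qed
    next
      fix A B t a assume "A \<in> Ob C" "B \<in> Ob C" "t \<in> mor C A B" and a: "a \<in> el (P 0) B"
      then have t: "arr C t" "src C t = A" "tgt C t = B" "A \<in> Ob C" "B \<in> Ob C" by auto
      obtain b where q: "Q B a b" using Qex[OF t(5) a] by blast
      then have b: "b \<in> el (P (Suc 0)) B" by (simp add: Q_def)
      note ar = \<psi>a[OF t(5) a] \<theta>a[OF t(5) b]
      have \<psi>t: "\<psi> A (FMap (P 0) t a) = \<psi> B a \<cdot> t" using nt_natural[OF \<psi> t(1), of a] t a by simp
      have c: "FMap (P 0) (\<psi> B a) y0 \<in> el (P 0) B" "d 0 B b \<in> el (P 0) B"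
        using P ar y0 nt_closed[OF d t(5) b] by simp_all
      have "FMap (P 0) t a = FMap (P 0) t (FMap (P 0) (\<psi> B a) y0 \<otimes>\<^bsub>FOb (P 0) B\<^esub> d 0 B b)"
        using q by (simp add: Q_def)
      also have "\<dots> = FMap (P 0) (\<psi> B a \<cdot> t) y0 \<otimes>\<^bsub>FOb (P 0) A\<^esub> d 0 A (FMap (P (Suc 0)) t b)"
        using act_mult[OF P t(1), of "FMap (P 0) (\<psi> B a) y0" 0 "d 0 B b"] nt_natural[OF d t(1), of b 0]
          act_cmp[OF P t(1), of "\<psi> B a" y0 0] c t ar y0 b by simp
      finally have "Q A (FMap (P 0) t a) (FMap (P (Suc 0)) t b)"
        unfolding Q_def \<psi>t using P t b by simp
      from \<phi>[OF t(4) _ this] show "\<phi> A (FMap (P 0) t a) = FMap (Yon C Z) t (\<phi> B a)"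
        using \<phi>[OF t(5) a q] \<psi>t \<theta>n[OF t(1), of b] ar t g P a b by simp
    qed
    \<comment> \<open>For a boundary, \<open>\<psi>\<close> takes a value
      \<open>f \<cdot> r\<close>. Then \<open>b\<close> minus the multiple of \<open>y1\<close> by
      \<open>r\<close> may be used in \<open>Q\<close>, and \<open>g \<cdot> f = h\<close> restores
      the subtracted term.\<close>
    have "\<theta> A b = \<phi> A (d 0 A b)" if A: "A \<in> Ob C" "b \<in> el (P (Suc 0)) A" for A b
    proof -
      interpret G: comm_group "FOb (P 0) A" by (rule mod_comm_group[OF P A(1)])
      interpret G1: comm_group "FOb (P (Suc 0)) A" by (rule mod_comm_group[OF P A(1)])
      let ?a = "d 0 A b"
      have a: "?a \<in> el (P 0) A" using nt_closed[OF d A] .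
      have "FMap F (\<psi> A ?a) x = \<one>\<^bsub>FOb F A\<^esub>" using \<psi>\<epsilon>[OF A(1) a] ex0[OF A(1) a] A by auto
      then have "factors C (\<psi> A ?a) f" using dF(5)[of "\<psi> A ?a"] \<psi>a[OF A(1) a] by simp
      then obtain r where r: "arr C r" "src C r = A" "tgt C r = ?X" "f \<cdot> r = \<psi> A ?a"
        using \<psi>a[OF A(1) a] by (auto simp: factors_def)
      let ?c = "FMap (P (Suc 0)) r y1"
      have c: "?c \<in> el (P (Suc 0)) A" using P r y1 by simp
      have "FMap (P 0) (\<psi> A ?a) y0 = d 0 A ?c"
        using act_cmp[OF P, of r f y0 0] nt_natural[OF d, of r y1 0] y1 y0 r dF(2) unfolding r(4)[symmetric] by simp
      then have "Q A ?a (inv\<^bsub>FOb (P (Suc 0)) A\<^esub> ?c \<otimes>\<^bsub>FOb (P (Suc 0)) A\<^esub> b)"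
        unfolding Q_def using c A a nt_mult[OF d A(1), of "inv\<^bsub>FOb (P (Suc 0)) A\<^esub> ?c" 0 b] nt_inv[OF d P P A(1) c]
          nt_closed[OF d A(1) c] by (simp add: G.m_assoc[symmetric])
      from \<phi>[OF A(1) a this]
      have "\<phi> A ?a = g \<cdot> \<psi> A ?a \<boxplus> \<theta> A (inv\<^bsub>FOb (P (Suc 0)) A\<^esub> ?c \<otimes>\<^bsub>FOb (P (Suc 0)) A\<^esub> b)" .
      also have "g \<cdot> \<psi> A ?a = \<theta> A ?c"
        unfolding r(4)[symmetric] using \<theta>n[of r y1] r(1-3) g y1 cmp_red[OF g(4)] dF(2) unfolding h_def by simp
      also have "\<theta> A ?c \<boxplus> \<theta> A (inv\<^bsub>FOb (P (Suc 0)) A\<^esub> ?c \<otimes>\<^bsub>FOb (P (Suc 0)) A\<^esub> b) = \<theta> A b"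
        using \<theta>m[OF A(1) c, of "inv\<^bsub>FOb (P (Suc 0)) A\<^esub> ?c \<otimes>\<^bsub>FOb (P (Suc 0)) A\<^esub> b"] c A
        by (simp add: G1.m_assoc[symmetric])
      finally show ?thesis by simp
    qed
    then show "\<exists>\<phi>. nat_trans C (P 0) (Yon C Z) \<phi> \<and> (\<forall>A\<in>Ob C. \<forall>b\<in>el (P (Suc 0)) A. \<theta> A b = \<phi> A (d 0 A b))"
      using nt by blast
  next
    fix h assume L: ?L and "arr C h \<and> src C h = ?X \<and> h \<cdot> k = zer C (src C k) (tgt C h)"
    then have h: "arr C h" "src C h = ?X" "h \<cdot> k = zer C (src C k) (tgt C h)" by auto
    let ?Z = "tgt C h"
    have Z: "?Z \<in> Ob C" using h by simp
    \<comment> \<open>Conversely \<open>h\<close> gives a cocycle: on boundaries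
      \<open>\<psi>\<close> factors through \<open>f\<close>, and the value of \<open>h\<close> on
      the factor is independent of its choice because \<open>h\<close> kills the kernel
      \<open>k\<close>.\<close>
    define \<theta> where "\<theta> A b = h \<cdot> (SOME r. arr C r \<and> src C r = A \<and> tgt C r = ?X \<and> f \<cdot> r = \<psi> A (d 0 A b))" for A b
    have rex: "\<exists>r. arr C r \<and> src C r = A \<and> tgt C r = ?X \<and> f \<cdot> r = \<psi> A (d 0 A b)"
      if A: "A \<in> Ob C" "b \<in> el (P (Suc 0)) A" for A b
    proof -
      note a = nt_closed[OF d A]
      have "FMap F (\<psi> A (d 0 A b)) x = \<one>\<^bsub>FOb F A\<^esub>" using \<psi>\<epsilon>[OF A(1) a] ex0[OF A(1) a] A by auto
      then have "factors C (\<psi> A (d 0 A b)) f" using dF(5)[of "\<psi> A (d 0 A b)"] \<psi>a[OF A(1) a] by simp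
      then show ?thesis using \<psi>a[OF A(1) a] by (auto simp: factors_def)
    qed
    have hr: "h \<cdot> r = h \<cdot> r'" if r: "arr C r" "arr C r'" "src C r' = src C r" "tgt C r = ?X" "tgt C r' = ?X" "f \<cdot> r = f \<cdot> r'" for r r'
    proof -
      have "f \<cdot> (r \<boxplus> neg C r') = zer C (src C (r \<boxplus> neg C r')) (tgt C f)" "arr C (r \<boxplus> neg C r')" "tgt C (r \<boxplus> neg C r') = src C f"
        using r dF(2) by simp_all
      then obtain l where l: "arr C l" "src C l = src C (r \<boxplus> neg C r')" "tgt C l = src C k" "k \<cdot> l = r \<boxplus> neg C r'"
        using ker_lift[OF k] by metis
      have "h \<cdot> (k \<cdot> l) = zer C (src C l) ?Z" using cmp_red[OF h(3)] l(1,3) h(1,2) kd by simp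
      then have "h \<cdot> r \<boxplus> neg C (h \<cdot> r') = zer C (src C r) ?Z" unfolding l(4) using l(2) r h(1,2) by simp
      then have e: "h \<cdot> r \<boxplus> neg C (h \<cdot> r') = zer C (src C (h \<cdot> r)) (tgt C (h \<cdot> r))" using r h(1,2) by simp
      show ?thesis by (rule eq_if_diff_zer[OF e]) (use r h(1,2) in simp_all)
    qed
    have \<theta>: "\<theta> A b = h \<cdot> r" if A: "A \<in> Ob C" "b \<in> el (P (Suc 0)) A"
      and r: "arr C r" "src C r = A" "tgt C r = ?X" "f \<cdot> r = \<psi> A (d 0 A b)" for A b r
      unfolding \<theta>_def using someI_ex[OF rex[OF A]] r by (intro hr) auto
    have nt: "nat_trans C (P (Suc 0)) (Yon C ?Z) \<theta>" unfolding nat_trans_def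
    proof (intro conjI ballI)
      fix A assume A: "A \<in> Ob C"
      interpret G1: comm_group "FOb (P (Suc 0)) A" by (rule mod_comm_group[OF P A(1)])
      show "\<theta> A \<in> hom (FOb (P (Suc 0)) A) (FOb (Yon C ?Z) A)" unfolding hom_def
      proof (intro CollectI conjI Pi_I ballI)
        fix b assume b: "b \<in> el (P (Suc 0)) A"
        obtain r where r: "arr C r" "src C r = A" "tgt C r = ?X" "f \<cdot> r = \<psi> A (d 0 A b)" using rex[OF A b] by blast
        show "\<theta> A b \<in> el (Yon C ?Z) A" using \<theta>[OF A b r] r(1-3) h(1,2) A Z by simp
        fix b' assume b': "b' \<in> el (P (Suc 0)) A"
        obtain r' where r': "arr C r'" "src C r' = A" "tgt C r' = ?X" "f \<cdot> r' = \<psi> A (d 0 A b')" using rex[OF A b'] by blast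
        note a = nt_closed[OF d A b] and a' = nt_closed[OF d A b']
        have "f \<cdot> (r \<boxplus> r') = \<psi> A (d 0 A (b \<otimes>\<^bsub>FOb (P (Suc 0)) A\<^esub> b'))"
          using nt_mult[OF \<psi> A a a'] nt_mult[OF d A b b'] r r' \<psi>a[OF A a] \<psi>a[OF A a'] dF(2) A O by (simp add: add_mor)
        then show "\<theta> A (b \<otimes>\<^bsub>FOb (P (Suc 0)) A\<^esub> b') = \<theta> A b \<otimes>\<^bsub>FOb (Yon C ?Z) A\<^esub> \<theta> A b'"
          using \<theta>[OF A _, of "b \<otimes>\<^bsub>FOb (P (Suc 0)) A\<^esub> b'" "r \<boxplus> r'"] \<theta>[OF A b r] \<theta>[OF A b' r'] r(1-3) r'(1-3) b b' h(1,2) A Z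
          by (simp flip: add_mor)
      qed
    next
      fix A B t b assume "A \<in> Ob C" "B \<in> Ob C" "t \<in> mor C A B" and b: "b \<in> el (P (Suc 0)) B"
      then have t: "arr C t" "src C t = A" "tgt C t = B" "A \<in> Ob C" "B \<in> Ob C" by auto
      obtain r where r: "arr C r" "src C r = B" "tgt C r = ?X" "f \<cdot> r = \<psi> B (d 0 B b)" using rex[OF t(5) b] by blast
      have "f \<cdot> (r \<cdot> t) = \<psi> A (d 0 A (FMap (P (Suc 0)) t b))"
        using nt_natural[OF d t(1), of b 0] nt_natural[OF \<psi> t(1), of "d 0 B b"] nt_closed[OF d t(5) b] cmp_red[OF r(4)] r(1-3) t b dF(2) by simp
      then show "\<theta> A (FMap (P (Suc 0)) t b) = FMap (Yon C ?Z) t (\<theta> B b)"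
        using \<theta>[OF t(4), of "FMap (P (Suc 0)) t b" "r \<cdot> t"] \<theta>[OF t(5) b r] r(1-3) t b h(1,2) P by simp
    qed
    have "\<theta> A (d (Suc 0) A b) = zer C A ?Z" if A: "A \<in> Ob C" "b \<in> el (P (Suc (Suc 0))) A" for A b
    proof -
      note c = nt_closed[OF d A]
      have "d 0 A (d (Suc 0) A b) = \<one>\<^bsub>FOb (P 0) A\<^esub>" using ex[OF A(1) c] A by blast
      then have "f \<cdot> zer C A ?X = \<psi> A (d 0 A (d (Suc 0) A b))"
        using nt_one[OF \<psi> P Yon_Modules[OF O(2)] A(1)] A(1) dF(2) by simp
      from \<theta>[OF A(1) c _ _ _ this] show ?thesis using A(1) O h(1,2) by simp
    qed
    then obtain \<phi> where \<phi>: "nat_trans C (P 0) (Yon C ?Z) \<phi>"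
      and \<phi>\<theta>: "\<And>A b. \<lbrakk>A \<in> Ob C; b \<in> el (P (Suc 0)) A\<rbrakk> \<Longrightarrow> \<theta> A b = \<phi> A (d 0 A b)"
      using L Z nt by metis
    define g0 where "g0 = \<phi> ?Y y0"
    have g0: "arr C g0" "src C g0 = ?Y" "tgt C g0 = ?Z" using nt_closed[OF \<phi> O(2) y0(1)] O Z unfolding g0_def by auto
    note \<psi>y = \<psi>a[OF O(2) y0(1)]
    have "FMap F (\<psi> ?Y y0) x = FMap F (Idt C ?Y) x" using \<psi>\<epsilon>[OF O(2) y0(1)] y0(2) dF(1,3) O by simp
    then have "factors C (\<psi> ?Y y0 \<boxplus> neg C (Idt C ?Y)) f"
      using pres_eq[OF F, of "\<psi> ?Y y0" "Idt C ?Y"] \<psi>y O by simp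
    \<comment> \<open>The round trip on the generator is the identity only up to
      \<open>f \<cdot> \<sigma>\<close>, so the arrow read off from \<open>\<phi>\<close> is
      corrected by \<open>h \<cdot> \<sigma>\<close>.\<close>
    then obtain \<sigma> where \<sigma>: "arr C \<sigma>" "src C \<sigma> = ?Y" "tgt C \<sigma> = ?X" "f \<cdot> \<sigma> = \<psi> ?Y y0 \<boxplus> neg C (Idt C ?Y)"
      using \<psi>y O by (auto simp: factors_def)
    have "f \<cdot> (Idt C ?X \<boxplus> \<sigma> \<cdot> f) = \<psi> ?X (d 0 ?X y1)"
    proof -
      have "f \<cdot> (Idt C ?X \<boxplus> \<sigma> \<cdot> f) = \<psi> ?Y y0 \<cdot> f"
        using cmp_red[OF \<sigma>(4)] \<sigma>(1-3) \<psi>y dF(2) by (simp add: add_left_comm[of f])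
      also have "\<dots> = \<psi> ?X (FMap (P 0) f y0)" using nt_natural[OF \<psi> dF(2) y0(1)] by simp
      finally show ?thesis using y1(2) by simp
    qed
    from \<theta>[OF O(1) y1(1) _ _ _ this] have "\<theta> ?X y1 = h \<boxplus> h \<cdot> (\<sigma> \<cdot> f)" using \<sigma>(1-3) dF(2) h(1,2) O by simp
    moreover have "\<theta> ?X y1 = g0 \<cdot> f"
      using \<phi>\<theta>[OF O(1) y1(1)] y1(2)[symmetric] nt_natural[OF \<phi> dF(2) y0(1)] unfolding g0_def by simp
    ultimately have "(g0 \<boxplus> neg C (h \<cdot> \<sigma>)) \<cdot> f = h" using g0 \<sigma>(1-3) h(1,2) dF(2) by (simp add: add_assoc)
    then show "\<exists>g. arr C g \<and> src C g = ?Y \<and> tgt C g = ?Z \<and> g \<cdot> f = h"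
      using g0 \<sigma>(1-3) h(1,2) by (intro exI[of _ "g0 \<boxplus> neg C (h \<cdot> \<sigma>)"]) simp
  qed
qed

text \<open>Transformations from \<open>F\<close> to \<open>Hom(-,Z)\<close> are the arrows killing
  \<open>f\<close> on the right, so degree 0 vanishes when \<open>f\<close> is epic. Degree 1
  vanishes when every arrow killing \<open>k\<close> factors through \<open>f\<close>; together
  these are the definition of \<open>coker_of C f k\<close>.\<close>

lemma grade_neq_1_iff:
  fixes F :: "('o, 'm, 'u) cfunctor"
  assumes e: "inj (e :: 'm set \<Rightarrow> 'u)" and F: "pres C f F x" and k: "ker_of C k f"
  shows "grade C F \<noteq> 1 \<longleftrightarrow> (epic C f \<longrightarrow> coker_of C f k)"
proof -
  note dF = presD[OF F] and kd = ker_ofD[OF k]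
  obtain P d \<epsilon> where PP: "(SOME (P, d, \<epsilon>). projective_resolution C F P d \<epsilon>) = (P, d, \<epsilon>)"
    by (metis prod_cases3)
  \<comment> \<open>Existence guarantees that the triple selected in \<open>Ext_pos\<close> is a
    resolution.\<close>
  have "\<exists>z. case z of (P, d, \<epsilon>) \<Rightarrow> projective_resolution C F P d \<epsilon>"
    using projective_resolution_ex[OF e F k] by auto
  from someI_ex[OF this] have res: "projective_resolution C F P d \<epsilon>" unfolding PP by simp
  have "(\<forall>Z\<in>Ob C. Ext_vanishes C (Suc 0) F (Yon C Z)) \<longleftrightarrow>
    (\<forall>h. arr C h \<and> src C h = src C f \<and> h \<cdot> k = zer C (src C k) (tgt C h) \<longrightarrow>
      (\<exists>g. arr C g \<and> src C g = tgt C f \<and> tgt C g = tgt C h \<and> g \<cdot> f = h))"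
    unfolding Ext_1_zero_iff[OF e F k res, symmetric]
    using cohomology_0_trivial_iff[of P d, OF projective_resolutionD(1,2)[OF res dF(1)] Yon_Modules]
    by (simp add: Ext_pos_def PP)
  moreover have "(\<forall>Z\<in>Ob C. Ext_vanishes C 0 F (Yon C Z)) \<longleftrightarrow> epic C f"
  proof
    assume V: "\<forall>Z\<in>Ob C. Ext_vanishes C 0 F (Yon C Z)"
    show "epic C f" unfolding monic_def
    proof (intro conjI allI impI)
      fix t assume "arr (opp C) t" "tgt (opp C) t = src (opp C) f"
        "f \<cdot>\<^bsub>opp C\<^esub> t = zer (opp C) (src (opp C) t) (tgt (opp C) f)"
      then have t: "arr C t" "src C t = tgt C f" "t \<cdot> f = zer C (src C f) (tgt C t)" by simp_all
      note YM = Yon_Modules[OF src_tgt_Ob(2)[OF t(1)]]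
      have "t \<in> el (Yon C (tgt C t)) (tgt C f)" "FMap (Yon C (tgt C t)) f t = \<one>\<^bsub>FOb (Yon C (tgt C t)) (src C f)\<^esub>"
        using t dF(2) by simp_all
      then obtain \<eta> where \<eta>: "nat_trans C F (Yon C (tgt C t)) \<eta>"
        "\<And>g. \<lbrakk>arr C g; tgt C g = tgt C f\<rbrakk> \<Longrightarrow> \<eta> (src C g) (FMap F g x) = FMap (Yon C (tgt C t)) g t"
        using pres_map[OF F YM] by metis
      have "\<eta> (tgt C f) x = t" using \<eta>(2)[of "Idt C (tgt C f)"] dF(1-3) t by simp
      moreover have "\<eta> (tgt C f) x = zer C (tgt C f) (tgt C t)"
        using V Ext_vanishes_0_iff[OF dF(1) YM] \<eta>(1) dF(2,3) t(1) by simp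
      ultimately show "t = zer (opp C) (src (opp C) t) (src (opp C) f)" by simp
    qed (use dF(2) in simp)
  next
    assume ep: "epic C f"
    show "\<forall>Z\<in>Ob C. Ext_vanishes C 0 F (Yon C Z)"
    proof
      fix Z assume Z: "Z \<in> Ob C"
      show "Ext_vanishes C 0 F (Yon C Z)" unfolding Ext_vanishes_0_iff[OF dF(1) Yon_Modules[OF Z]]
      proof (intro allI impI ballI)
        fix \<eta> A v assume \<eta>: "nat_trans C F (Yon C Z) \<eta>" and A: "A \<in> Ob C" "v \<in> el F A"
        let ?t = "\<eta> (tgt C f) x"
        have t: "arr C ?t" "src C ?t = tgt C f" "tgt C ?t = Z" using nt_closed[OF \<eta>, of "tgt C f" x] dF(2,3) Z by auto
        have "?t \<cdot> f = zer C (src C f) (tgt C ?t)"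
          using nt_natural[OF \<eta> dF(2,3)] pres_rel[OF F] nt_one[OF \<eta> dF(1) Yon_Modules[OF Z], of "src C f"] t dF(2) by simp
        then have t0: "?t = zer C (tgt C f) Z" using epicD[OF ep, of ?t] t by simp
        obtain g where g: "arr C g" "src C g = A" "tgt C g = tgt C f" "FMap F g x = v" using dF(4)[OF A] by blast
        have "\<eta> A v = ?t \<cdot> g" using nt_natural[OF \<eta> g(1), of x] g dF(3) by simp
        then show "\<eta> A v = \<one>\<^bsub>FOb (Yon C Z) A\<^esub>" unfolding t0 using g Z by simp
      qed
    qed
  qed
  moreover have "coker_of C f k \<longleftrightarrow> epic C f \<and>
    (\<forall>h. arr C h \<and> src C h = src C f \<and> h \<cdot> k = zer C (src C k) (tgt C h) \<longrightarrow>
      (\<exists>g. arr C g \<and> src C g = tgt C f \<and> tgt C g = tgt C h \<and> g \<cdot> f = h))"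
    unfolding ker_of_def[of "opp C"] using kd by auto
  ultimately show ?thesis unfolding grade_eq_1_iff by blast
qed

section \<open>Stable isomorphisms, direct sums and transposes\<close>

lemma nat_trans_comp:
  assumes "nat_trans C F G \<eta>" "nat_trans C G H \<theta>"
  shows "nat_trans C F H (\<lambda>A x. \<theta> A (\<eta> A x))"
  unfolding nat_trans_def
proof (intro conjI ballI)
  fix A assume A: "A \<in> Ob C"
  show "(\<lambda>x. \<theta> A (\<eta> A x)) \<in> hom (FOb F A) (FOb H A)" unfolding hom_def
    using nt_closed[OF assms(1) A] nt_closed[OF assms(2) A] nt_mult[OF assms(1) A] nt_mult[OF assms(2) A] by auto
next
  fix A B f x assume "A \<in> Ob C" "B \<in> Ob C" "f \<in> mor C A B" "x \<in> el F B"
  then show "\<theta> A (\<eta> A (FMap F f x)) = FMap H f (\<theta> B (\<eta> B x))"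
    using nt_natural[OF assms(1), of f x] nt_natural[OF assms(2), of f "\<eta> B x"] nt_closed[OF assms(1), of B x]
    by auto
qed

lemma nat_trans_id: "F \<in> Modules C \<Longrightarrow> nat_trans C F F (\<lambda>A x. x)"
  unfolding nat_trans_def hom_def by auto

text \<open>A zero difference factors through the functor represented by a zero object.\<close>

lemma stable_eqI:
  assumes F: "F \<in> Modules C" and G: "G \<in> Modules C"
    and eq: "\<And>A x. \<lbrakk>A \<in> Ob C; x \<in> el F A\<rbrakk> \<Longrightarrow> \<eta> A x = \<eta>' A x"
    and cl: "\<And>A x. \<lbrakk>A \<in> Ob C; x \<in> el F A\<rbrakk> \<Longrightarrow> \<eta>' A x \<in> el G A"
  shows "stable_eq C F G \<eta> \<eta>'"
proof -
  obtain Z where Z: "is_zero C Z" using zero_obE .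
  then have ZO: "Z \<in> Ob C" by (simp add: is_zero_def)
  show ?thesis unfolding stable_eq_def
  proof (intro bexI[OF _ ZO] exI conjI ballI)
    show "nat_trans C F (Yon C Z) (\<lambda>A x. \<one>\<^bsub>FOb (Yon C Z) A\<^esub>)" by (rule nat_trans_one[OF F Yon_Modules[OF ZO]])
    show "nat_trans C (Yon C Z) G (\<lambda>A x. \<one>\<^bsub>FOb G A\<^esub>)" by (rule nat_trans_one[OF Yon_Modules[OF ZO] G])
    fix A x assume A: "A \<in> Ob C" "x \<in> el F A"
    show "\<eta> A x = \<eta>' A x \<otimes>\<^bsub>FOb G A\<^esub> \<one>\<^bsub>FOb G A\<^esub>"
      using monoid.r_one[OF mod_monoid[OF G A(1)] cl[OF A]] eq[OF A] by simp
  qed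
qed

lemma stable_iso_refl: "F \<in> Modules C \<Longrightarrow> stable_iso C F F"
  unfolding stable_iso_def
  by (intro exI[of _ "\<lambda>A x. x"] conjI nat_trans_id stable_eqI) auto

lemma nt_iso_inverse:
  assumes "nt_iso C F G" and F: "F \<in> Modules C" and G: "G \<in> Modules C"
  obtains \<eta> \<theta> where "nat_trans C F G \<eta>" "nat_trans C G F \<theta>"
    "\<And>A x. \<lbrakk>A \<in> Ob C; x \<in> el F A\<rbrakk> \<Longrightarrow> \<theta> A (\<eta> A x) = x"
    "\<And>A x. \<lbrakk>A \<in> Ob C; x \<in> el G A\<rbrakk> \<Longrightarrow> \<eta> A (\<theta> A x) = x"
proof -
  obtain \<eta> where \<eta>: "nat_trans C F G \<eta>" and bij: "\<And>A. A \<in> Ob C \<Longrightarrow> bij_betw (\<eta> A) (el F A) (el G A)"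
    using assms(1) unfolding nt_iso_def by blast
  define \<theta> where "\<theta> A = inv_into (el F A) (\<eta> A)" for A
  have 1: "\<theta> A (\<eta> A x) = x" if "A \<in> Ob C" "x \<in> el F A" for A x
    unfolding \<theta>_def using bij_betw_inv_into_left[OF bij] that by blast
  have 2: "\<eta> A (\<theta> A x) = x" "\<theta> A x \<in> el F A" if "A \<in> Ob C" "x \<in> el G A" for A x
    unfolding \<theta>_def using bij_betw_inv_into_right[OF bij] bij_betw_apply[OF bij_betw_inv_into[OF bij]] that
    by auto
  have "nat_trans C G F \<theta>" unfolding nat_trans_def
  proof (intro conjI ballI)
    fix A assume A: "A \<in> Ob C"
    show "\<theta> A \<in> hom (FOb G A) (FOb F A)" unfolding hom_def
    proof (intro CollectI conjI Pi_I ballI)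
      fix x y assume x: "x \<in> el G A" and y: "y \<in> el G A"
      have "\<theta> A (\<eta> A (\<theta> A x \<otimes>\<^bsub>FOb F A\<^esub> \<theta> A y)) = \<theta> A x \<otimes>\<^bsub>FOb F A\<^esub> \<theta> A y"
        by (rule 1[OF A]) (use monoid.m_closed[OF mod_monoid[OF F A]] 2(2)[OF A] x y in simp)
      then show "\<theta> A (x \<otimes>\<^bsub>FOb G A\<^esub> y) = \<theta> A x \<otimes>\<^bsub>FOb F A\<^esub> \<theta> A y"
        using nt_mult[OF \<eta> A 2(2)[OF A x] 2(2)[OF A y]] 2(1)[OF A x] 2(1)[OF A y] by simp
    qed (use 2 A in auto)
  next
    fix A B f x assume "A \<in> Ob C" "B \<in> Ob C" "f \<in> mor C A B" "x \<in> el G B"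
    then have f: "arr C f" "src C f = A" "tgt C f = B" "A \<in> Ob C" "B \<in> Ob C" "x \<in> el G B" by auto
    have "\<theta> A (\<eta> A (FMap F f (\<theta> B x))) = FMap F f (\<theta> B x)" using 1[OF f(4)] F f 2(2)[OF f(5,6)] by simp
    then show "\<theta> A (FMap G f x) = FMap F f (\<theta> B x)"
      using nt_natural[OF \<eta> f(1), of "\<theta> B x"] f 2[OF f(5,6)] by simp
  qed
  then show ?thesis using that \<eta> 1 2 by blast
qed

lemma direct_sum_Modules:
  assumes F: "F \<in> Modules C" and G: "G \<in> Modules C"
  shows "direct_sum F G \<in> Modules C"
proof -
  have grp: "comm_group (FOb F A \<times>\<times> FOb G A)" if A: "A \<in> Ob C" for A
  proof -
    interpret F: comm_group "FOb F A" by (rule mod_comm_group[OF F A])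
    interpret G: comm_group "FOb G A" by (rule mod_comm_group[OF G A])
    show ?thesis
      by (rule group.group_comm_groupI[OF DirProd_group[OF F.is_group G.is_group]])
        (auto simp: F.m_comm G.m_comm)
  qed
  show ?thesis unfolding Modules_def direct_sum_def
  proof (intro CollectI conjI ballI)
    fix A B f assume "A \<in> Ob C" "B \<in> Ob C" "f \<in> mor C A B"
    then have f: "arr C f" "src C f = A" "tgt C f = B" by auto
    show "FMap \<lparr>FOb = \<lambda>A. FOb F A \<times>\<times> FOb G A, FMap = \<lambda>f. map_prod (FMap F f) (FMap G f)\<rparr> f
      \<in> hom (FOb \<lparr>FOb = \<lambda>A. FOb F A \<times>\<times> FOb G A, FMap = \<lambda>f. map_prod (FMap F f) (FMap G f)\<rparr> B)
        (FOb \<lparr>FOb = \<lambda>A. FOb F A \<times>\<times> FOb G A, FMap = \<lambda>f. map_prod (FMap F f) (FMap G f)\<rparr> A)"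
      using act_hom[OF F f(1)] act_hom[OF G f(1)] f by (auto simp: hom_def)
    fix g x assume "g \<in> mor C A B"
      "x \<in> carrier (FOb \<lparr>FOb = \<lambda>A. FOb F A \<times>\<times> FOb G A, FMap = \<lambda>f. map_prod (FMap F f) (FMap G f)\<rparr> B)"
    then show "FMap \<lparr>FOb = \<lambda>A. FOb F A \<times>\<times> FOb G A, FMap = \<lambda>f. map_prod (FMap F f) (FMap G f)\<rparr> (f \<otimes>\<^bsub>Hom C A B\<^esub> g) x =
      FMap \<lparr>FOb = \<lambda>A. FOb F A \<times>\<times> FOb G A, FMap = \<lambda>f. map_prod (FMap F f) (FMap G f)\<rparr> f x
      \<otimes>\<^bsub>FOb \<lparr>FOb = \<lambda>A. FOb F A \<times>\<times> FOb G A, FMap = \<lambda>f. map_prod (FMap F f) (FMap G f)\<rparr> A\<^esub>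
      FMap \<lparr>FOb = \<lambda>A. FOb F A \<times>\<times> FOb G A, FMap = \<lambda>f. map_prod (FMap F f) (FMap G f)\<rparr> g x"
      using act_add[OF F, of f g "fst x"] act_add[OF G, of f g "snd x"] f \<open>A \<in> Ob C\<close> \<open>B \<in> Ob C\<close>
      by (auto simp flip: add_mor)
  qed (use grp F G in auto)
qed

lemma P2_Modules: "F \<in> P2 C \<Longrightarrow> F \<in> Modules C"
  by (simp add: P2_def)

lemma summand_retract:
  assumes iso: "nt_iso C H (direct_sum F G)" and H: "H \<in> Modules C" and F: "F \<in> Modules C" and G: "G \<in> Modules C"
  obtains \<eta> \<theta> where "nat_trans C F H \<eta>" "nat_trans C H F \<theta>"
    "\<And>A x. \<lbrakk>A \<in> Ob C; x \<in> el F A\<rbrakk> \<Longrightarrow> \<theta> A (\<eta> A x) = x"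
proof -
  obtain \<zeta> \<xi> where \<zeta>: "nat_trans C H (direct_sum F G) \<zeta>" "nat_trans C (direct_sum F G) H \<xi>"
    and inv: "\<And>A x. \<lbrakk>A \<in> Ob C; x \<in> el (direct_sum F G) A\<rbrakk> \<Longrightarrow> \<zeta> A (\<xi> A x) = x"
    using nt_iso_inverse[OF iso H direct_sum_Modules[OF F G]] by metis
  have one: "\<one>\<^bsub>FOb G A\<^esub> \<in> el G A" if "A \<in> Ob C" for A using monoid.one_closed[OF mod_monoid[OF G that]] .
  have "nat_trans C F (direct_sum F G) (\<lambda>A x. (x, \<one>\<^bsub>FOb G A\<^esub>))"
    unfolding nat_trans_def direct_sum_def hom_def
    using one act_one[OF G] monoid.l_one[OF mod_monoid[OF G]] by auto
  from nat_trans_comp[OF this \<zeta>(2)] have 1: "nat_trans C F H (\<lambda>A x. \<xi> A (x, \<one>\<^bsub>FOb G A\<^esub>))" .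
  have "nat_trans C (direct_sum F G) F (\<lambda>A. fst)"
    unfolding nat_trans_def direct_sum_def hom_def by auto
  from nat_trans_comp[OF \<zeta>(1) this] have 2: "nat_trans C H F (\<lambda>A x. fst (\<zeta> A x))" .
  show ?thesis
    by (rule that[OF 1 2]) (use inv one in \<open>simp add: direct_sum_def\<close>)
qed

text \<open>By \<open>retract_mem\<close> this makes having a kernel a property of the module
  instead of one of its presentations, which is the content of \<open>P2_has_kernel\<close>.\<close>

lemma has_kernel_stably_closed:
  assumes ic: "idempotent_complete C"
  shows "stably_closed C {f. has_kernel C f}"
proof unfold_locales
  fix f assume "f \<in> {f. has_kernel C f}"
  then obtain k where k: "ker_of C k f" by (auto simp: has_kernel_def)
  note kd = ker_ofD[OF k]
  show "arr C f" by (rule kd)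
  fix V P i j p q
  { fix P' i' j' p' q'
    assume b: "biprod C P (src C f) V i j p q" and b': "biprod C P' (tgt C f) V i' j' p' q'"
    note d = biprodD[OF b] and d' = biprodD[OF b']
    let ?F = "i' \<cdot> (f \<cdot> p) \<boxplus> j' \<cdot> q"
    have F: "arr C ?F" "src C ?F = P" "tgt C ?F = P'" using kd(2-4) d d' by simp_all
    have "ker_of C (i \<cdot> k) ?F" unfolding ker_of_def
    proof (intro conjI allI impI)
      show "monic C (i \<cdot> k)" by (rule monic_cmp[OF biprod_monic[OF b] kd(1)]) (use kd(4) d in simp)
      show "?F \<cdot> (i \<cdot> k) = zer C (src C (i \<cdot> k)) (tgt C ?F)" using kd(2-5) d d' by simp
      fix t assume "arr C t" "tgt C t = src C ?F" "?F \<cdot> t = zer C (src C t) (tgt C ?F)"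
      then have t: "arr C t" "tgt C t = P" "?F \<cdot> t = zer C (src C t) P'" using F by simp_all
      have "f \<cdot> (p \<cdot> t) = p' \<cdot> (?F \<cdot> t)" "q \<cdot> t = q' \<cdot> (?F \<cdot> t)" using t(1,2) kd(2-4) d d' by simp_all
      then have z: "f \<cdot> (p \<cdot> t) = zer C (src C (p \<cdot> t)) (tgt C f)" "q \<cdot> t = zer C (src C t) V"
        unfolding t(3) using t(1,2) d d' by simp_all
      have "arr C (p \<cdot> t)" "tgt C (p \<cdot> t) = src C f" using t(1,2) d by simp_all
      from ker_lift[OF k z(1) this] obtain g where
        "arr C g" "src C g = src C (p \<cdot> t)" "tgt C g = src C k" "k \<cdot> g = p \<cdot> t" by metis
      then have g: "arr C g" "src C g = src C t" "tgt C g = src C k" "k \<cdot> g = p \<cdot> t" using t(1,2) d by simp_all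
      have "(i \<cdot> k) \<cdot> g = t" by (rule biprod_eqI[OF b]) (use g z t(1,2) kd(2,4) d in simp_all)
      then show "\<exists>g. arr C g \<and> src C g = src C t \<and> tgt C g = src C (i \<cdot> k) \<and> i \<cdot> k \<cdot> g = t"
        using g(1-3) kd(2,4) d by (intro exI[of _ g]) simp
    qed (use F kd(2-4) d in simp_all)
    then show "?F \<in> {f. has_kernel C f}" by (auto simp: has_kernel_def) }
  { assume b: "biprod C P (src C f) V i j p q"
    note d = biprodD[OF b]
    obtain K' a c pK qP where b': "biprod C K' (src C k) V a c pK qP" using biprod_ex[of "src C k" V] kd d by auto
    show "f \<cdot> p \<in> {f. has_kernel C f}" using proj_kernel[OF b b' k refl] by (auto simp: has_kernel_def) }
  { assume b: "biprod C P (tgt C f) V i j p q"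
    show "i \<cdot> f \<in> {f. has_kernel C f}"
      using k has_kernel_monic_cmp[OF biprod_monic[OF b], of f] kd biprodD[OF b] by (auto simp: has_kernel_def) }
  fix f1 s r s' r' assume "arrow_retract C f1 f s r s' r'"
  then show "f1 \<in> {f. has_kernel C f}" using retract_kernel[OF ic k] by simp
qed

end

lemma (in stably_closed) retract_mem:
  assumes F: "pres C f F x" and fM: "f \<in> M" and F': "pres C f' F' x'"
    and \<eta>: "nat_trans C F' F \<eta>" and \<theta>: "nat_trans C F F' \<theta>"
    and inv: "\<And>A x. \<lbrakk>A \<in> Ob C; x \<in> el F' A\<rbrakk> \<Longrightarrow> \<theta> A (\<eta> A x) = x"
  shows "f' \<in> M"
  using stable_retract_mem[OF F fM F' \<eta> \<theta> stable_eqI] presD(1)[OF F'] inv by simp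

context additive_category
begin

lemma P2_has_kernel:
  assumes ic: "idempotent_complete C" and F: "F \<in> P2 C" and f: "pres C f F x"
  shows "has_kernel C f"
proof -
  interpret K: stably_closed C "{f. has_kernel C f}" by (rule has_kernel_stably_closed[OF ic])
  obtain g y where g: "pres C g F y" "has_kernel C g" using P2_iff[THEN iffD1, OF F] by blast
  have "f \<in> {f. has_kernel C f}"
    by (rule K.retract_mem[OF g(1) _ f nat_trans_id nat_trans_id]) (use g presD(1)[OF f] in auto)
  then show ?thesis by simp
qed

lemma is_transpose_iff:
  assumes "F \<in> Modules C"
  shows "is_transpose C F T \<longleftrightarrow> (\<exists>f x t. pres C f F x \<and> pres (opp C) f T t)"
proof -
  interpret op: additive_category "opp C" by (rule opp_additive)
  show ?thesis
  proof
    assume "is_transpose C F T"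
    then obtain X Y f where "T \<in> Modules (opp C)" "X \<in> Ob C" "Y \<in> Ob C" "presented_by C X Y f F"
      "presented_by (opp C) Y X f T" unfolding is_transpose_def by blast
    then show "\<exists>f x t. pres C f F x \<and> pres (opp C) f T t"
      using presented_by_iff[of X Y F f] op.presented_by_iff[of Y X T f] assms by auto
  next
    assume "\<exists>f x t. pres C f F x \<and> pres (opp C) f T t"
    then obtain f x t where f: "pres C f F x" "pres (opp C) f T t" by blast
    note d = presD[OF f(1)] and d' = op.presD[OF f(2)]
    have "presented_by C (src C f) (tgt C f) f F" "presented_by (opp C) (tgt C f) (src C f) f T"
      using presented_by_iff[of "src C f" "tgt C f" F f] op.presented_by_iff[of "tgt C f" "src C f" T f]
        d(1) d'(1) src_tgt_Ob[OF d(2)] f by simp_all blast+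
    then show "is_transpose C F T" unfolding is_transpose_def using d' d(2) src_tgt_Ob[OF d(2)] by blast
  qed
qed

lemma zero_monic:
  assumes "arr C f" "is_zero C (src C f)"
  shows "monic C f"
  unfolding monic_def
proof (intro conjI allI impI)
  fix t assume "arr C t" "tgt C t = src C f"
  then show "t = zer C (src C t) (src C f)" using tgt_zero[of t] assms by simp
qed (use assms in simp)

end

section \<open>Modules with an admissible presentation\<close>

context exact_ic_category
begin

lemma mod_adm_iff: "F \<in> mod_adm C S \<longleftrightarrow> (\<exists>f x. pres C f F x \<and> adm C S f)"
proof
  assume "F \<in> mod_adm C S"
  then obtain X Y f where "F \<in> Modules C" "X \<in> Ob C" "Y \<in> Ob C" "admissible C S X Y f" "presented_by C X Y f F"
    unfolding mod_adm_def by blast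
  then show "\<exists>f x. pres C f F x \<and> adm C S f" using presented_by_iff[of X Y F f] admissible_iff[of X Y f] by blast
next
  assume "\<exists>f x. pres C f F x \<and> adm C S f"
  then obtain f x where f: "pres C f F x" "adm C S f" by blast
  note d = presD[OF f(1)]
  have "presented_by C (src C f) (tgt C f) f F" "admissible C S (src C f) (tgt C f) f"
    using presented_by_iff[of "src C f" "tgt C f" F f] admissible_iff[of "src C f" "tgt C f" f] f d by auto
  then show "F \<in> mod_adm C S" unfolding mod_adm_def using d(1) src_tgt_Ob[OF d(2)] by blast
qed

lemma mod_adm_retract:
  assumes F: "F \<in> mod_adm C S" and F': "pres C f' F' x'"
    and \<eta>: "nat_trans C F' F \<eta>" and \<theta>: "nat_trans C F F' \<theta>"
    and inv: "\<And>A x. \<lbrakk>A \<in> Ob C; x \<in> el F' A\<rbrakk> \<Longrightarrow> \<theta> A (\<eta> A x) = x"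
  shows "adm C S f'"
proof -
  interpret A: stably_closed C "{f. adm C S f}" by (rule adm_stably_closed)
  obtain f x where f: "pres C f F x" "adm C S f" using mod_adm_iff[THEN iffD1, OF F] by blast
  have fA: "f \<in> {f. adm C S f}" using f(2) by simp
  have "f' \<in> {f. adm C S f}"
  proof (rule A.retract_mem[OF f(1) fA F' \<eta> \<theta>])
    fix A x assume "A \<in> Ob C" "x \<in> el F' A"
    then show "\<theta> A (\<eta> A x) = x" by (rule inv)
  qed
  then show ?thesis by simp
qed

text \<open>The identity of a module is a retraction between any two of its presentations, so
  admissibility of one gives admissibility of all.\<close>

lemma mod_adm_pres:
  assumes "F \<in> mod_adm C S" "pres C f F x"
  shows "adm C S f"
  by (rule mod_adm_retract[OF assms nat_trans_id nat_trans_id]) (use presD(1)[OF assms(2)] in auto)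

lemma adm_has_kernel:
  assumes "adm C S f"
  shows "has_kernel C f"
proof -
  obtain p m where *: "deflation S p" "inflation S m" "src C m = tgt C p" "f = m \<cdot> p"
    using assms by (auto simp: adm_def)
  obtain k where "ker_of C k p" using * conflationD by (auto simp: deflation_def)
  then show ?thesis
    using * has_kernel_monic_cmp[OF inflation_monic[OF *(2)] deflation_arr[OF *(1)]] by (auto simp: has_kernel_def)
qed

lemma mod_adm_P2: "F \<in> mod_adm C S \<Longrightarrow> F \<in> P2 C"
  unfolding mod_adm_iff P2_iff using adm_has_kernel by blast

text \<open>The zero arrow from a zero object is a biproduct injection, hence an inflation; so
  representable functors have admissible presentations.\<close>

lemma zero_adm:
  assumes Z: "is_zero C Z" and B: "B \<in> Ob C"
  shows "adm C S (zer C Z B)"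
proof -
  have ZO: "Z \<in> Ob C" "Idt C Z = zer C Z Z" using Z by (simp_all add: is_zero_def)
  have "biprod C B Z B (zer C Z B) (Idt C B) (zer C B Z) (Idt C B)"
    unfolding biprod_def using ZO B by simp
  then show ?thesis using inflation_adm[OF biprod_inflation] by blast
qed

lemma mod_adm_iso_closed:
  assumes "F \<in> mod_adm C S" "nt_iso C F G" "G \<in> Modules C"
  shows "G \<in> mod_adm C S"
proof -
  obtain f x where f: "pres C f F x" "adm C S f" using mod_adm_iff[THEN iffD1, OF assms(1)] by blast
  then show ?thesis unfolding mod_adm_iff using pres_nt_iso[OF assms(2,3) f(1)] by blast
qed

text \<open>Extensions are presented by triangular arrows, kernels of deflations by rows, and direct
  summands are retracts; each construction has been shown to preserve admissibility.\<close>

lemma resolving_mod_adm: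
  assumes e: "inj (e :: 'b set \<Rightarrow> 'u)"
  shows "resolving C (P2 C) (mod_adm C S :: ('a, 'b, 'u) cfunctor set)"
  unfolding resolving_def
proof (intro conjI ballI impI)
  show "subcategory_of C (P2 C) (mod_adm C S :: ('a, 'b, 'u) cfunctor set)"
    unfolding subcategory_of_def using mod_adm_P2 mod_adm_iso_closed P2_Modules by blast
next
  fix F G H :: "('a, 'b, 'u) cfunctor"
  assume F: "F \<in> mod_adm C S" and G: "G \<in> P2 C" and H: "H \<in> mod_adm C S" and se: "short_exact C F G H"
  obtain f x where f: "pres C f F x" "adm C S f" using mod_adm_iff[THEN iffD1, OF F] by blast
  obtain h z where h: "pres C h H z" "adm C S h" using mod_adm_iff[THEN iffD1, OF H] by blast
  note df = presD[OF f(1)] and dh = presD[OF h(1)]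
  obtain X i1 i2 p1 p2 where X: "biprod C X (src C f) (src C h) i1 i2 p1 p2"
    using biprod_ex[of "src C f" "src C h"] df dh by auto
  obtain Y j1 j2 q1 q2 where Y: "biprod C Y (tgt C f) (tgt C h) j1 j2 q1 q2"
    using biprod_ex[of "tgt C f" "tgt C h"] df dh by auto
  obtain s y where s: "arr C s" "src C s = src C h" "tgt C s = tgt C f"
    and sk: "\<And>t. \<lbrakk>arr C t; tgt C t = src C h; h \<cdot> t = zer C (src C t) (tgt C h)\<rbrakk> \<Longrightarrow> factors C (s \<cdot> t) f"
    and T: "pres C (j1 \<cdot> (f \<cdot> p1 \<boxplus> s \<cdot> p2) \<boxplus> j2 \<cdot> (h \<cdot> p2)) G y"
    by (rule short_exact_extension[OF se P2_Modules[OF G] f(1) h(1) X Y]) blast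
  have "\<exists>r. arr C r \<and> src C r = src C t \<and> tgt C r = src C f \<and> s \<cdot> t = f \<cdot> r"
    if t: "arr C t" "tgt C t = src C h" "h \<cdot> t = zer C (src C t) (tgt C h)" for t
  proof -
    obtain r where "arr C r" "src C r = src C (s \<cdot> t)" "tgt C r = src C f" "f \<cdot> r = s \<cdot> t"
      using sk[OF t] by (auto simp: factors_def)
    then show ?thesis using t s by (intro exI[of _ r]) simp
  qed
  from adm_extension[OF f(2) h(2) s this X Y] show "G \<in> mod_adm C S" unfolding mod_adm_iff using T by blast
next
  fix F G H :: "('a, 'b, 'u) cfunctor"
  assume F: "F \<in> P2 C" and G: "G \<in> P2 C" and H: "H \<in> mod_adm C S" and iso: "nt_iso C H (direct_sum F G)"
  obtain f x where f: "pres C f F x" using P2_iff[THEN iffD1, OF F] by blast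
  obtain \<eta> \<theta> where r: "nat_trans C F H \<eta>" "nat_trans C H F \<theta>"
    "\<And>A x. \<lbrakk>A \<in> Ob C; x \<in> el F A\<rbrakk> \<Longrightarrow> \<theta> A (\<eta> A x) = x"
    by (rule summand_retract[OF iso P2_Modules[OF mod_adm_P2[OF H]] P2_Modules[OF F] P2_Modules[OF G]]) blast
  show "F \<in> mod_adm C S" unfolding mod_adm_iff using mod_adm_retract[OF H f r] f by blast
next
  fix F G H :: "('a, 'b, 'u) cfunctor"
  assume F: "F \<in> P2 C" and G: "G \<in> mod_adm C S" and H: "H \<in> mod_adm C S" and se: "short_exact C F G H"
  obtain g y where g: "pres C g G y" "adm C S g" using mod_adm_iff[THEN iffD1, OF G] by blast
  obtain h0 z0 where h0: "pres C h0 H z0" using mod_adm_iff[THEN iffD1, OF H] by blast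
  obtain h z w where h: "pres C h H z" and w: "arr C w" "src C w = src C g" "tgt C w = src C h" "h \<cdot> w = g"
    and pr: "\<And>k P i j \<pi> \<rho>. \<lbrakk>ker_of C k h; biprod C P (src C w) (src C k) i j \<pi> \<rho>\<rbrakk> \<Longrightarrow>
      \<exists>x. pres C (w \<cdot> \<pi> \<boxplus> k \<cdot> \<rho>) F x"
    by (rule short_exact_deflation_kernel[OF se P2_Modules[OF F] g(1) h0]) blast
  have ah: "adm C S h" using mod_adm_pres[OF H h] .
  obtain k where k: "ker_of C k h" using adm_has_kernel[OF ah] by (auto simp: has_kernel_def)
  obtain P i j \<pi> \<rho> where b: "biprod C P (src C w) (src C k) i j \<pi> \<rho>"
    using biprod_ex[of "src C w" "src C k"] w(1) ker_ofD(2)[OF k] by auto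
  have "adm C S (w \<cdot> \<pi> \<boxplus> k \<cdot> \<rho>)" by (rule adm_kernel[OF ah w(1,3) _ k b]) (use g w in simp)
  then show "F \<in> mod_adm C S" unfolding mod_adm_iff using pr[OF k b] by blast
next
  fix H :: "('a, 'b, 'u) cfunctor"
  assume H: "H \<in> P2 C"
  then obtain h z where h: "pres C h H z" "has_kernel C h" using P2_iff[THEN iffD1] by blast
  then obtain k where k: "ker_of C k h" by (auto simp: has_kernel_def)
  note kd = ker_ofD[OF k]
  obtain Z where Z: "is_zero C Z" using zero_obE .
  then have ZO: "Z \<in> Ob C" by (simp add: is_zero_def)
  have za: "arr C (zer C Z (tgt C h))" using kd ZO by simp
  \<comment> \<open>Generation: the representable functor \<open>G\<close> on \<open>tgt C h\<close>
    covers \<open>H\<close>, and the kernel is the syzygy presented by \<open>k\<close>.\<close>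
  obtain G :: "('a, 'b, 'u) cfunctor" and y where G: "pres C (zer C Z (tgt C h)) G y"
    using pres_ex[OF e za] by blast
  obtain F :: "('a, 'b, 'u) cfunctor" and x where F: "pres C k F x" using pres_ex[OF e kd(2)] by blast
  have "short_exact C F G H" by (rule short_exact_pres[OF F G h(1) arrow_ses_kernel[OF Z k]])
  moreover have "G \<in> mod_adm C S" unfolding mod_adm_iff using G zero_adm[OF Z, of "tgt C h"] kd by auto
  moreover have "F \<in> P2 C" unfolding P2_iff using F monic_has_kernel[OF kd(1)] by blast
  ultimately show "\<exists>G\<in>mod_adm C S. \<exists>F\<in>P2 C. short_exact C F G H" by blast
qed

text \<open>An admissible epimorphism is a deflation and therefore the cokernel of its
  kernel.\<close>

lemma grade_mod_adm:
  assumes e: "inj (e :: 'b set \<Rightarrow> 'u)" and F: "(F :: ('a, 'b, 'u) cfunctor) \<in> mod_adm C S"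
  shows "grade C F \<noteq> 1"
proof -
  obtain f x where f: "pres C f F x" "adm C S f" using mod_adm_iff[THEN iffD1, OF F] by blast
  show ?thesis
  proof (cases "epic C f")
    case True
    then obtain i where i: "(i, f) \<in> S" using adm_epic_deflation[OF f(2)] by (auto simp: deflation_def)
    then show ?thesis using grade_neq_1_iff[OF e f(1) conflationD(1)[OF i]] conflationD(2)[OF i] by simp
  next
    case False
    obtain k where "ker_of C k f" using adm_has_kernel[OF f(2)] by (auto simp: has_kernel_def)
    then show ?thesis using grade_neq_1_iff[OF e f(1)] False by blast
  qed
qed

text \<open>Transposing keeps the presenting arrow, and admissibility is self-dual. The inclusion of
  the left side needs stable invariance of admissibility in \<open>opp C\<close>, since
  \<open>Tr\<close> is closed under stable isomorphism.\<close>

lemma Tr_mod_adm: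
  assumes e: "inj (e :: 'b set \<Rightarrow> 'u)"
  shows "Tr C (mod_adm C S :: ('a, 'b, 'u) cfunctor set) = mod_adm (opp C) (S\<inverse>)"
proof -
  interpret op: exact_ic_category "opp C" "S\<inverse>" by (rule opp_exact_ic)
  interpret A: stably_closed "opp C" "{f. adm (opp C) (S\<inverse>) f}" by (rule op.adm_stably_closed)
  show ?thesis
  proof (intro equalityI subsetI)
    fix G :: "('a, 'b, 'u) cfunctor" assume "G \<in> Tr C (mod_adm C S)"
    then obtain F T :: "('a, 'b, 'u) cfunctor" where G: "G \<in> fp_modules (opp C)" and F: "F \<in> mod_adm C S"
      and T: "is_transpose C F T" and st: "stable_iso (opp C) G T" unfolding Tr_def by blast
    obtain f x t where f: "pres C f F x" "pres (opp C) f T t"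
      using T is_transpose_iff[OF P2_Modules[OF mod_adm_P2[OF F]]] by blast
    obtain g y where g: "pres (opp C) g G y" using op.fp_iff[THEN iffD1, OF G] by blast
    obtain \<eta> \<theta> where \<eta>: "nat_trans (opp C) G T \<eta>" "nat_trans (opp C) T G \<theta>"
      "stable_eq (opp C) G G (\<lambda>A x. \<theta> A (\<eta> A x)) (\<lambda>A x. x)" using st unfolding stable_iso_def by blast
    have "g \<in> {f. adm (opp C) (S\<inverse>) f}"
      by (rule A.stable_retract_mem[OF f(2) _ g \<eta>]) (use mod_adm_pres[OF F f(1)] in simp)
    then show "G \<in> mod_adm (opp C) (S\<inverse>)" unfolding op.mod_adm_iff using g by blast
  next
    fix G :: "('a, 'b, 'u) cfunctor" assume "G \<in> mod_adm (opp C) (S\<inverse>)"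
    then obtain g y where g: "pres (opp C) g G y" "adm (opp C) (S\<inverse>) g" using op.mod_adm_iff[THEN iffD1] by blast
    have "arr C g" using op.presD(2)[OF g(1)] by simp
    then obtain F :: "('a, 'b, 'u) cfunctor" and x where F: "pres C g F x" using pres_ex[OF e] by blast
    have "F \<in> mod_adm C S" unfolding mod_adm_iff using F g(2) by auto
    moreover have "is_transpose C F G" using is_transpose_iff[OF presD(1)[OF F]] F g(1) by blast
    moreover have "stable_iso (opp C) G G" by (rule op.stable_iso_refl[OF op.presD(1)[OF g(1)]])
    moreover have "G \<in> fp_modules (opp C)" unfolding op.fp_iff using g(1) by blast
    ultimately show "G \<in> Tr C (mod_adm C S)" unfolding Tr_def by blast
  qed
qed

text \<open>The right-hand side refers to \<open>S\<close> only through \<open>mod_adm C S\<close>;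
  this yields injectivity of the correspondence.\<close>

lemma conflation_iff:
  assumes e: "inj (e :: 'b set \<Rightarrow> 'u)"
  shows "(i, p) \<in> S \<longleftrightarrow> ker_of C i p \<and> coker_of C p i \<and>
    (\<exists>F\<in>mod_adm C S. \<exists>x. pres C p (F :: ('a, 'b, 'u) cfunctor) x)"
proof
  assume S: "(i, p) \<in> S"
  note k = conflationD[OF S]
  have "adm C S p" using deflation_adm S by (auto simp: deflation_def)
  moreover obtain F :: "('a, 'b, 'u) cfunctor" and x where "pres C p F x"
    using pres_ex[OF e ker_ofD(3)[OF k(1)]] by blast
  ultimately show "ker_of C i p \<and> coker_of C p i \<and> (\<exists>F\<in>mod_adm C S. \<exists>x. pres C p (F :: ('a, 'b, 'u) cfunctor) x)"
    using k mod_adm_iff[THEN iffD2, of F] by blast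
next
  assume R: "ker_of C i p \<and> coker_of C p i \<and> (\<exists>F\<in>mod_adm C S. \<exists>x. pres C p (F :: ('a, 'b, 'u) cfunctor) x)"
  then obtain F :: "('a, 'b, 'u) cfunctor" and x where F: "F \<in> mod_adm C S" "pres C p F x" by blast
  have "adm C S p" by (rule mod_adm_pres[OF F])
  then have "deflation S p" using adm_epic_deflation coker_ofD(1) R by blast
  then show "(i, p) \<in> S" using ker_conflation R by blast
qed

end

section \<open>Splitting off direct summands\<close>

context additive_category
begin

text \<open>The complementary idempotents split and give an arrow \<open>f2\<close> with
  \<open>f\<close> isomorphic to the sum of \<open>f1\<close> and \<open>f2\<close>. A retract of
  arrows thus becomes a direct summand of modules, the form in which \<open>resolving\<close> states
  its closure.\<close>

lemma direct_sum_pres: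
  assumes ic: "idempotent_complete C" and e: "inj (e :: 'm set \<Rightarrow> 'u)"
    and F: "pres C f (F :: ('o, 'm, 'u) cfunctor) x" and k: "has_kernel C f"
    and ret: "arrow_retract C f1 f s r s' r'" and F1: "pres C f1 (F1 :: ('o, 'm, 'u) cfunctor) x1"
  obtains F2 :: "('o, 'm, 'u) cfunctor" where "F2 \<in> P2 C" "nt_iso C F (direct_sum F1 F2)"
proof -
  note dF = presD[OF F] and d1 = presD[OF F1]
  have R: "arr C s" "src C s = src C f1" "tgt C s = src C f" "arr C r" "src C r = src C f" "tgt C r = src C f1"
    "arr C s'" "src C s' = tgt C f1" "tgt C s' = tgt C f" "arr C r'" "src C r' = tgt C f" "tgt C r' = tgt C f1"
    and E: "r \<cdot> s = Idt C (src C f1)" "r' \<cdot> s' = Idt C (tgt C f1)" "f \<cdot> s = s' \<cdot> f1" "r' \<cdot> f = f1 \<cdot> r"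
    using ret unfolding arrow_retract_def by simp_all
  note f = dF(2) and f1 = d1(2)
  have red: "\<And>t. \<lbrakk>arr C t; tgt C t = src C f1\<rbrakk> \<Longrightarrow> r \<cdot> (s \<cdot> t) = t"
    "\<And>t. \<lbrakk>arr C t; tgt C t = tgt C f1\<rbrakk> \<Longrightarrow> r' \<cdot> (s' \<cdot> t) = t"
    "\<And>t. \<lbrakk>arr C t; tgt C t = src C f1\<rbrakk> \<Longrightarrow> f \<cdot> (s \<cdot> t) = s' \<cdot> (f1 \<cdot> t)"
    "\<And>t. \<lbrakk>arr C t; tgt C t = src C f\<rbrakk> \<Longrightarrow> r' \<cdot> (f \<cdot> t) = f1 \<cdot> (r \<cdot> t)"
    using cmp_red[OF E(1)] cmp_red[OF E(2)] cmp_red[OF E(3)] cmp_red[OF E(4)] R f f1 by simp_all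
  \<comment> \<open>The idempotents \<open>1 - s \<cdot> r\<close> and
    \<open>1 - s' \<cdot> r'\<close> project onto the complements of \<open>f1\<close> in source and
    target.\<close>
  define u where "u = Idt C (src C f) \<boxplus> neg C (s \<cdot> r)"
  define u' where "u' = Idt C (tgt C f) \<boxplus> neg C (s' \<cdot> r')"
  have u: "arr C u" "src C u = src C f" "tgt C u = src C f" unfolding u_def using R f by simp_all
  have u': "arr C u'" "src C u' = tgt C f" "tgt C u' = tgt C f" unfolding u'_def using R f by simp_all
  have "u \<cdot> u = u" unfolding u_def using R f red E by simp
  then obtain r2 s2 where S: "arr C r2" "arr C s2" "src C r2 = src C f" "tgt C s2 = src C f"
    "src C s2 = tgt C r2" "s2 \<cdot> r2 = u" "r2 \<cdot> s2 = Idt C (tgt C r2)"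
    using split_idempotent[OF ic u(1)] u by metis
  have "u' \<cdot> u' = u'" unfolding u'_def using R f red E by simp
  then obtain r2' s2' where S': "arr C r2'" "arr C s2'" "src C r2' = tgt C f" "tgt C s2' = tgt C f"
    "src C s2' = tgt C r2'" "s2' \<cdot> r2' = u'" "r2' \<cdot> s2' = Idt C (tgt C r2')"
    using split_idempotent[OF ic u'(1)] u' by metis
  have redS: "\<And>t. \<lbrakk>arr C t; tgt C t = tgt C r2\<rbrakk> \<Longrightarrow> r2 \<cdot> (s2 \<cdot> t) = t"
    "\<And>t. \<lbrakk>arr C t; tgt C t = tgt C r2'\<rbrakk> \<Longrightarrow> r2' \<cdot> (s2' \<cdot> t) = t"
    "\<And>t. \<lbrakk>arr C t; tgt C t = src C f\<rbrakk> \<Longrightarrow> s2 \<cdot> (r2 \<cdot> t) = t \<boxplus> neg C (s \<cdot> (r \<cdot> t))"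
    "\<And>t. \<lbrakk>arr C t; tgt C t = tgt C f\<rbrakk> \<Longrightarrow> s2' \<cdot> (r2' \<cdot> t) = t \<boxplus> neg C (s' \<cdot> (r' \<cdot> t))"
    using cmp_red[OF S(7)] cmp_red[OF S'(7)] cmp_red[OF S(6)] cmp_red[OF S'(6)] S(1-5) S'(1-5) R f
    unfolding u_def u'_def by simp_all
  have rs2: "r \<cdot> s2 = zer C (tgt C r2) (src C f1)"
  proof -
    have "r \<cdot> s2 = r \<cdot> (s2 \<cdot> (r2 \<cdot> s2))" using S(1-5,7) R by simp
    also have "\<dots> = zer C (tgt C r2) (src C f1)" using redS(3)[of s2] S(1-5) R red f by simp
    finally show ?thesis .
  qed
  have rs2': "r' \<cdot> s2' = zer C (tgt C r2') (tgt C f1)"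
  proof -
    have "r' \<cdot> s2' = r' \<cdot> (s2' \<cdot> (r2' \<cdot> s2'))" using S'(1-5,7) R by simp
    also have "\<dots> = zer C (tgt C r2') (tgt C f1)" using redS(4)[of s2'] S'(1-5) R red f by simp
    finally show ?thesis .
  qed
  have r2s': "r2' \<cdot> s' = zer C (tgt C f1) (tgt C r2')"
  proof -
    have "r2' \<cdot> s' = r2' \<cdot> (s2' \<cdot> (r2' \<cdot> s'))" using S'(1-5) redS(2)[of "r2' \<cdot> s'"] R f1 by simp
    also have "\<dots> = zer C (tgt C f1) (tgt C r2')" using redS(4)[of s'] S'(1-5) R E f f1 by simp
    finally show ?thesis .
  qed
  have red2: "\<And>t. \<lbrakk>arr C t; tgt C t = tgt C r2\<rbrakk> \<Longrightarrow> r \<cdot> (s2 \<cdot> t) = zer C (src C t) (src C f1)"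
    "\<And>t. \<lbrakk>arr C t; tgt C t = tgt C r2'\<rbrakk> \<Longrightarrow> r' \<cdot> (s2' \<cdot> t) = zer C (src C t) (tgt C f1)"
    "\<And>t. \<lbrakk>arr C t; tgt C t = tgt C f1\<rbrakk> \<Longrightarrow> r2' \<cdot> (s' \<cdot> t) = zer C (src C t) (tgt C r2')"
    using cmp_red[OF rs2] cmp_red[OF rs2'] cmp_red[OF r2s'] S(1-5) S'(1-5) R f1 by simp_all
  define f2 where "f2 = r2' \<cdot> (f \<cdot> s2)"
  have f2: "arr C f2" "src C f2 = tgt C r2" "tgt C f2 = tgt C r2'" unfolding f2_def using S(1-5) S'(1-5) f by simp_all
  have fs2: "f \<cdot> s2 = s2' \<cdot> f2"
    unfolding f2_def using redS(4)[of "f \<cdot> s2"] S(1-5) S'(1-5) R f f1 red rs2 by simp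
  have r2f: "r2' \<cdot> f = f2 \<cdot> r2"
  proof -
    have "f2 \<cdot> r2 = r2' \<cdot> (f \<cdot> (s2 \<cdot> r2))" unfolding f2_def using S(1-5) S'(1-5) f by simp
    also have "\<dots> = r2' \<cdot> f" unfolding S(6) u_def using S'(1-5) R f f1 red red2 by simp
    finally show ?thesis by simp
  qed
  have "arrow_retract C f2 f s2 r2 s2' r2'"
    unfolding arrow_retract_def using f2 f S S' fs2 r2f by simp
  then have k2: "has_kernel C f2" using retract_kernel[OF ic] k by (auto simp: has_kernel_def)
  obtain F2 :: "('o, 'm, 'u) cfunctor" and x2 where F2: "pres C f2 F2 x2" using pres_ex[OF e f2(1)] by blast
  note d2 = presD[OF F2]
  have r'x1: "FMap F1 r' x1 \<in> el F1 (tgt C f)" using d1(1,3) R by simp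
  have "factors C (r' \<cdot> f) f1" unfolding factors_def by (rule exI[of _ r]) (use R E f f1 in simp)
  then have "FMap F1 f (FMap F1 r' x1) = \<one>\<^bsub>FOb F1 (src C f)\<^esub>"
    using d1(5)[of "r' \<cdot> f"] act_cmp[OF d1(1), of f r' x1] d1(3) R f by simp
  then obtain \<eta>1 where \<eta>1: "nat_trans C F F1 \<eta>1"
    and "\<And>g. \<lbrakk>arr C g; tgt C g = tgt C f\<rbrakk> \<Longrightarrow> \<eta>1 (src C g) (FMap F g x) = FMap F1 g (FMap F1 r' x1)"
    using pres_map[OF F d1(1) r'x1] by metis
  then have \<eta>1x: "\<And>g. \<lbrakk>arr C g; tgt C g = tgt C f\<rbrakk> \<Longrightarrow> \<eta>1 (src C g) (FMap F g x) = FMap F1 (r' \<cdot> g) x1"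
    using act_cmp[OF d1(1) _ R(10)] d1(3) R by simp
  have r2'x2: "FMap F2 r2' x2 \<in> el F2 (tgt C f)" using d2(1,3) S' f2 by simp
  have "factors C (r2' \<cdot> f) f2" unfolding factors_def by (rule exI[of _ r2]) (use S S' r2f f f2 in simp)
  then have "FMap F2 f (FMap F2 r2' x2) = \<one>\<^bsub>FOb F2 (src C f)\<^esub>"
    using d2(5)[of "r2' \<cdot> f"] act_cmp[OF d2(1), of f r2' x2] d2(3) S' f f2 by simp
  then obtain \<eta>2 where \<eta>2: "nat_trans C F F2 \<eta>2"
    and "\<And>g. \<lbrakk>arr C g; tgt C g = tgt C f\<rbrakk> \<Longrightarrow> \<eta>2 (src C g) (FMap F g x) = FMap F2 g (FMap F2 r2' x2)"
    using pres_map[OF F d2(1) r2'x2] by metis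
  then have \<eta>2x: "\<And>g. \<lbrakk>arr C g; tgt C g = tgt C f\<rbrakk> \<Longrightarrow> \<eta>2 (src C g) (FMap F g x) = FMap F2 (r2' \<cdot> g) x2"
    using act_cmp[OF d2(1) _ S'(1)] d2(3) S' f2 by simp
  have nt: "nat_trans C F (direct_sum F1 F2) (\<lambda>A v. (\<eta>1 A v, \<eta>2 A v))"
    unfolding nat_trans_def direct_sum_def hom_def
    using nt_closed[OF \<eta>1] nt_closed[OF \<eta>2] nt_mult[OF \<eta>1] nt_mult[OF \<eta>2] nt_natural[OF \<eta>1] nt_natural[OF \<eta>2]
    by auto
  have "bij_betw (\<lambda>v. (\<eta>1 A v, \<eta>2 A v)) (el F A) (el (direct_sum F1 F2) A)" if A: "A \<in> Ob C" for A
    unfolding bij_betw_def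
  proof (intro conjI inj_onI equalityI subsetI)
    fix v w assume v: "v \<in> el F A" and w: "w \<in> el F A" and eq: "(\<eta>1 A v, \<eta>2 A v) = (\<eta>1 A w, \<eta>2 A w)"
    obtain g where g: "arr C g" "src C g = A" "tgt C g = tgt C f" "FMap F g x = v" using dF(4)[OF A v] by blast
    obtain h where h: "arr C h" "src C h = A" "tgt C h = tgt C f" "FMap F h x = w" using dF(4)[OF A w] by blast
    let ?t = "g \<boxplus> neg C h"
    have t: "arr C ?t" "src C ?t = A" "tgt C ?t = tgt C f" using g h by simp_all
    have "factors C (r' \<cdot> g \<boxplus> neg C (r' \<cdot> h)) f1"
      using pres_eq[OF F1, of "r' \<cdot> g" "r' \<cdot> h"] \<eta>1x[of g] \<eta>1x[of h] eq g h R by simp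
    then obtain a where a: "arr C a" "src C a = A" "tgt C a = src C f1" "f1 \<cdot> a = r' \<cdot> ?t"
      using g h R by (auto simp: factors_def)
    have "factors C (r2' \<cdot> g \<boxplus> neg C (r2' \<cdot> h)) f2"
      using pres_eq[OF F2, of "r2' \<cdot> g" "r2' \<cdot> h"] \<eta>2x[of g] \<eta>2x[of h] eq g h S' f2 by simp
    then obtain b where b: "arr C b" "src C b = A" "tgt C b = src C f2" "f2 \<cdot> b = r2' \<cdot> ?t"
      using g h S' by (auto simp: factors_def)
    \<comment> \<open>As \<open>s' \<cdot> r'\<close> and \<open>s2' \<cdot> r2'\<close> add up to
      the identity, the two component factorizations assemble to one of \<open>?t\<close> through
      \<open>f\<close>.\<close>
    have "f \<cdot> (s \<cdot> a \<boxplus> s2 \<cdot> b) = f \<cdot> (s \<cdot> a) \<boxplus> f \<cdot> (s2 \<cdot> b)" using a b R S f f2 by simp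
    also have "f \<cdot> (s2 \<cdot> b) = s2' \<cdot> (f2 \<cdot> b)" using cmp_red[OF fs2] b S(1-5) S'(1-5) f f2 by simp
    also have "f \<cdot> (s \<cdot> a) = s' \<cdot> (f1 \<cdot> a)" using red a by simp
    also have "s' \<cdot> (f1 \<cdot> a) \<boxplus> s2' \<cdot> (f2 \<cdot> b) = s' \<cdot> (r' \<cdot> ?t) \<boxplus> s2' \<cdot> (r2' \<cdot> ?t)" by (simp only: a(4) b(4))
    also have "s2' \<cdot> (r2' \<cdot> ?t) = ?t \<boxplus> neg C (s' \<cdot> (r' \<cdot> ?t))" by (rule redS(4)[OF t(1,3)])
    also have "s' \<cdot> (r' \<cdot> ?t) \<boxplus> (?t \<boxplus> neg C (s' \<cdot> (r' \<cdot> ?t))) = ?t"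
      by (rule add_add_neg) (use t R in simp_all)
    finally have "factors C ?t f" unfolding factors_def
      by (intro exI[of _ "s \<cdot> a \<boxplus> s2 \<cdot> b"]) (use a(1-3) b(1-3) R S(1-5) f2 t in simp)
    then show "v = w" using pres_eq[OF F g(1) h(1)] g h by simp
  next
    fix v assume "v \<in> (\<lambda>v. (\<eta>1 A v, \<eta>2 A v)) ` el F A"
    then show "v \<in> el (direct_sum F1 F2) A"
      using nt_closed[OF \<eta>1 A] nt_closed[OF \<eta>2 A] by (auto simp: direct_sum_def)
  next
    fix v assume "v \<in> el (direct_sum F1 F2) A"
    then obtain v1 v2 where v: "v = (v1, v2)" "v1 \<in> el F1 A" "v2 \<in> el F2 A" by (auto simp: direct_sum_def)
    obtain a where a: "arr C a" "src C a = A" "tgt C a = tgt C f1" "FMap F1 a x1 = v1" using d1(4)[OF A v(2)] by blast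
    obtain b where b: "arr C b" "src C b = A" "tgt C b = tgt C f2" "FMap F2 b x2 = v2" using d2(4)[OF A v(3)] by blast
    let ?g = "s' \<cdot> a \<boxplus> s2' \<cdot> b"
    have g: "arr C ?g" "src C ?g = A" "tgt C ?g = tgt C f" using a b R S' f2 by simp_all
    have "r' \<cdot> ?g = a" "r2' \<cdot> ?g = b" using a(1-3) b(1-3) R S'(1-5) f2 red red2 redS by simp_all
    then have "v = (\<eta>1 A (FMap F ?g x), \<eta>2 A (FMap F ?g x))"
      using \<eta>1x[OF g(1,3)] \<eta>2x[OF g(1,3)] g a b v by simp
    moreover have "FMap F ?g x \<in> el F A" using dF(1,3) g by simp
    ultimately show "v \<in> (\<lambda>v. (\<eta>1 A v, \<eta>2 A v)) ` el F A" by blast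
  qed
  then have "nt_iso C F (direct_sum F1 F2)" unfolding nt_iso_def using nt by blast
  moreover have "F2 \<in> P2 C" unfolding P2_iff using F2 k2 by blast
  ultimately show ?thesis using that by blast
qed

text \<open>The quotient \<open>H\<close> is a copy of a representable functor, so a preimage
  \<open>y\<close> of its generator defines a section and the sequence splits.\<close>

lemma split_short_exact:
  assumes se: "short_exact C F G H" and F: "F \<in> Modules C" and G: "G \<in> Modules C"
    and H: "pres C (zer C Z A) H z" and Z: "is_zero C Z" and A: "A \<in> Ob C"
  shows "nt_iso C G (direct_sum H F)"
proof -
  have ZO: "Z \<in> Ob C" using Z by (simp add: is_zero_def)
  have tz: "tgt C (zer C Z A) = A" "src C (zer C Z A) = Z" using A ZO by simp_all
  note dH = presD[OF H, unfolded tz]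
  obtain \<eta> \<theta> where \<eta>: "nat_trans C F G \<eta>" and \<theta>: "nat_trans C G H \<theta>"
    and mono: "\<And>A v. \<lbrakk>A \<in> Ob C; v \<in> el F A; \<eta> A v = \<one>\<^bsub>FOb G A\<^esub>\<rbrakk> \<Longrightarrow> v = \<one>\<^bsub>FOb F A\<^esub>"
    and comp: "\<And>A v. \<lbrakk>A \<in> Ob C; v \<in> el F A\<rbrakk> \<Longrightarrow> \<theta> A (\<eta> A v) = \<one>\<^bsub>FOb H A\<^esub>"
    and ex: "\<And>A v. \<lbrakk>A \<in> Ob C; v \<in> el G A; \<theta> A v = \<one>\<^bsub>FOb H A\<^esub>\<rbrakk> \<Longrightarrow> \<exists>u\<in>el F A. v = \<eta> A u"
    and epi: "\<And>A v. \<lbrakk>A \<in> Ob C; v \<in> el H A\<rbrakk> \<Longrightarrow> \<exists>u\<in>el G A. v = \<theta> A u"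
    using short_exactE[OF se F G dH(1)] by blast
  obtain y where y: "y \<in> el G A" "\<theta> A y = z" using epi[OF A dH(3)] by auto
  have "FMap G (zer C Z A) y = \<one>\<^bsub>FOb G Z\<^esub>" using G A ZO y by simp
  then obtain \<sigma> where \<sigma>: "nat_trans C H G \<sigma>"
    and \<sigma>z: "\<And>g. \<lbrakk>arr C g; tgt C g = A\<rbrakk> \<Longrightarrow> \<sigma> (src C g) (FMap H g z) = FMap G g y"
    using pres_map[OF H G, of y] y tz by metis
  have \<theta>\<sigma>: "\<theta> B (\<sigma> B v) = v" if B: "B \<in> Ob C" "v \<in> el H B" for B v
  proof -
    obtain g where g: "arr C g" "src C g = B" "tgt C g = A" "FMap H g z = v" using dH(4)[OF B] by blast
    then show ?thesis using \<sigma>z[of g] nt_natural[OF \<theta> g(1), of y] y by simp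
  qed
  let ?D = "direct_sum H F"
  have DM: "?D \<in> Modules C" by (rule direct_sum_Modules[OF dH(1) F])
  have fst: "nat_trans C ?D H (\<lambda>B. fst)" and snd: "nat_trans C ?D F (\<lambda>B. snd)"
    unfolding nat_trans_def direct_sum_def hom_def by auto
  have \<zeta>: "nat_trans C ?D G (\<lambda>B p. \<sigma> B (fst p) \<otimes>\<^bsub>FOb G B\<^esub> \<eta> B (snd p))"
    by (rule nat_trans_mult[OF nat_trans_comp[OF fst \<sigma>] nat_trans_comp[OF snd \<eta>] DM G])
  have "bij_betw (\<lambda>p. \<sigma> B (fst p) \<otimes>\<^bsub>FOb G B\<^esub> \<eta> B (snd p)) (el ?D B) (el G B)" if B: "B \<in> Ob C" for B
  proof -
    interpret GB: comm_group "FOb G B" by (rule mod_comm_group[OF G B])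
    interpret HB: comm_group "FOb H B" by (rule mod_comm_group[OF dH(1) B])
    have D: "el ?D B = el H B \<times> el F B" by (simp add: direct_sum_def)
    have \<theta>\<zeta>: "\<theta> B (\<sigma> B a \<otimes>\<^bsub>FOb G B\<^esub> \<eta> B b) = a" if "a \<in> el H B" "b \<in> el F B" for a b
      using nt_mult[OF \<theta> B nt_closed[OF \<sigma> B that(1)] nt_closed[OF \<eta> B that(2)]] \<theta>\<sigma>[OF B that(1)] comp[OF B that(2)] that
      by simp
    have mo: "nt_mono C F \<eta>" by (rule nt_monoI[OF \<eta> F G]) (use mono in auto)
    show ?thesis unfolding bij_betw_def
    proof (intro conjI inj_onI equalityI subsetI)
      fix p q assume p: "p \<in> el ?D B" and q: "q \<in> el ?D B"
        and eq: "\<sigma> B (fst p) \<otimes>\<^bsub>FOb G B\<^esub> \<eta> B (snd p) = \<sigma> B (fst q) \<otimes>\<^bsub>FOb G B\<^esub> \<eta> B (snd q)"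
      obtain a b where p': "p = (a, b)" "a \<in> el H B" "b \<in> el F B" using p D by auto
      obtain a' b' where q': "q = (a', b')" "a' \<in> el H B" "b' \<in> el F B" using q D by auto
      have aa: "a = a'" using \<theta>\<zeta>[OF p'(2,3)] \<theta>\<zeta>[OF q'(2,3)] eq p' q' by simp
      then have "\<eta> B b = \<eta> B b'"
        using eq p' q' nt_closed[OF \<sigma> B p'(2)] nt_closed[OF \<eta> B p'(3)] nt_closed[OF \<eta> B q'(3)] by simp
      then have "b = b'" using mo B p' q' unfolding nt_mono_def inj_on_def by blast
      then show "p = q" using aa p' q' by simp
    next
      fix v assume "v \<in> (\<lambda>p. \<sigma> B (fst p) \<otimes>\<^bsub>FOb G B\<^esub> \<eta> B (snd p)) ` el ?D B"
      then show "v \<in> el G B" using nt_closed[OF \<sigma> B] nt_closed[OF \<eta> B] by (auto simp: D)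
    next
      fix v assume v: "v \<in> el G B"
      let ?a = "\<theta> B v"
      have a: "?a \<in> el H B" "\<sigma> B ?a \<in> el G B" using nt_closed[OF \<theta> B v] nt_closed[OF \<sigma> B] by auto
      have "\<theta> B (inv\<^bsub>FOb G B\<^esub> (\<sigma> B ?a) \<otimes>\<^bsub>FOb G B\<^esub> v) = \<one>\<^bsub>FOb H B\<^esub>"
        using nt_mult[OF \<theta> B, of "inv\<^bsub>FOb G B\<^esub> (\<sigma> B ?a)" v] nt_inv[OF \<theta> G dH(1) B a(2)] \<theta>\<sigma>[OF B a(1)] a v by simp
      then obtain b where b: "b \<in> el F B" "inv\<^bsub>FOb G B\<^esub> (\<sigma> B ?a) \<otimes>\<^bsub>FOb G B\<^esub> v = \<eta> B b"
        using ex[OF B, of "inv\<^bsub>FOb G B\<^esub> (\<sigma> B ?a) \<otimes>\<^bsub>FOb G B\<^esub> v"] a v by auto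
      have "v = \<sigma> B ?a \<otimes>\<^bsub>FOb G B\<^esub> \<eta> B b" unfolding b(2)[symmetric] using a v by (simp add: GB.m_assoc[symmetric])
      then show "v \<in> (\<lambda>p. \<sigma> B (fst p) \<otimes>\<^bsub>FOb G B\<^esub> \<eta> B (snd p)) ` el ?D B"
        using a(1) b(1) by (intro image_eqI[of _ _ "(?a, b)"]) (auto simp: D)
    qed
  qed
  then have "nt_iso C ?D G" unfolding nt_iso_def using \<zeta> by blast
  then obtain \<alpha> \<beta> where ab: "nat_trans C ?D G \<alpha>" "nat_trans C G ?D \<beta>"
    "\<And>A x. \<lbrakk>A \<in> Ob C; x \<in> el ?D A\<rbrakk> \<Longrightarrow> \<beta> A (\<alpha> A x) = x"
    "\<And>A x. \<lbrakk>A \<in> Ob C; x \<in> el G A\<rbrakk> \<Longrightarrow> \<alpha> A (\<beta> A x) = x"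
    by (rule nt_iso_inverse[OF _ DM G]) blast
  have "bij_betw (\<beta> B) (el G B) (el ?D B)" if "B \<in> Ob C" for B
    by (rule bij_betw_byWitness[of _ "\<alpha> B"]) (use ab that nt_closed[OF ab(1)] nt_closed[OF ab(2)] in auto)
  then show ?thesis unfolding nt_iso_def using ab(2) by blast
qed

end

section \<open>The correspondence\<close>

definition presenting_arrows :: "('o, 'm) precat \<Rightarrow> ('o, 'm, 'u) cfunctor set \<Rightarrow> 'm set"
  where "presenting_arrows C \<X> = {f. \<exists>F\<in>\<X>. \<exists>x. pres C f F x}"

locale resolving_modules = additive_category C for C :: "('o, 'm) precat" (structure) +
  fixes \<X> :: "('o, 'm, 'u) cfunctor set" and e :: "'m set \<Rightarrow> 'u"
  assumes ic: "idempotent_complete C" and e: "inj e" and res: "resolving C (P2 C) \<X>"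
begin

abbreviation "M \<equiv> presenting_arrows C \<X>"

lemma X_P2: "F \<in> \<X> \<Longrightarrow> F \<in> P2 C"
  using res unfolding resolving_def subcategory_of_def by blast

text \<open>Two modules presented by \<open>f\<close> are isomorphic. Closure of \<open>\<X>\<close>
  under isomorphism holds inside \<open>P2 C\<close>, so the second module is first placed there by
  the kernel of \<open>f\<close>.\<close>

lemma mem_iff:
  assumes "pres C f F x"
  shows "f \<in> M \<longleftrightarrow> F \<in> \<X>"
proof
  assume "f \<in> M"
  then obtain F' x' where F': "F' \<in> \<X>" "pres C f F' x'" by (auto simp: presenting_arrows_def)
  have "F \<in> P2 C" unfolding P2_iff using P2_has_kernel[OF ic X_P2[OF F'(1)] F'(2)] assms by blast
  then show "F \<in> \<X>"
    using res F'(1) nt_iso_pres[OF F'(2) assms] unfolding resolving_def subcategory_of_def by blast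
qed (use assms in \<open>auto simp: presenting_arrows_def\<close>)

lemma M_has_kernel: "f \<in> M \<Longrightarrow> has_kernel C f"
  by (auto simp: presenting_arrows_def intro: P2_has_kernel[OF ic X_P2])

lemma M_arrow: "f \<in> M \<Longrightarrow> arr C f"
  by (auto simp: presenting_arrows_def dest: presD(2))

lemma mem_extension:
  assumes ses: "arrow_ses C f g h a b" and f: "f \<in> M" and h: "h \<in> M" and g: "has_kernel C g"
  shows "g \<in> M"
proof -
  obtain F x where F: "F \<in> \<X>" "pres C f F x" using f by (auto simp: presenting_arrows_def)
  obtain H z where H: "H \<in> \<X>" "pres C h H z" using h by (auto simp: presenting_arrows_def)
  obtain G :: "('o, 'm, 'u) cfunctor" and y where G: "pres C g G y" using pres_ex[OF e arrow_sesD(2)[OF ses]] by blast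
  have "G \<in> P2 C" unfolding P2_iff using G g by blast
  then have "G \<in> \<X>" using res F(1) H(1) short_exact_pres[OF F(2) G H(2) ses] unfolding resolving_def by blast
  then show ?thesis using mem_iff[OF G] by simp
qed

lemma mem_deflation_kernel:
  assumes ses: "arrow_ses C f g h a b" and g: "g \<in> M" and h: "h \<in> M" and f: "has_kernel C f"
  shows "f \<in> M"
proof -
  obtain G y where G: "G \<in> \<X>" "pres C g G y" using g by (auto simp: presenting_arrows_def)
  obtain H z where H: "H \<in> \<X>" "pres C h H z" using h by (auto simp: presenting_arrows_def)
  obtain F :: "('o, 'm, 'u) cfunctor" and x where F: "pres C f F x" using pres_ex[OF e arrow_sesD(1)[OF ses]] by blast
  have "F \<in> P2 C" unfolding P2_iff using F f by blast
  then have "F \<in> \<X>" using res G(1) H(1) short_exact_pres[OF F G(2) H(2) ses] unfolding resolving_def by blast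
  then show ?thesis using mem_iff[OF F] by simp
qed

lemma summand_mem:
  assumes "F \<in> P2 C" "(G :: ('o, 'm, 'u) cfunctor) \<in> P2 C" "H \<in> \<X>" "nt_iso C H (direct_sum F G)"
  shows "F \<in> \<X>"
  using res assms unfolding resolving_def by blast

text \<open>Generation gives a deflation from an object of \<open>\<X>\<close> onto the
  representable functor presented by \<open>f\<close>. It splits, so the representable functor is a
  summand of that object.\<close>

lemma zero_mem:
  assumes f: "arr C f" and Z: "is_zero C (src C f)"
  shows "f \<in> M"
proof -
  have fz: "f = zer C (src C f) (tgt C f)" by (rule src_zero[OF Z f])
  obtain H :: "('o, 'm, 'u) cfunctor" and z where H: "pres C f H z" using pres_ex[OF e f] by blast
  have "H \<in> P2 C" unfolding P2_iff using H monic_has_kernel[OF zero_monic[OF f Z]] by blast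
  moreover from this obtain G F where G: "G \<in> \<X>" and F: "F \<in> P2 C" and se: "short_exact C F G H"
    using res unfolding resolving_def by blast
  have "pres C (zer C (src C f) (tgt C f)) H z" using H fz by simp
  then have "nt_iso C G (direct_sum H F)"
    using split_short_exact[OF se P2_Modules[OF F] P2_Modules[OF X_P2[OF G]] _ Z src_tgt_Ob(2)[OF f]] by blast
  ultimately have "H \<in> \<X>" using summand_mem F G by blast
  then show ?thesis using mem_iff[OF H] by simp
qed

lemma resolving_arrows_M:
  assumes gr: "\<forall>F\<in>\<X>. grade C F \<noteq> 1"
  shows "resolving_arrows C M"
proof unfold_locales
  fix f k assume f: "f \<in> M" "epic C f" "ker_of C k f"
  then obtain F x where F: "F \<in> \<X>" "pres C f F x" by (auto simp: presenting_arrows_def)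
  then show "coker_of C f k" using grade_neq_1_iff[OF e F(2) f(3)] gr f(2) by blast
qed (fact M_arrow M_has_kernel mem_extension mem_deflation_kernel zero_mem)+

text \<open>Adding an identity or a zero source summand leaves the presented module as it is. A zero
  target summand gives an extension by a representable functor, and retracts of arrows give direct
  summands.\<close>

lemma stably_closed_M: "stably_closed C M"
proof unfold_locales
  fix f assume "f \<in> M"
  then obtain F x where F: "F \<in> \<X>" "pres C f F x" by (auto simp: presenting_arrows_def)
  note d = presD[OF F(2)] and fM = \<open>f \<in> M\<close>
  show "arr C f" by (rule d)
  fix V P i j p q
  { fix P' i' j' p' q'
    assume b: "biprod C P (src C f) V i j p q" and b': "biprod C P' (tgt C f) V i' j' p' q'"
    note e1 = biprodD[OF b] and e2 = biprodD[OF b']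
    let ?T = "i' \<cdot> (f \<cdot> p) \<boxplus> j' \<cdot> q"
    have T: "arr C ?T" "src C ?T = P" "tgt C ?T = P'" using d(2) e1 e2 by simp_all
    have act: "FMap F t (FMap F p' x) = FMap F (p' \<cdot> t) x" if "arr C t" "tgt C t = P'" for t
      using act_cmp[OF d(1) that(1), of p' x] that e2 d(3) by simp
    \<comment> \<open>The same module, with its generator restricted along the projection
      \<open>p'\<close> of the enlarged target.\<close>
    have "pres C ?T F (FMap F p' x)" unfolding pres_def
    proof (intro conjI ballI allI impI)
      fix A v assume A: "A \<in> Ob C" "v \<in> el F A"
      obtain g where g: "arr C g" "src C g = A" "tgt C g = tgt C f" "FMap F g x = v" using d(4)[OF A] by blast
      have "FMap F (i' \<cdot> g) (FMap F p' x) = v" using act[of "i' \<cdot> g"] g e2 by simp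
      then show "\<exists>g. arr C g \<and> src C g = A \<and> tgt C g = tgt C ?T \<and> FMap F g (FMap F p' x) = v"
        using g e2 T by (intro exI[of _ "i' \<cdot> g"]) simp
    next
      fix t assume "arr C t" "tgt C t = tgt C ?T"
      then have t: "arr C t" "tgt C t = P'" using T by simp_all
      have "factors C (p' \<cdot> t) f \<longleftrightarrow> factors C t ?T"
      proof
        assume "factors C (p' \<cdot> t) f"
        then obtain r where r: "arr C r" "src C r = src C t" "tgt C r = src C f" "f \<cdot> r = p' \<cdot> t"
          using t e2 by (auto simp: factors_def)
        have "?T \<cdot> (i \<cdot> r \<boxplus> j \<cdot> (q' \<cdot> t)) = t"
          by (rule biprod_eqI[OF b']) (use r t d(2) e1 e2 in simp_all)
        then show "factors C t ?T" unfolding factors_def T(2)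
          by (intro exI[of _ "i \<cdot> r \<boxplus> j \<cdot> (q' \<cdot> t)"]) (use r t e1 e2 in simp)
      next
        assume "factors C t ?T"
        then obtain r where r: "arr C r" "src C r = src C t" "tgt C r = P" "?T \<cdot> r = t"
          unfolding factors_def T(2) by auto
        have "f \<cdot> (p \<cdot> r) = p' \<cdot> t" unfolding r(4)[symmetric] using r(1-3) d(2) e1 e2 by simp
        then show "factors C (p' \<cdot> t) f" unfolding factors_def
          by (intro exI[of _ "p \<cdot> r"]) (use r(1-3) t e1 e2 in simp)
      qed
      then show "FMap F t (FMap F p' x) = \<one>\<^bsub>FOb F (src C t)\<^esub> \<longleftrightarrow> factors C t ?T"
        using act[OF t] d(5)[of "p' \<cdot> t"] t e2 by simp
    qed (use d(1,3) T e2 in simp_all)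
    then show "?T \<in> M" using mem_iff F(1) by blast }
  { assume b: "biprod C P (src C f) V i j p q"
    note e1 = biprodD[OF b]
    have "factors C t (f \<cdot> p) \<longleftrightarrow> factors C t f" if "arr C t" "tgt C t = tgt C f" for t
    proof
      assume "factors C t (f \<cdot> p)"
      then obtain r where r: "arr C r" "src C r = src C t" "tgt C r = src C (f \<cdot> p)" "f \<cdot> p \<cdot> r = t"
        unfolding factors_def by metis
      then have "tgt C r = P" "f \<cdot> (p \<cdot> r) = t" using e1 d(2) by simp_all
      with r(1,2) show "factors C t f" unfolding factors_def by (intro exI[of _ "p \<cdot> r"]) (use e1 in simp)
    next
      assume "factors C t f"
      then obtain r where "arr C r" "src C r = src C t" "tgt C r = src C f" "f \<cdot> r = t" by (auto simp: factors_def)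
      then show "factors C t (f \<cdot> p)" unfolding factors_def by (intro exI[of _ "i \<cdot> r"]) (use e1 d(2) in simp)
    qed
    then have "pres C (f \<cdot> p) F x" unfolding pres_def using d e1 by simp
    then show "f \<cdot> p \<in> M" using mem_iff F(1) by blast }
  { assume b: "biprod C P (tgt C f) V i j p q"
    note e1 = biprodD[OF b]
    obtain Z where Z: "is_zero C Z" using zero_obE .
    then have ZO: "Z \<in> Ob C" by (simp add: is_zero_def)
    let ?z = "zer C Z V"
    have z: "arr C ?z" "src C ?z = Z" "tgt C ?z = V" using ZO e1 by simp_all
    have zM: "?z \<in> M" using zero_mem[of ?z] z Z by simp
    have fz: "factors C t ?z \<longleftrightarrow> t = zer C (src C t) V" if t: "arr C t" "tgt C t = V" for t
    proof
      assume "factors C t ?z"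
      then obtain r where r: "arr C r" "src C r = src C t" "tgt C r = Z" "?z \<cdot> r = t" using z by (auto simp: factors_def)
      then show "t = zer C (src C t) V" using e1 by (metis zer_cmp)
    next
      assume t0: "t = zer C (src C t) V"
      show "factors C t ?z" using factors_zer[of ?z "src C t" V] z t t0 by simp
    qed
    \<comment> \<open>This sequence is split, its right term being the representable functor on
      \<open>V\<close>; written this way it falls under closure under extensions.\<close>
    have "arrow_ses C f (i \<cdot> f) ?z i q" unfolding arrow_ses_def
    proof (intro conjI allI impI)
      fix t assume t: "arr C t" "tgt C t = tgt C f"
      show "factors C (i \<cdot> t) (i \<cdot> f) \<longleftrightarrow> factors C t f"
      proof
        assume "factors C (i \<cdot> t) (i \<cdot> f)"
        then obtain r where r: "arr C r" "src C r = src C t" "tgt C r = src C f" "i \<cdot> (f \<cdot> r) = i \<cdot> t"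
          using t e1 d(2) by (auto simp: factors_def)
        have "f \<cdot> r = t" by (rule monic_cancel[OF biprod_monic[OF b]]) (use r t e1 d(2) in simp_all)
        then show "factors C t f" using r by (auto simp: factors_def)
      next
        assume "factors C t f"
        then obtain r where "arr C r" "src C r = src C t" "tgt C r = src C f" "f \<cdot> r = t" by (auto simp: factors_def)
        then show "factors C (i \<cdot> t) (i \<cdot> f)" unfolding factors_def by (intro exI[of _ r]) (use e1 d(2) in auto)
      qed
    next
      fix t assume "arr C t" "tgt C t = tgt C (i \<cdot> f)"
      then have t: "arr C t" "tgt C t = P" using e1 d(2) by simp_all
      show "factors C (q \<cdot> t) ?z \<longleftrightarrow> (\<exists>r. arr C r \<and> src C r = src C t \<and> tgt C r = tgt C f \<and>
          factors C (t \<boxplus> neg C (i \<cdot> r)) (i \<cdot> f))"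
      proof
        assume "factors C (q \<cdot> t) ?z"
        then have q0: "q \<cdot> t = zer C (src C t) V" using fz[of "q \<cdot> t"] t e1 by simp
        have "t \<boxplus> neg C (i \<cdot> (p \<cdot> t)) = zer C (src C t) P"
          by (rule biprod_eqI[OF b]) (use q0 t e1 in simp_all)
        then have "factors C (t \<boxplus> neg C (i \<cdot> (p \<cdot> t))) (i \<cdot> f)"
          using factors_zer[of "i \<cdot> f" "src C t" P] t e1 d(2) by simp
        then show "\<exists>r. arr C r \<and> src C r = src C t \<and> tgt C r = tgt C f \<and> factors C (t \<boxplus> neg C (i \<cdot> r)) (i \<cdot> f)"
          using t e1 by (intro exI[of _ "p \<cdot> t"]) simp
      next
        assume "\<exists>r. arr C r \<and> src C r = src C t \<and> tgt C r = tgt C f \<and> factors C (t \<boxplus> neg C (i \<cdot> r)) (i \<cdot> f)"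
        then obtain r a where r: "arr C r" "src C r = src C t" "tgt C r = tgt C f"
          and a: "arr C a" "src C a = src C t" "tgt C a = src C f" and eq: "i \<cdot> (f \<cdot> a) = t \<boxplus> neg C (i \<cdot> r)"
          using t e1 d(2) by (auto simp: factors_def)
        have "q \<cdot> (i \<cdot> (f \<cdot> a)) = zer C (src C t) V" using a d(2) e1 by simp
        then have "q \<cdot> t = zer C (src C t) V" unfolding eq using r t e1 by simp
        then show "factors C (q \<cdot> t) ?z" using fz[of "q \<cdot> t"] t e1 by simp
      qed
    next
      fix t assume "arr C t" "tgt C t = tgt C ?z"
      then have t: "arr C t" "tgt C t = V" using z by simp_all
      have "factors C (t \<boxplus> neg C (q \<cdot> (j \<cdot> t))) ?z" using factors_zer[of ?z "src C t" V] t e1 z by simp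
      then show "\<exists>s. arr C s \<and> src C s = src C t \<and> tgt C s = tgt C (i \<cdot> f) \<and> factors C (t \<boxplus> neg C (q \<cdot> s)) ?z"
        using t e1 d(2) by (intro exI[of _ "j \<cdot> t"]) simp
    qed (use z e1 d(2) in simp_all)
    moreover have "has_kernel C (i \<cdot> f)"
      using M_has_kernel[OF fM] has_kernel_monic_cmp[OF biprod_monic[OF b] d(2)] e1 by (simp add: has_kernel_def)
    ultimately show "i \<cdot> f \<in> M" using mem_extension fM zM by blast }
  fix f1 s r s' r' assume ret: "arrow_retract C f1 f s r s' r'"
  have f1: "arr C f1" using ret by (simp add: arrow_retract_def)
  obtain F1 :: "('o, 'm, 'u) cfunctor" and x1 where F1: "pres C f1 F1 x1" using pres_ex[OF e f1] by blast
  obtain F2 :: "('o, 'm, 'u) cfunctor" where F2: "F2 \<in> P2 C" "nt_iso C F (direct_sum F1 F2)"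
    using direct_sum_pres[OF ic e F(2) M_has_kernel[OF fM] ret F1] .
  have "has_kernel C f1" using M_has_kernel[OF fM] retract_kernel[OF ic _ ret] by (auto simp: has_kernel_def)
  then have "F1 \<in> P2 C" unfolding P2_iff using F1 by blast
  then have "F1 \<in> \<X>" using summand_mem F2 F(1) by blast
  then show "f1 \<in> M" using mem_iff[OF F1] by simp
qed

text \<open>One inclusion needs only a transpose for each arrow. The other uses stable closure,
  because an object of \<open>Tr C \<X>\<close> is only stably isomorphic to a transpose and may
  have unrelated presentations.\<close>

lemma presenting_arrows_Tr: "presenting_arrows (opp C) (Tr C \<X>) = M"
proof -
  interpret op: additive_category "opp C" by (rule opp_additive)
  interpret A: stably_closed "opp C" M by (rule stably_closed_opp[OF stably_closed_M])
  show ?thesis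
  proof (intro equalityI subsetI)
    fix g assume "g \<in> presenting_arrows (opp C) (Tr C \<X>)"
    then obtain G y where G: "G \<in> Tr C \<X>" "pres (opp C) g G y" by (auto simp: presenting_arrows_def)
    then obtain F T where F: "F \<in> \<X>" and T: "is_transpose C F T" and st: "stable_iso (opp C) G T"
      unfolding Tr_def by blast
    obtain f x t where f: "pres C f F x" "pres (opp C) f T t"
      using T is_transpose_iff[OF P2_Modules[OF X_P2[OF F]]] by blast
    obtain \<eta> \<theta> where \<eta>: "nat_trans (opp C) G T \<eta>" "nat_trans (opp C) T G \<theta>"
      "stable_eq (opp C) G G (\<lambda>A x. \<theta> A (\<eta> A x)) (\<lambda>A x. x)" using st unfolding stable_iso_def by blast
    have "f \<in> M" using mem_iff[OF f(1)] F by simp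
    from A.stable_retract_mem[OF f(2) this G(2) \<eta>] show "g \<in> M" .
  next
    fix f assume fM: "f \<in> M"
    then obtain F x where F: "F \<in> \<X>" "pres C f F x" by (auto simp: presenting_arrows_def)
    have "arr (opp C) f" using M_arrow[OF fM] by simp
    then obtain T :: "('o, 'm, 'u) cfunctor" and t where T: "pres (opp C) f T t" using op.pres_ex[OF e] by blast
    have "is_transpose C F T" using is_transpose_iff[OF presD(1)[OF F(2)]] F(2) T by blast
    moreover have "stable_iso (opp C) T T" by (rule op.stable_iso_refl[OF op.presD(1)[OF T]])
    moreover have "T \<in> fp_modules (opp C)" unfolding op.fp_iff using T by blast
    ultimately have "T \<in> Tr C \<X>" unfolding Tr_def using F(1) by blast
    then show "f \<in> presenting_arrows (opp C) (Tr C \<X>)" using T by (auto simp: presenting_arrows_def)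
  qed
qed

end

theorem theorem1p6:
  fixes C :: "('o, 'm) precat"
  assumes "additive_category C"
    and "idempotent_complete C"
    and universe: "\<exists>e :: 'm set \<Rightarrow> 'u. inj e"
  shows "bij_betw (mod_adm C :: ('m \<times> 'm) set \<Rightarrow> ('o, 'm, 'u) cfunctor set)
    {S. exact_structure C S}
    {\<X>. subcategory_of C (fp_modules C) \<X> \<and>
         (resolving C (P2 C) \<X> \<and> resolving (opp C) (P2 (opp C)) (Tr C \<X>)) \<and>
         ((\<forall>F\<in>\<X>. grade C F \<noteq> 1) \<and> (\<forall>G\<in>Tr C \<X>. grade (opp C) G \<noteq> 1))}"
    (is "bij_betw ?\<Phi> ?E ?R")
proof -
  interpret additive_category C by fact
  interpret op: additive_category "opp C" by (rule opp_additive)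
  obtain e :: "'m set \<Rightarrow> 'u" where e: "inj e" using universe by blast
  have ex: "exact_ic_category C S" if "exact_structure C S" for S
    using that assms by (simp add: exact_ic_category_def exact_category_def exact_ic_category_axioms_def)
  have "inj_on ?\<Phi> ?E"
  proof (rule inj_onI)
    fix S S' assume S: "S \<in> ?E" and S': "S' \<in> ?E" and eq: "?\<Phi> S = ?\<Phi> S'"
    interpret S: exact_ic_category C S using ex S by simp
    interpret S': exact_ic_category C S' using ex S' by simp
    have "(i, p) \<in> S \<longleftrightarrow> (i, p) \<in> S'" for i p
      unfolding S.conflation_iff[OF e] S'.conflation_iff[OF e] eq ..
    then show "S = S'" by auto
  qed
  moreover have "?\<Phi> ` ?E = ?R"
  proof (intro equalityI subsetI)
    fix \<X> assume "\<X> \<in> ?\<Phi> ` ?E"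
    then obtain S where S: "exact_structure C S" and X: "\<X> = ?\<Phi> S" by blast
    interpret S: exact_ic_category C S using ex S .
    interpret So: exact_ic_category "opp C" "S\<inverse>" by (rule S.opp_exact_ic)
    have "subcategory_of C (fp_modules C) (?\<Phi> S)"
      unfolding subcategory_of_def
    proof (intro conjI subsetI ballI impI)
      fix F assume "F \<in> ?\<Phi> S"
      then show "F \<in> fp_modules C" unfolding S.mod_adm_iff fp_iff by blast
    next
      fix F G :: "('o, 'm, 'u) cfunctor" assume "F \<in> ?\<Phi> S" "G \<in> fp_modules C" "nt_iso C F G"
      then show "G \<in> ?\<Phi> S" using S.mod_adm_iso_closed[of F G] by (simp add: fp_modules_def)
    qed
    \<comment> \<open>The conditions on \<open>Tr\<close> are those already proved, applied to the
      opposite exact category through \<open>Tr_mod_adm\<close>.\<close>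
    then show "\<X> \<in> ?R"
      unfolding X using S.resolving_mod_adm[OF e] So.resolving_mod_adm[OF e] S.grade_mod_adm[OF e]
        So.grade_mod_adm[OF e] S.Tr_mod_adm[OF e] by simp
  next
    fix \<X> assume R: "\<X> \<in> ?R"
    interpret X: resolving_modules C \<X> e
      using R assms e by unfold_locales auto
    interpret Y: resolving_modules "opp C" "Tr C \<X>" e
      using R idempotent_complete_opp[OF assms(2)] e by unfold_locales auto
    have "resolving_arrows C X.M" using X.resolving_arrows_M R by simp
    \<comment> \<open>The opposite category is treated with the class of arrows presenting
      \<open>Tr C \<X>\<close>, which is again \<open>X.M\<close>; this is what ties the two halves
      together.\<close>
    moreover have "resolving_arrows (opp C) X.M" using Y.resolving_arrows_M R X.presenting_arrows_Tr by simp
    ultimately interpret B: biresolving_arrows C X.M by (simp add: biresolving_arrows_def)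
    let ?S = "conflations C X.M"
    interpret S: exact_ic_category C ?S by (rule ex[OF B.exact_conflations])
    have "?\<Phi> ?S = \<X>"
    proof (intro equalityI subsetI)
      fix F assume "F \<in> ?\<Phi> ?S"
      then obtain f x where "pres C f F x" "adm C ?S f" unfolding S.mod_adm_iff by blast
      then show "F \<in> \<X>" using X.mem_iff B.mem_iff_adm by blast
    next
      fix F assume F: "F \<in> \<X>"
      then have "F \<in> fp_modules C" using R by (auto simp: subcategory_of_def)
      then obtain f x where f: "pres C f F x" unfolding fp_iff by blast
      then have "adm C ?S f" using X.mem_iff[OF f] B.mem_iff_adm F by blast
      then show "F \<in> ?\<Phi> ?S" unfolding S.mod_adm_iff using f by blast
    qed
    then show "\<X> \<in> ?\<Phi> ` ?E" using B.exact_conflations by blast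
  qed
  ultimately show ?thesis by (simp add: bij_betw_def)
qed

end
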